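(* Let $K$ be the kernel of the natural map from the subgroup generated by $\{T_n : n>0\}$ in the algebraic concordance group to the rational algebraic concordance group. Then $$\langle\{T_n : n \text{ is a perfect square}\}\rangle\subseteq K\subseteq\langle\{T_n : n\text{ is a perfect power}\}\rangle,$$ where $\langle\cdot\rangle$ denotes the generated subgroup of the algebraic concordance group and $n$ ranges over positive integers.
   Context: $T_n$ is the $n$-twist knot ($T_1$ the figure-eight knot, $T_2$ the stevedore knot), which has Seifert matrix $\begin{pmatrix}-1&1\\0&n\end{pmatrix}$ and Alexander polynomial $nt^2-(2n+1)t+n$. A positive integer is a perfect power if it equals $\alpha^k$ with $\alpha\ge1$, $k>1$ integers (in particular $1$ is a perfect square and a perfect power). Alexander polynomials are normalized to lie in $\mathbb{Z}[t]$ with non-zero constant term. Levine's invariants. An algebraic number $z$ is reciprocal if $z$ and $z^{-1}$ are roots of the same irreducible polynomial over $\mathbb{Q}$; let $\varphi_z$ be that polynomial. For a knot $K$: if $z$ is reciprocal with $|z|=1$, $s_z(K)\in\mathbb{Z}$ is the jump of the Tristram–Levine signature function of $K$ at $z$; if $z$ is reciprocal, $e_z(K)\in\mathbb{Z}/2\mathbb{Z}$ is the mod 2 multiplicity of $\varphi_z$ as a factor of $\Delta_K$; and $d_z(K)\in \mathbb{Q}(z+z^{-1})^\times/\{u\overline{u}: u\in\mathbb{Q}(z)^\times\}$ (with $\overline{\cdot}$ the involution $z\mapsto z^{-1}$) is the discriminant of the $z$-primary part of a Seifert matrix of $K$. Explicitly: let $A$ be a nonsingular rational matrix that is $S$-equivalent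 over $\mathbb{Q}$ to a Seifert matrix of $K$, with symmetric form $\beta=A+A^T$ and isometry $t=A^{-1}A^T$; the $\varphi_z(t)$-primary part of this isometric structure is Witt equivalent to one annihilated by $\varphi_z(t)$, which is a $\mathbb{Q}(z)$-vector space of some dimension $r$ ($t$ acting as $z$) with a unique nonsingular Hermitian form $H$ such that $\beta=\mathrm{Tr}_{\mathbb{Q}(z)/\mathbb{Q}}\circ H$; put $d_z(K)=(-1)^{r(r-1)/2}\det H$. All three invariants are trivial when $\Delta_K$ is relatively prime to $\varphi_z$; $s_z$ and $e_z$ are additive under connected sum, and $d_z(K\#J)=(-1)^{e_z(K)e_z(J)}d_z(K)d_z(J)$. A knot is algebraically slice if and only if all its invariants $s_z,e_z,d_z$ are trivial; the algebraic concordance group is the quotient of the knot concordance group by the algebraically slice knots. Rational version (Cha). Let $P$ be the set of sequences $(a_k)_{k\ge1}$ of reciprocal numbers with $(a_{nk})^n=a_k$ for all $n,k\geq 1$, and $P_0\subset P$ the subset of sequences with $|a_k|=1$ for all $k$. For $a\in P_0$ and $b\in P$ put $s_a(K)=(s_{a_k}(K))_{k\ge1}$, $e_b(K)=(e_{b_k}(K))_{k\ge1}$, $d_b(K)=(d_{b_k}(K))_{k\ge1}$. These form a complete set of invariants of rational algebraic concordance: $K$ is rationally algebraically slice if and only if $s_a(K)$ is trivial for all $a\in P_0$ and $e_b(K)$, $d_b(K)$ are trivial for all $b\in P$. The rational algebraic concordance group is the quotient of the group of knots up to (rational) concordance by the rationally algebraically slice knots; algebraically slice knots are rationally algebraically slice,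 giving the natural map. *)

theory Defs
  imports
    "HOL-Computational_Algebra.Field_as_Ring"
    "HOL-Algebra.Coset"
    "HOL-Algebra.Generated_Groups"
    "Jordan_Normal_Form.Char_Poly"
    "Jordan_Normal_Form.Gauss_Jordan_Elimination"
    "Jordan_Normal_Form.Matrix_Kernel"
begin

text \<open>The Seifert matrices of knots are exactly the integral square matrices V with
  det (V - V^T) = 1 (such V automatically has even size), and every invariant below depends on a
  knot only through any of its Seifert matrices. A knot is therefore represented by a Seifert
  matrix, connected sum by block sum, and the concordance inverse by -V. The unknot is the
  0 by 0 matrix.\<close>

definition seifert_matrix :: "int mat \<Rightarrow> bool" where
  "seifert_matrix V \<longleftrightarrow>
     (\<exists>n. V \<in> carrier_mat n n) \<and> det (V - transpose_mat V) = 1"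

definition block_sum :: "'a::zero mat \<Rightarrow> 'a mat \<Rightarrow> 'a mat" (infixl \<open>\<boxplus>\<close> 65) where
  "V \<boxplus> W = four_block_mat V (0\<^sub>m (dim_row V) (dim_col W)) (0\<^sub>m (dim_row W) (dim_col V)) W"

text \<open>V is integrally congruent to a matrix whose upper left half-size block vanishes.\<close>

definition algebraically_slice :: "int mat \<Rightarrow> bool" where
  "algebraically_slice V \<longleftrightarrow>
     (\<exists>g P. V \<in> carrier_mat (2 * g) (2 * g) \<and> P \<in> carrier_mat (2 * g) (2 * g) \<and>
        \<bar>det P\<bar> = 1 \<and> (\<forall>i<g. \<forall>j<g. (transpose_mat P * V * P) $$ (i, j) = 0))"

definition alg_concordant :: "(int mat \<times> int mat) set" where
  "alg_concordant =
     {(V, W). seifert_matrix V \<and> seifert_matrix W \<and> algebraically_slice (V \<boxplus> - W)}"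

definition alg_class :: "int mat \<Rightarrow> int mat set" where
  "alg_class V = alg_concordant `` {V}"

definition alg_concordance_group :: "int mat set monoid" where
  "alg_concordance_group =
     \<lparr>carrier = {V. seifert_matrix V} // alg_concordant,
      mult = (\<lambda>X Y. \<Union>V\<in>X. \<Union>W\<in>Y. alg_class (V \<boxplus> W)),
      one = alg_class (0\<^sub>m 0 0)\<rparr>"

definition twist_knot :: "nat \<Rightarrow> int mat" where
  "twist_knot n = mat_of_rows_list 2 [[-1, 1], [0, int n]]"

lemma det_2:
  assumes A: "A \<in> carrier_mat 2 2"
  shows "det A = A $$ (0, 0) * A $$ (1, 1) - A $$ (0, 1) * A $$ (1, 0)"
proof -
  note [simp] = carrier_matD[OF A]
  have d: "mat_delete A 0 j \<in> carrier_mat 1 1" for j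
    by (intro carrier_matI) (simp_all add: mat_delete_def)
  have "det A = (\<Sum>j<2. A $$ (0, j) * cofactor A 0 j)"
    by (rule laplace_expansion_row[OF A]) simp
  also have "\<dots> = A $$ (0, 0) * A $$ (1, 1) - A $$ (0, 1) * A $$ (1, 0)"
    by (simp add: numeral_2_eq_2 cofactor_def det_single[OF d])
       (simp add: mat_delete_def numeral_2_eq_2)
  finally show ?thesis .
qed

lemma twist_knot_carrier: "twist_knot n \<in> carrier_mat 2 2"
  unfolding twist_knot_def mat_of_rows_list_def carrier_mat_def by simp

lemma twist_knot_index:
  "twist_knot n $$ (0, 0) = - 1" "twist_knot n $$ (0, 1) = 1"
  "twist_knot n $$ (1, 0) = 0" "twist_knot n $$ (1, 1) = int n"
  unfolding twist_knot_def mat_of_rows_list_def by simp_all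

lemma seifert_matrix_twist_knot: "seifert_matrix (twist_knot n)"
proof -
  note [simp] = carrier_matD[OF twist_knot_carrier]
  have "twist_knot n - transpose_mat (twist_knot n) \<in> carrier_mat 2 2"
    by (intro carrier_matI) simp_all
  from det_2[OF this] have "det (twist_knot n - transpose_mat (twist_knot n)) = 1"
    by (simp add: twist_knot_index[unfolded One_nat_def] numeral_2_eq_2)
  with twist_knot_carrier show ?thesis
    unfolding seifert_matrix_def by blast
qed

definition perfect_square :: "nat \<Rightarrow> bool" where
  "perfect_square n \<longleftrightarrow> (\<exists>\<alpha>\<ge>1. n = \<alpha> ^ 2)"

definition perfect_power :: "nat \<Rightarrow> bool" where
  "perfect_power n \<longleftrightarrow> (\<exists>\<alpha> k. \<alpha> \<ge> 1 \<and> k > 1 \<and> n = \<alpha> ^ k)"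

text \<open>The Alexander polynomial det (V - t V^T), divided by the largest possible power of t;
  the sign is not normalized.\<close>

definition alexander_poly :: "int mat \<Rightarrow> int poly" where
  "alexander_poly V =
     (let p = det (map_mat (\<lambda>c. [:c:]) V -
                   [:0, 1:] \<cdot>\<^sub>m map_mat (\<lambda>c. [:c:]) (transpose_mat V))
      in poly_shift (Polynomial.order 0 p) p)"

lemma alexander_poly_twist_knot:
  assumes "n > 0"
  shows "alexander_poly (twist_knot n) = - [:int n, - (2 * int n + 1), int n:]"
proof -
  note [simp] = carrier_matD[OF twist_knot_carrier]
  let ?V = "twist_knot n"
  let ?M = "map_mat (\<lambda>c. [:c:]) ?V - [:0, 1:] \<cdot>\<^sub>m map_mat (\<lambda>c. [:c:]) (transpose_mat ?V)"
  have "?M \<in> carrier_mat 2 2"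
    by (intro carrier_matI) simp_all
  from det_2[OF this] have d: "det ?M = - [:int n, - (2 * int n + 1), int n:]"
    by (simp add: twist_knot_index[unfolded One_nat_def] algebra_simps)
  have "poly (det ?M) 0 \<noteq> 0"
    unfolding d using assms by simp
  then have "Polynomial.order 0 (det ?M) = 0"
    by (rule order_0I)
  then have "alexander_poly ?V = poly_shift 0 (det ?M)"
    unfolding alexander_poly_def Let_def by (rule arg_cong[where f = "\<lambda>k. poly_shift k _"])
  also have "\<dots> = det ?M"
    by (simp add: poly_eq_iff coeff_poly_shift)
  finally show ?thesis
    unfolding d .
qed

definition rpoly :: "rat poly \<Rightarrow> complex \<Rightarrow> complex" where
  "rpoly p z = poly (map_poly of_rat p) z"

definition reciprocal :: "complex \<Rightarrow> bool" where
  "reciprocal z \<longleftrightarrow>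
     z \<noteq> 0 \<and> (\<exists>p. irreducible p \<and> rpoly p z = 0 \<and> rpoly p (inverse z) = 0)"

definition min_poly :: "complex \<Rightarrow> rat poly" where
  "min_poly z = (THE p. irreducible p \<and> lead_coeff p = 1 \<and> rpoly p z = 0)"

text \<open>All numbers z to which the following are applied are algebraic, so the field Q(z) is the
  ring Q[z].\<close>

definition Qadj :: "complex \<Rightarrow> complex set" where
  "Qadj z = range (\<lambda>p. rpoly p z)"

text \<open>The involution of Q(z) sending z to its inverse; it is complex conjugation only
  when z lies on the unit circle.\<close>

definition Qbar :: "complex \<Rightarrow> complex \<Rightarrow> complex" where
  "Qbar z x = (THE y. \<exists>p. x = rpoly p z \<and> y = rpoly p (inverse z))"

text \<open>The trace from Q(z) to Q, as the sum over the embeddings of Q(z), which correspond to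
  the (simple) roots of the minimal polynomial.\<close>

definition Qtrace :: "complex \<Rightarrow> complex \<Rightarrow> rat" where
  "Qtrace z x =
     (THE s. \<exists>p. x = rpoly p z \<and> of_rat s = (\<Sum>w | rpoly (min_poly z) w = 0. rpoly p w))"

text \<open>Only meaningful for Hermitian matrices, whose eigenvalues are real.\<close>

definition signature :: "complex mat \<Rightarrow> int" where
  "signature M =
     (\<Sum>x | poly (char_poly M) x = 0 \<and> Re x > 0. int (Polynomial.order x (char_poly M))) -
     (\<Sum>x | poly (char_poly M) x = 0 \<and> Re x < 0. int (Polynomial.order x (char_poly M)))"

definition tristram_levine :: "int mat \<Rightarrow> complex \<Rightarrow> int" where
  "tristram_levine V \<omega> =
     signature ((1 - \<omega>) \<cdot>\<^sub>m map_mat of_int V + (1 - cnj \<omega>) \<cdot>\<^sub>m map_mat of_int (transpose_mat V))"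

text \<open>The full difference of the two one-sided limits, not half of it.\<close>

definition s_inv :: "complex \<Rightarrow> int mat \<Rightarrow> int" where
  "s_inv z V =
     Lim (at_right (0::real)) (\<lambda>\<theta>. tristram_levine V (z * cis \<theta>)) -
     Lim (at_left (0::real)) (\<lambda>\<theta>. tristram_levine V (z * cis \<theta>))"

text \<open>The value in Z/2 is represented by 0 or 1.\<close>

definition e_inv :: "complex \<Rightarrow> int mat \<Rightarrow> nat" where
  "e_inv z V = multiplicity (min_poly z) (map_poly of_int (alexander_poly V)) mod 2"

inductive S_step :: "rat mat \<Rightarrow> rat mat \<Rightarrow> bool" where
  congruence: "\<lbrakk>A \<in> carrier_mat n n; P \<in> carrier_mat n n; det P \<noteq> 0\<rbrakk>
    \<Longrightarrow> S_step A (transpose_mat P * A * P)"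
| column_enlargement: "\<lbrakk>A \<in> carrier_mat n n; c \<in> carrier_mat n 1\<rbrakk>
    \<Longrightarrow> S_step A
          (four_block_mat A (four_block_mat c (0\<^sub>m n 1) (0\<^sub>m 0 1) (0\<^sub>m 0 1))
             (0\<^sub>m 2 n) (mat_of_rows_list 2 [[0, 1], [0, 0]]))"
| row_enlargement: "\<lbrakk>A \<in> carrier_mat n n; r \<in> carrier_mat 1 n\<rbrakk>
    \<Longrightarrow> S_step A
          (four_block_mat A (0\<^sub>m n 2)
             (four_block_mat r (0\<^sub>m 1 0) (0\<^sub>m 1 n) (0\<^sub>m 1 0))
             (mat_of_rows_list 2 [[0, 0], [1, 0]]))"

definition S_equivalent :: "rat mat \<Rightarrow> rat mat \<Rightarrow> bool" where
  "S_equivalent = equivclp S_step"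

text \<open>A rational isometric structure: the Gram matrix of a nonsingular symmetric bilinear form
  together with the matrix of an isometry of it.\<close>

type_synonym iso_struct = "rat mat \<times> rat mat"

definition isometric_structure :: "nat \<Rightarrow> iso_struct \<Rightarrow> bool" where
  "isometric_structure n = (\<lambda>(B, T). B \<in> carrier_mat n n \<and> T \<in> carrier_mat n n \<and>
     transpose_mat B = B \<and> det B \<noteq> 0 \<and> transpose_mat T * B * T = B)"

text \<open>Only used for nonsingular A.\<close>

definition seifert_structure :: "rat mat \<Rightarrow> iso_struct" where
  "seifert_structure A = (A + transpose_mat A, the (mat_inverse A) * transpose_mat A)"

text \<open>In metabolic and primary_part a linear subspace of Q^n is given as the range of a matrix
  with trivial kernel, i.e. by a basis.\<close>

definition metabolic :: "iso_struct \<Rightarrow> bool" where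
  "metabolic = (\<lambda>(B, T). \<exists>m P S. isometric_structure (2 * m) (B, T) \<and>
     P \<in> carrier_mat (2 * m) m \<and> mat_kernel P = {0\<^sub>v m} \<and>
     S \<in> carrier_mat m m \<and> T * P = P * S \<and> transpose_mat P * B * P = 0\<^sub>m m m)"

definition witt_equivalent :: "iso_struct \<Rightarrow> iso_struct \<Rightarrow> bool" where
  "witt_equivalent X Y \<longleftrightarrow>
     (\<exists>m. isometric_structure m X) \<and> (\<exists>m. isometric_structure m Y) \<and>
     metabolic (fst X \<boxplus> - fst Y, snd X \<boxplus> snd Y)"

definition poly_mat :: "'a::comm_ring_1 poly \<Rightarrow> 'a mat \<Rightarrow> 'a mat" where
  "poly_mat p T = mat (dim_row T) (dim_row T)
     (\<lambda>(i, j). \<Sum>k\<le>degree p. coeff p k * (T ^\<^sub>m k) $$ (i, j))"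

definition primary_part :: "rat poly \<Rightarrow> iso_struct \<Rightarrow> iso_struct \<Rightarrow> bool" where
  "primary_part q = (\<lambda>(B, T) (B', T'). \<exists>m P.
     P \<in> carrier_mat (dim_row T) m \<and> mat_kernel P = {0\<^sub>v m} \<and>
     (\<lambda>v. P *\<^sub>v v) ` carrier_vec m = (\<Union>k. mat_kernel (poly_mat (q ^ k) T)) \<and>
     B' = transpose_mat P * B * P \<and> T' \<in> carrier_mat m m \<and> T * P = P * T')"

text \<open>f identifies the underlying rational vector space with Q(z)^r so that T becomes
  multiplication by z, and B is the trace of the nonsingular Hermitian form with matrix H.\<close>

definition hermitian_lift ::
  "complex \<Rightarrow> iso_struct \<Rightarrow> nat \<Rightarrow> (rat vec \<Rightarrow> complex vec) \<Rightarrow> complex mat \<Rightarrow> bool" where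
  "hermitian_lift z = (\<lambda>(B, T) r f H.
     let m = dim_row B in
     bij_betw f (carrier_vec m) {x \<in> carrier_vec r. \<forall>i<r. x $ i \<in> Qadj z} \<and>
     (\<forall>v\<in>carrier_vec m. \<forall>w\<in>carrier_vec m. f (v + w) = f v + f w) \<and>
     (\<forall>c. \<forall>v\<in>carrier_vec m. f (c \<cdot>\<^sub>v v) = of_rat c \<cdot>\<^sub>v f v) \<and>
     (\<forall>v\<in>carrier_vec m. f (T *\<^sub>v v) = z \<cdot>\<^sub>v f v) \<and>
     H \<in> carrier_mat r r \<and> det H \<noteq> 0 \<and>
     (\<forall>i<r. \<forall>j<r. H $$ (i, j) \<in> Qadj z \<and> H $$ (j, i) = Qbar z (H $$ (i, j))) \<and>
     (\<forall>v\<in>carrier_vec m. \<forall>w\<in>carrier_vec m.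
        v \<bullet> (B *\<^sub>v w) = Qtrace z (\<Sum>i<r. \<Sum>j<r. f v $ i * H $$ (i, j) * Qbar z (f w $ j))))"

text \<open>The discriminant takes values in the quotient of the multiplicative group of
  Q(z + 1/z) by the norms from Q(z).\<close>

definition fixed_units :: "complex \<Rightarrow> complex monoid" where
  "fixed_units z = \<lparr>carrier = Qadj (z + inverse z) - {0}, mult = (*), one = 1\<rparr>"

definition norms :: "complex \<Rightarrow> complex set" where
  "norms z = {u * Qbar z u |u. u \<in> Qadj z \<and> u \<noteq> 0}"

definition d_group :: "complex \<Rightarrow> complex set monoid" where
  "d_group z = fixed_units z Mod norms z"

text \<open>The resulting coset does not depend on the choices of A, X, Y, r, f and H.\<close>

definition d_inv :: "complex \<Rightarrow> int mat \<Rightarrow> complex set" where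
  "d_inv z V = (THE c. \<exists>A n X Y r f H.
     A \<in> carrier_mat n n \<and> det A \<noteq> 0 \<and> S_equivalent (map_mat of_int V) A \<and>
     primary_part (min_poly z) (seifert_structure A) X \<and>
     witt_equivalent X Y \<and>
     poly_mat (min_poly z) (snd Y) = 0\<^sub>m (dim_row (snd Y)) (dim_row (snd Y)) \<and>
     hermitian_lift z Y r f H \<and>
     c = norms z #>\<^bsub>fixed_units z\<^esub> ((-1) ^ (r * (r - 1) div 2) * det H))"

text \<open>Sequences are indexed by the positive integers; the value at 0 is irrelevant.\<close>

definition P_seq :: "(nat \<Rightarrow> complex) set" where
  "P_seq = {a. (\<forall>k\<ge>1. reciprocal (a k)) \<and> (\<forall>n\<ge>1. \<forall>k\<ge>1. a (n * k) ^ n = a k)}"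

definition P0_seq :: "(nat \<Rightarrow> complex) set" where
  "P0_seq = {a \<in> P_seq. \<forall>k\<ge>1. cmod (a k) = 1}"

definition rationally_algebraically_slice :: "int mat \<Rightarrow> bool" where
  "rationally_algebraically_slice V \<longleftrightarrow>
     (\<forall>a\<in>P0_seq. \<forall>k\<ge>1. s_inv (a k) V = 0) \<and>
     (\<forall>b\<in>P_seq. \<forall>k\<ge>1. e_inv (b k) V = 0 \<and> d_inv (b k) V = \<one>\<^bsub>d_group (b k)\<^esub>)"

text \<open>Algebraically slice knots being rationally algebraically slice, the rational group is
  the quotient of the algebraic concordance group by the classes of the rationally
  algebraically slice knots, and the natural map is the canonical projection.\<close>

definition rationally_slice_classes :: "int mat set set" where
  "rationally_slice_classes =
     {alg_class V |V. seifert_matrix V \<and> rationally_algebraically_slice V}"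

definition rat_alg_concordance_group :: "int mat set set monoid" where
  "rat_alg_concordance_group = alg_concordance_group Mod rationally_slice_classes"

definition natural_map :: "int mat set \<Rightarrow> int mat set set" where
  "natural_map X = rationally_slice_classes #>\<^bsub>alg_concordance_group\<^esub> X"

definition twist_subgroup :: "(nat \<Rightarrow> bool) \<Rightarrow> int mat set set" where
  "twist_subgroup Q =
     generate alg_concordance_group {alg_class (twist_knot n) |n. n > 0 \<and> Q n}"

definition twist_kernel :: "int mat set set" where
  "twist_kernel =
     Coset.kernel (alg_concordance_group\<lparr>carrier := twist_subgroup (\<lambda>_. True)\<rparr>)
       rat_alg_concordance_group natural_map"

end

(*
  Idea. Let t be the class of T_n in the algebraic concordance group. Since 4n+1
  is a sum of four squares, 4 t = 0. Both the
  parity of the multiplicity of a root z of the Alexander polynomial and the discriminant at z are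
  unchanged when T_m with m different from n is added, because the Alexander polynomials of distinct
  twist knots have no common root. If n = m^2 then no root of the Alexander polynomial of T_n has a
  reciprocal square root, so no member of P passes through it and T_n is invisible rationally. If n
  is no perfect power and 4n+1 is no square, then the real k-th roots of z are reciprocal (a Capelli
  type argument), so z belongs to a member of P: an odd multiple of t is detected by e_z, and 2 t is
  detected by d_z unless -1 is a norm from Q(z), in which case 2 t = 0. If 4n+1 is a square, T_n is
  slice.
  The Witt-theoretic invariance of d_z is expressed by Lagrangian relations between forms: relations
  compose, and over Q(z) a Lagrangian makes the determinant a norm up to sign.
*)
theory Submission
  imports Defs "HOL-Number_Theory.Cong"
begin

text \<open>Seifert matrices can be singular, and so can the rational matrices along a chain of
  S-equivalences, whereas \<open>A - trp A\<close> stays nonsingular throughout. Concordance is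
  therefore rephrased as a Lagrangian relation for the skew-symmetrizations on which the Seifert
  forms agree. An isotropic subspace of half the dimension is Lagrangian for every nonsingular form
  that vanishes on it; this carries the relation over to the symmetrizations and makes it invariant
  under the isometries. \<open>d_inv\<close> is a definite description over many choices, so
  evaluating it takes a value and its uniqueness. Working with the set of all admissible values
  turns the effect of adding \<open>T_m\<close> into inclusions, and four copies of
  \<open>T_m\<close> bring back the original class, so the inclusions close up to equalities. Apart
  from the empty form, a Hermitian form is computed only for the sum of two copies of
  \<open>T_n\<close>: it is -1 on each copy, with discriminant -1. Signatures never contribute: on
  the unit circle the Tristram-Levine matrix of \<open>T_n\<close> with \<open>n > 0\<close> is zero
  or has negative determinant.\<close>

abbreviation Vec where "Vec \<equiv> carrier_vec"
abbreviation Mat where "Mat \<equiv> carrier_mat"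
abbreviation (input) trp where "trp \<equiv> transpose_mat"
notation mult_mat_vec (infixl "*v" 70)
notation smult_vec (infixl "*s" 70)

section \<open>Submodules over a subring and bases adapted to them\<close>

text \<open>Scalars form a subset of an ambient ring, so that one elimination serves the integers,
  the rationals and the field Q(z) inside the complex numbers.\<close>

definition subring_set :: "'a::comm_ring_1 set => bool" where
  "subring_set R \<longleftrightarrow> 0 \<in> R \<and> 1 \<in> R \<and> (\<forall>a\<in>R. \<forall>b\<in>R. a + b \<in> R \<and> a * b \<in> R) \<and> (\<forall>a\<in>R. - a \<in> R)"

definition Fvec :: "'a set => nat => 'a vec set" where
  "Fvec R n = {v \<in> Vec n. \<forall>i<n. v $ i \<in> R}"

definition Fmat :: "'a set => nat => 'a mat set" where
  "Fmat R n = {A \<in> Mat n n. \<forall>i<n. \<forall>j<n. A $$ (i, j) \<in> R}"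

definition submod :: "'a::comm_ring_1 set => nat => 'a vec set => bool" where
  "submod R n L \<longleftrightarrow> L \<subseteq> Fvec R n \<and> 0\<^sub>v n \<in> L \<and> (\<forall>x\<in>L. \<forall>y\<in>L. x + y \<in> L) \<and>
     (\<forall>c\<in>R. \<forall>x\<in>L. c *s x \<in> L)"

text \<open>Over the integers this is the condition that makes a submodule a direct summand; for
  subspaces over a field it is automatic.\<close>

definition saturated :: "'a::comm_ring_1 set => nat => 'a vec set => bool" where
  "saturated R n L \<longleftrightarrow> (\<forall>c\<in>R. \<forall>v\<in>Fvec R n. c \<noteq> 0 --> c *s v \<in> L --> v \<in> L)"

text \<open>Exactly the reduction that elimination performs: of two nonzero entries, one can be made
  smaller by adding a multiple of the other. The measure is the absolute value for integers, and 0
  or 1 for a field.\<close>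

definition euclidean_on :: "'a::comm_ring_1 set => ('a => nat) => bool" where
  "euclidean_on R \<nu> \<longleftrightarrow> (\<forall>a\<in>R. \<forall>b\<in>R. a \<noteq> 0 --> b \<noteq> 0 -->
     (\<exists>c\<in>R. \<nu> (a + c * b) < \<nu> a) \<or> (\<exists>c\<in>R. \<nu> (b + c * a) < \<nu> b))"

text \<open>The inverse is carried along so that it also has entries in \<open>R\<close>.
  Determinants are restricted to 1 and -1 so that a change of basis does not alter the determinant
  of a form, not even by a norm.\<close>

definition GL_pair :: "'a::comm_ring_1 set => nat => 'a mat => 'a mat => bool" where
  "GL_pair R n U U' \<longleftrightarrow> U \<in> Fmat R n \<and> U' \<in> Fmat R n \<and> U * U' = 1\<^sub>m n \<and> U' * U = 1\<^sub>m n \<and>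
     (det U = 1 \<or> det U = - 1)"

text \<open>The first \<open>k\<close> columns of \<open>U\<close> form a basis of \<open>L\<close>,
  expressed through the coordinates \<open>U' *v v\<close>.\<close>

definition adapted :: "'a::comm_ring_1 set => nat => 'a vec set => 'a mat => 'a mat => nat => bool" where
  "adapted R n L U U' k \<longleftrightarrow> GL_pair R n U U' \<and> k \<le> n \<and>
     (\<forall>v\<in>Fvec R n. v \<in> L \<longleftrightarrow> (\<forall>i. k \<le> i --> i < n --> (U' *v v) $ i = 0))"

lemma subring_sum: "subring_set R ==> (\<And>i. i \<in> I ==> f i \<in> R) ==> sum f I \<in> R"
  by (induction I rule: infinite_finite_induct) (auto simp: subring_set_def)

lemma subring_prod: "subring_set R ==> (\<And>i. i \<in> I ==> f i \<in> R) ==> prod f I \<in> R"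
  by (induction I rule: infinite_finite_induct) (auto simp: subring_set_def)

lemma subring_UNIV [simp]: "subring_set UNIV"
  by (simp add: subring_set_def)

lemma Fvec_UNIV [simp]: "Fvec UNIV n = Vec n"
  by (simp add: Fvec_def)

lemma Fmat_UNIV [simp]: "Fmat UNIV n = Mat n n"
  by (simp add: Fmat_def)

lemma Fmat_carrier: "A \<in> Fmat R n ==> A \<in> Mat n n"
  by (simp add: Fmat_def)

lemma Fvec_carrier: "v \<in> Fvec R n ==> v \<in> Vec n"
  by (simp add: Fvec_def)

lemma Fmat_mult:
  assumes "subring_set R" "A \<in> Fmat R n" "B \<in> Fmat R n"
  shows "A * B \<in> Fmat R n"
  using assms unfolding Fmat_def
  by (auto simp: scalar_prod_def intro!: subring_sum) (auto simp: subring_set_def)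

lemma Fmat_mult_vec:
  assumes "subring_set R" "A \<in> Fmat R n" "v \<in> Fvec R n"
  shows "A *v v \<in> Fvec R n"
  using assms unfolding Fmat_def Fvec_def
  by (auto simp: scalar_prod_def intro!: subring_sum) (auto simp: subring_set_def)

lemma Fmat_one: "subring_set R ==> 1\<^sub>m n \<in> Fmat R n"
  by (auto simp: subring_set_def Fmat_def)

lemma GL_pair_mult:
  fixes U :: "'a::idom mat"
  assumes R: "subring_set R" and U: "GL_pair R n U U'" and W: "GL_pair R n W W'"
  shows "GL_pair R n (U * W) (W' * U')"
proof -
  have c: "U \<in> Mat n n" "U' \<in> Mat n n" "W \<in> Mat n n" "W' \<in> Mat n n"
    using U W by (auto simp: GL_pair_def Fmat_def)
  have "(U * W) * (W' * U') = U * (W * W') * U'"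
    using c by (simp add: assoc_mult_mat[of _ n n _ n _ n])
  also have "\<dots> = 1\<^sub>m n" using U W c by (auto simp: GL_pair_def)
  finally have 1: "(U * W) * (W' * U') = 1\<^sub>m n" .
  have "(W' * U') * (U * W) = W' * (U' * U) * W"
    using c by (simp add: assoc_mult_mat[of _ n n _ n _ n])
  also have "\<dots> = 1\<^sub>m n" using U W c by (auto simp: GL_pair_def)
  finally have 2: "(W' * U') * (U * W) = 1\<^sub>m n" .
  have "det (U * W) = det U * det W" using c by (intro det_mult) auto
  then show ?thesis using U W R 1 2 by (auto simp: GL_pair_def intro!: Fmat_mult)
qed

lemma GL_pair_one: "subring_set R ==> GL_pair R n (1\<^sub>m n) (1\<^sub>m n)"
  by (auto simp: GL_pair_def Fmat_one)

lemma GL_pair_addrow: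
  fixes c :: "'a::idom"
  assumes R: "subring_set R" and c: "c \<in> R" and ij: "i < n" "j < n" "i \<noteq> j"
  shows "GL_pair R n (addrow_mat n (- c) i j) (addrow_mat n c i j)"
proof -
  have "addrow_mat n (- c) i j \<in> Fmat R n" "addrow_mat n c i j \<in> Fmat R n"
    using R c ij(3) by (auto simp: Fmat_def addrow_mat_def subring_set_def)
  moreover have "addrow_mat n (- c) i j * addrow_mat n c i j = 1\<^sub>m n"
    using addrow_mat_inv[OF ij, of "- c"] by simp
  moreover have "addrow_mat n c i j * addrow_mat n (- c) i j = 1\<^sub>m n"
    using addrow_mat_inv[OF ij, of c] by simp
  moreover have "det (addrow_mat n (- c) i j) = 1" using ij by (intro det_addrow_mat) auto
  ultimately show ?thesis by (simp add: GL_pair_def)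
qed

lemma GL_pair_swap:
  assumes R: "subring_set (R :: 'a::idom set)" and ij: "i < n" "j < n"
  shows "\<exists>W W'. GL_pair R n W W' \<and> (\<forall>l<n. l \<noteq> i --> l \<noteq> j --> col W l = unit_vec n l) \<and> col W i = unit_vec n j"
proof (cases "i = j")
  case True
  then show ?thesis using GL_pair_one[OF R] ij by (intro exI[of _ "1\<^sub>m n"]) auto
next
  case False
  have "GL_pair R n (swaprows_mat n i j) (swaprows_mat n i j)"
    using R swaprows_mat_inv[OF ij] det_swaprows_mat[OF ij False]
    by (auto simp: GL_pair_def Fmat_def swaprows_mat_def subring_set_def)
  moreover have "col (swaprows_mat n i j) l = unit_vec n l" if "l < n" "l \<noteq> i" "l \<noteq> j" for l
    using that ij by (intro eq_vecI) (auto simp: swaprows_mat_def)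
  moreover have "col (swaprows_mat n i j) i = unit_vec n j"
    using ij False by (intro eq_vecI) (auto simp: swaprows_mat_def)
  ultimately show ?thesis by blast
qed

lemma mult_mat_vec_smult:
  fixes A :: "'a::comm_ring_1 mat"
  assumes "A \<in> Mat n m" "v \<in> Vec m"
  shows "A *v (c *s v) = c *s (A *v v)"
  using assms by (intro eq_vecI) auto

lemma mult_mat_vec_in_submod:
  fixes U :: "'a::idom mat"
  assumes R: "subring_set R" and L: "submod R n L" and U: "U \<in> Mat n n"
    and w: "w \<in> Fvec R n" and c: "\<And>i. i < n ==> w $ i \<noteq> 0 ==> col U i \<in> L"
  shows "U *v w \<in> L"
proof -
  let ?v = "\<lambda>m. vec n (\<lambda>i. if i < m then w $ i else 0)"
  have "U *v ?v m \<in> L" if "m \<le> n" for m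
    using that
  proof (induction m)
    case 0
    have "U *v ?v 0 = 0\<^sub>v n" using U by (intro eq_vecI) (auto simp: scalar_prod_def)
    then show ?case using L by (simp add: submod_def)
  next
    case (Suc m)
    have e: "U *v ?v (Suc m) = U *v ?v m + w $ m *s col U m"
    proof -
      have "?v (Suc m) = ?v m + w $ m *s unit_vec n m"
        using Suc.prems by (intro eq_vecI) (auto simp: unit_vec_def less_Suc_eq)
      then have "U *v ?v (Suc m) = U *v ?v m + w $ m *s (U *v unit_vec n m)"
        using U mult_mat_vec_smult[OF U unit_vec_carrier[of n m], of "w $ m"]
        by (simp add: mult_add_distrib_mat_vec[of _ n n])
      moreover have "U *v unit_vec n m = col U m"
        using U Suc.prems by (intro eq_vecI) auto
      ultimately show ?thesis by simp
    qed
    have IH: "U *v ?v m \<in> L" using Suc by simp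
    show ?case
    proof (cases "w $ m = 0")
      case True
      have "U *v ?v m \<in> Vec n" using U by simp
      then have "U *v ?v m + w $ m *s col U m = U *v ?v m"
        using True U by (intro eq_vecI) auto
      then show ?thesis using e IH by simp
    next
      case False
      then have "w $ m *s col U m \<in> L" using L c[of m] w Suc.prems
        by (auto simp: submod_def Fvec_def)
      then show ?thesis using IH L e by (simp add: submod_def)
    qed
  qed
  moreover have "?v n = w" using w by (intro eq_vecI) (auto simp: Fvec_def)
  ultimately show ?thesis by (metis order_refl)
qed

lemma single_entry_smult_col:
  fixes U :: "'a::comm_ring_1 mat"
  assumes "U \<in> Mat n n" "j < n" 
  shows "U *v (a *s unit_vec n j) = a *s col U j"
proof -
  have "U *v unit_vec n j = col U j" using assms by (intro eq_vecI) auto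
  then show ?thesis using mult_mat_vec_smult[OF assms(1) unit_vec_carrier[of n j], of a] by simp
qed

text \<open>Take a basis of the ambient module with as many initial columns in \<open>L\<close> as
  possible. If some vector of \<open>L\<close> had a nonzero coordinate beyond these, Euclidean
  reduction would leave a single such coordinate, saturation would put the corresponding basis
  column into \<open>L\<close>, and moving it forward would contradict maximality.\<close>

lemma adapted_exists:
  fixes L :: "'a::idom vec set"
  assumes R: "subring_set R" and eu: "euclidean_on R \<nu>" and L: "submod R n L" and sat: "saturated R n L"
  shows "\<exists>U U' k. adapted R n L U U' k"
proof -
  define good where "good U U' k \<longleftrightarrow> GL_pair R n U U' \<and> k \<le> n \<and> (\<forall>i<k. col U i \<in> L)" for U U' k
  have "good (1\<^sub>m n) (1\<^sub>m n) 0" by (simp add: good_def GL_pair_one R)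
  then have ex: "\<exists>U U'. good U U' 0" by blast
  define P where "P k \<longleftrightarrow> (\<exists>U U'. good U U' k)" for k
  have bnd: "k \<le> n" if "P k" for k using that by (auto simp: P_def good_def)
  define k where "k = (GREATEST k. P k)"
  have "P k" unfolding k_def by (rule GreatestI_nat[of P 0 n]) (use ex bnd in \<open>auto simp: P_def\<close>)
  then obtain U0 U0' where g0: "good U0 U0' k" by (auto simp: P_def)
  have kmax: "k' \<le> k" if "good U U' k'" for k' U U'
    unfolding k_def by (rule Greatest_le_nat[of P k' n]) (use that bnd in \<open>auto simp: P_def\<close>)
  have Lc: "v \<in> Vec n" if "v \<in> L" for v using L that by (auto simp: submod_def Fvec_def)
  have LF: "v \<in> Fvec R n" if "v \<in> L" for v using L that by (auto simp: submod_def)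
  have key: "\<forall>i. k \<le> i --> i < n --> (U0' *v v0) $ i = 0" if v0: "v0 \<in> L" for v0
  proof (rule ccontr)
    assume neg: "\<not> ?thesis"
    define bad where "bad U U' v \<longleftrightarrow> good U U' k \<and> v \<in> L \<and> (\<exists>i. k \<le> i \<and> i < n \<and> (U' *v v) $ i \<noteq> 0)" for U U' v
    \<comment> \<open>Total size of the coordinates beyond \<open>k\<close>. It is minimized over
      bases and vectors at once, so that every possible reduction is a contradiction.\<close>
    define \<mu> where "\<mu> = (\<lambda>(U::'a mat, U', v). \<Sum>i\<in>{k..<n}. \<nu> ((U' *v v) $ i))"
    have "bad U0 U0' v0" using neg g0 v0 by (auto simp: bad_def)
    then obtain U U' v where b: "bad U U' v"
      and min: "\<And>W W' w. bad W W' w ==> \<mu> (U, U', v) \<le> \<mu> (W, W', w)"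
      using ex_has_least_nat[of "\<lambda>(U, U', v). bad U U' v" "(U0, U0', v0)" \<mu>] by auto
    define y where "y = U' *v v"
    have gU: "GL_pair R n U U'" and kn: "k \<le> n" and cols: "\<And>i. i < k ==> col U i \<in> L" and v: "v \<in> L"
      using b by (auto simp: bad_def good_def)
    have Uc: "U \<in> Mat n n" "U' \<in> Mat n n" using gU by (auto simp: GL_pair_def Fmat_def)
    have y: "y \<in> Fvec R n" unfolding y_def
      using gU R LF[OF v] by (intro Fmat_mult_vec) (auto simp: GL_pair_def)
    have Uy: "U *v y = v" unfolding y_def using gU Uc Lc[OF v]
      by (simp add: GL_pair_def flip: assoc_mult_mat_vec[of _ n n _ n])
    obtain j where j: "k \<le> j" "j < n" "y $ j \<noteq> 0" using b by (auto simp: bad_def y_def)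
    \<comment> \<open>The row operation on coordinates is a change of basis that alters only column
      \<open>l\<close>; since \<open>k \<le> l\<close>, the columns already in \<open>L\<close>
      survive.\<close>
    have reduce: False if i: "k \<le> i" "i < n" "i \<noteq> l" and l: "k \<le> l" "l < n" "y $ l \<noteq> 0" 
      and c: "c \<in> R" "\<nu> (y $ i + c * y $ l) < \<nu> (y $ i)" for i l c
    proof -
      let ?W = "U * addrow_mat n (- c) i l" and ?W' = "addrow_mat n c i l * U'"
      have gW: "GL_pair R n ?W ?W'"
        using i l by (intro GL_pair_mult[OF R gU] GL_pair_addrow[OF R c(1)]) auto
      have "?W' *v v = addrow_mat n c i l *v y"
        unfolding y_def using Uc Lc[OF v] by (intro assoc_mult_mat_vec) auto
      moreover have "addrow_mat n c i l *v y = vec n (\<lambda>m. if m = i then y $ i + c * y $ l else y $ m)"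
      proof (rule eq_vecI)
        fix m assume "m < dim_vec (vec n (\<lambda>m. if m = i then y $ i + c * y $ l else y $ m))"
        then have m: "m < n" by simp
        have yc: "y \<in> Vec n" using y by (rule Fvec_carrier)
        show "(addrow_mat n c i l *v y) $ m = vec n (\<lambda>m. if m = i then y $ i + c * y $ l else y $ m) $ m"
        proof (cases "m = i")
          case True
          have "row (addrow_mat n c i l) i = c *s unit_vec n l + unit_vec n i"
            using i l by (intro eq_vecI) auto
          then show ?thesis using True m yc i l by (simp add: add_scalar_prod_distrib[of _ n])
        next
          case False
          then have "row (addrow_mat n c i l) m = unit_vec n m"
            using i l m by (intro eq_vecI) auto
          then show ?thesis using False m yc i l by simp
        qed
      qed simp
      ultimately have e: "?W' *v v = vec n (\<lambda>m. if m = i then y $ i + c * y $ l else y $ m)" by simp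
      have "col ?W m \<in> L" if "m < k" for m
      proof -
        have m: "m < n" using that kn by simp
        have "col (addrow_mat n (- c) i l) m = unit_vec n m"
          using that i l m by (intro eq_vecI) (auto simp: addrow_mat_def)
        then have "col ?W m = U *v unit_vec n m"
          using m Uc by (subst col_mult2[of _ n n _ n]) auto
        also have "\<dots> = col U m" using m Uc by (intro eq_vecI) auto
        finally show ?thesis using cols[OF that] by simp
      qed
      then have "bad ?W ?W' v" using gW kn v e i l
        unfolding bad_def good_def by (auto intro!: exI[of _ l])
      from min[OF this] have "(\<Sum>m\<in>{k..<n}. \<nu> (y $ m)) \<le> (\<Sum>m\<in>{k..<n}. \<nu> (if m = i then y $ i + c * y $ l else y $ m))"
        unfolding \<mu>_def prod.case e y_def[symmetric] by simp
      moreover have "(\<Sum>m\<in>{k..<n}. \<nu> (if m = i then y $ i + c * y $ l else y $ m)) < (\<Sum>m\<in>{k..<n}. \<nu> (y $ m))"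
        using c(2) i by (intro sum_strict_mono_ex1) auto
      ultimately show False by simp
    qed
    have only: "y $ i = 0" if "k \<le> i" "i < n" "i \<noteq> j" for i
    proof (rule ccontr)
      assume "y $ i \<noteq> 0"
      then have "(\<exists>c\<in>R. \<nu> (y $ i + c * y $ j) < \<nu> (y $ i)) \<or> (\<exists>c\<in>R. \<nu> (y $ j + c * y $ i) < \<nu> (y $ j))"
        using eu y j that by (auto simp: euclidean_on_def Fvec_def)
      then show False using reduce[of i j] reduce[of j i] that j \<open>y $ i \<noteq> 0\<close> by blast
    qed
    \<comment> \<open>Cancels the first \<open>k\<close> coordinates by an element of
      \<open>L\<close>, leaving a multiple of one basis column.\<close>
    define y1 where "y1 = vec n (\<lambda>i. if i < k then - y $ i else 0)"
    have "y1 \<in> Fvec R n" using y R by (auto simp: y1_def Fvec_def subring_set_def)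
    then have "U *v y1 \<in> L"
      using Uc cols by (intro mult_mat_vec_in_submod[OF R L]) (auto simp: y1_def split: if_splits)
    moreover have "y + y1 = y $ j *s unit_vec n j"
      using y j only by (intro eq_vecI) (auto simp: y1_def Fvec_def unit_vec_def not_less)
    moreover have "U *v (y + y1) = v + U *v y1"
      using Uc y Uy by (simp add: mult_add_distrib_mat_vec[of _ n n] Fvec_def y1_def)
    ultimately have "U *v (y $ j *s unit_vec n j) \<in> L"
      using v L by (auto simp: submod_def)
    then have "y $ j *s col U j \<in> L"
      using single_entry_smult_col Uc j by metis
    moreover have "col U j \<in> Fvec R n" using gU j by (auto simp: GL_pair_def Fmat_def Fvec_def)
    \<comment> \<open>Saturation removes the factor \<open>y $ j\<close>.\<close>
    ultimately have colj: "col U j \<in> L"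
      using sat j y by (auto simp: saturated_def Fvec_def)
    obtain W W' where W: "GL_pair R n W W'" "\<And>l. l < n ==> l \<noteq> k ==> l \<noteq> j ==> col W l = unit_vec n l"
      "col W k = unit_vec n j" 
      using GL_pair_swap[OF R, of k n j] j by auto
    have Wc: "W \<in> Mat n n" using W by (auto simp: GL_pair_def Fmat_def)
    have cU: "U *v unit_vec n m = col U m" if "m < n" for m
      using that Uc by (intro eq_vecI) auto
    have "good (U * W) (W' * U') (Suc k)"
      unfolding good_def
    proof (intro conjI allI impI GL_pair_mult[OF R gU W(1)])
      show "Suc k \<le> n" using j by simp
      fix i assume i: "i < Suc k"
      then have "col (U * W) i = U *v col W i" using j Uc Wc by (subst col_mult2[of _ n n _ n]) auto
      then show "col (U * W) i \<in> L"
        using i W(2)[of i] W(3) j colj cols[of i] cU by (cases "i = k") auto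
    qed
    from kmax[OF this] show False by simp
  qed
  have "adapted R n L U0 U0' k"
    unfolding adapted_def
  proof (intro conjI ballI iffI)
    show "GL_pair R n U0 U0'" "k \<le> n" using g0 by (auto simp: good_def)
    fix v assume v: "v \<in> Fvec R n"
    show "\<forall>i. k \<le> i --> i < n --> (U0' *v v) $ i = 0" if "v \<in> L" using key that by blast
    assume z: "\<forall>i. k \<le> i --> i < n --> (U0' *v v) $ i = 0"
    have Uc: "U0 \<in> Mat n n" "U0' \<in> Mat n n" using g0 by (auto simp: good_def GL_pair_def Fmat_def)
    have "U0 *v (U0' *v v) \<in> L"
    proof (rule mult_mat_vec_in_submod[OF R L Uc(1)])
      show "U0' *v v \<in> Fvec R n" using g0 v R by (auto simp: good_def GL_pair_def intro: Fmat_mult_vec)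
      fix i assume "i < n" "(U0' *v v) $ i \<noteq> 0"
      then show "col U0 i \<in> L" using z g0 by (auto simp: good_def not_le[symmetric])
    qed
    moreover have "U0 *v (U0' *v v) = v" using Uc v g0
      by (simp add: good_def GL_pair_def Fvec_def flip: assoc_mult_mat_vec[of _ n n _ n])
    ultimately show "v \<in> L" by simp
  qed
  then show ?thesis by blast
qed

lemma adapted_field:
  fixes L :: "'a::field vec set"
  assumes R: "subring_set R" and inv: "\<And>a. a \<in> R ==> inverse a \<in> R" and L: "submod R n L"
  shows "\<exists>U U' k. adapted R n L U U' k"
proof (rule adapted_exists[OF R _ L])
  show "euclidean_on R (\<lambda>a. if a = 0 then 0 else 1)"
    unfolding euclidean_on_def
  proof (intro ballI impI disjI1)
    fix a b :: 'a assume "a \<in> R" "b \<in> R" "a \<noteq> 0" "b \<noteq> 0"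
    then show "\<exists>c\<in>R. (if a + c * b = 0 then 0 else 1) < (if a = 0 then 0 else 1::nat)"
      using R inv[of b] by (intro bexI[of _ "- (a * inverse b)"]) (auto simp: subring_set_def)
  qed
  show "saturated R n L"
    unfolding saturated_def
  proof (intro ballI impI)
    fix c :: 'a and v assume "c \<in> R" "v \<in> Fvec R n" "c \<noteq> 0" "c *s v \<in> L"
    then have "inverse c *s (c *s v) \<in> L" using L inv by (auto simp: submod_def)
    then show "v \<in> L" using \<open>c \<noteq> 0\<close> by (simp add: smult_smult_assoc)
  qed
qed

lemma adapted_int:
  fixes L :: "int vec set"
  assumes L: "submod UNIV n L" and sat: "saturated UNIV n L"
  shows "\<exists>U U' k. adapted UNIV n L U U' k"
proof (rule adapted_exists[OF _ _ L sat])
  show "euclidean_on UNIV (\<lambda>a::int. nat \<bar>a\<bar>)"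
    unfolding euclidean_on_def
  proof (intro ballI impI)
    fix a b :: int assume "a \<noteq> 0" "b \<noteq> 0"
    have *: "nat \<bar>x + (- (x div y)) * y\<bar> < nat \<bar>x\<bar>" if "\<bar>y\<bar> \<le> \<bar>x\<bar>" "y \<noteq> 0" for x y :: int
    proof -
      have "x + (- (x div y)) * y = x mod y" by (simp add: minus_div_mult_eq_mod)
      moreover have "\<bar>x mod y\<bar> < \<bar>y\<bar>" using that by (rule_tac abs_mod_less) auto
      ultimately show ?thesis using that by simp
    qed
    show "(\<exists>c\<in>UNIV. nat \<bar>a + c * b\<bar> < nat \<bar>a\<bar>) \<or> (\<exists>c\<in>UNIV. nat \<bar>b + c * a\<bar> < nat \<bar>b\<bar>)"
    proof (cases "\<bar>b\<bar> \<le> \<bar>a\<bar>")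
      case True
      from *[OF this \<open>b \<noteq> 0\<close>] show ?thesis by (intro disjI1 bexI[of _ "- (a div b)"]) simp_all
    next
      case False
      then have "\<bar>a\<bar> \<le> \<bar>b\<bar>" by simp
      from *[OF this \<open>a \<noteq> 0\<close>] show ?thesis by (intro disjI2 bexI[of _ "- (b div a)"]) simp_all
    qed
  qed
qed simp

section \<open>Determinants of matrices with a zero block\<close>

text \<open>Frobenius-Koenig: by pigeonhole every permutation sends some index of \<open>I\<close>
  into \<open>J\<close>, so every term of the Leibniz sum vanishes.\<close>

lemma det_zero_block:
  fixes A :: "'a::idom mat"
  assumes A: "A \<in> Mat n n" and I: "I \<subseteq> {..<n}" and J: "J \<subseteq> {..<n}" and c: "card I + card J > n"
    and z: "\<And>i j. i \<in> I ==> j \<in> J ==> A $$ (i, j) = 0"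
  shows "det A = 0"
  unfolding det_def'[OF A]
proof (intro sum.neutral ballI)
  fix p assume "p \<in> {p. p permutes {0..<n}}"
  then have p: "p permutes {0..<n}" by simp
  have "card (p ` I) = card I" using p by (intro card_image) (meson inj_on_subset permutes_inj subset_UNIV)
  moreover have "p ` I \<subseteq> {..<n}" using p I permutes_in_image[OF p] by auto
  moreover have "finite I" "finite J" using I J finite_subset by auto
  ultimately have "p ` I \<inter> J \<noteq> {}"
    using card_Un_disjoint[of "p ` I" J] card_mono[of "{..<n}" "p ` I \<union> J"] J c by auto
  then obtain i where i: "i \<in> I" "p i \<in> J" by auto
  then have "(\<Prod>i = 0..<n. A $$ (i, p i)) = 0" using z[OF i] I i(1) by (intro prod_zero) (auto intro!: bexI[of _ i])
  then show "signof p * (\<Prod>i = 0..<n. A $$ (i, p i)) = 0" by simp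
qed

lemma det_in_subring:
  assumes R: "subring_set R" and A: "A \<in> Fmat R n"
  shows "det A \<in> R"
proof -
  have neg: "- a \<in> R" if "a \<in> R" for a using R that by (simp add: subring_set_def)
  have "signof p * (\<Prod>i = 0..<n. A $$ (i, p i)) \<in> R" if p: "p permutes {0..<n}" for p
  proof -
    have "(\<Prod>i = 0..<n. A $$ (i, p i)) \<in> R"
      using A permutes_in_image[OF p] by (intro subring_prod[OF R]) (auto simp: Fmat_def)
    then show ?thesis using neg by (auto simp: sign_def)
  qed
  then show ?thesis unfolding det_def'[OF Fmat_carrier[OF A]] by (intro subring_sum[OF R]) auto
qed

lemma adj_mat_in_Fmat:
  assumes R: "subring_set R" and A: "A \<in> Fmat R n"
  shows "adj_mat A \<in> Fmat R n"
proof -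
  have "cofactor A j i \<in> R" if "i < n" "j < n" for i j
  proof -
    have "mat_delete A j i \<in> Fmat R (n - 1)"
      using A that unfolding Fmat_def mat_delete_def by auto
    then have "det (mat_delete A j i) \<in> R" by (rule det_in_subring[OF R])
    moreover have "(- 1) ^ k \<in> R" for k
      using R by (induction k) (auto simp: subring_set_def)
    ultimately show ?thesis using R by (auto simp: cofactor_def subring_set_def)
  qed
  then show ?thesis using A by (auto simp: adj_mat_def Fmat_def)
qed

definition zero_block :: "nat => 'a::zero mat => bool" where
  "zero_block k G \<longleftrightarrow> (\<forall>i<k. \<forall>j<k. G $$ (i, j) = 0)"

text \<open>The span of the first \<open>k\<close> coordinate vectors is its own orthogonal
  complement. Isotropy is a \<open>k\<close> by \<open>k\<close> zero block in \<open>G\<close>,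
  hence \<open>2 * k \<le> n\<close>; maximality is a zero block of size \<open>n - k\<close> in the
  adjugate, hence \<open>2 * (n - k) \<le> n\<close>.\<close>

lemma half_dim:
  fixes G :: "'a::field mat"
  assumes R: "subring_set R" and G: "G \<in> Fmat R n" and d: "det G \<noteq> 0" and kn: "k \<le> n"
    and ch: "\<And>a. a \<in> Fvec R n ==> (\<forall>i. k \<le> i --> i < n --> a $ i = 0) \<longleftrightarrow> (\<forall>j<k. (\<Sum>i<n. a $ i * G $$ (i, j)) = 0)"
  shows "n = 2 * k \<and> zero_block k G"
proof -
  have Gc: "G \<in> Mat n n" using G by (rule Fmat_carrier)
  have R01: "0 \<in> R" "1 \<in> R" using R by (auto simp: subring_set_def)
  have z: "G $$ (i, j) = 0" if "i < k" "j < k" for i j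
  proof -
    have "unit_vec n i \<in> Fvec R n" using R01 by (auto simp: Fvec_def unit_vec_def)
    from ch[OF this] have "(\<Sum>l<n. unit_vec n i $ l * G $$ (l, j)) = 0" using that kn by auto
    moreover have "(\<Sum>l<n. unit_vec n i $ l * G $$ (l, j)) = (\<Sum>l<n. if l = i then G $$ (l, j) else 0)"
      using that kn by (intro sum.cong) (auto simp: unit_vec_def)
    ultimately show ?thesis using that kn by simp
  qed
  have 1: "2 * k \<le> n"
  proof (rule ccontr)
    assume "\<not> 2 * k \<le> n"
    then have "det G = 0" using kn z by (intro det_zero_block[OF Gc, of "{..<k}" "{..<k}"]) auto
    then show False using d by simp
  qed
  \<comment> \<open>The adjugate rather than the inverse, because its entries stay in
    \<open>R\<close>.\<close>
  define K where "K = adj_mat G"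
  have K: "K \<in> Fmat R n" unfolding K_def by (rule adj_mat_in_Fmat[OF R G])
  have KG: "K * G = det G \<cdot>\<^sub>m 1\<^sub>m n" unfolding K_def by (rule adj_mat(3)[OF Gc])
  have Kc: "K \<in> Mat n n" using K by (rule Fmat_carrier)
  have "det K * det G = det G ^ n" using KG det_mult[OF Kc Gc] by simp
  then have dK: "det K \<noteq> 0" using d by auto
  have zK: "K $$ (i, j) = 0" if i: "k \<le> i" "i < n" and j: "k \<le> j" "j < n" for i j
  proof -
    \<comment> \<open>A row of \<open>K\<close> beyond \<open>k\<close>, cut off below
      \<open>k\<close>. The cut does not change the pairing with the first \<open>k\<close> vectors,
      since the dropped entries meet the zero block of \<open>G\<close>.\<close>
    define a where "a = vec n (\<lambda>j. if k \<le> j then K $$ (i, j) else 0)"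
    have a: "a \<in> Fvec R n" using K R01 i by (auto simp: a_def Fvec_def Fmat_def)
    have "(\<Sum>l<n. a $ l * G $$ (l, j')) = 0" if j': "j' < k" for j'
    proof -
      have "(\<Sum>l<n. a $ l * G $$ (l, j')) = (\<Sum>l<n. K $$ (i, l) * G $$ (l, j'))"
        using z j' by (intro sum.cong) (auto simp: a_def not_le)
      also have "\<dots> = (K * G) $$ (i, j')"
        using Kc Gc i j' kn by (auto simp: scalar_prod_def atLeast0LessThan)
      also have "\<dots> = 0" using i j' kn KG by auto
      finally show ?thesis .
    qed
    then have "a $ j = 0" using ch[OF a] j by auto
    then show ?thesis using j by (simp add: a_def)
  qed
  have "2 * (n - k) \<le> n"
  proof (rule ccontr)
    assume "\<not> 2 * (n - k) \<le> n"
    then have "det K = 0" using zK by (intro det_zero_block[OF Kc, of "{k..<n}" "{k..<n}"]) auto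
    then show False using dK by simp
  qed
  then show ?thesis using 1 kn z by (auto simp: zero_block_def)
qed

text \<open>Exchanging the two halves of the columns gives a block triangular matrix; the exchange
  has sign \<open>(- 1) ^ (k * k)\<close>, which is \<open>(- 1) ^ k\<close>.\<close>

lemma det_antidiagonal:
  fixes G :: "'a::idom mat"
  assumes G: "G \<in> Mat (2 * k) (2 * k)" and z: "zero_block k G"
  shows "det G = (- 1) ^ k * det (mat k k (\<lambda>(i, j). G $$ (i, k + j))) * det (mat k k (\<lambda>(i, j). G $$ (k + i, j)))"
proof -
  have G': "G \<in> Mat (k + k) (k + k)" using G by (simp add: mult_2)
  let ?C = "mat k k (\<lambda>(i, j). G $$ (i, k + j))" and ?D = "mat k k (\<lambda>(i, j). G $$ (k + i, j))"
  let ?E = "mat k k (\<lambda>(i, j). G $$ (k + i, k + j))"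
  have "mat (k + k) (k + k) (\<lambda>(i,j). G $$ (i,(if j < k then j + k else j - k)))
     = four_block_mat ?C (0\<^sub>m k k) ?E ?D"
    using z by (intro eq_matI) (auto simp: zero_block_def add.commute)
  moreover have "det (four_block_mat ?C (0\<^sub>m k k) ?E ?D) = det ?C * det ?D"
    by (rule det_four_block_mat_upper_right_zero) auto
  moreover have "(- 1 :: 'a) ^ (k * k) = (- 1) ^ k"
    by (simp add: minus_one_power_iff)
  ultimately show ?thesis using det_swap_cols[OF G'] by simp
qed

section \<open>Sesquilinear forms and Lagrangians over a field with involution\<close>

definition hf :: "('a::comm_ring_1 => 'a) => nat => 'a mat => 'a vec => 'a vec => 'a" where
  "hf \<sigma> n G x y = (\<Sum>i<n. \<Sum>j<n. x $ i * G $$ (i, j) * \<sigma> (y $ j))"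

text \<open>Nothing is asked of \<open>\<sigma>\<close> outside \<open>R\<close>: the involution of
  Q(z) is a definite description that is meaningful only on Q(z).\<close>

definition hom_on :: "'a::comm_ring_1 set => ('a => 'a) => bool" where
  "hom_on R \<sigma> \<longleftrightarrow> (\<forall>a\<in>R. \<sigma> a \<in> R) \<and> (\<forall>a\<in>R. \<forall>b\<in>R. \<sigma> (a + b) = \<sigma> a + \<sigma> b) \<and>
     (\<forall>a\<in>R. \<forall>b\<in>R. \<sigma> (a * b) = \<sigma> a * \<sigma> b) \<and> \<sigma> 1 = 1 \<and> \<sigma> 0 = 0"

lemma hom_on_sum:
  assumes "subring_set R" "hom_on R \<sigma>" "\<And>i. i \<in> I ==> f i \<in> R"
  shows "\<sigma> (sum f I) = (\<Sum>i\<in>I. \<sigma> (f i))"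
  using assms(3)
proof (induction I rule: infinite_finite_induct)
  case (insert x F)
  then have "\<sigma> (f x + sum f F) = \<sigma> (f x) + \<sigma> (sum f F)"
    using assms(1,2) subring_sum[OF assms(1), of F f] unfolding hom_on_def by auto
  then show ?case using insert by auto
qed (use assms(2) in \<open>auto simp: hom_on_def\<close>)

lemma hom_on_uminus:
  assumes "subring_set R" "hom_on R \<sigma>" "a \<in> R"
  shows "\<sigma> (- a) = - \<sigma> a"
proof -
  have "\<sigma> (a + - a) = \<sigma> a + \<sigma> (- a)" using assms unfolding hom_on_def subring_set_def by blast
  then show ?thesis using assms by (simp add: hom_on_def eq_neg_iff_add_eq_0 add.commute)
qed

lemma hom_on_prod:
  assumes "subring_set R" "hom_on R \<sigma>" "\<And>i. i \<in> I ==> f i \<in> R"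
  shows "\<sigma> (prod f I) = (\<Prod>i\<in>I. \<sigma> (f i))"
  using assms(3)
proof (induction I rule: infinite_finite_induct)
  case (insert x F)
  then have "\<sigma> (f x * prod f F) = \<sigma> (f x) * \<sigma> (prod f F)"
    using assms(1,2) subring_prod[OF assms(1), of F f] unfolding hom_on_def by auto
  then show ?case using insert by auto
qed (use assms(2) in \<open>auto simp: hom_on_def\<close>)

lemma hom_on_det:
  assumes R: "subring_set R" and h: "hom_on R \<sigma>" and A: "A \<in> Fmat R n"
  shows "det (map_mat \<sigma> A) = \<sigma> (det A)"
proof -
  have Ac: "A \<in> Mat n n" "map_mat \<sigma> A \<in> Mat n n" using A by (auto simp: Fmat_def)
  have sgn: "\<sigma> (signof p * a) = signof p * \<sigma> a" if "a \<in> R" for p :: "nat => nat" and a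
    using hom_on_uminus[OF R h that] by (auto simp: sign_def)
  have pr: "(\<Prod>i = 0..<n. A $$ (i, p i)) \<in> R" if p: "p permutes {0..<n}" for p
    using A permutes_in_image[OF p] by (intro subring_prod[OF R]) (auto simp: Fmat_def)
  have "\<sigma> (det A) = (\<Sum>p\<in>{p. p permutes {0..<n}}. \<sigma> (signof p * (\<Prod>i = 0..<n. A $$ (i, p i))))"
    unfolding det_def'[OF Ac(1)]
  proof (rule hom_on_sum[OF R h])
    fix p assume "p \<in> {p. p permutes {0..<n}}"
    with pr[of p] show "signof p * (\<Prod>i = 0..<n. A $$ (i, p i)) \<in> R"
      using R by (auto simp: sign_def subring_set_def)
  qed
  also have "\<dots> = (\<Sum>p\<in>{p. p permutes {0..<n}}. signof p * (\<Prod>i = 0..<n. map_mat \<sigma> A $$ (i, p i)))"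
  proof (rule sum.cong[OF refl])
    fix p assume "p \<in> {p. p permutes {0..<n}}"
    then have p: "p permutes {0..<n}" by simp
    have "\<sigma> (signof p * (\<Prod>i = 0..<n. A $$ (i, p i))) = signof p * \<sigma> (\<Prod>i = 0..<n. A $$ (i, p i))"
      by (rule sgn[OF pr[OF p]])
    also have "\<sigma> (\<Prod>i = 0..<n. A $$ (i, p i)) = (\<Prod>i = 0..<n. \<sigma> (A $$ (i, p i)))"
      using A permutes_in_image[OF p] by (intro hom_on_prod[OF R h]) (auto simp: Fmat_def)
    also have "\<dots> = (\<Prod>i = 0..<n. map_mat \<sigma> A $$ (i, p i))"
      using Ac permutes_in_image[OF p] by (intro prod.cong) auto
    finally show "\<sigma> (signof p * (\<Prod>i = 0..<n. A $$ (i, p i))) = signof p * (\<Prod>i = 0..<n. map_mat \<sigma> A $$ (i, p i))" .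
  qed
  finally show ?thesis unfolding det_def'[OF Ac(2)] by simp
qed

lemma hf_transform:
  assumes R: "subring_set R" and h: "hom_on R \<sigma>" and U: "U \<in> Fmat R n" and G: "G \<in> Fmat R n"
    and a: "a \<in> Fvec R n" and b: "b \<in> Fvec R n"
  shows "hf \<sigma> n G (U *v a) (U *v b) = hf \<sigma> n (trp U * G * map_mat \<sigma> U) a b"
proof -
  have Uc: "U \<in> Mat n n" and Gc: "G \<in> Mat n n" using U G by (auto simp: Fmat_def)
  have Ua: "(U *v a) $ i = (\<Sum>l<n. U $$ (i, l) * a $ l)" if "i < n" for i
    using that Uc a by (auto simp: scalar_prod_def Fvec_def atLeast0LessThan intro!: sum.cong)
  have Ub: "\<sigma> ((U *v b) $ j) = (\<Sum>m<n. \<sigma> (U $$ (j, m)) * \<sigma> (b $ m))" if "j < n" for j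
  proof -
    have "(U *v b) $ j = (\<Sum>l<n. U $$ (j, l) * b $ l)"
      using that Uc b by (auto simp: scalar_prod_def Fvec_def atLeast0LessThan intro!: sum.cong)
    also have "\<sigma> \<dots> = (\<Sum>m<n. \<sigma> (U $$ (j, m) * b $ m))"
      using R U b that by (intro hom_on_sum[OF R h]) (auto simp: Fmat_def Fvec_def subring_set_def)
    finally show ?thesis using h U b that by (auto simp: hom_on_def Fmat_def Fvec_def intro!: sum.cong)
  qed
  have M: "(trp U * G * map_mat \<sigma> U) $$ (l, m) = (\<Sum>i<n. \<Sum>j<n. U $$ (i, l) * G $$ (i, j) * \<sigma> (U $$ (j, m)))"
    if "l < n" "m < n" for l m
  proof -
    have "(trp U * G * map_mat \<sigma> U) $$ (l, m) = (\<Sum>i<n. U $$ (i, l) * (\<Sum>j<n. G $$ (i, j) * \<sigma> (U $$ (j, m))))"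
      using that Uc Gc by (auto simp: scalar_prod_def atLeast0LessThan intro!: sum.cong)
    then show ?thesis by (simp add: sum_distrib_left mult.assoc)
  qed
  have "hf \<sigma> n (trp U * G * map_mat \<sigma> U) a b =
    (\<Sum>l<n. \<Sum>m<n. \<Sum>i<n. \<Sum>j<n. a $ l * (U $$ (i, l) * G $$ (i, j) * \<sigma> (U $$ (j, m))) * \<sigma> (b $ m))"
    unfolding hf_def by (simp add: M sum_distrib_left sum_distrib_right)
  also have "\<dots> = (\<Sum>i<n. \<Sum>j<n. \<Sum>l<n. \<Sum>m<n. a $ l * (U $$ (i, l) * G $$ (i, j) * \<sigma> (U $$ (j, m))) * \<sigma> (b $ m))"
  proof -
    have "(\<Sum>l<n. \<Sum>m<n. \<Sum>i<n. \<Sum>j<n. f l m i j) = (\<Sum>i<n. \<Sum>j<n. \<Sum>l<n. \<Sum>m<n. f l m i j)" for f :: "_ => _ => _ => _ => 'a"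
    proof -
      have 3: "(\<Sum>m<n. \<Sum>i<n. \<Sum>j<n. g m i j) = (\<Sum>i<n. \<Sum>j<n. \<Sum>m<n. g m i j)" for g :: "_ => _ => _ => 'a"
      proof -
        have "(\<Sum>m<n. \<Sum>i<n. \<Sum>j<n. g m i j) = (\<Sum>i<n. \<Sum>m<n. \<Sum>j<n. g m i j)" by (rule sum.swap)
        also have "\<dots> = (\<Sum>i<n. \<Sum>j<n. \<Sum>m<n. g m i j)" by (rule sum.cong[OF refl], rule sum.swap)
        finally show ?thesis .
      qed
      have "(\<Sum>l<n. \<Sum>m<n. \<Sum>i<n. \<Sum>j<n. f l m i j) = (\<Sum>l<n. \<Sum>i<n. \<Sum>j<n. \<Sum>m<n. f l m i j)"
        by (rule sum.cong[OF refl], rule 3)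
      also have "\<dots> = (\<Sum>i<n. \<Sum>j<n. \<Sum>l<n. \<Sum>m<n. f l m i j)" by (rule 3)
      finally show ?thesis .
    qed
    then show ?thesis .
  qed
  also have "\<dots> = hf \<sigma> n G (U *v a) (U *v b)"
    unfolding hf_def
  proof (intro sum.cong refl)
    fix i j assume ij: "i \<in> {..<n}" "j \<in> {..<n}"
    have "(U *v a) $ i * G $$ (i, j) * \<sigma> ((U *v b) $ j) = (\<Sum>l<n. U $$ (i, l) * a $ l) * G $$ (i, j) * (\<Sum>m<n. \<sigma> (U $$ (j, m)) * \<sigma> (b $ m))"
      using ij Ua[of i] Ub[of j] by simp
    also have "\<dots> = (\<Sum>l<n. \<Sum>m<n. a $ l * (U $$ (i, l) * G $$ (i, j) * \<sigma> (U $$ (j, m))) * \<sigma> (b $ m))"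
      by (simp add: sum_distrib_left sum_distrib_right mult.assoc mult.left_commute mult.commute)
    finally show "(\<Sum>l<n. \<Sum>m<n. a $ l * (U $$ (i, l) * G $$ (i, j) * \<sigma> (U $$ (j, m))) * \<sigma> (b $ m)) =
      (U *v a) $ i * G $$ (i, j) * \<sigma> ((U *v b) $ j)" by simp
  qed
  finally show ?thesis by simp
qed

text \<open>Equality of \<open>L\<close> with its orthogonal complement. That the dimension is half
  of \<open>n\<close> is a consequence when \<open>G\<close> is nonsingular.\<close>

definition lagrangian :: "'a::comm_ring_1 set => ('a => 'a) => nat => 'a mat => 'a vec set => bool" where
  "lagrangian R \<sigma> n G L \<longleftrightarrow> submod R n L \<and> (\<forall>x\<in>Fvec R n. x \<in> L \<longleftrightarrow> (\<forall>y\<in>L. hf \<sigma> n G x y = 0))"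

lemma GL_pair_cancel:
  assumes "GL_pair R n U U'" "a \<in> Vec n"
  shows "U' *v (U *v a) = a" "U *v (U' *v a) = a"
  using assms by (auto simp: GL_pair_def Fmat_def simp flip: assoc_mult_mat_vec[of _ n n _ n])

lemma adapted_mem:
  assumes R: "subring_set R" and ad: "adapted R n L U U' k" and a: "a \<in> Fvec R n"
  shows "U *v a \<in> L \<longleftrightarrow> (\<forall>i. k \<le> i --> i < n --> a $ i = 0)"
proof -
  have "U *v a \<in> Fvec R n" using ad R a by (auto simp: adapted_def GL_pair_def intro: Fmat_mult_vec)
  moreover have "U' *v (U *v a) = a"
    using ad a GL_pair_cancel by (auto simp: adapted_def Fvec_def)
  ultimately show ?thesis using ad by (auto simp: adapted_def)
qed

text \<open>In coordinates adapted to \<open>L\<close>, being its own orthogonal complement becomes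
  the hypothesis of \<open>half_dim\<close>. The determinant is unchanged because
  \<open>det U\<close> is 1 or -1 and \<open>\<sigma>\<close> fixes both.\<close>

lemma lagrangian_half_dim:
  fixes G :: "'a::field mat"
  assumes R: "subring_set R" and h: "hom_on R \<sigma>" and G: "G \<in> Fmat R n" and d: "det G \<noteq> 0"
    and ad: "adapted R n L U U' k" and L: "lagrangian R \<sigma> n G L"
  shows "n = 2 * k" "zero_block k (trp U * G * map_mat \<sigma> U)"
    "det (trp U * G * map_mat \<sigma> U) = det G"
    "trp U * G * map_mat \<sigma> U \<in> Fmat R n"
proof -
  let ?G = "trp U * G * map_mat \<sigma> U"
  have U: "U \<in> Fmat R n" "U' \<in> Fmat R n" and kn: "k \<le> n" using ad by (auto simp: adapted_def GL_pair_def)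
  have Uc: "U \<in> Mat n n" "U' \<in> Mat n n" "G \<in> Mat n n" using U G by (auto simp: Fmat_def)
  have "trp U \<in> Fmat R n" using U by (auto simp: Fmat_def)
  moreover have "map_mat \<sigma> U \<in> Fmat R n" using U h by (auto simp: Fmat_def hom_on_def)
  ultimately show G': "?G \<in> Fmat R n" using G by (intro Fmat_mult[OF R])
  have R01: "0 \<in> R" "1 \<in> R" using R by (auto simp: subring_set_def)
  have s1: "\<sigma> (- 1) = - 1" using hom_on_uminus[OF R h R01(2)] h by (simp add: hom_on_def)
  have "det ?G = det U * det G * \<sigma> (det U)"
  proof -
    have "det ?G = det (trp U * G) * det (map_mat \<sigma> U)"
      using Uc by (intro det_mult) auto
    also have "det (trp U * G) = det (trp U) * det G"
      using Uc by (intro det_mult) auto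
    finally show ?thesis using Uc hom_on_det[OF R h U(1)] by (simp add: det_transpose)
  qed
  then show dG: "det ?G = det G"
    using ad h s1 by (auto simp: adapted_def GL_pair_def hom_on_def)
  have "n = 2 * k \<and> zero_block k ?G"
  proof (rule half_dim[OF R G' _ kn])
    show "det ?G \<noteq> 0" using dG d by simp
    fix a assume a: "a \<in> Fvec R n"
    have "(\<forall>i. k \<le> i --> i < n --> a $ i = 0) \<longleftrightarrow> U *v a \<in> L" using adapted_mem[OF R ad a] by simp
    also have "\<dots> \<longleftrightarrow> (\<forall>y\<in>L. hf \<sigma> n G (U *v a) y = 0)"
      using L Fmat_mult_vec[OF R U(1) a] by (auto simp: lagrangian_def)
    also have "\<dots> \<longleftrightarrow> (\<forall>b\<in>Fvec R n. (\<forall>i. k \<le> i --> i < n --> b $ i = 0) --> hf \<sigma> n ?G a b = 0)"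
    proof (intro iffI ballI impI)
      fix b assume 1: "\<forall>y\<in>L. hf \<sigma> n G (U *v a) y = 0" and b: "b \<in> Fvec R n" and z: "\<forall>i. k \<le> i --> i < n --> b $ i = 0"
      have "U *v b \<in> L" using adapted_mem[OF R ad b] z by simp
      then show "hf \<sigma> n ?G a b = 0" using 1 hf_transform[OF R h U(1) G a b] by simp
    next
      fix y assume 1: "\<forall>b\<in>Fvec R n. (\<forall>i. k \<le> i --> i < n --> b $ i = 0) --> hf \<sigma> n ?G a b = 0" and y: "y \<in> L"
      have yF: "y \<in> Fvec R n" using y L by (auto simp: lagrangian_def submod_def)
      let ?b = "U' *v y"
      have b: "?b \<in> Fvec R n" by (rule Fmat_mult_vec[OF R U(2) yF])
      have e: "U *v ?b = y" using ad yF GL_pair_cancel by (auto simp: adapted_def Fvec_def)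
      then have "\<forall>i. k \<le> i --> i < n --> ?b $ i = 0" using adapted_mem[OF R ad b] y by simp
      then have "hf \<sigma> n ?G a ?b = 0" using 1 b by blast
      then show "hf \<sigma> n G (U *v a) y = 0" using hf_transform[OF R h U(1) G a b] e by simp
    qed
    also have "\<dots> \<longleftrightarrow> (\<forall>j<k. (\<Sum>i<n. a $ i * ?G $$ (i, j)) = 0)"
    proof (intro iffI ballI allI impI)
      fix j assume 1: "\<forall>b\<in>Fvec R n. (\<forall>i. k \<le> i --> i < n --> b $ i = 0) --> hf \<sigma> n ?G a b = 0" and j: "j < k"
      have "unit_vec n j \<in> Fvec R n" "\<forall>i. k \<le> i --> i < n --> unit_vec n j $ i = 0"
        using R01 j kn by (auto simp: Fvec_def unit_vec_def)
      then have "hf \<sigma> n ?G a (unit_vec n j) = 0" using 1 by blast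
      moreover have "hf \<sigma> n ?G a (unit_vec n j) = (\<Sum>i<n. \<Sum>m<n. if m = j then a $ i * ?G $$ (i, j) else 0)"
        unfolding hf_def using h j kn by (intro sum.cong refl) (auto simp: hom_on_def unit_vec_def)
      ultimately show "(\<Sum>i<n. a $ i * ?G $$ (i, j)) = 0" using j kn by simp
    next
      fix b assume 1: "\<forall>j<k. (\<Sum>i<n. a $ i * ?G $$ (i, j)) = 0" and b: "b \<in> Fvec R n" and z: "\<forall>i. k \<le> i --> i < n --> b $ i = 0"
      have "hf \<sigma> n ?G a b = (\<Sum>j<n. (\<Sum>i<n. a $ i * ?G $$ (i, j)) * \<sigma> (b $ j))"
        unfolding hf_def by (subst sum.swap) (simp add: sum_distrib_right)
      also have "\<dots> = 0"
      proof (intro sum.neutral ballI)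
        fix j assume "j \<in> {..<n}"
        then show "(\<Sum>i<n. a $ i * ?G $$ (i, j)) * \<sigma> (b $ j) = 0"
          using 1 z h by (cases "j < k") (auto simp: hom_on_def)
      qed
      finally show "hf \<sigma> n ?G a b = 0" .
    qed
    finally show "(\<forall>i. k \<le> i --> i < n --> a $ i = 0) \<longleftrightarrow> (\<forall>j<k. (\<Sum>i<n. a $ i * ?G $$ (i, j)) = 0)" .
  qed
  then show "n = 2 * k" "zero_block k ?G" by auto
qed

section \<open>Bilinear forms given by matrices, and block sums\<close>

definition bf :: "'a::comm_ring_1 mat => 'a vec => 'a vec => 'a" where
  "bf G x y = x \<bullet> (G *v y)"

lemma hom_on_id: "hom_on R (\<lambda>x. x)"
  by (simp add: hom_on_def)

lemma map_mat_id [simp]: "map_mat (\<lambda>x. x) A = A"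
  by (intro eq_matI) auto

lemma bf_hf: "G \<in> Mat n n ==> x \<in> Vec n ==> y \<in> Vec n ==> bf G x y = hf (\<lambda>x. x) n G x y"
  by (auto simp: bf_def hf_def scalar_prod_def atLeast0LessThan sum_distrib_left mult.assoc intro!: sum.cong)

lemma bf_add_left: "G \<in> Mat n m ==> x \<in> Vec n ==> x' \<in> Vec n ==> y \<in> Vec m ==>
  bf G (x + x') y = bf G x y + bf G x' y"
  by (auto simp: bf_def intro!: add_scalar_prod_distrib[of _ n])

lemma bf_add_right: "G \<in> Mat n m ==> x \<in> Vec n ==> y \<in> Vec m ==> y' \<in> Vec m ==>
  bf G x (y + y') = bf G x y + bf G x y'"
  by (auto simp: bf_def mult_add_distrib_mat_vec[of _ n m] intro!: scalar_prod_add_distrib[of _ n])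

lemma bf_smult_left: "G \<in> Mat n m ==> x \<in> Vec n ==> y \<in> Vec m ==> bf G (c *s x) y = c * bf G x y"
  by (auto simp: bf_def)

lemma bf_smult_right: "G \<in> Mat n m ==> x \<in> Vec n ==> y \<in> Vec m ==> bf G x (c *s y) = c * bf G x y"
  by (auto simp: bf_def mult_mat_vec_smult[of _ n m] simp del: smult_carrier_vec)

lemma bf_minus_left: "G \<in> Mat n m ==> x \<in> Vec n ==> x' \<in> Vec n ==> y \<in> Vec m ==>
  bf G (x - x') y = bf G x y - bf G x' y"
  by (auto simp: bf_def intro!: minus_scalar_prod_distrib[of _ n])

lemma bf_minus_right: "G \<in> Mat n m ==> x \<in> Vec n ==> y \<in> Vec m ==> y' \<in> Vec m ==>
  bf G x (y - y') = bf G x y - bf G x y'"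
  by (auto simp: bf_def mult_minus_distrib_mat_vec[of _ n m] intro!: scalar_prod_minus_distrib[of _ n])

lemma bf_zero_left [simp]: "G \<in> Mat n m ==> y \<in> Vec m ==> bf G (0\<^sub>v n) y = 0"
  by (auto simp: bf_def)

lemma bf_zero_right [simp]: "G \<in> Mat n m ==> x \<in> Vec n ==> bf G x (0\<^sub>v m) = 0"
proof -
  assume "G \<in> Mat n m" "x \<in> Vec n"
  moreover then have "G *v 0\<^sub>v m = 0\<^sub>v n" by (intro eq_vecI) auto
  ultimately show ?thesis by (auto simp: bf_def)
qed

lemma bf_transpose: "G \<in> Mat n m ==> x \<in> Vec m ==> y \<in> Vec n ==> bf (trp G) x y = bf G y x"
proof -
  assume a: "G \<in> Mat n m" "x \<in> Vec m" "y \<in> Vec n"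
  have "bf (trp G) x y = (trp G *v y) \<bullet> x"
    unfolding bf_def using a by (intro comm_scalar_prod[of _ m]) auto
  also have "\<dots> = bf G y x" unfolding bf_def using a by (intro transpose_vec_mult_scalar[of _ n m]) auto
  finally show ?thesis .
qed

lemma bf_mult_right: "G \<in> Mat n m ==> P \<in> Mat m k ==> v \<in> Vec k ==>
  bf G x (P *v v) = bf (G * P) x v"
  by (simp add: bf_def)

lemma bf_congruence:
  assumes "G \<in> Mat n m" "P \<in> Mat n k" "Q \<in> Mat m l" "v \<in> Vec k" "w \<in> Vec l"
  shows "bf G (P *v v) (Q *v w) = bf (trp P * G * Q) v w"
proof -
  have "bf (trp P * G * Q) v w = v \<bullet> (trp P *v (G *v (Q *v w)))"
    unfolding bf_def using assms by (simp add: assoc_mult_mat_vec[of _ k n _ l] assoc_mult_mat_vec[of _ n m _ l])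
  also have "\<dots> = bf (trp P) v (G *v (Q *v w))" by (simp add: bf_def)
  also have "\<dots> = bf P (G *v (Q *v w)) v" using assms by (intro bf_transpose) auto
  also have "\<dots> = bf G (P *v v) (Q *v w)"
    unfolding bf_def using assms by (intro comm_scalar_prod[of _ n]) auto
  finally show ?thesis by simp
qed

lemma bf_add_mat: "G \<in> Mat n m ==> H \<in> Mat n m ==> x \<in> Vec n ==> y \<in> Vec m ==>
  bf (G + H) x y = bf G x y + bf H x y"
  by (auto simp: bf_def add_mult_distrib_mat_vec[of _ n m] intro!: scalar_prod_add_distrib[of _ n])

lemma bf_minus_mat: "G \<in> Mat n m ==> H \<in> Mat n m ==> x \<in> Vec n ==> y \<in> Vec m ==>
  bf (G - H) x y = bf G x y - bf H x y"
  by (auto simp: bf_def minus_mult_distrib_mat_vec[of _ n m] intro!: scalar_prod_minus_distrib[of _ n])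

lemma bf_uminus_mat: "G \<in> Mat n m ==> x \<in> Vec n ==> y \<in> Vec m ==> bf (- G) x y = - bf G x y"
  by (auto simp: bf_def)

lemma bf_unit: "G \<in> Mat n m ==> i < n ==> j < m ==> bf G (unit_vec n i) (unit_vec m j) = G $$ (i, j)"
  by (simp add: bf_def)

lemma bf_eqI:
  assumes "G \<in> Mat n m" "H \<in> Mat n m"
    "\<And>x y. x \<in> Vec n ==> y \<in> Vec m ==> bf G x y = bf H x y"
  shows "G = H"
  using assms bf_unit[of G n m] bf_unit[of H n m] by (intro eq_matI) (metis carrier_matD unit_vec_carrier)+

lemma block_sum_carrier: "G \<in> Mat n n ==> H \<in> Mat m m ==> G \<boxplus> H \<in> Mat (n + m) (n + m)"
  by (auto simp: block_sum_def)

lemma block_sum_mult_vec: "G \<in> Mat n n ==> H \<in> Mat m m ==> x \<in> Vec n ==> y \<in> Vec m ==>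
   (G \<boxplus> H) *v (x @\<^sub>v y) = (G *v x) @\<^sub>v (H *v y)"
  unfolding block_sum_def by (simp add: mult_mat_vec_split)

lemma bf_block_sum: "G \<in> Mat n n ==> H \<in> Mat m m ==> x \<in> Vec n ==> y \<in> Vec m ==>
   x' \<in> Vec n ==> y' \<in> Vec m ==> bf (G \<boxplus> H) (x @\<^sub>v y) (x' @\<^sub>v y') = bf G x x' + bf H y y'"
  by (simp add: bf_def block_sum_mult_vec scalar_prod_append[of _ n _ m])

lemma det_block_sum: "G \<in> Mat n n ==> H \<in> Mat m m ==> det (G \<boxplus> H) = det G * det (H :: 'a::idom mat)"
  unfolding block_sum_def by (simp add: det_four_block_mat_upper_right_zero[of _ n _ m])

lemma append_vec_cases:
  assumes "z \<in> Vec (n + m)"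
  obtains x y where "x \<in> Vec n" "y \<in> Vec m" "z = x @\<^sub>v y"
  using vec_first_last_append[OF assms] vec_first_carrier vec_last_carrier by metis

lemma append_vec_inj: "x \<in> Vec n ==> x' \<in> Vec n ==> x @\<^sub>v y = x' @\<^sub>v y' \<longleftrightarrow> x = x' \<and> y = y'"
  by (rule append_vec_eq)

lemma append_vec_add': "x \<in> Vec n ==> x' \<in> Vec n ==> y \<in> Vec m ==> y' \<in> Vec m ==>
  (x @\<^sub>v y) + (x' @\<^sub>v y') = (x + x') @\<^sub>v (y + y')"
  by (intro eq_vecI) auto

lemma append_vec_smult: "c *s (x @\<^sub>v y) = (c *s x) @\<^sub>v (c *s y)"
  by (intro eq_vecI) auto

lemma append_vec_zero: "0\<^sub>v n @\<^sub>v 0\<^sub>v m = 0\<^sub>v (n + m)"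
  by (intro eq_vecI) auto

lemma mult_mat_zero_vec:
  fixes A :: "'a::comm_ring_1 mat"
  assumes "A \<in> Mat n m"
  shows "A *v 0\<^sub>v m = 0\<^sub>v n"
  using assms by (intro eq_vecI) auto

lemma mat_inv_exists:
  fixes G :: "'a::field mat"
  assumes G: "G \<in> Mat n n" and d: "det G \<noteq> 0"
  shows "\<exists>G'\<in>Mat n n. G * G' = 1\<^sub>m n \<and> G' * G = 1\<^sub>m n"
proof (intro bexI conjI)
  let ?G' = "inverse (det G) \<cdot>\<^sub>m adj_mat G"
  note a = adj_mat[OF G]
  show "?G' \<in> Mat n n" using a by simp
  show "G * ?G' = 1\<^sub>m n" using a(2) d by (simp add: mult_smult_distrib[OF G a(1)]) (intro eq_matI, auto)
  show "?G' * G = 1\<^sub>m n" using a(3) d by (simp add: mult_smult_assoc_mat[OF a(1) G]) (intro eq_matI, auto)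
qed

text \<open>Padding with zero rows gives a singular square matrix, and a kernel vector of it solves
  the system.\<close>

lemma underdetermined:
  fixes M :: "'a::field mat"
  assumes M: "M \<in> Mat k m" and km: "k < m"
  shows "\<exists>v\<in>Vec m. v \<noteq> 0\<^sub>v m \<and> M *v v = 0\<^sub>v k"
proof -
  let ?A = "mat m m (\<lambda>(i, j). if i < k then M $$ (i, j) else 0)"
  have "det ?A = 0" using km by (intro det_zero_block[of _ m "{k}" "{..<m}"]) auto
  then obtain v where v: "v \<in> Vec m" "v \<noteq> 0\<^sub>v m" "?A *v v = 0\<^sub>v m"
    using det_0_iff_vec_prod_zero_field[of ?A m] by auto
  have "(M *v v) $ i = 0" if "i < k" for i
  proof -
    have "(?A *v v) $ i = 0" using v(3) that km by simp
    then have "row ?A i \<bullet> v = 0" using that km by simp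
    moreover have "row ?A i = row M i" using that km M by (intro eq_vecI) auto
    ultimately show ?thesis using that M by simp
  qed
  then have "M *v v = 0\<^sub>v k" using M by (intro eq_vecI) auto
  then show ?thesis using v by blast
qed

section \<open>Lagrangian subspaces over a field\<close>

abbreviation subsp :: "nat => 'a::field vec set => bool" where
  "subsp \<equiv> submod UNIV"

definition Lagr :: "nat => 'a::field mat => 'a vec set => bool" where
  "Lagr n G L \<longleftrightarrow> subsp n L \<and> (\<forall>x\<in>Vec n. x \<in> L \<longleftrightarrow> (\<forall>y\<in>L. bf G x y = 0))"

lemma Lagr_lagrangian: "G \<in> Mat n n ==> Lagr n G L \<longleftrightarrow> lagrangian UNIV (\<lambda>x. x) n G L"
  unfolding Lagr_def lagrangian_def by (auto simp: submod_def bf_hf subset_iff)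

lemma subspD:
  assumes "subsp n L"
  shows "x \<in> L ==> x \<in> Vec n" "0\<^sub>v n \<in> L" "x \<in> L ==> y \<in> L ==> x + y \<in> L" "x \<in> L ==> c *s x \<in> L"
  using assms by (auto simp: submod_def)

lemma adapted_subsp:
  assumes "subsp n (L :: 'a::field vec set)"
  shows "\<exists>U U' k. adapted UNIV n L U U' k"
  by (rule adapted_field[OF _ _ assms]) auto

text \<open>Multiplying by it on the right selects the first \<open>k\<close> columns, so
  \<open>U * emb n k\<close> is a basis matrix of an adapted subspace.\<close>

definition emb :: "nat => nat => 'a::field mat" where
  "emb n k = mat n k (\<lambda>(i, j). if i = j then 1 else 0)"

lemma emb_mult: "k \<le> n ==> v \<in> Vec k ==> emb n k *v v = vec n (\<lambda>i. if i < k then v $ i else 0)"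
proof (intro eq_vecI)
  fix i assume a: "k \<le> n" "v \<in> Vec k" "i < dim_vec (vec n (\<lambda>i. if i < k then v $ i else 0))"
  then have "(emb n k *v v) $ i = (\<Sum>j<k. (if i = j then 1 else 0) * v $ j)"
    by (auto simp: emb_def scalar_prod_def atLeast0LessThan)
  also have "\<dots> = (\<Sum>j<k. if i = j then v $ j else 0)" by (intro sum.cong) auto
  finally show "(emb n k *v v) $ i = vec n (\<lambda>i. if i < k then v $ i else 0) $ i" using a by simp
qed (simp add: emb_def)

lemma basis_of_adapted:
  assumes ad: "adapted UNIV n (L :: 'a::field vec set) U U' k" and L: "L \<subseteq> Vec n"
  shows "U * emb n k \<in> Mat n k" "mat_kernel (U * emb n k) = {0\<^sub>v k}"
    "(\<lambda>v. (U * emb n k) *v v) ` Vec k = L"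
proof -
  have U: "U \<in> Mat n n" "U' \<in> Mat n n" and kn: "k \<le> n" and GL: "GL_pair UNIV n U U'"
    using ad by (auto simp: adapted_def GL_pair_def)
  have E: "emb n k \<in> Mat n k" by (simp add: emb_def)
  show P: "U * emb n k \<in> Mat n k" using U(1) E by (rule mult_carrier_mat)
  have Pv: "(U * emb n k) *v v = U *v (vec n (\<lambda>i. if i < k then v $ i else 0))" if "v \<in> Vec k" for v
    using assoc_mult_mat_vec[OF U(1) E that] emb_mult[OF kn that] by simp
  have z: "U *v 0\<^sub>v n = 0\<^sub>v n" "U' *v 0\<^sub>v n = 0\<^sub>v n" using U by (auto intro!: eq_vecI)
  show "mat_kernel (U * emb n k) = {0\<^sub>v k}"
  proof (intro equalityI subsetI)
    fix v assume "v \<in> mat_kernel (U * emb n k)"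
    then have v: "v \<in> Vec k" "(U * emb n k) *v v = 0\<^sub>v n" using mat_kernelD[OF P] by auto
    then have "U' *v (U *v (vec n (\<lambda>i. if i < k then v $ i else 0))) = 0\<^sub>v n" using Pv z by simp
    then have "vec n (\<lambda>i. if i < k then v $ i else 0) = 0\<^sub>v n"
      using GL_pair_cancel(1)[OF GL, of "vec n (\<lambda>i. if i < k then v $ i else 0)"] by simp
    then have e: "vec n (\<lambda>i. if i < k then v $ i else 0) $ i = 0\<^sub>v n $ i" for i by simp
    have "v $ i = 0" if "i < k" for i using e[of i] that kn by simp
    then show "v \<in> {0\<^sub>v k}" using v by (auto intro!: eq_vecI)
  next
    fix v assume "v \<in> {0\<^sub>v k :: 'a vec}"
    moreover have "(U * emb n k) *v 0\<^sub>v k = 0\<^sub>v n" by (rule mult_mat_zero_vec[OF P])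
    ultimately show "v \<in> mat_kernel (U * emb n k)" using P by (intro mat_kernelI[OF P]) simp_all
  qed
  show "(\<lambda>v. (U * emb n k) *v v) ` Vec k = L"
  proof (intro equalityI subsetI)
    fix x assume "x \<in> (\<lambda>v. (U * emb n k) *v v) ` Vec k"
    then obtain v where v: "v \<in> Vec k" "x = U *v (vec n (\<lambda>i. if i < k then v $ i else 0))"
      using Pv by auto
    show "x \<in> L" unfolding v(2) by (subst adapted_mem[OF _ ad]) auto
  next
    fix x assume x: "x \<in> L"
    then have xc: "x \<in> Vec n" using L by auto
    define a where "a = U' *v x"
    have a: "a \<in> Vec n" "U *v a = x" using U xc GL_pair_cancel(2)[OF GL xc] by (auto simp: a_def)
    then have "\<forall>i. k \<le> i --> i < n --> a $ i = 0" using adapted_mem[OF _ ad, of a] x by simp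
    then have e: "vec n (\<lambda>i. if i < k then vec k (\<lambda>i. a $ i) $ i else 0) = a" using a(1) kn by (intro eq_vecI) auto
    have "(U * emb n k) *v vec k (\<lambda>i. a $ i) = U *v vec n (\<lambda>i. if i < k then vec k (\<lambda>i. a $ i) $ i else 0)"
      by (rule Pv) simp
    also have "\<dots> = x" unfolding e by (rule a(2))
    finally have "(U * emb n k) *v vec k (\<lambda>i. a $ i) = x" .
    then show "x \<in> (\<lambda>v. (U * emb n k) *v v) ` Vec k"
      using imageI[OF vec_carrier[of k "\<lambda>i. a $ i"], of "\<lambda>v. (U * emb n k) *v v"]
      by (simp only:)
  qed
qed

lemma subsp_basis:
  assumes "subsp n (L :: 'a::field vec set)"
  shows "\<exists>k P. k \<le> n \<and> P \<in> Mat n k \<and> mat_kernel P = {0\<^sub>v k} \<and> (\<lambda>v. P *v v) ` Vec k = L"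
proof -
  obtain U U' k where ad: "adapted UNIV n L U U' k" using adapted_subsp[OF assms] by auto
  have "L \<subseteq> Vec n" using assms by (auto simp: submod_def)
  from basis_of_adapted[OF ad this] ad show ?thesis unfolding adapted_def by blast
qed

lemma Lagr_adapted_dim:
  assumes "G \<in> Mat n n" "det G \<noteq> 0" "Lagr n G L" "adapted UNIV n L U U' k"
  shows "n = 2 * k"
  using lagrangian_half_dim(1)[OF _ hom_on_id _ assms(2,4)] assms Lagr_lagrangian[OF assms(1)] by auto

lemma Lagr_basis:
  assumes G: "G \<in> Mat n n" and d: "det G \<noteq> 0" and L: "Lagr n G L"
  shows "\<exists>k P. n = 2 * k \<and> P \<in> Mat n k \<and> mat_kernel P = {0\<^sub>v k} \<and> (\<lambda>v. P *v v) ` Vec k = L"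
proof -
  have s: "subsp n L" using L by (simp add: Lagr_def)
  obtain U U' k where ad: "adapted UNIV n L U U' k" using adapted_subsp[OF s] by auto
  have "L \<subseteq> Vec n" using s by (auto simp: submod_def)
  from basis_of_adapted[OF ad this] Lagr_adapted_dim[OF G d L ad] show ?thesis by blast
qed

lemma range_subsp:
  assumes "P \<in> Mat n k"
  shows "subsp n ((\<lambda>v. P *v v) ` Vec k)"
  unfolding submod_def
proof (intro conjI ballI)
  show "(\<lambda>v. P *v v) ` Vec k \<subseteq> Fvec UNIV n" using assms by auto
  have "P *v 0\<^sub>v k = 0\<^sub>v n" using assms by (auto intro!: eq_vecI)
  then show "0\<^sub>v n \<in> (\<lambda>v. P *v v) ` Vec k" by (metis image_eqI zero_carrier_vec)
  fix x y :: "'a vec" and c :: 'a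
  assume "x \<in> (\<lambda>v. P *v v) ` Vec k"
  then obtain v where v: "v \<in> Vec k" "x = P *v v" by auto
  show "c *s x \<in> (\<lambda>v. P *v v) ` Vec k"
    using v mult_mat_vec_smult[OF assms v(1), of c] by (auto intro!: image_eqI[of _ _ "c *s v"])
  assume "y \<in> (\<lambda>v. P *v v) ` Vec k"
  then obtain w where w: "w \<in> Vec k" "y = P *v w" by auto
  show "x + y \<in> (\<lambda>v. P *v v) ` Vec k"
    using v w mult_add_distrib_mat_vec[OF assms v(1) w(1)] by (auto intro!: image_eqI[of _ _ "v + w"])
qed

text \<open>Isotropic of half the dimension already implies Lagrangian. In an adapted basis the form
  has a zero block of half size, so nonsingularity of \<open>G\<close> forces the block below it to
  be invertible, and a vector orthogonal to \<open>L\<close> then has no component outside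
  \<open>L\<close>.\<close>

lemma basis_Lagr:
  fixes G :: "'a::field mat"
  assumes P: "P \<in> Mat n m" and n: "n = 2 * m" and ker: "mat_kernel P = {0\<^sub>v m}"
    and G: "G \<in> Mat n n" and d: "det G \<noteq> 0" and L: "L = (\<lambda>v. P *v v) ` Vec m"
    and iso: "\<And>x y. x \<in> L ==> y \<in> L ==> bf G x y = 0"
  shows "Lagr n G L"
proof -
  have s: "subsp n L" unfolding L by (rule range_subsp[OF P])
  obtain U U' k where ad: "adapted UNIV n L U U' k" using adapted_subsp[OF s] by auto
  have U: "U \<in> Mat n n" "U' \<in> Mat n n" and kn: "k \<le> n" and GL: "GL_pair UNIV n U U'"
    using ad by (auto simp: adapted_def GL_pair_def)
  define G' where "G' = trp U * G * U"
  have G': "G' \<in> Mat n n" using U G by (auto simp: G'_def)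
  have "det G' = det U * det G * det U" unfolding G'_def
    using U G by (simp add: det_mult[of _ n] det_transpose del: assoc_mult_mat)
  then have dG': "det G' \<noteq> 0" using d GL by (auto simp: GL_pair_def)
  have tr: "bf G (U *v a) (U *v b) = bf G' a b" if "a \<in> Vec n" "b \<in> Vec n" for a b
    unfolding G'_def using U G that by (intro bf_congruence)
  have uL: "U *v unit_vec n i \<in> L" if "i < k" for i
    using that kn by (subst adapted_mem[OF _ ad]) auto
  have z: "G' $$ (i, j) = 0" if "i < k" "j < k" for i j
    using iso[OF uL uL, OF that] tr[of "unit_vec n i" "unit_vec n j"] bf_unit[OF G'] that kn by simp
  have "2 * k \<le> n"
  proof (rule ccontr)
    assume "\<not> 2 * k \<le> n"
    then have "det G' = 0" using kn z by (intro det_zero_block[OF G', of "{..<k}" "{..<k}"]) auto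
    then show False using dG' by simp
  qed
  then have km: "k \<le> m" using n by simp
  \<comment> \<open>Otherwise the \<open>k\<close> coordinates along \<open>L\<close> would be fewer
    than the \<open>m\<close> parameters of \<open>P\<close>, and \<open>P\<close> would have a
    nonzero kernel vector.\<close>
  have "m \<le> k"
  proof (rule ccontr)
    assume "\<not> m \<le> k"
    then have "k < m" by simp
    define M where "M = mat k m (\<lambda>(i, j). (U' * P) $$ (i, j))"
    obtain v where v: "v \<in> Vec m" "v \<noteq> 0\<^sub>v m" "M *v v = 0\<^sub>v k"
      using underdetermined[of M k m] \<open>k < m\<close> by (auto simp: M_def)
    have PvL: "P *v v \<in> L" using v(1) L by auto
    have Pv: "P *v v \<in> Vec n" using P v by simp
    have "U' *v (P *v v) = 0\<^sub>v n"
    proof (rule eq_vecI)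
      fix i assume "i < dim_vec (0\<^sub>v n :: 'a vec)"
      then have i: "i < n" by simp
      show "(U' *v (P *v v)) $ i = 0\<^sub>v n $ i"
      proof (cases "i < k")
        case True
        have "(M *v v) $ i = 0" using v True by simp
        moreover have "(M *v v) $ i = row M i \<bullet> v" using True by (simp add: M_def)
        moreover have "row M i = row (U' * P) i" using True i U P by (intro eq_vecI) (auto simp: M_def)
        moreover have "((U' * P) *v v) $ i = row (U' * P) i \<bullet> v" using i U P by simp
        moreover have "(U' * P) *v v = U' *v (P *v v)" using U P v by (simp add: assoc_mult_mat_vec[of _ n n _ m])
        ultimately show ?thesis using i by simp
      next
        case False
        then show ?thesis using ad PvL Pv i by (auto simp: adapted_def)
      qed
    qed (use U in auto)
    moreover have "U *v (U' *v (P *v v)) = P *v v" by (rule GL_pair_cancel(2)[OF GL Pv])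
    moreover have "U *v 0\<^sub>v n = 0\<^sub>v n" using U by (auto intro!: eq_vecI)
    ultimately have "P *v v = 0\<^sub>v n" by simp
    then have "v \<in> mat_kernel P" using P v by (auto intro!: mat_kernelI)
    then show False using ker v by auto
  qed
  then have nk: "n = 2 * k" using n km by simp
  \<comment> \<open>The block that pairs the complement of \<open>L\<close> with \<open>L\<close>;
    its transpose annihilates the outer coordinates of any vector orthogonal to
    \<open>L\<close>.\<close>
  define D where "D = mat k k (\<lambda>(i, j). G' $$ (k + i, j))"
  have Dc: "D \<in> Mat k k" by (simp add: D_def)
  have dD: "det D \<noteq> 0" using det_antidiagonal[of G' k] G' z dG' nk by (auto simp: zero_block_def D_def)
  show ?thesis
    unfolding Lagr_def
  proof (intro conjI ballI s iffI)
    fix x y assume "x \<in> L" "y \<in> L" then show "bf G x y = 0" by (rule iso)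
  next
    fix x :: "'a vec" assume x: "x \<in> Vec n" and perp: "\<forall>y\<in>L. bf G x y = 0"
    define a where "a = U' *v x"
    have a: "a \<in> Vec n" "U *v a = x" using U x GL_pair_cancel(2)[OF GL x] by (auto simp: a_def)
    define a2 where "a2 = vec k (\<lambda>i. a $ (k + i))"
    have "trp D *v a2 = 0\<^sub>v k"
    proof (rule eq_vecI)
      fix j assume "j < dim_vec (0\<^sub>v k :: 'a vec)"
      then have j: "j < k" by simp
      have "0 = bf G (U *v a) (U *v unit_vec n j)" using perp uL[OF j] a by simp
      also have "\<dots> = bf G' a (unit_vec n j)" using a by (intro tr) auto
      also have "\<dots> = (\<Sum>i<n. a $ i * G' $$ (i, j))"
        using G' a j nk by (auto simp: bf_def scalar_prod_def atLeast0LessThan unit_vec_def if_distrib cong: if_cong intro!: sum.cong)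
      also have "\<dots> = (\<Sum>i\<in>{k..<k+k}. a $ i * G' $$ (i, j))"
        using z j nk by (intro sum.mono_neutral_right) auto
      also have "\<dots> = (\<Sum>i<k. a $ (k + i) * G' $$ (k + i, j))"
        by (rule sum.reindex_bij_witness[of _ "\<lambda>i. k + i" "\<lambda>i. i - k"]) auto
      also have "\<dots> = (trp D *v a2) $ j"
        using j by (auto simp: D_def a2_def scalar_prod_def atLeast0LessThan mult.commute intro!: sum.cong)
      finally show "(trp D *v a2) $ j = 0\<^sub>v k $ j" using j by simp
    qed (simp add: D_def)
    moreover have "det (trp D) \<noteq> 0" using dD Dc by (simp add: det_transpose)
    moreover have "a2 \<in> Vec k" "trp D \<in> Mat k k" using Dc by (auto simp: a2_def)
    ultimately have "a2 = 0\<^sub>v k" using det_0_iff_vec_prod_zero_field[of "trp D" k] by blast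
    then have "a $ i = 0" if "k \<le> i" "i < n" for i
      using that nk index_vec[of "i - k" k "\<lambda>i. a $ (k + i)"] by (simp add: a2_def)
    then show "x \<in> L" using adapted_mem[OF _ ad, of a] a by auto
  qed
qed

text \<open>A linear functional on a subspace extends to the whole space, by zero on the rest of an
  adapted basis, and is then a scalar product with a fixed vector.\<close>

lemma functional_rep:
  fixes \<phi> :: "'a::field vec => 'a"
  assumes D: "subsp n D" and add: "\<And>x y. x \<in> D ==> y \<in> D ==> \<phi> (x + y) = \<phi> x + \<phi> y"
    and smult: "\<And>c x. x \<in> D ==> \<phi> (c *s x) = c * \<phi> x"
  shows "\<exists>w\<in>Vec n. \<forall>x\<in>D. w \<bullet> x = \<phi> x"
proof -
  obtain U U' k where ad: "adapted UNIV n D U U' k" using adapted_subsp[OF D] by auto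
  have U: "U \<in> Mat n n" "U' \<in> Mat n n" and kn: "k \<le> n" and GL: "GL_pair UNIV n U U'"
    using ad by (auto simp: adapted_def GL_pair_def)
  \<comment> \<open>Coefficients of the extended functional in the basis \<open>U\<close>; the dual
    basis matrix turns them into \<open>?w\<close>.\<close>
  define f where "f = vec n (\<lambda>i. if i < k then \<phi> (col U i) else 0)"
  have f: "f \<in> Vec n" by (simp add: f_def)
  have cU: "U *v unit_vec n i = col U i" if "i < n" for i using U that by (intro eq_vecI) auto
  have colD: "col U i \<in> D" if "i < k" for i
    using adapted_mem[OF _ ad, of "unit_vec n i"] that kn cU by auto
  have key: "\<phi> (U *v vec n (\<lambda>i. if i < m then a i else 0)) = (\<Sum>i<m. a i * \<phi> (col U i))
      \<and> U *v vec n (\<lambda>i. if i < m then a i else 0) \<in> D" if "m \<le> k" for m and a :: "nat => 'a"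
    using that
  proof (induction m)
    case 0
    have e: "U *v vec n (\<lambda>i. if i < 0 then a i else 0) = 0\<^sub>v n"
      using U by (auto simp: scalar_prod_def intro!: eq_vecI)
    have "\<phi> (0 *s 0\<^sub>v n) = 0 * \<phi> (0\<^sub>v n)" using D by (intro smult) (auto simp: submod_def)
    moreover have "0 *s 0\<^sub>v n = (0\<^sub>v n :: 'a vec)" by (intro eq_vecI) auto
    ultimately show ?case unfolding e using D by (auto simp: submod_def)
  next
    case (Suc m)
    let ?v = "vec n (\<lambda>i. if i < m then a i else 0)"
    have "vec n (\<lambda>i. if i < Suc m then a i else 0) = ?v + a m *s unit_vec n m"
      using Suc.prems by (intro eq_vecI) (auto simp: unit_vec_def less_Suc_eq)
    moreover have "U *v (?v + a m *s unit_vec n m) = U *v ?v + U *v (a m *s unit_vec n m)"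
      using U by (intro mult_add_distrib_mat_vec) auto
    moreover have "U *v (a m *s unit_vec n m) = a m *s col U m"
      using U Suc.prems kn by (intro single_entry_smult_col) auto
    ultimately have e: "U *v vec n (\<lambda>i. if i < Suc m then a i else 0) = U *v ?v + a m *s col U m" by simp
    have 1: "U *v ?v \<in> D" "a m *s col U m \<in> D" "col U m \<in> D"
      using Suc colD[of m] subspD[OF D] by auto
    show ?case unfolding e using Suc 1 subspD(3)[OF D 1(1,2)] by (simp add: add[OF 1(1,2)] smult[OF 1(3)])
  qed
  let ?w = "trp U' *v f"
  have "?w \<bullet> x = \<phi> x" if x: "x \<in> D" for x
  proof -
    have xc: "x \<in> Vec n" using subspD(1)[OF D x] .
    let ?a = "U' *v x"
    have a: "?a \<in> Vec n" "U *v ?a = x" using U xc GL_pair_cancel(2)[OF GL xc] by auto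
    have sup: "\<forall>i. k \<le> i --> i < n --> ?a $ i = 0" using adapted_mem[OF _ ad, of ?a] a x by simp
    have e: "vec n (\<lambda>i. if i < k then ?a $ i else 0) = ?a" using sup U by (intro eq_vecI) auto
    have "?w \<bullet> x = f \<bullet> ?a" using U f xc by (intro transpose_vec_mult_scalar) auto
    also have "\<dots> = (\<Sum>i<n. f $ i * ?a $ i)"
      using U by (simp add: scalar_prod_def atLeast0LessThan)
    also have "\<dots> = (\<Sum>i<k. ?a $ i * \<phi> (col U i))"
      using kn by (intro sum.mono_neutral_cong_right) (auto simp: f_def)
    also have "\<dots> = \<phi> (U *v vec n (\<lambda>i. if i < k then ?a $ i else 0))" using key[of k "\<lambda>i. ?a $ i"] by simp
    also have "\<dots> = \<phi> x" unfolding e using a by simp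
    finally show ?thesis .
  qed
  moreover have "?w \<in> Vec n" using U f by simp
  ultimately show ?thesis by blast
qed

section \<open>Lagrangian relations and their composition\<close>

definition linrel :: "nat => nat => ('a::field vec \<times> 'a vec) set => bool" where
  "linrel n m R \<longleftrightarrow> R \<subseteq> Vec n \<times> Vec m \<and> (0\<^sub>v n, 0\<^sub>v m) \<in> R \<and>
     (\<forall>x y x' y'. (x, y) \<in> R --> (x', y') \<in> R --> (x + x', y + y') \<in> R) \<and>
     (\<forall>c x y. (x, y) \<in> R --> (c *s x, c *s y) \<in> R)"

lemma linrelD:
  assumes "linrel n m R"
  shows "(x, y) \<in> R ==> x \<in> Vec n" "(x, y) \<in> R ==> y \<in> Vec m" "(0\<^sub>v n, 0\<^sub>v m) \<in> R"
    "(x, y) \<in> R ==> (x', y') \<in> R ==> (x + x', y + y') \<in> R" "(x, y) \<in> R ==> (c *s x, c *s y) \<in> R"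
  using assms by (auto simp: linrel_def)

lemma linrel_minus:
  assumes "linrel n m R" "(x, y) \<in> R" "(x', y') \<in> R"
  shows "(x - x', y - y') \<in> R"
proof -
  have "(x + (- 1) *s x', y + (- 1) *s y') \<in> R" using assms linrelD[OF assms(1)] by auto
  moreover have "x + (- 1) *s x' = x - x'" "y + (- 1) *s y' = y - y'"
    using assms linrelD(1,2)[OF assms(1)] by (auto intro!: eq_vecI)
  ultimately show ?thesis by simp
qed

text \<open>A Lagrangian subspace of the form \<open>G \<boxplus> - H\<close> is viewed as a relation, so that Witt equivalence
  becomes composition of relations.\<close>

definition Lrel :: "nat => nat => 'a::field mat => 'a mat => ('a vec \<times> 'a vec) set => bool" where
  "Lrel n m G H R \<longleftrightarrow> linrel n m R \<and> (\<forall>x\<in>Vec n. \<forall>y\<in>Vec m.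
     (x, y) \<in> R \<longleftrightarrow> (\<forall>x' y'. (x', y') \<in> R --> bf G x x' = bf H y y'))"

text \<open>Kept apart from \<open>Lrel\<close> because it is also imposed on the Seifert forms
  themselves, which may be singular and are not symmetric.\<close>

definition isotropic_rel :: "'a::field mat => 'a mat => ('a vec \<times> 'a vec) set => bool" where
  "isotropic_rel A B R \<longleftrightarrow> (\<forall>x y x' y'. (x, y) \<in> R --> (x', y') \<in> R --> bf A x x' = bf B y y')"

lemma Lrel_isotropic: "Lrel n m G H R ==> isotropic_rel G H R"
  unfolding Lrel_def isotropic_rel_def using linrelD by blast

lemma LrelI:
  assumes "linrel n m R" "isotropic_rel G H R"
    "\<And>x y. x \<in> Vec n ==> y \<in> Vec m ==> (\<And>x' y'. (x', y') \<in> R ==> bf G x x' = bf H y y') ==> (x, y) \<in> R"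
  shows "Lrel n m G H R"
  using assms unfolding Lrel_def isotropic_rel_def by blast

lemma Lrel_memI:
  assumes "Lrel n m G H R" "x \<in> Vec n" "y \<in> Vec m" "\<And>x' y'. (x', y') \<in> R ==> bf G x x' = bf H y y'"
  shows "(x, y) \<in> R"
  using assms unfolding Lrel_def by blast

definition rel_vecs :: "('a vec \<times> 'a vec) set => 'a vec set" where
  "rel_vecs R = {x @\<^sub>v y | x y. (x, y) \<in> R}"

lemma rel_vecs_mem:
  assumes "linrel n m R" "x \<in> Vec n"
  shows "x @\<^sub>v y \<in> rel_vecs R \<longleftrightarrow> (x, y) \<in> R"
proof
  assume "x @\<^sub>v y \<in> rel_vecs R"
  then obtain x' y' where r: "x @\<^sub>v y = x' @\<^sub>v y'" "(x', y') \<in> R" by (auto simp: rel_vecs_def)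
  then show "(x, y) \<in> R" using append_vec_inj[OF assms(2) linrelD(1)[OF assms(1) r(2)]] by simp
qed (auto simp: rel_vecs_def)

lemma subsp_rel_vecs:
  assumes R: "linrel n m R"
  shows "subsp (n + m) (rel_vecs R)"
  unfolding submod_def
proof (intro conjI ballI)
  note D = linrelD[OF R]
  show "rel_vecs R \<subseteq> Fvec UNIV (n + m)" using D(1,2) by (auto simp: rel_vecs_def)
  show "0\<^sub>v (n + m) \<in> rel_vecs R" using D(3) by (auto simp: rel_vecs_def append_vec_zero[symmetric])
  fix z z' :: "'a vec" and c :: 'a assume z: "z \<in> rel_vecs R"
  then obtain x y where xy: "(x, y) \<in> R" "z = x @\<^sub>v y" by (auto simp: rel_vecs_def)
  then show "c *s z \<in> rel_vecs R" using D(5)[OF xy(1), of c] by (auto simp: rel_vecs_def append_vec_smult)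
  assume "z' \<in> rel_vecs R"
  then obtain x' y' where xy': "(x', y') \<in> R" "z' = x' @\<^sub>v y'" by (auto simp: rel_vecs_def)
  have "z + z' = (x + x') @\<^sub>v (y + y')"
    unfolding xy xy' using D(1,2)[OF xy(1)] D(1,2)[OF xy'(1)] by (rule_tac append_vec_add') auto
  then show "z + z' \<in> rel_vecs R" using D(4)[OF xy(1) xy'(1)] by (auto simp: rel_vecs_def)
qed

lemma linrel_of_subsp:
  assumes L: "subsp (n + m) L"
  shows "linrel n m {(x, y). x \<in> Vec n \<and> y \<in> Vec m \<and> x @\<^sub>v y \<in> L}" (is "linrel n m ?R")
    "rel_vecs {(x, y). x \<in> Vec n \<and> y \<in> Vec m \<and> x @\<^sub>v y \<in> L} = L"
proof -
  note D = subspD[OF L]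
  show "linrel n m ?R" unfolding linrel_def
  proof (intro conjI allI impI)
    show "(0\<^sub>v n, 0\<^sub>v m) \<in> ?R" using D(2) by (auto simp: append_vec_zero)
    fix x y x' y' assume "(x, y) \<in> ?R" "(x', y') \<in> ?R"
    then show "(x + x', y + y') \<in> ?R" using D(3)[of "x @\<^sub>v y" "x' @\<^sub>v y'"] append_vec_add'[of x n x' y m y'] by auto
  next
    fix c x y assume "(x, y) \<in> ?R"
    then show "(c *s x, c *s y) \<in> ?R" using D(4)[of "x @\<^sub>v y" c] by (auto simp: append_vec_smult)
  qed auto
  show "rel_vecs ?R = L"
  proof (intro equalityI subsetI)
    fix z assume "z \<in> rel_vecs ?R"
    then show "z \<in> L" by (auto simp: rel_vecs_def)
  next
    fix z assume z: "z \<in> L"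
    obtain x y where "x \<in> Vec n" "y \<in> Vec m" "z = x @\<^sub>v y"
      using append_vec_cases[OF D(1)[OF z]] by blast
    then show "z \<in> rel_vecs ?R" using z unfolding rel_vecs_def by blast
  qed
qed

text \<open>The sign in \<open>G \<boxplus> - H\<close> turns orthogonality to a pair into equality
  of the two pairings.\<close>

lemma Lrel_Lagr:
  assumes G: "G \<in> Mat n n" and H: "H \<in> Mat m m" and R: "linrel n m R"
  shows "Lrel n m G H R \<longleftrightarrow> Lagr (n + m) (G \<boxplus> - H) (rel_vecs R)"
proof -
  have b: "bf (G \<boxplus> - H) (x @\<^sub>v y) (x' @\<^sub>v y') = bf G x x' - bf H y y'"
    if "x \<in> Vec n" "y \<in> Vec m" "x' \<in> Vec n" "y' \<in> Vec m" for x y x' y'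
    using bf_block_sum[of G n "- H" m x y x' y'] bf_uminus_mat[of H m m y y'] G H that by simp
  note D = linrelD[OF R]
  have q: "(\<forall>z\<in>rel_vecs R. bf (G \<boxplus> - H) (x @\<^sub>v y) z = 0) \<longleftrightarrow> (\<forall>x' y'. (x', y') \<in> R --> bf G x x' = bf H y y')"
    if "x \<in> Vec n" "y \<in> Vec m" for x y
  proof (intro iffI allI impI ballI)
    fix x' y' assume 1: "\<forall>z\<in>rel_vecs R. bf (G \<boxplus> - H) (x @\<^sub>v y) z = 0" and r: "(x', y') \<in> R"
    then have "bf (G \<boxplus> - H) (x @\<^sub>v y) (x' @\<^sub>v y') = 0" by (auto simp: rel_vecs_def)
    then show "bf G x x' = bf H y y'" using b[OF that D(1,2)[OF r]] by simp
  next
    fix z assume 1: "\<forall>x' y'. (x', y') \<in> R --> bf G x x' = bf H y y'" and z: "z \<in> rel_vecs R"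
    then obtain x' y' where r: "(x', y') \<in> R" "z = x' @\<^sub>v y'" by (auto simp: rel_vecs_def)
    then show "bf (G \<boxplus> - H) (x @\<^sub>v y) z = 0" using 1 b[OF that D(1,2)[OF r(1)]] by simp
  qed
  have all: "(\<forall>z\<in>Vec (n + m). Q z) \<longleftrightarrow> (\<forall>x\<in>Vec n. \<forall>y\<in>Vec m. Q (x @\<^sub>v y))" for Q :: "'a vec => bool"
    by (rule all_vec_append)
  have "Lagr (n + m) (G \<boxplus> - H) (rel_vecs R) \<longleftrightarrow> (\<forall>x\<in>Vec n. \<forall>y\<in>Vec m.
      x @\<^sub>v y \<in> rel_vecs R \<longleftrightarrow> (\<forall>z\<in>rel_vecs R. bf (G \<boxplus> - H) (x @\<^sub>v y) z = 0))"
    unfolding Lagr_def all using subsp_rel_vecs[OF R] by simp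
  also have "\<dots> \<longleftrightarrow> Lrel n m G H R"
    unfolding Lrel_def by (simp add: q rel_vecs_mem[OF R] R)
  finally show ?thesis by simp
qed

lemma Lagr_Lrel:
  assumes G: "G \<in> Mat n n" and H: "H \<in> Mat m m" and L: "Lagr (n + m) (G \<boxplus> - H) L"
  shows "Lrel n m G H {(x, y). x \<in> Vec n \<and> y \<in> Vec m \<and> x @\<^sub>v y \<in> L}"
proof -
  have s: "subsp (n + m) L" using L by (simp add: Lagr_def)
  show ?thesis using Lrel_Lagr[OF G H linrel_of_subsp(1)[OF s]] L unfolding linrel_of_subsp(2)[OF s] by simp
qed

lemma det_uminus_ne_0: "G \<in> Mat n n ==> det (- G) \<noteq> 0 \<longleftrightarrow> det (G :: 'a::field mat) \<noteq> 0"
  by (simp add: det_0_negate[of G n])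

text \<open>The dimension of a Lagrangian does not depend on the form. So a relation that is
  Lagrangian for one pair of nonsingular forms is Lagrangian for every pair of nonsingular forms
  that it respects. This transfers a relation between skew forms to the symmetric forms and to the
  transposed Seifert forms.\<close>

lemma Lrel_change_form:
  fixes G :: "'a::field mat"
  assumes G: "G \<in> Mat n n" "det G \<noteq> 0" and H: "H \<in> Mat m m" "det H \<noteq> 0"
    and G': "G' \<in> Mat n n" "det G' \<noteq> 0" and H': "H' \<in> Mat m m" "det H' \<noteq> 0"
    and R: "Lrel n m G H R" and iso: "isotropic_rel G' H' R"
  shows "Lrel n m G' H' R"
proof -
  have l: "linrel n m R" using R by (simp add: Lrel_def)
  have c: "G \<boxplus> - H \<in> Mat (n + m) (n + m)" "G' \<boxplus> - H' \<in> Mat (n + m) (n + m)"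
    using G H G' H' by (auto intro!: block_sum_carrier)
  have d: "det (G \<boxplus> - H) \<noteq> 0" "det (G' \<boxplus> - H') \<noteq> 0"
    using G H G' H' det_uminus_ne_0 by (auto simp: det_block_sum[of _ n _ m])
  obtain k P where P: "n + m = 2 * k" "P \<in> Mat (n + m) k" "mat_kernel P = {0\<^sub>v k}"
    "(\<lambda>v. P *v v) ` Vec k = rel_vecs R"
    using Lagr_basis[OF c(1) d(1)] R Lrel_Lagr[OF G(1) H(1) l] by blast
  have "Lagr (n + m) (G' \<boxplus> - H') (rel_vecs R)"
  proof (rule basis_Lagr[OF P(2,1,3) c(2) d(2)])
    fix z z' assume "z \<in> rel_vecs R" "z' \<in> rel_vecs R"
    then obtain x y x' y' where "z = x @\<^sub>v y" "z' = x' @\<^sub>v y'" "(x, y) \<in> R" "(x', y') \<in> R"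
      by (auto simp: rel_vecs_def)
    then show "bf (G' \<boxplus> - H') z z' = 0"
      using bf_block_sum[of G' n "- H'" m x y x' y'] bf_uminus_mat[of H' m m y y'] G' H' iso linrelD(1,2)[OF l]
      by (auto simp: isotropic_rel_def)
  qed (use P in simp)
  then show ?thesis using Lrel_Lagr[OF G'(1) H'(1) l] by blast
qed

lemma Lrel_converse:
  assumes "Lrel n m G H R"
  shows "Lrel m n H G (R\<inverse>)"
  using assms unfolding Lrel_def linrel_def by (auto simp: eq_commute)

lemma form_represents:
  fixes G :: "'a::field mat"
  assumes G: "G \<in> Mat n n" "det G \<noteq> 0" and w: "w \<in> Vec n"
  shows "\<exists>x\<in>Vec n. \<forall>y\<in>Vec n. bf G x y = w \<bullet> y"
proof -
  obtain G' where G': "G' \<in> Mat n n" "G * G' = 1\<^sub>m n" "G' * G = 1\<^sub>m n"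
    using mat_inv_exists[OF G] by blast
  let ?x = "trp G' *v w"
  have "bf G ?x y = w \<bullet> y" if y: "y \<in> Vec n" for y
  proof -
    have "bf G ?x y = w \<bullet> (G' *v (G *v y))"
      unfolding bf_def using G G' w y by (intro transpose_vec_mult_scalar) auto
    also have "G' *v (G *v y) = y" using G G' y by (simp flip: assoc_mult_mat_vec[of _ n n _ n])
    finally show ?thesis .
  qed
  moreover have "?x \<in> Vec n" using G' w by simp
  ultimately show ?thesis by blast
qed

text \<open>Isotropy composes at once; maximality is the issue. For \<open>(x, z)\<close> orthogonal
  to the composite, a middle vector must be produced. The pairings with \<open>x\<close> and
  \<open>z\<close> determine a functional on the sum of the range of \<open>R\<close> and the domain
  of \<open>S\<close>; it extends to the middle space and is represented through the nonsingular
  form \<open>H\<close>, and maximality of \<open>R\<close> and \<open>S\<close> puts the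
  representing vector between \<open>x\<close> and \<open>z\<close>.\<close>

lemma Lrel_comp:
  fixes G :: "'a::field mat"
  assumes G: "G \<in> Mat n n" and H: "H \<in> Mat m m" "det H \<noteq> 0" and K: "K \<in> Mat p p"
    and R: "Lrel n m G H R" and S: "Lrel m p H K S"
  shows "Lrel n p G K (R O S)"
proof (rule LrelI)
  have lR: "linrel n m R" and lS: "linrel m p S" using R S by (auto simp: Lrel_def)
  note DR = linrelD[OF lR] and DS = linrelD[OF lS]
  show l: "linrel n p (R O S)"
    unfolding linrel_def
  proof (intro conjI allI impI)
    show "R O S \<subseteq> Vec n \<times> Vec p" using DR(1) DS(2) by auto
    show "(0\<^sub>v n, 0\<^sub>v p) \<in> R O S" using DR(3) DS(3) by auto
    fix x y x' y' c assume "(x, y) \<in> R O S"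
    then obtain v where v: "(x, v) \<in> R" "(v, y) \<in> S" by auto
    show "(c *s x, c *s y) \<in> R O S" using DR(5)[OF v(1)] DS(5)[OF v(2)] by auto
    assume "(x', y') \<in> R O S"
    then obtain v' where v': "(x', v') \<in> R" "(v', y') \<in> S" by auto
    show "(x + x', y + y') \<in> R O S" using DR(4)[OF v(1) v'(1)] DS(4)[OF v(2) v'(2)] by auto
  qed
  show iso: "isotropic_rel G K (R O S)"
    unfolding isotropic_rel_def
  proof (intro allI impI)
    fix x y x' y' assume "(x, y) \<in> R O S" "(x', y') \<in> R O S"
    then obtain v v' where v: "(x, v) \<in> R" "(v, y) \<in> S" "(x', v') \<in> R" "(v', y') \<in> S" by auto
    have "bf G x x' = bf H v v'" using Lrel_isotropic[OF R] v unfolding isotropic_rel_def by blast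
    also have "\<dots> = bf K y y'" using Lrel_isotropic[OF S] v unfolding isotropic_rel_def by blast
    finally show "bf G x x' = bf K y y'" .
  qed
  note DRS = linrelD[OF l]
  fix x z assume x: "x \<in> Vec n" and z: "z \<in> Vec p"
    and perp: "\<And>x' z'. (x', z') \<in> R O S ==> bf G x x' = bf K z z'"
  \<comment> \<open>The subspace of the middle space on which the pairings prescribe the functional;
    \<open>\<psi>\<close> is its graph, with one value contributed by each side.\<close>
  define D where "D = {y + y' | y y' x' z'. (x', y) \<in> R \<and> (y', z') \<in> S}"
  define \<psi> where "\<psi> v c \<longleftrightarrow> (\<exists>x' y y' z'. v = y + y' \<and> (x', y) \<in> R \<and> (y', z') \<in> S \<and> c = bf G x x' + bf K z z')" for v c
  \<comment> \<open>Two decompositions of the same vector differ by a pair in \<open>R O S\<close>,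
    where the orthogonality of \<open>(x, z)\<close> makes the two values agree.\<close>
  have uniq: "c = c'" if h: "\<psi> v c" "\<psi> v c'" for v c c'
  proof -
    obtain x1 y1 y1' z1 where 1: "v = y1 + y1'" "(x1, y1) \<in> R" "(y1', z1) \<in> S" "c = bf G x x1 + bf K z z1"
      using h(1) unfolding \<psi>_def by blast
    obtain x2 y2 y2' z2 where 2: "v = y2 + y2'" "(x2, y2) \<in> R" "(y2', z2) \<in> S" "c' = bf G x x2 + bf K z z2"
      using h(2) unfolding \<psi>_def by blast
    have cs: "y1 \<in> Vec m" "y1' \<in> Vec m" "y2 \<in> Vec m" "y2' \<in> Vec m"
      "x1 \<in> Vec n" "x2 \<in> Vec n" "z1 \<in> Vec p" "z2 \<in> Vec p"
      using 1 2 DR DS by auto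
    have e: "y1 - y2 = y2' - y1'"
    proof (rule eq_vecI)
      fix i assume "i < dim_vec (y2' - y1')"
      then have i: "i < m" using cs by simp
      have "(y1 + y1') $ i = (y2 + y2') $ i" using 1(1) 2(1) by simp
      then have "y1 $ i + y1' $ i = y2 $ i + y2' $ i" using i cs by simp
      then show "(y1 - y2) $ i = (y2' - y1') $ i" using i cs by (simp add: algebra_simps)
    qed (use cs in simp)
    have "(x1 - x2, y1 - y2) \<in> R" by (rule linrel_minus[OF lR 1(2) 2(2)])
    moreover have "(y2' - y1', z2 - z1) \<in> S" by (rule linrel_minus[OF lS 2(3) 1(3)])
    ultimately have "(x1 - x2, z2 - z1) \<in> R O S" using e by auto
    then have "bf G x (x1 - x2) = bf K z (z2 - z1)" by (rule perp)
    then show ?thesis using 1(4) 2(4) cs x z G K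
      by (simp add: bf_minus_right[of _ n n] bf_minus_right[of _ p p] algebra_simps)
  qed
  define \<phi> where "\<phi> v = (THE c. \<psi> v c)" for v
  have \<phi>: "\<phi> v = c" if "\<psi> v c" for v c unfolding \<phi>_def using that uniq by blast
  have Dex: "\<exists>c. \<psi> v c" if "v \<in> D" for v using that unfolding D_def \<psi>_def by blast
  have \<psi>D: "v \<in> D" if "\<psi> v c" for v c using that unfolding D_def \<psi>_def by blast
  have \<psi>_add: "\<psi> (v + v') (c + c')" if h: "\<psi> v c" "\<psi> v' c'" for v v' c c'
  proof -
    obtain x1 y1 y1' z1 where 1: "v = y1 + y1'" "(x1, y1) \<in> R" "(y1', z1) \<in> S" "c = bf G x x1 + bf K z z1"
      using h(1) unfolding \<psi>_def by blast
    obtain x2 y2 y2' z2 where 2: "v' = y2 + y2'" "(x2, y2) \<in> R" "(y2', z2) \<in> S" "c' = bf G x x2 + bf K z z2"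
      using h(2) unfolding \<psi>_def by blast
    have cs: "y1 \<in> Vec m" "y1' \<in> Vec m" "y2 \<in> Vec m" "y2' \<in> Vec m"
      "x1 \<in> Vec n" "x2 \<in> Vec n" "z1 \<in> Vec p" "z2 \<in> Vec p"
      using 1 2 DR DS by auto
    have "v + v' = (y1 + y2) + (y1' + y2')" unfolding 1(1) 2(1) using cs by (intro eq_vecI) auto
    moreover have "c + c' = bf G x (x1 + x2) + bf K z (z1 + z2)"
      unfolding 1(4) 2(4) using cs x z G K by (simp add: bf_add_right[of _ n n] bf_add_right[of _ p p])
    ultimately show ?thesis unfolding \<psi>_def using DR(4)[OF 1(2) 2(2)] DS(4)[OF 1(3) 2(3)] by blast
  qed
  have \<psi>_smult: "\<psi> (a *s v) (a * c)" if h: "\<psi> v c" for v c a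
  proof -
    obtain x1 y1 y1' z1 where 1: "v = y1 + y1'" "(x1, y1) \<in> R" "(y1', z1) \<in> S" "c = bf G x x1 + bf K z z1"
      using h(1) unfolding \<psi>_def by blast
    have cs: "y1 \<in> Vec m" "y1' \<in> Vec m" "x1 \<in> Vec n" "z1 \<in> Vec p"
      using 1 DR DS by auto
    have "a *s v = a *s y1 + a *s y1'" unfolding 1(1) using cs by (intro smult_add_distrib_vec) auto
    moreover have "a * c = bf G x (a *s x1) + bf K z (a *s z1)"
      unfolding 1(4) using cs x z G K by (simp add: bf_smult_right[of _ n n] bf_smult_right[of _ p p] algebra_simps)
    ultimately show ?thesis unfolding \<psi>_def using DR(5)[OF 1(2)] DS(5)[OF 1(3)] by blast
  qed
  have \<psi>R: "\<psi> y (bf G x x')" if "(x', y) \<in> R" for x' y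
  proof -
    have "y = y + 0\<^sub>v m" using DR(2)[OF that] by simp
    moreover have "bf G x x' = bf G x x' + bf K z (0\<^sub>v p)" using K z by simp
    ultimately show ?thesis unfolding \<psi>_def using that DS(3) by blast
  qed
  have \<psi>S: "\<psi> y (bf K z z')" if "(y, z') \<in> S" for z' y
  proof -
    have "y = 0\<^sub>v m + y" using DS(1)[OF that] by simp
    moreover have "bf K z z' = bf G x (0\<^sub>v n) + bf K z z'" using G x by simp
    ultimately show ?thesis unfolding \<psi>_def using that DR(3) by blast
  qed
  have "subsp m D"
    unfolding submod_def
  proof (intro conjI ballI)
    show "D \<subseteq> Fvec UNIV m" unfolding D_def using DR(2) DS(1) by auto
    show "0\<^sub>v m \<in> D" using \<psi>R[OF DR(3)] \<psi>D by blast
    fix v v' a assume "v \<in> D"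
    then obtain c where c: "\<psi> v c" using Dex by blast
    show "a *s v \<in> D" by (rule \<psi>D[OF \<psi>_smult[OF c]])
    assume "v' \<in> D"
    then obtain c' where c': "\<psi> v' c'" using Dex by blast
    show "v + v' \<in> D" by (rule \<psi>D[OF \<psi>_add[OF c c']])
  qed
  moreover have "\<phi> (v + v') = \<phi> v + \<phi> v'" if h: "v \<in> D" "v' \<in> D" for v v'
  proof -
    obtain c c' where "\<psi> v c" "\<psi> v' c'" using Dex h by blast
    then show ?thesis using \<phi>[OF \<psi>_add[of v c v' c']] \<phi> by simp
  qed
  moreover have "\<phi> (a *s v) = a * \<phi> v" if h: "v \<in> D" for v a
  proof -
    obtain c where "\<psi> v c" using Dex h by blast
    then show ?thesis using \<phi>[OF \<psi>_smult[of v c a]] \<phi> by simp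
  qed
  ultimately obtain w where w: "w \<in> Vec m" "\<And>v. v \<in> D ==> w \<bullet> v = \<phi> v"
    using functional_rep[of m D \<phi>] by blast
  obtain y where y: "y \<in> Vec m" "\<And>v. v \<in> Vec m ==> bf H y v = w \<bullet> v"
    using form_represents[OF H w(1)] by blast
  have "(x, y) \<in> R"
  proof (rule Lrel_memI[OF R x y(1)])
    fix x' y' assume r: "(x', y') \<in> R"
    show "bf G x x' = bf H y y'" using y(2) DR(2)[OF r] w(2) \<psi>D[OF \<psi>R[OF r]] \<phi>[OF \<psi>R[OF r]] by simp
  qed
  moreover have "(y, z) \<in> S"
  proof (rule Lrel_memI[OF S y(1) z])
    fix y' z' assume r: "(y', z') \<in> S"
    show "bf H y y' = bf K z z'" using y(2) DS(1)[OF r] w(2) \<psi>D[OF \<psi>S[OF r]] \<phi>[OF \<psi>S[OF r]] by simp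
  qed
  ultimately show "(x, z) \<in> R O S" by auto
qed

lemma form_nondegenerate:
  fixes G :: "'a::field mat"
  assumes G: "G \<in> Mat n n" "det G \<noteq> 0" and x: "x \<in> Vec n"
    and z: "\<And>y. y \<in> Vec n ==> bf G x y = 0"
  shows "x = 0\<^sub>v n"
proof -
  obtain G' where G': "G' \<in> Mat n n" "G * G' = 1\<^sub>m n" using mat_inv_exists[OF G] by blast
  have "x $ i = 0" if "i < n" for i
  proof -
    have "bf G x (G' *v unit_vec n i) = x \<bullet> unit_vec n i"
      unfolding bf_def using G G' by (simp flip: assoc_mult_mat_vec[of _ n n _ n])
    then show ?thesis using z[of "G' *v unit_vec n i"] G' that x by simp
  qed
  then show ?thesis using x by (intro eq_vecI) auto
qed

text \<open>The graph of an isometry. A pair orthogonal to it has \<open>x - P *v y\<close> in the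
  radical of \<open>G\<close>, since \<open>P\<close> is surjective.\<close>

lemma Lrel_graph:
  fixes G :: "'a::field mat"
  assumes G: "G \<in> Mat n n" "det G \<noteq> 0" and P: "P \<in> Mat n n" "det P \<noteq> 0"
  shows "Lrel n n G (trp P * G * P) {(P *v v, v) |v. v \<in> Vec n}" (is "Lrel n n G ?H ?R")
proof (rule LrelI)
  obtain P' where P': "P' \<in> Mat n n" "P * P' = 1\<^sub>m n" using mat_inv_exists[OF P] by blast
  show "linrel n n ?R"
    unfolding linrel_def
  proof (intro conjI allI impI)
    show "(0\<^sub>v n, 0\<^sub>v n) \<in> ?R" using P by (auto intro!: exI[of _ "0\<^sub>v n"] eq_vecI)
    fix x y x' y' c assume xy: "(x, y) \<in> ?R"
    show "(c *s x, c *s y) \<in> ?R" using xy mult_mat_vec_smult[OF P(1)] by auto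
    assume "(x', y') \<in> ?R"
    then show "(x + x', y + y') \<in> ?R" using xy mult_add_distrib_mat_vec[OF P(1)] by auto
  qed (use P in auto)
  have b: "bf G (P *v v) (P *v w) = bf ?H v w" if "v \<in> Vec n" "w \<in> Vec n" for v w
    using G P that by (intro bf_congruence) auto
  show "isotropic_rel G ?H ?R" unfolding isotropic_rel_def using b by auto
  fix x y assume x: "x \<in> Vec n" and y: "y \<in> Vec n"
    and perp: "\<And>x' y'. (x', y') \<in> ?R ==> bf G x x' = bf ?H y y'"
  have "x - P *v y = 0\<^sub>v n"
  proof (rule form_nondegenerate[OF G])
    show "x - P *v y \<in> Vec n" using x y P by simp
    fix u :: "'a vec" assume u: "u \<in> Vec n"
    define w where "w = P' *v u"
    have w: "w \<in> Vec n" "P *v w = u"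
      using u P P' by (auto simp: w_def simp flip: assoc_mult_mat_vec[of _ n n _ n])
    have "bf G x u = bf ?H y w" using perp[of u w] w by auto
    also have "\<dots> = bf G (P *v y) u" using b[OF y w(1)] w by simp
    finally show "bf G (x - P *v y) u = 0" using G x y P u by (simp add: bf_minus_left[of _ n n])
  qed
  have "x = P *v y"
  proof (rule eq_vecI)
    fix i assume i: "i < dim_vec (P *v y)"
    have "(x - P *v y) $ i = 0" using \<open>x - P *v y = 0\<^sub>v n\<close> i P by simp
    then show "x $ i = (P *v y) $ i" using i P by simp
  qed (use x P in simp)
  then show "(x, y) \<in> ?R" using y by blast
qed

section \<open>Rational Seifert forms related by Lagrangian relations\<close>

abbreviation rm :: "int mat => rat mat" where
  "rm \<equiv> map_mat rat_of_int"

definition sk :: "'a::comm_ring_1 mat => 'a mat" where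
  "sk A = A - trp A"

lemma sk_carrier [simp]: "A \<in> Mat n n ==> sk A \<in> Mat n n"
  by (auto simp: sk_def)

lemma bf_sk: "A \<in> Mat n n ==> x \<in> Vec n ==> y \<in> Vec n ==>
  bf (sk A) x y = bf A x y - bf A y x"
  by (simp add: sk_def bf_minus_mat[of _ n n] bf_transpose[of _ n n])

lemma sk_congruence:
  fixes A :: "'a::comm_ring_1 mat"
  assumes A: "A \<in> Mat n n" and P: "P \<in> Mat n m"
  shows "sk (trp P * A * P) = trp P * sk A * P"
proof (rule bf_eqI)
  show c: "sk (trp P * A * P) \<in> Mat m m" "trp P * sk A * P \<in> Mat m m"
    using A P by auto
  have c': "trp P * A * P \<in> Mat m m" using A P by auto
  fix x y :: "'a vec" assume x: "x \<in> Vec m" and y: "y \<in> Vec m"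
  have Px: "P *v x \<in> Vec n" "P *v y \<in> Vec n" using P x y by auto
  have "bf (sk (trp P * A * P)) x y = bf A (P *v x) (P *v y) - bf A (P *v y) (P *v x)"
    unfolding bf_sk[OF c' x y] bf_congruence[OF A P P x y] bf_congruence[OF A P P y x] ..
  also have "\<dots> = bf (trp P * sk A * P) x y"
    unfolding bf_congruence[OF sk_carrier[OF A] P P x y, symmetric] bf_sk[OF A Px] ..
  finally show "bf (sk (trp P * A * P)) x y = bf (trp P * sk A * P) x y" .
qed

lemma sk_block_sum: "A \<in> Mat n n ==> B \<in> Mat m m ==> sk (A \<boxplus> B) = sk A \<boxplus> sk (B :: 'a::comm_ring_1 mat)"
  by (intro eq_matI) (auto simp: sk_def block_sum_def)

lemma sk_uminus: "sk (- A) = - sk (A :: 'a::comm_ring_1 mat)" if "A \<in> Mat n n"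
  using that by (intro eq_matI) (auto simp: sk_def)

lemma map_block_sum: "A \<in> Mat n n ==> B \<in> Mat m m ==> f 0 = 0 ==>
  map_mat f (A \<boxplus> B) = map_mat f A \<boxplus> map_mat f B"
  by (intro eq_matI) (auto simp: block_sum_def)

lemma rm_sk: "V \<in> Mat n n ==> rm (sk V) = sk (rm V)"
  by (intro eq_matI) (auto simp: sk_def)

lemma rm_uminus: "rm (- V) = - rm V"
  by (intro eq_matI) auto

text \<open>Witt equivalence of Seifert forms, usable for singular ones: the half-dimension
  condition is expressed by the skew-symmetrization, which is unimodular for a Seifert
  matrix.\<close>

definition sim :: "rat mat => rat mat => bool" where
  "sim A B \<longleftrightarrow> (\<exists>n m R. A \<in> Mat n n \<and> B \<in> Mat m m \<and> det (sk A) \<noteq> 0 \<and> det (sk B) \<noteq> 0 \<and>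
     Lrel n m (sk A) (sk B) R \<and> isotropic_rel A B R)"

lemma simI:
  assumes "A \<in> Mat n n" "B \<in> Mat m m" "det (sk A) \<noteq> 0" "det (sk B) \<noteq> 0"
    "Lrel n m (sk A) (sk B) R" "isotropic_rel A B R"
  shows "sim A B"
  unfolding sim_def using assms by blast

lemma simE:
  assumes "sim A B" "A \<in> Mat n n" "B \<in> Mat m m"
  obtains R where "Lrel n m (sk A) (sk B) R" "isotropic_rel A B R" "det (sk A) \<noteq> 0" "det (sk B) \<noteq> 0"
proof -
  obtain n' m' R where *: "A \<in> Mat n' n'" "B \<in> Mat m' m'" "det (sk A) \<noteq> 0" "det (sk B) \<noteq> 0"
    "Lrel n' m' (sk A) (sk B) R" "isotropic_rel A B R" using assms(1) unfolding sim_def by blast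
  have "n' = n" "m' = m" using * assms by auto
  then show ?thesis using that * by blast
qed

lemma sim_carrier: "sim A B ==> \<exists>n. A \<in> Mat n n" "sim A B ==> \<exists>n. B \<in> Mat n n"
  "sim A B ==> det (sk A) \<noteq> 0" "sim A B ==> det (sk B) \<noteq> 0"
  unfolding sim_def by blast+

lemma sim_sym: "sim A B ==> sim B A"
  unfolding sim_def using Lrel_converse unfolding isotropic_rel_def by (metis converse_iff)

lemma sim_trans:
  assumes "sim A B" "sim B C"
  shows "sim A C"
proof -
  obtain n m p where c: "A \<in> Mat n n" "B \<in> Mat m m" "C \<in> Mat p p"
    using sim_carrier assms by blast
  obtain R where R: "Lrel n m (sk A) (sk B) R" "isotropic_rel A B R" "det (sk A) \<noteq> 0" "det (sk B) \<noteq> 0"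
    using simE[OF assms(1) c(1,2)] by blast
  obtain S where S: "Lrel m p (sk B) (sk C) S" "isotropic_rel B C S" "det (sk C) \<noteq> 0"
    using simE[OF assms(2) c(2,3)] by blast
  show ?thesis
  proof (rule simI[OF c(1,3) R(3) S(3)])
    show "Lrel n p (sk A) (sk C) (R O S)" using c by (intro Lrel_comp[OF _ _ R(4) _ R(1) S(1)]) auto
    show "isotropic_rel A C (R O S)"
      unfolding isotropic_rel_def
    proof (intro allI impI)
      fix x y x' y' assume "(x, y) \<in> R O S" "(x', y') \<in> R O S"
      then obtain v v' where v: "(x, v) \<in> R" "(v, y) \<in> S" "(x', v') \<in> R" "(v', y') \<in> S" by auto
      have "bf A x x' = bf B v v'" using R(2) v unfolding isotropic_rel_def by blast
      also have "\<dots> = bf C y y'" using S(2) v unfolding isotropic_rel_def by blast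
      finally show "bf A x x' = bf C y y'" .
    qed
  qed
qed

lemma sim_congruence:
  assumes A: "A \<in> Mat n n" "det (sk A) \<noteq> 0" and P: "P \<in> Mat n n" "det P \<noteq> 0"
  shows "sim A (trp P * A * P)"
proof (rule simI)
  show "A \<in> Mat n n" "det (sk A) \<noteq> 0" "trp P * A * P \<in> Mat n n" using A P by auto
  have e: "sk (trp P * A * P) = trp P * sk A * P" using sk_congruence A P by blast
  have "det (trp P * sk A * P) = det P * det (sk A) * det P"
    using A P by (simp add: det_mult[of _ n] det_transpose del: assoc_mult_mat)
  then show "det (sk (trp P * A * P)) \<noteq> 0" unfolding e using A P by simp
  show "Lrel n n (sk A) (sk (trp P * A * P)) {(P *v v, v) |v. v \<in> Vec n}"
    unfolding e using A P by (intro Lrel_graph) auto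
  show "isotropic_rel A (trp P * A * P) {(P *v v, v) |v. v \<in> Vec n}"
    unfolding isotropic_rel_def using bf_congruence[OF A(1) P(1) P(1)] by auto
qed

lemma sim_refl: "A \<in> Mat n n ==> det (sk A) \<noteq> 0 ==> sim A A"
  using sim_congruence[of A n "1\<^sub>m n"] by simp

definition rel_sum :: "('a vec \<times> 'a vec) set => ('a vec \<times> 'a vec) set => ('a vec \<times> 'a vec) set" where
  "rel_sum R S = {(x @\<^sub>v y, x' @\<^sub>v y') |x y x' y'. (x, x') \<in> R \<and> (y, y') \<in> S}"

lemma isotropic_rel_sum:
  fixes A :: "'a::field mat"
  assumes "A \<in> Mat n n" "A' \<in> Mat n' n'" "B \<in> Mat m m" "B' \<in> Mat m' m'"
    and R: "linrel n n' R" and S: "linrel m m' S" and "isotropic_rel A A' R" "isotropic_rel B B' S"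
  shows "isotropic_rel (A \<boxplus> B) (A' \<boxplus> B') (rel_sum R S)"
  unfolding isotropic_rel_def
proof (intro allI impI)
  fix u u' w w' assume "(u, u') \<in> rel_sum R S" "(w, w') \<in> rel_sum R S"
  then obtain x x' y y' p p' q q' where e: "u = x @\<^sub>v y" "u' = x' @\<^sub>v y'" "w = p @\<^sub>v q" "w' = p' @\<^sub>v q'"
    "(x, x') \<in> R" "(y, y') \<in> S" "(p, p') \<in> R" "(q, q') \<in> S" unfolding rel_sum_def by blast
  have "bf A x p = bf A' x' p'" "bf B y q = bf B' y' q'" using assms(7,8) e unfolding isotropic_rel_def by blast+
  then show "bf (A \<boxplus> B) u w = bf (A' \<boxplus> B') u' w'"
    using e assms(1-4) linrelD(1,2)[OF R e(5)] linrelD(1,2)[OF R e(7)] linrelD(1,2)[OF S e(6)] linrelD(1,2)[OF S e(8)]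
    by (simp add: bf_block_sum[of _ n _ m] bf_block_sum[of _ n' _ m'])
qed

lemma Lrel_sum:
  fixes A :: "'a::field mat"
  assumes A: "A \<in> Mat n n" "A' \<in> Mat n' n'" and B: "B \<in> Mat m m" "B' \<in> Mat m' m'"
    and R: "Lrel n n' A A' R" and S: "Lrel m m' B B' S"
  shows "Lrel (n + m) (n' + m') (A \<boxplus> B) (A' \<boxplus> B') (rel_sum R S)"
proof (rule LrelI)
  have lR: "linrel n n' R" and lS: "linrel m m' S" using R S by (auto simp: Lrel_def)
  note DR = linrelD[OF lR] and DS = linrelD[OF lS]
  show "linrel (n + m) (n' + m') (rel_sum R S)"
    unfolding linrel_def
  proof (intro conjI allI impI)
    show "rel_sum R S \<subseteq> Vec (n + m) \<times> Vec (n' + m')" unfolding rel_sum_def using DR(1,2) DS(1,2) by auto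
    show "(0\<^sub>v (n + m), 0\<^sub>v (n' + m')) \<in> rel_sum R S"
      unfolding rel_sum_def append_vec_zero[symmetric] using DR(3) DS(3) by blast
    fix u u' w w' c assume "(u, u') \<in> rel_sum R S"
    then obtain x x' y y' where e: "u = x @\<^sub>v y" "u' = x' @\<^sub>v y'" "(x, x') \<in> R" "(y, y') \<in> S" unfolding rel_sum_def by blast
    show "(c *s u, c *s u') \<in> rel_sum R S"
      unfolding rel_sum_def e append_vec_smult using DR(5)[OF e(3)] DS(5)[OF e(4)] by blast
    assume "(w, w') \<in> rel_sum R S"
    then obtain p p' q q' where f: "w = p @\<^sub>v q" "w' = p' @\<^sub>v q'" "(p, p') \<in> R" "(q, q') \<in> S" unfolding rel_sum_def by blast
    have "u + w = (x + p) @\<^sub>v (y + q)" unfolding e f using DR(1) DS(1) e f by (intro append_vec_add') auto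
    moreover have "u' + w' = (x' + p') @\<^sub>v (y' + q')" unfolding e f using DR(2) DS(2) e f by (intro append_vec_add') auto
    ultimately show "(u + w, u' + w') \<in> rel_sum R S"
      unfolding rel_sum_def using DR(4)[OF e(3) f(3)] DS(4)[OF e(4) f(4)] by blast
  qed
  show "isotropic_rel (A \<boxplus> B) (A' \<boxplus> B') (rel_sum R S)"
    by (rule isotropic_rel_sum[OF A B lR lS Lrel_isotropic[OF R] Lrel_isotropic[OF S]])
  fix u u' assume u: "u \<in> Vec (n + m)" "u' \<in> Vec (n' + m')"
    and perp: "\<And>w w'. (w, w') \<in> rel_sum R S ==> bf (A \<boxplus> B) u w = bf (A' \<boxplus> B') u' w'"
  obtain x y where x: "x \<in> Vec n" "y \<in> Vec m" "u = x @\<^sub>v y" using append_vec_cases[OF u(1)] by blast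
  obtain x' y' where x': "x' \<in> Vec n'" "y' \<in> Vec m'" "u' = x' @\<^sub>v y'" using append_vec_cases[OF u(2)] by blast
  have key: "bf A x p + bf B y q = bf A' x' p' + bf B' y' q'" if "(p, p') \<in> R" "(q, q') \<in> S" for p p' q q'
  proof -
    have "(p @\<^sub>v q, p' @\<^sub>v q') \<in> rel_sum R S" using that unfolding rel_sum_def by blast
    from perp[OF this] show ?thesis
      using A B x x' DR(1,2)[OF that(1)] DS(1,2)[OF that(2)] by (simp add: bf_block_sum[of _ n _ m] bf_block_sum[of _ n' _ m'])
  qed
  have "(x, x') \<in> R"
  proof (rule Lrel_memI[OF R x(1) x'(1)])
    fix p p' assume "(p, p') \<in> R"
    from key[OF this DS(3)] show "bf A x p = bf A' x' p'" using B x x' by simp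
  qed
  moreover have "(y, y') \<in> S"
  proof (rule Lrel_memI[OF S x(2) x'(2)])
    fix q q' assume "(q, q') \<in> S"
    from key[OF DR(3) this] show "bf B y q = bf B' y' q'" using A x x' by simp
  qed
  ultimately show "(u, u') \<in> rel_sum R S" unfolding rel_sum_def using x x' by blast
qed

lemma sim_block_sum:
  assumes "sim A A'" "sim B B'"
  shows "sim (A \<boxplus> B) (A' \<boxplus> B')"
proof -
  obtain n n' m m' where c: "A \<in> Mat n n" "A' \<in> Mat n' n'" "B \<in> Mat m m" "B' \<in> Mat m' m'"
    using sim_carrier assms by blast
  obtain R where R: "Lrel n n' (sk A) (sk A') R" "isotropic_rel A A' R" "det (sk A) \<noteq> 0" "det (sk A') \<noteq> 0"
    using simE[OF assms(1) c(1,2)] by blast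
  obtain S where S: "Lrel m m' (sk B) (sk B') S" "isotropic_rel B B' S" "det (sk B) \<noteq> 0" "det (sk B') \<noteq> 0"
    using simE[OF assms(2) c(3,4)] by blast
  have l: "linrel n n' R" "linrel m m' S" using R S by (auto simp: Lrel_def)
  have e: "sk (A \<boxplus> B) = sk A \<boxplus> sk B" "sk (A' \<boxplus> B') = sk A' \<boxplus> sk B'"
    using c by (auto intro: sk_block_sum)
  show ?thesis
  proof (rule simI)
    show "A \<boxplus> B \<in> Mat (n + m) (n + m)" "A' \<boxplus> B' \<in> Mat (n' + m') (n' + m')"
      using c by (auto intro: block_sum_carrier)
    show "det (sk (A \<boxplus> B)) \<noteq> 0" "det (sk (A' \<boxplus> B')) \<noteq> 0"
      unfolding e using c R S by (simp_all add: det_block_sum[of _ n _ m] det_block_sum[of _ n' _ m'])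
    show "Lrel (n + m) (n' + m') (sk (A \<boxplus> B)) (sk (A' \<boxplus> B')) (rel_sum R S)"
      unfolding e using c by (intro Lrel_sum[OF _ _ _ _ R(1) S(1)]) auto
    show "isotropic_rel (A \<boxplus> B) (A' \<boxplus> B') (rel_sum R S)"
      by (rule isotropic_rel_sum[OF c l R(2) S(2)])
  qed
qed

lemma sim_block_comm:
  assumes A: "A \<in> Mat n n" "det (sk A) \<noteq> 0" and B: "B \<in> Mat m m" "det (sk B) \<noteq> 0"
  shows "sim (A \<boxplus> B) (B \<boxplus> A)"
proof -
  let ?P = "four_block_mat (0\<^sub>m n m) (1\<^sub>m n) (1\<^sub>m m) (0\<^sub>m m n) :: rat mat"
  have P: "?P \<in> Mat (n + m) (n + m)" by (auto simp: add.commute)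
  have Pv: "?P *v (y @\<^sub>v x) = x @\<^sub>v y" if "x \<in> Vec n" "y \<in> Vec m" for x y
    using that by (subst four_block_mat_mult_vec[of _ n m _ n _ m]) auto
  have AB: "A \<boxplus> B \<in> Mat (n + m) (n + m)" using A B by (auto intro: block_sum_carrier)
  have BA: "B \<boxplus> A \<in> Mat (n + m) (n + m)" using block_sum_carrier[OF B(1) A(1)] by (simp add: add.commute)
  have "det ?P \<noteq> 0"
  proof
    assume "det ?P = 0"
    then obtain v where v: "v \<in> Vec (n + m)" "v \<noteq> 0\<^sub>v (n + m)" "?P *v v = 0\<^sub>v (n + m)"
      using det_0_iff_vec_prod_zero_field[OF P] by blast
    then have "v \<in> Vec (m + n)" by (simp add: add.commute)
    then obtain y x where xy: "y \<in> Vec m" "x \<in> Vec n" "v = y @\<^sub>v x" by (rule append_vec_cases)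
    then have "x @\<^sub>v y = 0\<^sub>v n @\<^sub>v 0\<^sub>v m" using v Pv by (simp add: append_vec_zero)
    then have "x = 0\<^sub>v n" "y = 0\<^sub>v m" using append_vec_inj[OF xy(2) zero_carrier_vec] by auto
    then show False using v xy append_vec_zero[of m n, where 'a=rat] by (simp add: add.commute)
  qed
  moreover have "trp ?P * (A \<boxplus> B) * ?P = B \<boxplus> A"
  proof (rule bf_eqI[OF _ BA])
    show "trp ?P * (A \<boxplus> B) * ?P \<in> Mat (n + m) (n + m)" 
      by (intro mult_carrier_mat[of _ _ "n + m"] AB P) (use P in simp)
    fix u v :: "rat vec" assume uv: "u \<in> Vec (n + m)" "v \<in> Vec (n + m)"
    obtain y x where xy: "y \<in> Vec m" "x \<in> Vec n" "u = y @\<^sub>v x"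
      using append_vec_cases[of u m n] uv by (metis add.commute)
    obtain y' x' where xy': "y' \<in> Vec m" "x' \<in> Vec n" "v = y' @\<^sub>v x'"
      using append_vec_cases[of v m n] uv by (metis add.commute)
    have "bf (trp ?P * (A \<boxplus> B) * ?P) u v = bf (A \<boxplus> B) (?P *v u) (?P *v v)"
      by (rule bf_congruence[OF AB P P uv, symmetric])
    also have "\<dots> = bf (A \<boxplus> B) (x @\<^sub>v y) (x' @\<^sub>v y')" using Pv xy xy' by simp
    also have "\<dots> = bf (B \<boxplus> A) u v"
      unfolding xy(3) xy'(3) using A B xy(1,2) xy'(1,2) by (simp add: bf_block_sum[of _ n _ m] bf_block_sum[of _ m _ n])
    finally show "bf (trp ?P * (A \<boxplus> B) * ?P) u v = bf (B \<boxplus> A) u v" .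
  qed
  moreover have "det (sk (A \<boxplus> B)) \<noteq> 0"
    using A B by (simp add: sk_block_sum[of _ n _ m] det_block_sum[of _ n _ m])
  ultimately show ?thesis using sim_congruence[OF AB _ P] by simp
qed

section \<open>Algebraic sliceness over the rationals\<close>

lemma bf_zero_block:
  fixes M :: "'a::comm_ring_1 mat"
  assumes M: "M \<in> Mat n n" and z: "zero_block k M" and a: "a \<in> Vec n" "\<And>i. k \<le> i ==> i < n ==> a $ i = 0"
    and b: "b \<in> Vec n" "\<And>i. k \<le> i ==> i < n ==> b $ i = 0"
  shows "bf M a b = 0"
  unfolding bf_hf[OF M a(1) b(1)] hf_def
proof (intro sum.neutral ballI)
  fix i j assume ij: "i \<in> {..<n}" "j \<in> {..<n}"
  show "a $ i * M $$ (i, j) * b $ j = 0"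
    using z a(2)[of i] b(2)[of j] ij by (cases "i < k"; cases "j < k") (auto simp: zero_block_def)
qed

text \<open>A rational metabolizer can be made integral: its intersection with the integer lattice
  is saturated, so it has a basis that extends to a unimodular matrix, and the same matrix is
  adapted to the rational subspace. The half rank then follows from nonsingularity of the skew
  form.\<close>

lemma slice_iff:
  assumes V: "V \<in> Mat n n" and d: "det (sk (rm V)) \<noteq> 0"
  shows "algebraically_slice V \<longleftrightarrow> (\<exists>L. Lagr n (sk (rm V)) L \<and> (\<forall>x\<in>L. \<forall>y\<in>L. bf (rm V) x y = 0))"
proof
  have rV: "rm V \<in> Mat n n" "sk (rm V) \<in> Mat n n" using V by auto
  assume "algebraically_slice V"
  then obtain g P where n: "V \<in> Mat (2 * g) (2 * g)" and P0: "P \<in> Mat (2 * g) (2 * g)" "\<bar>det P\<bar> = 1"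
    and z: "\<And>i j. i < g ==> j < g ==> (trp P * V * P) $$ (i, j) = 0"
    unfolding algebraically_slice_def by blast
  have n: "n = 2 * g" using n V by auto
  have P: "P \<in> Mat n n" using P0 n by simp
  define U where "U = rm P"
  have U: "U \<in> Mat n n" using P by (simp add: U_def)
  have "det U = of_int (det P)" unfolding U_def by simp
  then have dU: "det U = 1 \<or> det U = - 1" using P0(2) by (auto simp: abs_if split: if_splits)
  then obtain U' where U': "U' \<in> Mat n n" "U * U' = 1\<^sub>m n" "U' * U = 1\<^sub>m n"
    using mat_inv_exists[OF U] by auto
  \<comment> \<open>The rational span of the first \<open>g\<close> columns of \<open>P\<close>,
    written in the coordinates of the inverse matrix.\<close>
  define L where "L = {v \<in> Vec n. \<forall>i. g \<le> i --> i < n --> (U' *v v) $ i = 0}"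
  have GL: "GL_pair UNIV n U U'" using U U' dU by (simp add: GL_pair_def)
  have ad: "adapted UNIV n L U U' g" using GL n by (auto simp: adapted_def L_def)
  have iso: "bf (rm V) x y = 0" if "x \<in> L" "y \<in> L" for x y
  proof -
    have xy: "x \<in> Vec n" "y \<in> Vec n" using that by (auto simp: L_def)
    have "bf (rm V) (U *v (U' *v x)) (U *v (U' *v y)) = bf (trp U * rm V * U) (U' *v x) (U' *v y)"
      using rV U U' xy by (intro bf_congruence) auto
    also have "trp U * rm V * U = rm (trp P * V * P)"
      unfolding U_def using P V by (simp add: of_int_hom.mat_hom_mult[of _ n n _ n] map_mat_transpose del: assoc_mult_mat)
    also have "bf (rm (trp P * V * P)) (U' *v x) (U' *v y) = 0"
    proof (rule bf_zero_block[of _ n g])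
      show "zero_block g (rm (trp P * V * P))"
        unfolding zero_block_def
      proof (intro allI impI)
        fix i j assume ij: "i < g" "j < g"
        have "rm (trp P * V * P) $$ (i, j) = of_int ((trp P * V * P) $$ (i, j))"
          using ij n P V by (intro index_map_mat(1)) auto
        then show "rm (trp P * V * P) $$ (i, j) = 0" using z[OF ij] by simp
      qed
    qed (use that U' xy P V in \<open>auto simp: L_def\<close>)
    finally show ?thesis using GL_pair_cancel(2)[OF GL] xy by simp
  qed
  have Lc: "L \<subseteq> Vec n" by (auto simp: L_def)
  note B = basis_of_adapted[OF ad Lc]
  have "Lagr n (sk (rm V)) L"
    by (rule basis_Lagr[OF B(1) n B(2) rV(2) d B(3)[symmetric]])
       (use iso bf_sk[OF rV(1)] Lc in \<open>auto simp: subset_iff\<close>)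
  then show "\<exists>L. Lagr n (sk (rm V)) L \<and> (\<forall>x\<in>L. \<forall>y\<in>L. bf (rm V) x y = 0)" using iso by blast
next
  have rV: "rm V \<in> Mat n n" "sk (rm V) \<in> Mat n n" using V by auto
  assume "\<exists>L. Lagr n (sk (rm V)) L \<and> (\<forall>x\<in>L. \<forall>y\<in>L. bf (rm V) x y = 0)"
  then obtain L where L: "Lagr n (sk (rm V)) L" and iso: "\<And>x y. x \<in> L ==> y \<in> L ==> bf (rm V) x y = 0" by blast
  have s: "subsp n L" using L by (simp add: Lagr_def)
  let ?rv = "map_vec rat_of_int"
  \<comment> \<open>The lattice points of \<open>L\<close>.\<close>
  define M where "M = {v \<in> Vec n. ?rv v \<in> L}"
  have rvadd: "?rv (x + y) = ?rv x + ?rv y" if "x \<in> Vec n" "y \<in> Vec n" for x y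
    using that by (intro eq_vecI) auto
  have rvsmult: "?rv (c *s x) = of_int c *s ?rv x" for c x
    by (intro eq_vecI) auto
  have "submod UNIV n M"
    unfolding submod_def
  proof (intro conjI ballI)
    have "?rv (0\<^sub>v n) = 0\<^sub>v n" by (intro eq_vecI) auto
    then have "?rv (0\<^sub>v n) \<in> L" using subspD(2)[OF s] by (simp only:)
    then show "0\<^sub>v n \<in> M" by (simp add: M_def)
  qed (use subspD[OF s] rvadd rvsmult in \<open>auto simp: M_def\<close>)
  moreover have "saturated UNIV n M"
    unfolding saturated_def
  proof (intro ballI impI)
    fix c v assume v: "v \<in> Fvec UNIV n" and c: "(c :: int) \<noteq> 0" and cv: "c *s v \<in> M"
    have "of_int c *s ?rv v \<in> L" using cv rvsmult by (simp add: M_def)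
    then have "inverse (of_int c) *s (of_int c *s ?rv v) \<in> L" by (rule subspD(4)[OF s])
    then show "v \<in> M" using c v by (simp add: smult_smult_assoc M_def)
  qed
  ultimately obtain P P' k where adZ: "adapted UNIV n M P P' k" using adapted_int by blast
  have P: "P \<in> Mat n n" "P' \<in> Mat n n" "P * P' = 1\<^sub>m n" "P' * P = 1\<^sub>m n" "det P = 1 \<or> det P = - 1" and kn: "k \<le> n"
    using adZ by (auto simp: adapted_def GL_pair_def)
  have "adapted UNIV n L (rm P) (rm P') k"
    unfolding adapted_def
  proof (intro conjI ballI)
    have "rm P * rm P' = 1\<^sub>m n" "rm P' * rm P = 1\<^sub>m n"
      using of_int_hom.mat_hom_mult[OF P(1,2), where 'a=rat] of_int_hom.mat_hom_mult[OF P(2,1), where 'a=rat] P(3,4)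
      by (simp_all add: of_int_hom.mat_hom_one)
    moreover have "det (rm P) = of_int (det P)" by simp
    ultimately show "GL_pair UNIV n (rm P) (rm P')" using P by (auto simp: GL_pair_def)
    show "k \<le> n" by (rule kn)
    fix v :: "rat vec" assume "v \<in> Fvec UNIV n"
    then have v: "v \<in> Vec n" by simp
    \<comment> \<open>A common denominator of the entries of \<open>v\<close>; \<open>w\<close>
      below is the integer vector \<open>c\<close> times \<open>v\<close>, which lies in
      \<open>L\<close> exactly when \<open>v\<close> does.\<close>
    define c where "c = (\<Prod>i<n. snd (quotient_of (v $ i)))"
    have c0: "c \<noteq> 0" unfolding c_def using quotient_of_denom_pos' by (simp add: less_le)
    define w where "w = vec n (\<lambda>i. fst (quotient_of (v $ i)) * (\<Prod>j\<in>{..<n}-{i}. snd (quotient_of (v $ j))))"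
    have w: "w \<in> Vec n" by (simp add: w_def)
    have e: "?rv w = of_int c *s v"
    proof (rule eq_vecI)
      fix i assume "i < dim_vec (of_int c *s v)"
      then have i: "i < n" using v by simp
      have "v $ i = of_int (fst (quotient_of (v $ i))) / of_int (snd (quotient_of (v $ i)))"
        by (metis quotient_of_div surjective_pairing)
      moreover have "snd (quotient_of (v $ i)) \<noteq> 0" using quotient_of_denom_pos'[of "v $ i"] by simp
      ultimately have "of_int (snd (quotient_of (v $ i))) * v $ i = of_int (fst (quotient_of (v $ i)))"
        by (metis nonzero_mult_div_cancel_left of_int_eq_0_iff times_divide_eq_right)
      moreover have "c = snd (quotient_of (v $ i)) * (\<Prod>j\<in>{..<n}-{i}. snd (quotient_of (v $ j)))"
        unfolding c_def using i by (intro prod.remove) auto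
      ultimately show "?rv w $ i = (of_int c *s v) $ i" using i v by (simp add: w_def)
    qed (use v in \<open>simp add: w_def\<close>)
    have "v \<in> L \<longleftrightarrow> ?rv w \<in> L"
    proof
      assume "?rv w \<in> L"
      then have "inverse (of_int c) *s (of_int c *s v) \<in> L" unfolding e by (rule subspD(4)[OF s])
      then show "v \<in> L" using c0 by (simp add: smult_smult_assoc)
    qed (use e subspD(4)[OF s] in simp)
    also have "\<dots> \<longleftrightarrow> w \<in> M" using w by (simp add: M_def)
    also have "\<dots> \<longleftrightarrow> (\<forall>i. k \<le> i --> i < n --> (P' *v w) $ i = 0)" using adZ w by (simp add: adapted_def)
    also have "\<dots> \<longleftrightarrow> (\<forall>i. k \<le> i --> i < n --> (rm P' *v v) $ i = 0)"
    proof -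
      have "rm P' *v ?rv w = of_int c *s (rm P' *v v)"
        unfolding e using P v by (intro mult_mat_vec_smult[of _ n n]) auto
      moreover have "rm P' *v ?rv w = ?rv (P' *v w)"
        by (rule of_int_hom.mult_mat_vec_hom[OF P(2) w, symmetric])
      ultimately have f: "?rv (P' *v w) = of_int c *s (rm P' *v v)" by simp
      have "(P' *v w) $ i = 0 \<longleftrightarrow> (rm P' *v v) $ i = 0" if i: "i < n" for i
      proof -
        have "?rv (P' *v w) $ i = (of_int c *s (rm P' *v v)) $ i" unfolding f ..
        then have "of_int ((P' *v w) $ i) = of_int c * (rm P' *v v) $ i"
          using i P by (simp del: index_mult_mat_vec)
        then show ?thesis using c0 by (metis mult_eq_0_iff of_int_eq_0_iff)
      qed
      then show ?thesis by blast
    qed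
    finally show "v \<in> L \<longleftrightarrow> (\<forall>i. k \<le> i --> i < n --> (rm P' *v v) $ i = 0)" .
  qed
  then have nk: "n = 2 * k" using Lagr_adapted_dim[OF rV(2) d L] by blast
  have "(trp P * V * P) $$ (i, j) = 0" if ij: "i < k" "j < k" for i j
  proof -
    have u: "?rv (P *v unit_vec n l) \<in> L" if "l < k" for l
      using adapted_mem[OF _ adZ, of "unit_vec n l"] that nk by (auto simp: M_def)
    have rmP: "?rv (P *v unit_vec n l) = rm P *v ?rv (unit_vec n l)" for l
      by (rule of_int_hom.mult_mat_vec_hom[OF P(1) unit_vec_carrier])
    have "0 = bf (rm V) (?rv (P *v unit_vec n i)) (?rv (P *v unit_vec n j))" using iso u ij by simp
    also have "\<dots> = bf (rm V) (rm P *v ?rv (unit_vec n i)) (rm P *v ?rv (unit_vec n j))"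
      unfolding rmP ..
    also have "\<dots> = bf (trp (rm P) * rm V * rm P) (?rv (unit_vec n i)) (?rv (unit_vec n j))"
      using P rV by (intro bf_congruence) auto
    also have "trp (rm P) * rm V * rm P = rm (trp P * V * P)"
      using P V by (simp add: of_int_hom.mat_hom_mult[of _ n n _ n] map_mat_transpose del: assoc_mult_mat)
    also have "?rv (unit_vec n i) = unit_vec n i" using ij nk by (intro eq_vecI) (auto simp: unit_vec_def)
    also have "?rv (unit_vec n j) = unit_vec n j" using ij nk by (intro eq_vecI) (auto simp: unit_vec_def)
    also have "bf (rm (trp P * V * P)) (unit_vec n i) (unit_vec n j) = rm (trp P * V * P) $$ (i, j)"
      using P V ij nk by (intro bf_unit) auto
    finally show ?thesis using P V ij nk by (simp del: index_mult_mat(1) assoc_mult_mat)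
  qed
  moreover have "\<bar>det P\<bar> = 1" using P(5) by auto
  ultimately show "algebraically_slice V" unfolding algebraically_slice_def using V P nk by blast
qed

section \<open>The algebraic concordance group\<close>

lemma seifert_matrix_sk: "seifert_matrix V \<longleftrightarrow> (\<exists>n. V \<in> Mat n n) \<and> det (sk V) = 1"
  by (simp add: seifert_matrix_def sk_def)

lemma seifert_carrier: "seifert_matrix V ==> \<exists>n. V \<in> Mat n n"
  by (simp add: seifert_matrix_def)

lemma seifert_det_rat:
  assumes "seifert_matrix V"
  shows "det (sk (rm V)) \<noteq> 0"
proof -
  obtain n where V: "V \<in> Mat n n" and d: "det (sk V) = 1" using assms by (auto simp: seifert_matrix_sk)
  have "det (sk (rm V)) = det (rm (sk V))" using rm_sk[OF V] by simp
  also have "\<dots> = of_int (det (sk V))" by simp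
  finally show ?thesis using d by simp
qed

lemma seifert_block_sum: "seifert_matrix V ==> seifert_matrix W ==> seifert_matrix (V \<boxplus> W)"
proof -
  assume a: "seifert_matrix V" "seifert_matrix W"
  then obtain n m where c: "V \<in> Mat n n" "W \<in> Mat m m" using seifert_carrier by blast
  have "det (sk (V \<boxplus> W)) = det (sk V) * det (sk W)"
    using c by (simp add: sk_block_sum[of _ n _ m] det_block_sum[of _ n _ m])
  then show ?thesis using a block_sum_carrier[OF c] by (auto simp: seifert_matrix_sk)
qed

text \<open>The negative of the skew matrix is its transpose, so the determinant stays 1 without any
  appeal to the parity of the size.\<close>

lemma seifert_uminus:
  assumes "seifert_matrix V"
  shows "seifert_matrix (- V)"
proof -
  obtain n where V: "V \<in> Mat n n" and d: "det (sk V) = 1" using assms by (auto simp: seifert_matrix_sk)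
  have m: "- A = (- 1) \<cdot>\<^sub>m A" for A :: "int mat" by (intro eq_matI) auto
  have S: "sk V \<in> Mat n n" using V by simp
  have dm: "det (- sk V) = (- 1) ^ n * det (sk V)" unfolding m using S by (simp add: det_smult)
  have "trp (sk V) = - sk V" using V by (intro eq_matI) (auto simp: sk_def)
  then have "det (- sk V) = 1" using det_transpose[OF S] d by simp
  moreover have "sk (- V) = - sk V" by (rule sk_uminus[OF V])
  ultimately show ?thesis using V by (auto simp: seifert_matrix_sk)
qed

lemma seifert_zero: "seifert_matrix (0\<^sub>m 0 0)"
  unfolding seifert_matrix_def
  by (intro conjI exI[of _ 0] det_dim_zero) auto

text \<open>A metabolizer of \<open>V \<boxplus> - W\<close> is the graph-like relation between the
  two spaces. In this form transitivity of concordance is composition of relations.\<close>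

lemma alg_concordant_iff:
  "(V, W) \<in> alg_concordant \<longleftrightarrow> seifert_matrix V \<and> seifert_matrix W \<and> sim (rm V) (rm W)"
proof (cases "seifert_matrix V \<and> seifert_matrix W")
  case True
  then obtain n m where c: "V \<in> Mat n n" "W \<in> Mat m m" using seifert_carrier by blast
  let ?Z = "V \<boxplus> - W"
  have Z: "?Z \<in> Mat (n + m) (n + m)" using c by (intro block_sum_carrier) auto
  have "seifert_matrix ?Z" using True by (intro seifert_block_sum seifert_uminus) auto
  then have dZ: "det (sk (rm ?Z)) \<noteq> 0" by (rule seifert_det_rat)
  have rc: "rm V \<in> Mat n n" "rm W \<in> Mat m m" using c by auto
  have e: "rm ?Z = rm V \<boxplus> - rm W" using c by (subst map_block_sum[of _ n _ m]) (auto simp: rm_uminus)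
  have es: "sk (rm ?Z) = sk (rm V) \<boxplus> - sk (rm W)"
    unfolding e using rc by (subst sk_block_sum[of _ n _ m]) (auto simp: sk_uminus[of _ m])
  have b: "bf (rm ?Z) (x @\<^sub>v y) (x' @\<^sub>v y') = bf (rm V) x x' - bf (rm W) y y'"
    if "x \<in> Vec n" "y \<in> Vec m" "x' \<in> Vec n" "y' \<in> Vec m" for x y x' y'
    unfolding e using bf_block_sum[of "rm V" n "- rm W" m x y x' y'] bf_uminus_mat[of "rm W" m m y y'] rc that by simp
  have "algebraically_slice ?Z \<longleftrightarrow> sim (rm V) (rm W)"
  proof
    assume "algebraically_slice ?Z"
    then obtain L where L: "Lagr (n + m) (sk (rm ?Z)) L" "\<And>x y. x \<in> L ==> y \<in> L ==> bf (rm ?Z) x y = 0"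
      using slice_iff[OF Z dZ] by blast
    let ?R = "{(x, y). x \<in> Vec n \<and> y \<in> Vec m \<and> x @\<^sub>v y \<in> L}"
    have "Lrel n m (sk (rm V)) (sk (rm W)) ?R" using L(1) rc unfolding es by (intro Lagr_Lrel) auto
    moreover have "isotropic_rel (rm V) (rm W) ?R" unfolding isotropic_rel_def
    proof (intro allI impI)
      fix x y x' y' assume "(x, y) \<in> ?R" "(x', y') \<in> ?R"
      then show "bf (rm V) x x' = bf (rm W) y y'" using L(2)[of "x @\<^sub>v y" "x' @\<^sub>v y'"] b[of x y x' y'] by simp
    qed
    ultimately show "sim (rm V) (rm W)"
      using True by (intro simI[OF rc seifert_det_rat seifert_det_rat]) auto
  next
    assume "sim (rm V) (rm W)"
    then obtain R where R: "Lrel n m (sk (rm V)) (sk (rm W)) R" "isotropic_rel (rm V) (rm W) R"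
      using simE[OF _ rc] by blast
    have l: "linrel n m R" using R by (simp add: Lrel_def)
    have "Lagr (n + m) (sk (rm ?Z)) (rel_vecs R)"
      unfolding es using R(1) rc by (subst Lrel_Lagr[symmetric, OF _ _ l]) auto
    moreover have "bf (rm ?Z) z z' = 0" if h: "z \<in> rel_vecs R" "z' \<in> rel_vecs R" for z z'
    proof -
      obtain x y x' y' where q: "z = x @\<^sub>v y" "z' = x' @\<^sub>v y'" "(x, y) \<in> R" "(x', y') \<in> R"
        using h unfolding rel_vecs_def by blast
      have "bf (rm V) x x' = bf (rm W) y y'" using R(2) q unfolding isotropic_rel_def by blast
      then show ?thesis using b[of x y x' y'] linrelD(1,2)[OF l q(3)] linrelD(1,2)[OF l q(4)] q by simp
    qed
    ultimately show "algebraically_slice ?Z" using slice_iff[OF Z dZ] by blast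
  qed
  then show ?thesis using True by (simp add: alg_concordant_def)
qed (auto simp: alg_concordant_def)

lemma alg_concordant_refl: "seifert_matrix V ==> (V, V) \<in> alg_concordant"
proof -
  assume V: "seifert_matrix V"
  then obtain n where "rm V \<in> Mat n n" using seifert_carrier by auto
  then show ?thesis using V seifert_det_rat[OF V] by (auto simp: alg_concordant_iff intro: sim_refl)
qed

lemma alg_concordant_equiv: "equiv {V. seifert_matrix V} alg_concordant"
proof (rule equivI)
  show "alg_concordant \<subseteq> {V. seifert_matrix V} \<times> {V. seifert_matrix V}" by (auto simp: alg_concordant_def)
  show "refl_on {V. seifert_matrix V} alg_concordant"
    by (rule refl_onI) (use alg_concordant_refl in \<open>auto simp: alg_concordant_def\<close>)
  show "sym alg_concordant" by (rule symI) (auto simp: alg_concordant_iff intro: sim_sym)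
  show "trans alg_concordant" by (rule transI) (auto simp: alg_concordant_iff intro: sim_trans)
qed

lemma alg_class_eq_iff:
  assumes "seifert_matrix V" "seifert_matrix W"
  shows "alg_class V = alg_class W \<longleftrightarrow> (V, W) \<in> alg_concordant"
  unfolding alg_class_def using eq_equiv_class_iff[OF alg_concordant_equiv] assms by simp

lemma mem_alg_class: "W \<in> alg_class V \<longleftrightarrow> (V, W) \<in> alg_concordant"
  by (simp add: alg_class_def)

lemma alg_class_mem_eq: "V' \<in> alg_class V ==> alg_class V' = alg_class V \<and> seifert_matrix V' \<and> seifert_matrix V"
  using alg_class_eq_iff by (auto simp: mem_alg_class alg_concordant_iff sim_sym)

lemma alg_concordant_block_sum:
  "(V, V') \<in> alg_concordant ==> (W, W') \<in> alg_concordant ==> (V \<boxplus> W, V' \<boxplus> W') \<in> alg_concordant"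
proof -
  assume a: "(V, V') \<in> alg_concordant" "(W, W') \<in> alg_concordant"
  then have s: "seifert_matrix V" "seifert_matrix V'" "seifert_matrix W" "seifert_matrix W'"
    by (auto simp: alg_concordant_iff)
  obtain n n' m m' where c: "V \<in> Mat n n" "V' \<in> Mat n' n'" "W \<in> Mat m m" "W' \<in> Mat m' m'"
    using seifert_carrier s by blast
  have "sim (rm V \<boxplus> rm W) (rm V' \<boxplus> rm W')" using a by (intro sim_block_sum) (auto simp: alg_concordant_iff)
  then show ?thesis using s seifert_block_sum map_block_sum[OF c(1,3), of rat_of_int] map_block_sum[OF c(2,4), of rat_of_int]
    by (simp add: alg_concordant_iff)
qed

abbreviation (input) AG :: "int mat set monoid" where "AG \<equiv> alg_concordance_group"

lemma AG_mult:
  assumes "seifert_matrix V" "seifert_matrix W"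
  shows "alg_class V \<otimes>\<^bsub>AG\<^esub> alg_class W = alg_class (V \<boxplus> W)"
proof -
  have *: "alg_class (V' \<boxplus> W') = alg_class (V \<boxplus> W)" if "V' \<in> alg_class V" "W' \<in> alg_class W" for V' W'
  proof -
    have "(V \<boxplus> W, V' \<boxplus> W') \<in> alg_concordant"
      using that by (intro alg_concordant_block_sum) (auto simp: mem_alg_class)
    then show ?thesis using alg_class_mem_eq mem_alg_class by blast
  qed
  have m: "V \<in> alg_class V" "W \<in> alg_class W" using assms alg_concordant_refl by (auto simp: mem_alg_class)
  have "alg_class V \<otimes>\<^bsub>AG\<^esub> alg_class W = (\<Union>V'\<in>alg_class V. \<Union>W'\<in>alg_class W. alg_class (V' \<boxplus> W'))"
    by (simp add: alg_concordance_group_def)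
  also have "\<dots> = (\<Union>V'\<in>alg_class V. \<Union>W'\<in>alg_class W. alg_class (V \<boxplus> W))"
    by (intro SUP_cong refl) (rule *)
  also have "\<dots> = alg_class (V \<boxplus> W)" using m by blast
  finally show ?thesis .
qed

lemma AG_carrier: "X \<in> carrier AG \<longleftrightarrow> (\<exists>V. seifert_matrix V \<and> X = alg_class V)"
  unfolding alg_concordance_group_def alg_class_def quotient_def by auto

lemma AG_one: "\<one>\<^bsub>AG\<^esub> = alg_class (0\<^sub>m 0 0)"
  by (simp add: alg_concordance_group_def)

lemma block_sum_assoc: "A \<boxplus> B \<boxplus> C = A \<boxplus> (B \<boxplus> C)"
  unfolding block_sum_def by (rule assoc_four_block_mat[symmetric])

lemma block_sum_zero_left: "0\<^sub>m 0 0 \<boxplus> A = A"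
  by (intro eq_matI) (auto simp: block_sum_def)

lemma block_sum_zero_right: "A \<boxplus> 0\<^sub>m 0 0 = A"
  by (intro eq_matI) (auto simp: block_sum_def)

lemma slice_class_one:
  assumes "seifert_matrix V" "algebraically_slice V"
  shows "alg_class V = \<one>\<^bsub>AG\<^esub>"
proof -
  have "- 0\<^sub>m 0 0 = (0\<^sub>m 0 0 :: int mat)" by (intro eq_matI) auto
  then have "(V, 0\<^sub>m 0 0) \<in> alg_concordant" using assms seifert_zero by (simp add: alg_concordant_def block_sum_zero_right)
  then show ?thesis using alg_class_eq_iff[OF assms(1) seifert_zero] by (simp add: AG_one)
qed

lemma AG_inverse_class:
  assumes V: "seifert_matrix V"
  shows "alg_class V \<otimes>\<^bsub>AG\<^esub> alg_class (- V) = \<one>\<^bsub>AG\<^esub>"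
proof -
  have "algebraically_slice (V \<boxplus> - V)" using alg_concordant_refl[OF V] by (simp add: alg_concordant_def)
  then show ?thesis using AG_mult[OF V seifert_uminus[OF V]] slice_class_one seifert_block_sum seifert_uminus V by simp
qed

lemma AG_comm_group: "comm_group AG"
proof (rule comm_groupI)
  fix X Y Z assume "X \<in> carrier AG" "Y \<in> carrier AG" "Z \<in> carrier AG"
  then obtain V W U where s: "seifert_matrix V" "seifert_matrix W" "seifert_matrix U"
    and e: "X = alg_class V" "Y = alg_class W" "Z = alg_class U"
    by (auto simp: AG_carrier)
  show "X \<otimes>\<^bsub>AG\<^esub> Y \<in> carrier AG" using s by (auto simp: e AG_mult AG_carrier intro: seifert_block_sum)
  show "X \<otimes>\<^bsub>AG\<^esub> Y \<otimes>\<^bsub>AG\<^esub> Z = X \<otimes>\<^bsub>AG\<^esub> (Y \<otimes>\<^bsub>AG\<^esub> Z)"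
    using s by (simp add: e AG_mult seifert_block_sum block_sum_assoc)
  obtain n m where c: "V \<in> Mat n n" "W \<in> Mat m m" using s seifert_carrier by blast
  have "sim (rm V \<boxplus> rm W) (rm W \<boxplus> rm V)" using c s seifert_det_rat by (intro sim_block_comm) auto
  then have "(V \<boxplus> W, W \<boxplus> V) \<in> alg_concordant"
    using s seifert_block_sum map_block_sum[OF c, of rat_of_int] map_block_sum[OF c(2,1), of rat_of_int]
    by (simp add: alg_concordant_iff)
  then show "X \<otimes>\<^bsub>AG\<^esub> Y = Y \<otimes>\<^bsub>AG\<^esub> X" using s by (simp add: e AG_mult alg_class_eq_iff seifert_block_sum)
next
  show "\<one>\<^bsub>AG\<^esub> \<in> carrier AG" using seifert_zero by (auto simp: AG_carrier AG_one)
next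
  fix X assume "X \<in> carrier AG"
  then obtain V where s: "seifert_matrix V" and e: "X = alg_class V" by (auto simp: AG_carrier)
  show "\<one>\<^bsub>AG\<^esub> \<otimes>\<^bsub>AG\<^esub> X = X" using s seifert_zero by (simp add: e AG_one AG_mult block_sum_zero_left)
  have V': "seifert_matrix (- V)" using s by (rule seifert_uminus)
  moreover have "- (- V) = V" by simp
  ultimately have "alg_class (- V) \<otimes>\<^bsub>AG\<^esub> X = \<one>\<^bsub>AG\<^esub>" using AG_inverse_class[OF V'] e by simp
  then show "\<exists>Y\<in>carrier AG. Y \<otimes>\<^bsub>AG\<^esub> X = \<one>\<^bsub>AG\<^esub>"
    using V' by (intro bexI[of _ "alg_class (- V)"]) (auto simp: AG_carrier)
qed

text \<open>Rational congruence suffices, since \<open>sim\<close> sees only rational forms. The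
  congruences below come from norm equations that need not have integral solutions.\<close>

lemma class_eq_of_congruence:
  assumes V: "seifert_matrix V" "V \<in> Mat n n" and W: "seifert_matrix W"
    and P: "P \<in> Mat n n" "det P \<noteq> 0" "rm W = trp P * rm V * P"
  shows "alg_class V = alg_class W"
proof -
  have "sim (rm V) (rm W)" unfolding P(3) using V seifert_det_rat[OF V(1)] P by (intro sim_congruence) auto
  then show ?thesis using alg_class_eq_iff V W by (simp add: alg_concordant_iff)
qed

section \<open>Orders of twist knots in the algebraic concordance group\<close>

definition mat2 :: "'a => 'a => 'a => 'a => 'a mat" where
  "mat2 a b c d = mat_of_rows_list 2 [[a, b], [c, d]]"

lemma mat2_carrier [simp]: "mat2 a b c d \<in> Mat 2 2"
  and mat2_dim [simp]: "dim_row (mat2 a b c d) = 2" "dim_col (mat2 a b c d) = 2"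
  by (auto simp: mat2_def mat_of_rows_list_def)

lemma mat2_index [simp]: "mat2 a b c d $$ (0, 0) = a" "mat2 a b c d $$ (0, 1) = b"
  "mat2 a b c d $$ (0, Suc 0) = b" "mat2 a b c d $$ (1, 0) = c" "mat2 a b c d $$ (Suc 0, 0) = c"
  "mat2 a b c d $$ (1, 1) = d" "mat2 a b c d $$ (Suc 0, Suc 0) = d"
  by (auto simp: mat2_def mat_of_rows_list_def)

lemma eq_mat2I:
  assumes "A \<in> Mat 2 2" "A $$ (0, 0) = a" "A $$ (0, 1) = b" "A $$ (1, 0) = c" "A $$ (1, 1) = d"
  shows "A = mat2 a b c d"
proof (rule eq_matI)
  fix i j assume "i < dim_row (mat2 a b c d)" "j < dim_col (mat2 a b c d)"
  then have "(i = 0 \<or> i = 1) \<and> (j = 0 \<or> j = 1)" by auto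
  then show "A $$ (i, j) = mat2 a b c d $$ (i, j)" using assms by auto
qed (use assms in auto)

lemma mat2_mult: "mat2 a b c d * mat2 a' b' c' d' =
  mat2 (a * a' + b * c') (a * b' + b * d') (c * a' + d * c') (c * b' + d * d' :: 'a::comm_ring_1)"
  by (rule eq_mat2I) (auto simp: scalar_prod_def numeral_2_eq_2)

lemma mat2_transpose: "trp (mat2 a b c d) = mat2 a c b d"
  by (rule eq_mat2I) auto

lemma mat2_add: "mat2 a b c d + mat2 a' b' c' d' = mat2 (a + a') (b + b') (c + c') (d + d')"
  by (rule eq_mat2I) auto

lemma mat2_uminus: "- mat2 a b c d = mat2 (- a) (- b) (- c) (- d)"
  by (rule eq_mat2I) auto

lemma mat2_det: "det (mat2 a b c d) = a * d - b * (c :: 'a::comm_ring_1)"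
  by (subst det_2) auto

lemma mat2_zero: "mat2 0 0 0 0 = 0\<^sub>m 2 2"
  by (rule eq_mat2I[symmetric]) auto

lemma twist_knot_mat2: "twist_knot n = mat2 (- 1) 1 0 (int n)"
  by (simp add: twist_knot_def mat2_def)

lemma rm_twist: "rm (twist_knot n) = mat2 (- 1) 1 0 (of_nat n)"
  by (rule eq_mat2I) (auto simp: twist_knot_mat2)

text \<open>The matrix of \<open>a + b J\<close>, where \<open>J\<close> is the skew-adjoint operator with square \<open>4 n + 1\<close>.\<close>

definition Jmat :: "nat => rat => rat => rat mat" where
  "Jmat n a b = mat2 (a - b) (- 2 * of_nat n * b) (- 2 * b) (a + b)"

text \<open>Skew-adjointness of \<open>J\<close> turns the left factor into \<open>a - b J\<close>
  on the right. With \<open>V\<close> the Seifert matrix, the product is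
  \<open>a c - (4 n + 1) b d\<close> times \<open>V\<close> plus \<open>a d - b c\<close> times
  \<open>V J\<close>, which is the matrix displayed.\<close>

lemma Jmat_congruence: "trp (Jmat n a b) * rm (twist_knot n) * Jmat n c d =
  mat2 (- (a * c - (4 * of_nat n + 1) * b * d) - (a * d - b * c))
    (a * c - (4 * of_nat n + 1) * b * d + (2 * of_nat n + 1) * (a * d - b * c))
    (- 2 * of_nat n * (a * d - b * c))
    (of_nat n * (a * c - (4 * of_nat n + 1) * b * d) + of_nat n * (a * d - b * c))"
  unfolding Jmat_def rm_twist mat2_transpose mat2_mult by (simp add: algebra_simps)

text \<open>Congruence by \<open>a + b J\<close> scales the Seifert form by the norm of
  \<open>a + b J\<close>; norm -1 makes the form congruent to its negative.\<close>

lemma twist_order_2: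
  assumes "a\<^sup>2 - (4 * of_nat n + 1) * b\<^sup>2 = (- 1 :: rat)"
  shows "alg_class (twist_knot n) \<otimes>\<^bsub>AG\<^esub> alg_class (twist_knot n) = \<one>\<^bsub>AG\<^esub>"
proof -
  have s: "seifert_matrix (twist_knot n)" by (rule seifert_matrix_twist_knot)
  have "alg_class (twist_knot n) = alg_class (- twist_knot n)"
  proof (rule class_eq_of_congruence[OF s twist_knot_carrier seifert_uminus[OF s]])
    show "Jmat n a b \<in> Mat 2 2" by (simp add: Jmat_def)
    have "det (Jmat n a b) = a\<^sup>2 - (4 * of_nat n + 1) * b\<^sup>2"
      unfolding Jmat_def mat2_det by (simp add: algebra_simps power2_eq_square)
    then show "det (Jmat n a b) \<noteq> 0" using assms by simp
    have *: "a * a - (4 * of_nat n + 1) * b * b = - 1" using assms by (simp add: power2_eq_square algebra_simps)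
    have "trp (Jmat n a b) * rm (twist_knot n) * Jmat n a b = mat2 1 (- 1) 0 (- of_nat n)"
      unfolding Jmat_congruence * by (simp add: mult.commute)
    then show "rm (- twist_knot n) = trp (Jmat n a b) * rm (twist_knot n) * Jmat n a b"
      by (simp add: rm_uminus rm_twist mat2_uminus)
  qed
  then show ?thesis using AG_inverse_class[OF s] by simp
qed

text \<open>Here \<open>4 n + 1\<close> is the square of \<open>2 k + 1\<close>, so the form has a
  rational, even integral, null vector.\<close>

lemma twist_slice:
  shows "alg_class (twist_knot (k * (k + 1))) = \<one>\<^bsub>AG\<^esub>"
proof (rule slice_class_one[OF seifert_matrix_twist_knot])
  \<comment> \<open>The first column \<open>(k + 1, 1)\<close> is the null vector:
    \<open>- (k + 1)^2 + (k + 1) + k (k + 1) = 0\<close>.\<close>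
  let ?P = "mat2 (int k + 1) 1 1 0"
  let ?M = "trp ?P * twist_knot (k * (k + 1)) * ?P"
  have "?M $$ (0, 0) = 0" unfolding twist_knot_mat2 mat2_transpose mat2_mult by (simp add: algebra_simps)
  then show "algebraically_slice (twist_knot (k * (k + 1)))"
    unfolding algebraically_slice_def using twist_knot_carrier
    by (intro exI[of _ 1] exI[of _ ?P]) (auto simp: mat2_det)
qed

text \<open>With \<open>\<alpha> = a + b J\<close>, \<open>\<gamma> = c + d J\<close> and a bar for
  changing the sign of \<open>J\<close>, the matrix \<open>?P\<close> has rows
  \<open>\<alpha>, \<gamma>\<close> and \<open>- bar \<gamma>, bar \<alpha>\<close>, as in the
  matrix model of a quaternion algebra. It scales the doubled form by the sum of the two norms, here
  -1; the off-diagonal blocks cancel because \<open>\<alpha>\<close> and \<open>\<gamma>\<close>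
  commute.\<close>

lemma block_congruence_order_4:
  assumes e: "a\<^sup>2 - (4 * of_nat n + 1) * b\<^sup>2 + (c\<^sup>2 - (4 * of_nat n + 1) * d\<^sup>2) = (- 1 :: rat)" and n: "n > 0"
  shows "alg_class (twist_knot n \<boxplus> twist_knot n) = alg_class (- (twist_knot n \<boxplus> twist_knot n))"
proof -
  let ?T = "twist_knot n \<boxplus> twist_knot n"
  let ?V = "rm (twist_knot n)"
  let ?P = "four_block_mat (Jmat n a b) (Jmat n c d) (Jmat n (- c) d) (Jmat n a (- b))"
  have s: "seifert_matrix ?T" by (intro seifert_block_sum seifert_matrix_twist_knot)
  have T: "?T \<in> Mat 4 4" using block_sum_carrier[OF twist_knot_carrier[of n] twist_knot_carrier[of n]] by simp
  have J: "Jmat n x y \<in> Mat 2 2" for x y by (simp add: Jmat_def)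
  have V: "?V \<in> Mat 2 2" by (simp add: rm_twist)
  have P: "?P \<in> Mat 4 4" using four_block_carrier_mat[OF J J] by simp
  have rT: "rm ?T = ?V \<boxplus> ?V" by (rule map_block_sum[OF twist_knot_carrier twist_knot_carrier]) simp
  have tP: "trp ?P = four_block_mat (trp (Jmat n a b)) (trp (Jmat n (- c) d))
      (trp (Jmat n c d)) (trp (Jmat n a (- b)))"
    by (rule transpose_four_block_mat[OF J J J J])
  have tJ: "trp (Jmat n x y) \<in> Mat 2 2" for x y using J by simp
  have tJV: "trp (Jmat n x y) * ?V \<in> Mat 2 2" for x y using tJ V by (rule mult_carrier_mat)
  have Z: "0\<^sub>m 2 2 \<in> Mat 2 2" by simp
  have rB: "rm ?T = four_block_mat ?V (0\<^sub>m 2 2) (0\<^sub>m 2 2) ?V"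
    unfolding rT unfolding block_sum_def using V by simp
  have 1: "trp ?P * rm ?T = four_block_mat (trp (Jmat n a b) * ?V) (trp (Jmat n (- c) d) * ?V)
      (trp (Jmat n c d) * ?V) (trp (Jmat n a (- b)) * ?V)"
    unfolding tP rB mult_four_block_mat[OF tJ tJ tJ tJ V Z Z V]
    by (intro cong_four_block_mat) (simp_all add: right_mult_zero_mat[OF tJ] left_add_zero_mat[OF tJV] right_add_zero_mat[OF tJV])
  have "trp ?P * rm ?T * ?P = - rm ?T"
  proof -
    have N: "trp (Jmat n x y) * ?V * Jmat n x y = mat2 (- p) p 0 (of_nat n * p)"
      if "p = x * x - (4 * of_nat n + 1) * y * y" for x y p
      unfolding Jmat_congruence that by (simp add: mult.commute)
    define p where "p = a * a - (4 * of_nat n + 1) * b * b"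
    have q: "- 1 - p = c * c - (4 * of_nat n + 1) * d * d"
      using e by (simp add: p_def power2_eq_square algebra_simps)
    have q': "- 1 - p = (- c) * (- c) - (4 * of_nat n + 1) * d * d"
      and p': "p = a * a - (4 * of_nat n + 1) * (- b) * (- b)" using q by (simp_all add: p_def)
    have B1: "trp (Jmat n a b) * ?V * Jmat n a b + trp (Jmat n (- c) d) * ?V * Jmat n (- c) d = - ?V"
      unfolding N[OF p_def] N[OF q'] unfolding mat2_add rm_twist mat2_uminus by (simp add: algebra_simps)
    have B4: "trp (Jmat n c d) * ?V * Jmat n c d + trp (Jmat n a (- b)) * ?V * Jmat n a (- b) = - ?V"
      unfolding N[OF q] N[OF p'] unfolding mat2_add rm_twist mat2_uminus by (simp add: algebra_simps)
    have B2: "trp (Jmat n a b) * ?V * Jmat n c d + trp (Jmat n (- c) d) * ?V * Jmat n a (- b) = 0\<^sub>m 2 2"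
      unfolding Jmat_congruence mat2_add mat2_zero[symmetric] by (intro arg_cong4[where f=mat2]) (simp_all add: algebra_simps)
    have B3: "trp (Jmat n c d) * ?V * Jmat n a b + trp (Jmat n a (- b)) * ?V * Jmat n (- c) d = 0\<^sub>m 2 2"
      unfolding Jmat_congruence mat2_add mat2_zero[symmetric] by (intro arg_cong4[where f=mat2]) (simp_all add: algebra_simps)
    have 2: "- rm ?T = four_block_mat (- ?V) (0\<^sub>m 2 2) (0\<^sub>m 2 2) (- ?V)"
      unfolding rB using V by (intro eq_matI) auto
    show ?thesis unfolding 1 2 mult_four_block_mat[OF tJV tJV tJV tJV J J J J] B1 B2 B3 B4 ..
  qed
  then have pt: "rm (- ?T) = trp ?P * rm ?T * ?P" by (simp add: rm_uminus)
  \<comment> \<open>Invertibility of \<open>?P\<close> is read off the congruence, whose result is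
    nonsingular because \<open>n > 0\<close>.\<close>
  have "det (rm (- ?T)) \<noteq> 0"
  proof -
    have "det ?V \<noteq> 0" using n by (simp add: rm_twist mat2_det)
    then have "det (rm ?T) \<noteq> 0" unfolding rT by (simp add: det_block_sum[OF V V])
    moreover have "rm ?T \<in> Mat 4 4" using T by simp
    ultimately show ?thesis unfolding rm_uminus using det_uminus_ne_0 by blast
  qed
  moreover have "det (trp ?P * rm ?T * ?P) = det (trp ?P * rm ?T) * det ?P"
    using P T by (intro det_mult[of _ 4]) auto
  ultimately have "det ?P \<noteq> 0" unfolding pt by auto
  then show ?thesis by (rule class_eq_of_congruence[OF s T seifert_uminus[OF s] P _ pt])
qed

definition sum4 :: "rat => bool" where
  "sum4 q \<longleftrightarrow> (\<exists>a b c d. q = a\<^sup>2 + b\<^sup>2 + c\<^sup>2 + d\<^sup>2)"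

text \<open>Euler's four-square identity.\<close>

lemma sum4_mult:
  assumes "sum4 x" "sum4 y"
  shows "sum4 (x * y)"
proof -
  obtain a b c d where x: "x = a\<^sup>2 + b\<^sup>2 + c\<^sup>2 + d\<^sup>2" using assms(1) by (auto simp: sum4_def)
  obtain p q r s where y: "y = p\<^sup>2 + q\<^sup>2 + r\<^sup>2 + s\<^sup>2" using assms(2) by (auto simp: sum4_def)
  have "x * y = (a * p + b * q + c * r + d * s)\<^sup>2 + (a * q - b * p + c * s - d * r)\<^sup>2 + (a * r - b * s - c * p + d * q)\<^sup>2 + (a * s + b * r - c * q - d * p)\<^sup>2"
    unfolding x y by (simp add: power2_eq_square algebra_simps)
  then show ?thesis unfolding sum4_def by blast
qed

lemma sum4_divide:
  assumes "sum4 x" "sum4 y"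
  shows "sum4 (x / y)"
proof -
  have "x / y = x * y * (inverse y)\<^sup>2" by (simp add: power2_eq_square field_simps)
  moreover have "sum4 ((inverse y)\<^sup>2)" unfolding sum4_def by (rule exI[of _ "inverse y"]) (auto intro!: exI[of _ 0])
  ultimately show ?thesis using assms sum4_mult by simp
qed

text \<open>Pigeonhole modulo \<open>p\<close>: the squares of 0, ..., \<open>h\<close> and the
  values -1 minus such squares are \<open>h + 1\<close> residues each, together more than
  \<open>p\<close>. The bound \<open>m < p\<close> holds because \<open>x\<close> and
  \<open>y\<close> may be taken at most \<open>h = (p - 1) / 2\<close>.\<close>

lemma sum_two_squares_mod_prime:
  fixes p :: nat
  assumes p: "prime p" "odd p"
  shows "\<exists>x y m. x\<^sup>2 + y\<^sup>2 + 1 = m * p \<and> 0 < m \<and> m < p"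
proof -
  define h where "h = (p - 1) div 2"
  have ph: "p = 2 * h + 1" using p(2) by (auto simp: h_def elim!: oddE)
  have p2: "p > 2" using p prime_ge_2_nat[of p] by (cases "p = 2") auto
  let ?P = "int p"
  have inj: "x = y" if "0 \<le> x" "x \<le> int h" "0 \<le> y" "y \<le> int h" "x\<^sup>2 mod ?P = y\<^sup>2 mod ?P" for x y :: int
  proof -
    have "?P dvd x\<^sup>2 - y\<^sup>2" using that(5) by (simp add: mod_eq_dvd_iff)
    then have "?P dvd (x - y) * (x + y)" by (simp add: power2_eq_square algebra_simps)
    then have "?P dvd x - y \<or> ?P dvd x + y" using p(1) by (simp add: prime_dvd_mult_iff)
    then show ?thesis
    proof
      assume "?P dvd x - y"
      moreover have "\<bar>x - y\<bar> < ?P" using that ph by auto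
      ultimately have "x - y = 0" using dvd_imp_le_int[of "x - y" ?P] by linarith
      then show ?thesis by simp
    next
      assume "?P dvd x + y"
      moreover have "\<bar>x + y\<bar> < ?P" using that ph by auto
      ultimately have "x + y = 0" using dvd_imp_le_int[of "x + y" ?P] by linarith
      then show ?thesis using that by simp
    qed
  qed
  define A where "A = (\<lambda>x. x\<^sup>2 mod ?P) ` {0..int h}"
  define B where "B = (\<lambda>y. (- 1 - y\<^sup>2) mod ?P) ` {0..int h}"
  have "card A = h + 1" unfolding A_def by (subst card_image) (auto intro!: inj_onI inj)
  moreover have "card B = h + 1" unfolding B_def
  proof (subst card_image)
    show "inj_on (\<lambda>y. (- 1 - y\<^sup>2) mod ?P) {0..int h}"
    proof (rule inj_onI)
      fix x y assume xy: "x \<in> {0..int h}" "y \<in> {0..int h}" "(- 1 - x\<^sup>2) mod ?P = (- 1 - y\<^sup>2) mod ?P"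
      then have "?P dvd (- 1 - x\<^sup>2) - (- 1 - y\<^sup>2)" by (simp add: mod_eq_dvd_iff)
      then have "?P dvd y\<^sup>2 - x\<^sup>2" by (simp add: algebra_simps)
      then have "y\<^sup>2 mod ?P = x\<^sup>2 mod ?P" by (simp add: mod_eq_dvd_iff)
      then show "x = y" using inj[of y x] xy by auto
    qed
  qed simp
  moreover have "A \<subseteq> {0..<?P}" "B \<subseteq> {0..<?P}" unfolding A_def B_def using p2 by auto
  then have "card (A \<union> B) \<le> p" using card_mono[of "{0..<?P}" "A \<union> B"] by simp
  moreover have "finite A" "finite B" by (auto simp: A_def B_def)
  ultimately have "A \<inter> B \<noteq> {}" using card_Un_disjoint[of A B] ph by auto
  then obtain x y where xy: "0 \<le> x" "x \<le> int h" "0 \<le> y" "y \<le> int h" "x\<^sup>2 mod ?P = (- 1 - y\<^sup>2) mod ?P"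
    unfolding A_def B_def by auto
  have "?P dvd x\<^sup>2 - (- 1 - y\<^sup>2)" using xy(5) by (simp add: mod_eq_dvd_iff)
  then have d: "?P dvd x\<^sup>2 + y\<^sup>2 + 1" by (simp add: algebra_simps)
  define a b where "a = nat x" and "b = nat y"
  have ab: "x = int a" "y = int b" "a \<le> h" "b \<le> h" using xy by (auto simp: a_def b_def)
  have "int p dvd int (a\<^sup>2 + b\<^sup>2 + 1)" using d by (simp add: ab add_ac)
  then have "p dvd a\<^sup>2 + b\<^sup>2 + 1" by (simp only: int_dvd_int_iff)
  then obtain m where m: "a\<^sup>2 + b\<^sup>2 + 1 = m * p" by (metis dvd_def mult.commute)
  have "m > 0" using m by (cases m) auto
  moreover have "m < p"
  proof -
    have "a\<^sup>2 \<le> h\<^sup>2" "b\<^sup>2 \<le> h\<^sup>2" using ab by (auto intro: power_mono)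
    then have "a\<^sup>2 + b\<^sup>2 + 1 \<le> h\<^sup>2 + h\<^sup>2 + 1" by linarith
    also have "\<dots> < p * p" using p2 unfolding ph by (simp add: power2_eq_square algebra_simps)
    finally have "m * p < p * p" using m by simp
    then show ?thesis by simp
  qed
  ultimately show ?thesis using m by blast
qed

text \<open>The rational sums of four squares form a group, so it suffices to represent the primes, and
  there one only needs a multiple by a smaller number.\<close>

lemma sum4_of_nat: "n > 0 ==> sum4 (of_nat n)"
proof (induction n rule: less_induct)
  case (less n)
  have "odd n" if "prime n" "n \<noteq> 2" using that prime_odd_nat[of n] prime_ge_2_nat[of n] by linarith
  then consider "n = 1" | "n = 2" | "prime n" "odd n" | "n \<noteq> 1" "\<not> prime n" by blast
  then show ?case
  proof cases
    case 1
    then show ?thesis unfolding sum4_def by (intro exI[of _ 1] exI[of _ 0]) simp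
  next
    case 2
    have "of_nat n = (1::rat)\<^sup>2 + 1\<^sup>2 + 0\<^sup>2 + 0\<^sup>2" using 2 by simp
    then show ?thesis unfolding sum4_def by blast
  next
    case 3
    obtain x y m where m: "x\<^sup>2 + y\<^sup>2 + 1 = m * n" "0 < m" "m < n" using sum_two_squares_mod_prime[OF 3] by blast
    have "of_nat (x\<^sup>2 + y\<^sup>2 + 1) = (of_nat x :: rat)\<^sup>2 + (of_nat y)\<^sup>2 + 1\<^sup>2 + 0\<^sup>2" by simp
    then have "sum4 (of_nat (m * n))" unfolding sum4_def m(1) by blast
    moreover have "sum4 (of_nat m)" using less.IH m by blast
    ultimately have "sum4 (of_nat (m * n) / of_nat m)" by (rule sum4_divide)
    then show ?thesis using m by simp
  next
    case 4
    then obtain a b where ab: "n = a * b" "a \<noteq> 1" "b \<noteq> 1"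
      using less.prems by (auto simp: prime_nat_iff dvd_def)
    then have "a > 0" "b > 0" using less.prems by auto
    then have "a < n" "b < n" using ab by auto
    then have "sum4 (of_nat a * of_nat b)" using less.IH \<open>a > 0\<close> \<open>b > 0\<close> by (intro sum4_mult) auto
    then show ?thesis using ab by simp
  qed
qed

text \<open>Write \<open>D = p^2 + q^2 + r^2 + s^2\<close> and \<open>m = r^2 + s^2\<close>. By the
  two-square identity \<open>(p r - q s)^2 + (p s + q r)^2 = (D - m) m\<close>, so subtracting
  \<open>D (r^2 + s^2)\<close> leaves \<open>- m^2\<close>; dividing by \<open>m^2\<close> gives the
  solution.\<close>

lemma two_norms_sum:
  assumes "D > 0"
  shows "\<exists>a b c d. a\<^sup>2 - of_nat D * b\<^sup>2 + (c\<^sup>2 - of_nat D * d\<^sup>2) = (- 1 :: rat)"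
proof -
  obtain p q r s where D: "of_nat D = p\<^sup>2 + q\<^sup>2 + r\<^sup>2 + (s :: rat)\<^sup>2" using sum4_of_nat[OF assms] by (auto simp: sum4_def)
  \<comment> \<open>The two pairs of squares are interchanged if necessary, so that the denominator
    \<open>r^2 + s^2\<close> is nonzero.\<close>
  have "\<exists>p q r s. of_nat D = p\<^sup>2 + q\<^sup>2 + r\<^sup>2 + (s :: rat)\<^sup>2 \<and> r\<^sup>2 + s\<^sup>2 \<noteq> 0"
  proof (cases "r\<^sup>2 + s\<^sup>2 = 0")
    case True
    then have "p\<^sup>2 + q\<^sup>2 \<noteq> 0" using D assms by auto
    moreover have "of_nat D = r\<^sup>2 + s\<^sup>2 + p\<^sup>2 + q\<^sup>2" using D by simp
    ultimately show ?thesis by blast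
  qed (use D in blast)
  then obtain p q r s where D: "of_nat D = p\<^sup>2 + q\<^sup>2 + r\<^sup>2 + (s :: rat)\<^sup>2" and m0: "r\<^sup>2 + s\<^sup>2 \<noteq> 0" by blast
  define m where "m = r\<^sup>2 + s\<^sup>2"
  have m: "m \<noteq> 0" using m0 by (simp add: m_def)
  have 1: "(p * r - q * s)\<^sup>2 + (p * s + q * r)\<^sup>2 + m\<^sup>2 = of_nat D * (r\<^sup>2 + s\<^sup>2)"
    unfolding D m_def by (simp add: power2_eq_square algebra_simps)
  have gen: "(A / m)\<^sup>2 - of_nat D * (r / m)\<^sup>2 + ((B / m)\<^sup>2 - of_nat D * (s / m)\<^sup>2)
     = (A\<^sup>2 + B\<^sup>2 - of_nat D * (r\<^sup>2 + s\<^sup>2)) / m\<^sup>2" for A B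
    by (simp add: power_divide add_divide_distrib diff_divide_distrib algebra_simps)
  have "((p * r - q * s) / m)\<^sup>2 - of_nat D * (r / m)\<^sup>2 + (((p * s + q * r) / m)\<^sup>2 - of_nat D * (s / m)\<^sup>2)
     = ((p * r - q * s)\<^sup>2 + (p * s + q * r)\<^sup>2 - of_nat D * (r\<^sup>2 + s\<^sup>2)) / m\<^sup>2"
    by (rule gen)
  also have "(p * r - q * s)\<^sup>2 + (p * s + q * r)\<^sup>2 - of_nat D * (r\<^sup>2 + s\<^sup>2) = - (m\<^sup>2)" using 1 by linarith
  also have "- (m\<^sup>2) / m\<^sup>2 = - 1" using m by simp
  finally show ?thesis by blast
qed

lemma twist_order_4:
  assumes n: "n > 0"
  defines "X \<equiv> alg_class (twist_knot n)"
  shows "X \<otimes>\<^bsub>AG\<^esub> X \<otimes>\<^bsub>AG\<^esub> (X \<otimes>\<^bsub>AG\<^esub> X) = \<one>\<^bsub>AG\<^esub>"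
proof -
  have s: "seifert_matrix (twist_knot n \<boxplus> twist_knot n)" by (intro seifert_block_sum seifert_matrix_twist_knot)
  obtain a b c d where "a\<^sup>2 - of_nat (4 * n + 1) * b\<^sup>2 + (c\<^sup>2 - of_nat (4 * n + 1) * d\<^sup>2) = (- 1 :: rat)"
    using two_norms_sum[of "4 * n + 1"] by auto
  then have "a\<^sup>2 - (4 * of_nat n + 1) * b\<^sup>2 + (c\<^sup>2 - (4 * of_nat n + 1) * d\<^sup>2) = (- 1 :: rat)" by (simp add: add.commute)
  from block_congruence_order_4[OF this n] show ?thesis
    using AG_inverse_class[OF s] by (simp add: X_def AG_mult seifert_matrix_twist_knot)
qed

section \<open>Evaluation of rational polynomials, minimal polynomials and reciprocal
  numbers\<close>

lemma rpoly_pCons [simp]: "rpoly (pCons a p) z = of_rat a + z * rpoly p z"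
proof -
  have "map_poly complex_of_rat (pCons a p) = pCons (of_rat a) (map_poly of_rat p)"
    by (rule poly_eqI) (simp add: coeff_map_poly coeff_pCons split: nat.split)
  then show ?thesis by (simp add: rpoly_def)
qed

lemma rpoly_0 [simp]: "rpoly 0 z = 0"
  by (simp add: rpoly_def)

lemma rpoly_1 [simp]: "rpoly 1 z = 1"
  by (simp add: rpoly_def)

lemma rpoly_add [simp]: "rpoly (p + q) z = rpoly p z + rpoly q z"
  by (induction p q rule: poly_induct2) (auto simp: of_rat_add algebra_simps)

lemma rpoly_smult [simp]: "rpoly (Polynomial.smult c p) z = of_rat c * rpoly p z"
  by (induction p) (auto simp: of_rat_mult algebra_simps)

lemma rpoly_uminus [simp]: "rpoly (- p) z = - rpoly p z"
  using rpoly_smult[of "- 1" p z] by (simp add: of_rat_minus)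

lemma rpoly_diff [simp]: "rpoly (p - q) z = rpoly p z - rpoly q z"
  using rpoly_add[of p "- q" z] by simp

lemma rpoly_mult [simp]: "rpoly (p * q) z = rpoly p z * rpoly q z"
  by (induction p) (auto simp: algebra_simps)

lemma rpoly_power [simp]: "rpoly (p ^ k) z = rpoly p z ^ k"
  by (induction k) auto

lemma rpoly_monom [simp]: "rpoly (monom c k) z = of_rat c * z ^ k"
  by (simp add: rpoly_def map_poly_monom poly_monom)

lemma rpoly_sum: "rpoly (sum f I) z = (\<Sum>i\<in>I. rpoly (f i) z)"
  by (induction I rule: infinite_finite_induct) auto

lemma rpoly_dvd: "p dvd q ==> rpoly p z = 0 ==> rpoly q z = 0"
  by (auto simp: dvd_def)

lemma rpoly_roots_finite: "p \<noteq> 0 ==> finite {z. rpoly p z = 0}"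
  unfolding rpoly_def by (intro poly_roots_finite) (simp add: map_poly_eq_0_iff)

text \<open>The polynomial \<open>f\<close> witnesses that \<open>z\<close> is algebraic. A
  polynomial of least degree vanishing at \<open>z\<close> divides all others, by division with
  remainder.\<close>

lemma min_poly_exists:
  assumes f: "f \<noteq> 0" "rpoly f z = 0"
  shows "\<exists>m. irreducible m \<and> lead_coeff m = 1 \<and> rpoly m z = 0 \<and> (\<forall>g. rpoly g z = 0 --> m dvd g)"
proof -
  define Q where "Q g \<longleftrightarrow> g \<noteq> 0 \<and> rpoly g z = 0" for g
  obtain g where g: "Q g" and gmin: "\<And>h. Q h ==> degree g \<le> degree h"
    using ex_has_least_nat[of Q f degree] f by (auto simp: Q_def)
  have g0: "g \<noteq> 0" "rpoly g z = 0" using g by (auto simp: Q_def)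
  define m where "m = Polynomial.smult (inverse (lead_coeff g)) g"
  have m: "lead_coeff m = 1" "degree m = degree g" "rpoly m z = 0" "m \<noteq> 0"
    using g0 by (auto simp: m_def)
  have mmin: "degree m \<le> degree h" if "h \<noteq> 0" "rpoly h z = 0" for h using gmin[of h] that m by (simp add: Q_def)
  have dvd: "m dvd h" if "rpoly h z = 0" for h
  proof (rule ccontr)
    assume "\<not> m dvd h"
    then have r: "h mod m \<noteq> 0" by (simp add: mod_eq_0_iff_dvd)
    have "h mod m = h - h div m * m" by (simp add: minus_div_mult_eq_mod)
    then have "rpoly (h mod m) z = 0" using that m by simp
    then have "degree m \<le> degree (h mod m)" using mmin r by simp
    moreover have "degree (h mod m) < degree m \<or> h mod m = 0" using degree_mod_less[OF m(4), of h] by blast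
    ultimately show False using r by simp
  qed
  have "irreducible m"
  proof (rule irreducibleI)
    show "m \<noteq> 0" by (rule m(4))
    show "\<not> m dvd 1"
    proof
      assume "m dvd 1"
      then have "rpoly 1 z = 0" using rpoly_dvd m(3) by blast
      then show False by simp
    qed
    fix a b assume ab: "m = a * b"
    have nz: "a \<noteq> 0" "b \<noteq> 0" using ab m(4) by auto
    have "rpoly a z = 0 \<or> rpoly b z = 0" using m(3) ab by simp
    then show "a dvd 1 \<or> b dvd 1"
    proof
      assume "rpoly a z = 0"
      then have "degree m \<le> degree a" using mmin nz by simp
      then have "degree b = 0" using ab nz by (simp add: degree_mult_eq)
      then show ?thesis using nz is_unit_iff_degree by blast
    next
      assume "rpoly b z = 0"
      then have "degree m \<le> degree b" using mmin nz by simp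
      then have "degree a = 0" using ab nz by (simp add: degree_mult_eq)
      then show ?thesis using nz is_unit_iff_degree by blast
    qed
  qed
  then show ?thesis using m dvd by blast
qed

lemma min_poly_props:
  assumes f: "f \<noteq> 0" "rpoly f z = 0"
  shows "irreducible (min_poly z)" "lead_coeff (min_poly z) = 1" "rpoly g z = 0 \<longleftrightarrow> min_poly z dvd g"
proof -
  obtain m where m: "irreducible m" "lead_coeff m = 1" "rpoly m z = 0" "\<And>g. rpoly g z = 0 ==> m dvd g"
    using min_poly_exists[OF f] by blast
  have "min_poly z = m"
    unfolding min_poly_def
  proof (rule the_equality)
    fix p assume p: "irreducible p \<and> lead_coeff p = 1 \<and> rpoly p z = 0"
    then obtain c where c: "p = m * c" using m(4) by blast
    have "\<not> m dvd 1" using m(1) by (rule irreducible_not_unit)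
    then have "c dvd 1" using irreducibleD[of p m c] p c by blast
    then have "degree c = 0" by (simp add: poly_dvd_1)
    then obtain k where "c = [:k:]" by (auto elim: degree_eq_zeroE)
    then have "p = Polynomial.smult k m" using c by simp
    moreover from this have "k = 1" using p m(2) by (cases "k = 0") auto
    ultimately show "p = m" by simp
  qed (use m in blast)
  then show "irreducible (min_poly z)" "lead_coeff (min_poly z) = 1" "rpoly g z = 0 \<longleftrightarrow> min_poly z dvd g"
    using m rpoly_dvd by auto
qed

text \<open>The irreducible polynomial in the definition is a unit multiple of
  \<open>min_poly z\<close>, so \<open>z\<close> and its inverse share this minimal polynomial. The
  last fact is what makes the involution of Q(z) well defined.\<close>

lemma reciprocalD:
  assumes "reciprocal z"
  shows "z \<noteq> 0" "irreducible (min_poly z)" "lead_coeff (min_poly z) = 1"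
    "rpoly g z = 0 \<longleftrightarrow> min_poly z dvd g" "rpoly (min_poly z) z = 0" "rpoly (min_poly z) (inverse z) = 0"
    "rpoly g (inverse z) = 0 \<longleftrightarrow> min_poly z dvd g"
proof -
  obtain p where p: "irreducible p" "rpoly p z = 0" "rpoly p (inverse z) = 0" and z0: "z \<noteq> 0"
    using assms by (auto simp: reciprocal_def)
  have p0: "p \<noteq> 0" using p(1) by auto
  note M = min_poly_props[OF p0 p(2)]
  show "z \<noteq> 0" "irreducible (min_poly z)" "lead_coeff (min_poly z) = 1" "rpoly g z = 0 \<longleftrightarrow> min_poly z dvd g" for g
    using M z0 by auto
  show z1: "rpoly (min_poly z) z = 0" using M(3)[of "min_poly z"] by simp
  have "min_poly z dvd p" using M(3) p(2) by blast
  then obtain c where c: "p = min_poly z * c" by (auto simp: dvd_def)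
  have "\<not> min_poly z dvd 1" using M(1) by (rule irreducible_not_unit)
  then have "c dvd 1" using irreducibleD[OF p(1) c] by blast
  then obtain k where k: "1 = c * k" by (auto simp: dvd_def)
  then have "rpoly c (inverse z) * rpoly k (inverse z) = 1" by (metis rpoly_1 rpoly_mult)
  then have "rpoly c (inverse z) \<noteq> 0" by auto
  then show z2: "rpoly (min_poly z) (inverse z) = 0" using c p(3) by auto
  obtain m where m: "irreducible m" "rpoly m (inverse z) = 0" "\<And>g. rpoly g (inverse z) = 0 ==> m dvd g"
    using min_poly_exists[OF p0 p(3)] by blast
  then obtain c' where c': "min_poly z = m * c'" using z2 by blast
  have "\<not> m dvd 1" using m(1) by (rule irreducible_not_unit)
  then have "c' dvd 1" using irreducibleD[OF M(1) c'] by blast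
  then have "min_poly z dvd m" using c' by (simp add: dvd_mult_unit_iff)
  then show "rpoly g (inverse z) = 0 \<longleftrightarrow> min_poly z dvd g"
    using m(3) z2 rpoly_dvd dvd_trans by blast
qed

lemma Qadj_I: "rpoly p z \<in> Qadj z"
  by (simp add: Qadj_def)

lemma Qadj_subring: "subring_set (Qadj z)"
  unfolding subring_set_def
proof (intro conjI ballI)
  show "0 \<in> Qadj z" "1 \<in> Qadj z" using Qadj_I[of 0 z] Qadj_I[of 1 z] by auto
  fix a b assume ab: "a \<in> Qadj z" "b \<in> Qadj z"
  then obtain p q where pq: "a = rpoly p z" "b = rpoly q z" by (auto simp: Qadj_def)
  show "a + b \<in> Qadj z" "a * b \<in> Qadj z" using Qadj_I[of "p + q" z] Qadj_I[of "p * q" z] pq by auto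
next
  fix a assume "a \<in> Qadj z"
  then obtain p where "a = rpoly p z" by (auto simp: Qadj_def)
  then show "- a \<in> Qadj z" using Qadj_I[of "- p" z] by auto
qed

lemma Qadj_gen: "z \<in> Qadj z"
  using Qadj_I[of "[:0, 1:]" z] by simp

lemma Qadj_of_rat: "of_rat c \<in> Qadj z"
  using Qadj_I[of "[:c:]" z] by simp

text \<open>Bezout with the minimal polynomial, which is coprime to any polynomial not vanishing at
  \<open>z\<close>.\<close>

lemma Qadj_inverse:
  assumes f: "f \<noteq> 0" "rpoly f z = 0" and x: "x \<in> Qadj z"
  shows "inverse x \<in> Qadj z"
proof (cases "x = 0")
  case True
  then show ?thesis using Qadj_of_rat[of 0 z] by simp
next
  case False
  obtain p where p: "x = rpoly p z" using x by (auto simp: Qadj_def)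
  note M = min_poly_props[OF f]
  have "\<not> min_poly z dvd p" using M(3)[of p] False p by simp
  then have "coprime (min_poly z) p" using M(1) by (intro prime_elem_imp_coprime) (simp_all add: irreducible_imp_prime_elem)
  then obtain u v where "u * min_poly z + v * p = 1"
    using bezout_coefficients_fst_snd[of "min_poly z" p] by (simp add: coprime_iff_gcd_eq_1)
  then have "rpoly (u * min_poly z + v * p) z = 1" by simp
  moreover have "rpoly (min_poly z) z = 0" using M(3)[of "min_poly z"] by simp
  ultimately have "rpoly v z * x = 1" using p by simp
  then have "inverse x = rpoly v z" using False by (simp add: field_simps)
  then show ?thesis using Qadj_I by simp
qed

section \<open>Linear independence of real radicals\<close>

lemma subring_mult: "subring_set F ==> a \<in> F ==> b \<in> F ==> a * b \<in> F"
  by (simp add: subring_set_def)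

lemma subring_power: "subring_set F ==> a \<in> F ==> a ^ k \<in> F"
  by (induction k) (auto simp: subring_set_def)

text \<open>Long division by a monic polynomial never leaves the coefficient ring
  \<open>F\<close>.\<close>

lemma monic_division_over:
  fixes g :: "'a::field poly"
  assumes F: "subring_set F" and g: "\<And>i. coeff g i \<in> F" "lead_coeff g = 1"
  shows "(\<And>i. coeff f i \<in> F) ==> \<exists>q r. f = g * q + r \<and> (\<forall>i. coeff r i \<in> F) \<and> (r = 0 \<or> degree r < degree g)"
proof (induction "degree f" arbitrary: f rule: less_induct)
  case less
  show ?case
  proof (cases "f = 0 \<or> degree f < degree g")
    case True
    then show ?thesis using less.prems by (intro exI[of _ 0] exI[of _ f]) auto
  next
    case False
    define h where "h = monom (lead_coeff f) (degree f - degree g)"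
    define f' where "f' = f - g * h"
    have g0: "g \<noteq> 0" using g(2) by auto
    have lc: "lead_coeff f \<noteq> 0" using False by auto
    have dh: "degree h = degree f - degree g" unfolding h_def by (rule degree_monom_eq[OF lc])
    have h0: "h \<noteq> 0" using lc by (simp add: h_def)
    have dgh: "degree (g * h) = degree f" using dh h0 g0 False by (simp add: degree_mult_eq)
    have "coeff (g * h) (degree f) = lead_coeff (g * h)" using dgh by simp
    also have "\<dots> = lead_coeff f" unfolding lead_coeff_mult g(2) dh by (simp add: h_def)
    finally have "coeff f' (degree f) = 0" by (simp add: f'_def)
    moreover have "degree f' \<le> degree f" unfolding f'_def using dgh by (intro degree_diff_le) auto
    ultimately have deg: "f' = 0 \<or> degree f' < degree f"
      using leading_coeff_0_iff[of f'] by (metis le_neq_implies_less)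
    have cf: "coeff f' i \<in> F" for i
    proof -
      have "coeff (g * h) i \<in> F"
        using F g(1) less.prems unfolding h_def by (subst mult.commute) (auto simp: coeff_monom_mult subring_set_def)
      then have "- coeff (g * h) i \<in> F" using F by (simp add: subring_set_def)
      then have "coeff f i + - coeff (g * h) i \<in> F" using F less.prems unfolding subring_set_def by blast
      then show ?thesis by (simp add: f'_def)
    qed
    show ?thesis
    proof (cases "f' = 0")
      case True
      then show ?thesis using F by (intro exI[of _ h] exI[of _ 0]) (auto simp: f'_def subring_set_def)
    next
      case f': False
      then obtain q r where qr: "f' = g * q + r" "\<forall>i. coeff r i \<in> F" "r = 0 \<or> degree r < degree g"
        using less.hyps[of f'] deg cf by blast
      have "f = g * (q + h) + r" using qr(1) by (simp add: f'_def algebra_simps)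
      then show ?thesis using qr by blast
    qed
  qed
qed

text \<open>The constant term of a monic polynomial is, up to sign, the product of its
  roots.\<close>

lemma norm_constant_coeff:
  fixes g :: "complex poly"
  assumes "lead_coeff g = 1" "\<And>\<zeta>. poly g \<zeta> = 0 ==> cmod \<zeta> = x"
  shows "cmod (coeff g 0) = x ^ degree g"
  using assms
proof (induction "degree g" arbitrary: g)
  case 0
  then have "degree g = 0" by simp
  then show ?case using 0(2) by simp
next
  case (Suc m)
  have "\<not> constant (poly g)" using Suc(2) by (simp add: constant_degree)
  then obtain \<zeta> where \<zeta>: "poly g \<zeta> = 0" using fundamental_theorem_of_algebra by blast
  then obtain h where h: "g = [:- \<zeta>, 1:] * h" by (auto simp: poly_eq_0_iff_dvd dvd_def)
  have h0: "h \<noteq> 0" using h Suc(2) by auto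
  have "degree g = Suc (degree h)" using h h0 by (subst h, subst degree_mult_eq) auto
  then have dh: "degree h = m" using Suc(2) by simp
  have "lead_coeff h = 1" using Suc(3) unfolding h lead_coeff_mult by simp
  moreover have "cmod \<xi> = x" if "poly h \<xi> = 0" for \<xi> using Suc(4)[of \<xi>] that by (simp add: h)
  ultimately have "cmod (coeff h 0) = x ^ m" using Suc(1)[of h] dh by blast
  moreover have "coeff g 0 = - \<zeta> * coeff h 0" unfolding h by (simp add: coeff_mult)
  ultimately show ?case using Suc(4)[OF \<zeta>] Suc(2) by (simp add: norm_mult flip: Suc(2))
qed

text \<open>Real radicals are linearly independent as soon as no smaller power lies in the field: the
  conjugates of \<open>x\<close> all have absolute value \<open>x\<close>, so the constant term of a minimal relation is
  a power of \<open>x\<close> up to sign.\<close>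

lemma radical_independent:
  fixes F :: "complex set" and x :: real
  assumes F: "subring_set F" "\<And>a. a \<in> F ==> inverse a \<in> F" "F \<subseteq> \<real>" and x: "x > 0"
    and k: "of_real x ^ k \<in> F" "\<And>m. 0 < m ==> m < k ==> of_real x ^ m \<notin> F"
    and f: "\<And>i. coeff f i \<in> F" "degree f < k" "poly f (of_real x) = 0"
  shows "f = 0"
proof (rule ccontr)
  assume f0: "f \<noteq> 0"
  let ?w = "of_real x :: complex"
  define Q where "Q g \<longleftrightarrow> g \<noteq> 0 \<and> (\<forall>i. coeff g i \<in> F) \<and> poly g ?w = 0" for g
  have "Q f" using f f0 by (simp add: Q_def)
  then obtain g0 where g0: "Q g0" and min: "\<And>h. Q h ==> degree g0 \<le> degree h"
    using ex_has_least_nat[of Q f degree] by blast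
  define g where "g = Polynomial.smult (inverse (lead_coeff g0)) g0"
  have g: "lead_coeff g = 1" "degree g = degree g0" "poly g ?w = 0" "g \<noteq> 0"
    using g0 by (auto simp: g_def Q_def)
  have gF: "coeff g i \<in> F" for i
    using g0 F(1,2) unfolding g_def Q_def subring_set_def by simp
  have dk: "degree g < k" using min[OF \<open>Q f\<close>] g f by simp
  \<comment> \<open>The minimal relation \<open>g\<close> divides this polynomial, so all roots of
    \<open>g\<close> have absolute value \<open>x\<close>.\<close>
  define h where "h = monom 1 k - [:?w ^ k:]"
  have hF: "coeff h i \<in> F" for i
  proof -
    have "coeff h i = (if k = i then 1 else 0) + - (if i = 0 then ?w ^ k else 0)"
      by (auto simp: h_def coeff_pCons split: nat.splits)
    moreover have "- (if i = 0 then ?w ^ k else 0) \<in> F" "(if k = i then 1 else 0) \<in> F"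
      using F(1) k(1) by (auto simp: subring_set_def)
    ultimately show ?thesis using F(1) by (simp only: subring_set_def)
  qed
  obtain q r where qr: "h = g * q + r" "\<forall>i. coeff r i \<in> F" "r = 0 \<or> degree r < degree g"
    using monic_division_over[OF F(1) gF g(1), of h] hF by blast
  have "poly h ?w = 0" by (simp add: h_def poly_monom)
  then have "poly r ?w = 0" using qr(1) g(3) by simp
  then have "r = 0" using qr min[of r] g by (auto simp: Q_def)
  then have hg: "h = g * q" using qr by simp
  have "cmod \<zeta> = x" if "poly g \<zeta> = 0" for \<zeta>
  proof -
    have "poly h \<zeta> = 0" using that hg by simp
    then have "\<zeta> ^ k = ?w ^ k" by (simp add: h_def poly_monom)
    then have "cmod (\<zeta> ^ k) = cmod (?w ^ k)" by simp
    then have "cmod \<zeta> ^ k = x ^ k" using x by (simp add: norm_power)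
    then show ?thesis using x dk by (intro power_eq_imp_eq_base[of "cmod \<zeta>" k x]) auto
  qed
  then have n: "cmod (coeff g 0) = x ^ degree g" using norm_constant_coeff[OF g(1)] by blast
  \<comment> \<open>Reality of \<open>F\<close> leaves only a sign undetermined: the constant term
    is a power of \<open>x\<close> or its negative, and so a power of \<open>x\<close> with exponent
    below \<open>k\<close> lies in \<open>F\<close>.\<close>
  have "coeff g 0 \<in> \<real>" using gF F(3) by blast
  then obtain c where c: "coeff g 0 = of_real c" by (auto elim: Reals_cases)
  then have "\<bar>c\<bar> = x ^ degree g" using n by simp
  then have "coeff g 0 = ?w ^ degree g \<or> coeff g 0 = - (?w ^ degree g)"
    using c by (auto simp: abs_if split: if_splits simp flip: of_real_power)
  moreover have "- coeff g 0 \<in> F" "coeff g 0 \<in> F" using gF[of 0] F(1) by (auto simp: subring_set_def)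
  ultimately have "?w ^ degree g \<in> F" by auto
  moreover have "degree g > 0"
  proof (rule ccontr)
    assume "\<not> degree g > 0"
    then have d0: "degree g = 0" by simp
    then obtain a where a: "g = [:a:]" by (rule degree_eq_zeroE)
    then show False using g(1,3) by simp
  qed
  ultimately show False using k(2) dk by blast
qed

section \<open>The Alexander polynomials of twist knots and their roots\<close>

definition delta :: "nat => rat poly" where
  "delta n = [:of_nat n, - (2 * of_nat n + 1), of_nat n:]"

text \<open>In this shape a root satisfies \<open>n (z - 1)^2 = z\<close>, which determines
  \<open>n\<close> from \<open>z\<close> and becomes an equation between squares when
  \<open>n\<close> and \<open>z\<close> are squares.\<close>

lemma rpoly_delta: "rpoly (delta n) z = of_nat n * (z - 1)\<^sup>2 - z"
  by (simp add: delta_def power2_eq_square algebra_simps of_rat_minus of_rat_diff of_rat_add of_rat_mult)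

lemma delta_nonzero: "n > 0 ==> delta n \<noteq> 0" "n > 0 ==> degree (delta n) = 2" "n > 0 ==> lead_coeff (delta n) = of_nat n"
  by (auto simp: delta_def)

lemma delta_root_nonzero:
  assumes "rpoly (delta n) z = 0" "n > 0"
  shows "z \<noteq> 0" "rpoly (delta n) (inverse z) = 0" "z + inverse z = 2 + 1 / of_nat n"
proof -
  show z: "z \<noteq> 0" using assms by (auto simp: rpoly_delta)
  have *: "of_nat n * (z - 1)\<^sup>2 = z" using assms by (simp add: rpoly_delta)
  have "inverse z - 1 = - (z - 1) / z" using z by (simp add: field_simps)
  then have "of_nat n * (inverse z - 1)\<^sup>2 = of_nat n * (z - 1)\<^sup>2 / z\<^sup>2"
    by (simp add: power_divide power2_commute)
  also have "\<dots> = inverse z" unfolding * using z by (simp add: power2_eq_square inverse_eq_divide)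
  finally show "rpoly (delta n) (inverse z) = 0" by (simp add: rpoly_delta)
  have gen': "t + 2 * a * t = (2 * a + 1) * t" for a t :: complex by (simp add: algebra_simps)
  have gen: "a * (s + 2 * t) = a * s + 2 * a * t" for a s t :: complex by (simp add: algebra_simps)
  have "(z + inverse z) * z = (z - 1)\<^sup>2 + 2 * z" using z by (simp add: algebra_simps power2_eq_square)
  then have "of_nat n * (z + inverse z) * z = of_nat n * ((z - 1)\<^sup>2 + 2 * z)" by (simp add: mult.assoc)
  also have "\<dots> = of_nat n * (z - 1)\<^sup>2 + 2 * of_nat n * z" by (rule gen)
  also have "\<dots> = z + 2 * of_nat n * z" by (simp only: *)
  also have "\<dots> = (2 * of_nat n + 1) * z" by (rule gen')
  finally have "of_nat n * (z + inverse z) = 2 * of_nat n + 1" by (simp only: mult_right_cancel[OF z])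
  moreover have "c = 2 + 1 / a" if "a * c = 2 * a + 1" "a \<noteq> 0" for a c :: complex
  proof -
    have "c = (a * c) / a" using that(2) by simp
    also have "\<dots> = 2 + 1 / a" unfolding that(1) using that(2) by (simp add: add_divide_distrib)
    finally show ?thesis .
  qed
  ultimately show "z + inverse z = 2 + 1 / of_nat n" using assms(2) by simp
qed

text \<open>A root recovers the knot: \<open>n\<close> is \<open>z\<close> divided by the square of
  \<open>z - 1\<close>.\<close>

lemma delta_root_unique: "rpoly (delta n) z = 0 ==> rpoly (delta m) z = 0 ==> n > 0 ==> m > 0 ==> n = m"
proof -
  assume a: "rpoly (delta n) z = 0" "rpoly (delta m) z = 0" "n > 0" "m > 0"
  have "of_nat n * (z - 1)\<^sup>2 = z" "of_nat m * (z - 1)\<^sup>2 = z" using a by (simp_all add: rpoly_delta)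
  moreover have "z \<noteq> 0" using delta_root_nonzero a by blast
  moreover from calculation have "(z - 1)\<^sup>2 \<noteq> 0" by auto
  ultimately have "of_nat n = (of_nat m :: complex)" using mult_right_cancel[of "(z - 1)\<^sup>2" "of_nat n" "of_nat m"] by simp
  then show ?thesis by simp
qed

lemma rational_square_nat:
  fixes q :: rat
  assumes "q\<^sup>2 = of_nat m"
  shows "\<exists>k. m = k\<^sup>2"
proof -
  obtain r s where rs: "quotient_of q = (r, s)" by (cases "quotient_of q") auto
  have s: "s > 0" and co: "coprime r s" and q: "q = of_int r / of_int s"
    using quotient_of_denom_pos[OF rs] quotient_of_coprime[OF rs] quotient_of_div[OF rs] by auto
  have "of_int (r\<^sup>2) = (of_int (int m * s\<^sup>2) :: rat)"
    using assms s unfolding q by (simp add: power_divide field_simps)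
  then have e: "r\<^sup>2 = int m * s\<^sup>2" by (simp only: of_int_eq_iff)
  then have "s\<^sup>2 dvd r\<^sup>2" by simp
  moreover have "coprime (r\<^sup>2) (s\<^sup>2)" using co by simp
  ultimately have "s\<^sup>2 dvd 1" using coprime_common_divisor[of "r\<^sup>2" "s\<^sup>2" "s\<^sup>2"] by simp
  then have "s\<^sup>2 = 1" using s by (simp add: zdvd1_eq)
  then have "int m = r\<^sup>2" using e by simp
  then have "int m = int ((nat \<bar>r\<bar>)\<^sup>2)" by simp
  then have "m = (nat \<bar>r\<bar>)\<^sup>2" by (simp only: of_nat_eq_iff)
  then show ?thesis by blast
qed

context
  fixes n :: nat and z :: complex
  assumes n: "n > 0" and nsq: "\<nexists>k. 4 * n + 1 = k\<^sup>2" and z: "rpoly (delta n) z = 0"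
begin

text \<open>The discriminant of the quadratic is \<open>4 n + 1\<close>; a rational root would
  exhibit a rational square root of it.\<close>

lemma delta_root_irrational: "z \<noteq> of_rat q"
proof
  assume zq: "z = of_rat q"
  have "of_rat (of_nat n * (q - 1)\<^sup>2 - q) = (0 :: complex)" using z zq by (simp add: rpoly_delta of_rat_diff of_rat_mult of_rat_power)
  then have e: "of_nat n * (q - 1)\<^sup>2 = q" by simp
  have "(2 * of_nat n * q - (2 * of_nat n + 1))\<^sup>2 = 4 * of_nat n * (of_nat n * (q - 1)\<^sup>2 - q) + (4 * of_nat n + 1)"
    by (simp add: power2_eq_square algebra_simps)
  also have "\<dots> = of_nat (4 * n + 1)" using e by simp
  finally show False using rational_square_nat nsq by blast
qed

lemma delta_rep: "\<exists>a b q. p = delta n * q + [:a, b:]"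
proof -
  have d: "delta n \<noteq> 0" "degree (delta n) = 2" using delta_nonzero n by auto
  have "degree (p mod delta n) < 2 \<or> p mod delta n = 0" using degree_mod_less[OF d(1), of p] d by auto
  then have deg: "degree (p mod delta n) < 2" by auto
  have "p mod delta n = [:coeff (p mod delta n) 0, coeff (p mod delta n) 1:]"
    using deg by (intro poly_eqI) (auto simp: coeff_pCons coeff_eq_0 split: nat.splits)
  then have "p = delta n * (p div delta n) + [:coeff (p mod delta n) 0, coeff (p mod delta n) 1:]"
    by (metis mult_div_mod_eq)
  then show ?thesis by blast
qed

lemma delta_root_indep:
  assumes "of_rat a + of_rat b * z = 0"
  shows "a = 0" "b = 0"
proof -
  show b: "b = 0"
  proof (rule ccontr)
    assume "b \<noteq> 0"
    then have "z = of_rat (- a / b)" using assms by (simp add: of_rat_divide of_rat_minus field_simps eq_neg_iff_add_eq_0)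
    then show False using delta_root_irrational by blast
  qed
  show "a = 0" using assms b by simp
qed

text \<open>As \<open>z\<close> is irrational, 1 and \<open>z\<close> are independent over the
  rationals and the quadratic generates all relations of \<open>z\<close>. Its other root is the
  inverse of \<open>z\<close>.\<close>

lemma delta_root_conj: "rpoly p z = 0 ==> delta n dvd p" "rpoly p z = 0 ==> rpoly p (inverse z) = 0"
proof -
  assume p: "rpoly p z = 0"
  obtain a b q where e: "p = delta n * q + [:a, b:]" using delta_rep by blast
  have "of_rat a + of_rat b * z = 0" using p e z by (simp add: mult.commute)
  then show "delta n dvd p" using delta_root_indep[of a b] e by auto
  then show "rpoly p (inverse z) = 0" using rpoly_dvd delta_root_nonzero(2)[OF z n] by blast
qed

text \<open>Let \<open>\<alpha>\<close> and its conjugate \<open>\<beta>\<close> have norm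
  \<open>N\<close> and trace \<open>T\<close>. The norm is 1 or -1, because its \<open>e\<close>-th
  power is the norm of \<open>z\<close>. If \<open>T = r / s\<close> in lowest terms, then the trace
  of \<open>\<alpha> ^ e\<close> has exact denominator \<open>s ^ e\<close>. That trace is
  \<open>z + inverse z = (2 n + 1) / n\<close>, also in lowest terms, so
  \<open>n = s ^ e\<close>.\<close>

lemma delta_perfect_power:
  assumes \<alpha>: "\<alpha> \<in> Qadj z" and e: "e > 1" "\<alpha> ^ e = z"
  shows "perfect_power n"
proof -
  obtain p where p: "\<alpha> = rpoly p z" using \<alpha> by (auto simp: Qadj_def)
  obtain a b q where pab: "p = delta n * q + [:a, b:]" using delta_rep by blast
  define \<beta> where "\<beta> = rpoly p (inverse z)"
  have z0: "z \<noteq> 0" and tr: "z + inverse z = 2 + 1 / of_nat n" and zi: "rpoly (delta n) (inverse z) = 0"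
    using delta_root_nonzero[OF z n] by auto
  have "rpoly (p ^ e - [:0, 1:]) z = 0" using e p by simp
  then have "rpoly (p ^ e - [:0, 1:]) (inverse z) = 0" by (rule delta_root_conj)
  then have be: "\<beta> ^ e = inverse z" by (simp add: \<beta>_def)
  have ab: "\<alpha> = of_rat a + of_rat b * z" "\<beta> = of_rat a + of_rat b * inverse z"
    using p pab z zi by (simp_all add: \<beta>_def mult.commute)
  define t where "t = (2 + 1 / of_nat n :: rat)"
  have tr': "z + inverse z = of_rat t" unfolding tr t_def by (simp add: of_rat_add of_rat_divide)
  define N where "N = a\<^sup>2 + a * b * t + b\<^sup>2"
  define T where "T = 2 * a + b * t"
  have "\<alpha> * \<beta> = of_rat a ^ 2 + of_rat a * of_rat b * (z + inverse z) + of_rat b ^ 2 * (z * inverse z)"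
    unfolding ab by (simp add: power2_eq_square algebra_simps)
  then have N: "\<alpha> * \<beta> = of_rat N" using z0 unfolding tr' N_def by (simp add: of_rat_add of_rat_mult of_rat_power)
  have "\<alpha> + \<beta> = 2 * of_rat a + of_rat b * (z + inverse z)" unfolding ab by (simp add: algebra_simps)
  then have T: "\<alpha> + \<beta> = of_rat T" unfolding tr' T_def by (simp add: of_rat_add of_rat_mult)
  \<comment> \<open>\<open>\<alpha> ^ e\<close> and \<open>\<beta> ^ e\<close> are \<open>z\<close>
    and its inverse.\<close>
  have "of_rat (N ^ e) = (1 :: complex)" using e be z0 N by (simp add: of_rat_power flip: N power_mult_distrib) (simp add: power_mult_distrib)
  then have "N ^ e = 1" by simp
  then have "\<bar>N\<bar> ^ e = 1 ^ e" by (simp flip: power_abs)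
  then have "\<bar>N\<bar> = 1" using e(1) by (subst (asm) power_eq_iff_eq_base) auto
  then have "N = 1 \<or> N = - 1" by (auto simp: abs_if split: if_splits)
  then have "N = of_int 1 \<or> N = of_int (- 1)" by simp
  then obtain M :: int where M: "N = of_int M" by blast
  obtain r s where rs: "quotient_of T = (r, s)" by (cases "quotient_of T") auto
  have s: "s > 0" and co: "coprime r s" and Tq: "T = of_int r / of_int s"
    using quotient_of_denom_pos[OF rs] quotient_of_coprime[OF rs] quotient_of_div[OF rs] by auto
  have sT: "of_int s * (\<alpha> + \<beta>) = of_int r" unfolding T Tq using s by (simp add: of_rat_divide)
  have N': "\<alpha> * \<beta> = of_int M" using N M by simp
  \<comment> \<open>Recurrence for power sums, cleared of denominators: modulo \<open>s\<close> only
    the leading power \<open>r ^ i\<close> remains, since the norm term carries the factor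
    \<open>s\<^sup>2\<close>. Two consecutive exponents are carried along because the recurrence has
    order two.\<close>
  have step: "\<exists>c d. of_int s ^ Suc i * (\<alpha> ^ Suc i + \<beta> ^ Suc i) = of_int c \<and> s dvd c - r ^ Suc i \<and>
      of_int s ^ Suc (Suc i) * (\<alpha> ^ Suc (Suc i) + \<beta> ^ Suc (Suc i)) = of_int d \<and> s dvd d - r ^ Suc (Suc i)" for i
  proof (induction i)
    case 0
    have "of_int s ^ 2 * (\<alpha> ^ 2 + \<beta> ^ 2) = (of_int s * (\<alpha> + \<beta>))\<^sup>2 - 2 * of_int s ^ 2 * (\<alpha> * \<beta>)"
      by (simp add: power2_eq_square algebra_simps)
    also have "\<dots> = of_int (r\<^sup>2 - 2 * s\<^sup>2 * M)" unfolding sT N' by simp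
    finally have "of_int s ^ 2 * (\<alpha> ^ 2 + \<beta> ^ 2) = of_int (r\<^sup>2 - 2 * s\<^sup>2 * M)" .
    then show ?case using sT by (intro exI[of _ r] exI[of _ "r\<^sup>2 - 2 * s\<^sup>2 * M"]) (simp add: numeral_2_eq_2)
  next
    case (Suc i)
    then obtain c d where cd: "of_int s ^ Suc i * (\<alpha> ^ Suc i + \<beta> ^ Suc i) = of_int c" "s dvd c - r ^ Suc i"
      "of_int s ^ Suc (Suc i) * (\<alpha> ^ Suc (Suc i) + \<beta> ^ Suc (Suc i)) = of_int d" "s dvd d - r ^ Suc (Suc i)" by blast
    have "of_int s ^ Suc (Suc (Suc i)) * (\<alpha> ^ Suc (Suc (Suc i)) + \<beta> ^ Suc (Suc (Suc i)))
      = (of_int s * (\<alpha> + \<beta>)) * (of_int s ^ Suc (Suc i) * (\<alpha> ^ Suc (Suc i) + \<beta> ^ Suc (Suc i)))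
        - of_int s ^ 2 * (\<alpha> * \<beta>) * (of_int s ^ Suc i * (\<alpha> ^ Suc i + \<beta> ^ Suc i))"
      by (simp add: power2_eq_square algebra_simps)
    also have "\<dots> = of_int (r * d - s\<^sup>2 * M * c)" unfolding cd sT N' by simp
    finally have 1: "of_int s ^ Suc (Suc (Suc i)) * (\<alpha> ^ Suc (Suc (Suc i)) + \<beta> ^ Suc (Suc (Suc i))) = of_int (r * d - s\<^sup>2 * M * c)" .
    have "(r * d - s\<^sup>2 * M * c) - r ^ Suc (Suc (Suc i)) = r * (d - r ^ Suc (Suc i)) - s * (s * M * c)"
      by (simp add: power2_eq_square algebra_simps)
    then have 2: "s dvd (r * d - s\<^sup>2 * M * c) - r ^ Suc (Suc (Suc i))" using cd(4) by auto
    show ?case using cd(3,4) 1 2 by blast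
  qed
  obtain i where i: "e = Suc i" using e by (cases e) auto
  obtain c where c: "of_int s ^ e * (\<alpha> ^ e + \<beta> ^ e) = of_int c" "s dvd c - r ^ e" using step[of i] i by blast
  have cc: "coprime c s"
  proof (rule coprimeI)
    fix g assume g: "g dvd c" "g dvd s"
    have "g dvd c - r ^ e" using g(2) c(2) by (rule dvd_trans)
    then have "g dvd c - (c - r ^ e)" by (rule dvd_diff[OF g(1)])
    then have "g dvd r ^ e" by simp
    moreover have "coprime (r ^ e) s" using co by simp
    ultimately show "is_unit g" using g(2) by (rule_tac coprime_common_divisor)
  qed
  have "of_int s ^ e * (2 + 1 / of_nat n) = (of_int c :: complex)" using c(1) unfolding e(2) be tr .
  then have "of_int c * of_nat n = of_int s ^ e * ((2 + 1 / of_nat n) * (of_nat n :: complex))"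
    by (simp only: mult.assoc[symmetric])
  also have "(2 + 1 / of_nat n) * (of_nat n :: complex) = 2 * of_nat n + 1" using n by (simp add: distrib_right)
  finally have "of_int s ^ e * (2 * of_nat n + 1) = of_int c * (of_nat n :: complex)" by (rule sym)
  then have "of_int (s ^ e * (2 * int n + 1)) = (of_int (c * int n) :: complex)" by simp
  then have E: "s ^ e * (2 * int n + 1) = c * int n" by (simp only: of_int_eq_iff)
  have "coprime (int n) (2 * int n + 1)"
  proof (rule coprimeI)
    fix g assume "g dvd int n" "g dvd 2 * int n + 1"
    then have "g dvd (2 * int n + 1) - 2 * int n" by (intro dvd_diff) auto
    then show "is_unit g" by simp
  qed
  moreover have "int n dvd s ^ e * (2 * int n + 1)" unfolding E by simp
  ultimately have "int n dvd s ^ e" using coprime_dvd_mult_left_iff by blast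
  moreover have "s ^ e dvd int n"
  proof -
    have "s ^ e dvd c * int n" unfolding E[symmetric] by simp
    moreover have "coprime (s ^ e) c" using cc by (simp add: coprime_commute[of _ c])
    ultimately show ?thesis using coprime_dvd_mult_right_iff by blast
  qed
  ultimately have "int n = s ^ e" using s n by (intro zdvd_antisym_nonneg) auto
  then have "int n = int (nat s ^ e)" using s by simp
  then have "n = nat s ^ e" by (simp only: of_nat_eq_iff)
  then show ?thesis unfolding perfect_power_def using e(1) s by (intro exI[of _ "nat s"] exI[of _ e]) auto
qed

end


section \<open>Which roots belong to a member of P\<close>

text \<open>The larger root; it is real and positive, so it has compatible positive real roots of
  every order.\<close>

definition zroot :: "nat => real" where
  "zroot n = (2 * real n + 1 + sqrt (4 * real n + 1)) / (2 * real n)"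

lemma zroot:
  assumes n: "n > 0"
  shows "zroot n > 0" "rpoly (delta n) (of_real (zroot n)) = 0"
proof -
  have n': "real n > 0" using n by simp
  show "zroot n > 0" unfolding zroot_def using n' by (intro divide_pos_pos add_pos_nonneg) auto
  define s where "s = sqrt (4 * real n + 1)"
  have s2: "s * s = 4 * real n + 1" unfolding s_def by simp
  have "zroot n - 1 = (1 + s) / (2 * real n)" unfolding zroot_def s_def using n' by (simp add: field_simps)
  then have "real n * (zroot n - 1)\<^sup>2 = real n * ((1 + s) / (2 * real n))\<^sup>2" by simp
  also have "\<dots> = (1 + 2 * s + s * s) / (4 * real n)" using n' by (simp add: power2_eq_square field_simps)
  also have "\<dots> = zroot n" unfolding s2 zroot_def s_def[symmetric] using n' by (simp add: field_simps)
  finally have "complex_of_real (real n * (zroot n - 1)\<^sup>2) = of_real (zroot n)" by (rule arg_cong)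
  then show "rpoly (delta n) (of_real (zroot n)) = 0" by (simp add: rpoly_delta)
qed

lemma irreducible_factor_root:
  assumes "f \<noteq> 0" "rpoly f w = 0"
  shows "\<exists>p. irreducible p \<and> rpoly p w = 0"
  using min_poly_exists[OF assms] by blast

text \<open>The exponents of \<open>p\<close> are grouped by their residue modulo \<open>k\<close>;
  each group is a power of \<open>w\<close> times a polynomial in \<open>w ^ k\<close>.\<close>

lemma root_decomposition:
  assumes k: "k > 0" and w: "w ^ k = z"
  shows "rpoly p w = (\<Sum>j<k. w ^ j * rpoly (\<Sum>i | i \<le> degree p \<and> i mod k = j. monom (coeff p i) (i div k)) z)"
proof -
  have "rpoly p w = (\<Sum>i\<le>degree p. of_rat (coeff p i) * w ^ i)"
    by (simp add: rpoly_def poly_altdef of_rat_hom.degree_map_poly_hom coeff_map_poly)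
  also have "\<dots> = (\<Sum>i\<le>degree p. w ^ (i mod k) * (of_rat (coeff p i) * z ^ (i div k)))"
  proof (rule sum.cong[OF refl])
    fix i
    have "w ^ i = w ^ (k * (i div k) + i mod k)" by simp
    also have "\<dots> = z ^ (i div k) * w ^ (i mod k)" unfolding power_add power_mult w ..
    finally show "of_rat (coeff p i) * w ^ i = w ^ (i mod k) * (of_rat (coeff p i) * z ^ (i div k))" by simp
  qed
  also have "\<dots> = (\<Sum>j<k. \<Sum>i | i \<in> {..degree p} \<and> i mod k = j. w ^ (i mod k) * (of_rat (coeff p i) * z ^ (i div k)))"
    using k by (intro sum.group[symmetric]) auto
  also have "\<dots> = (\<Sum>j<k. w ^ j * rpoly (\<Sum>i | i \<le> degree p \<and> i mod k = j. monom (coeff p i) (i div k)) z)"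
    by (intro sum.cong refl) (auto simp: rpoly_sum sum_distrib_left intro!: sum.cong)
  finally show ?thesis .
qed

text \<open>If \<open>k\<close> is the smallest positive exponent with \<open>w ^ k\<close> in Q(z),
  the powers of \<open>w\<close> below \<open>k\<close> are independent over Q(z). A rational
  polynomial vanishing at \<open>w\<close> then has all its residue parts vanishing at
  \<open>z\<close>, hence at the conjugate \<open>inverse z\<close>, and so it vanishes at
  \<open>inverse w\<close> too. A smaller exponent would make \<open>z\<close> a proper power in
  Q(z), which forces \<open>n\<close> to be a perfect power.\<close>

lemma root_reciprocal:
  assumes n: "n > 0" and nsq: "\<nexists>k. 4 * n + 1 = k\<^sup>2" and npp: "\<not> perfect_power n" and k: "k > 0"
  shows "reciprocal (of_real (root k (zroot n)))"
proof -
  define x where "x = root k (zroot n)"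
  define z where "z = complex_of_real (zroot n)"
  let ?w = "complex_of_real x"
  have z: "rpoly (delta n) z = 0" using zroot[OF n] by (simp add: z_def)
  have x: "x > 0" unfolding x_def using zroot[OF n] k by simp
  have "x ^ k = zroot n" unfolding x_def using zroot[OF n] k by simp
  then have wk: "?w ^ k = z" unfolding z_def by (simp flip: of_real_power)
  define F where "F = Qadj z"
  have Fs: "subring_set F" unfolding F_def by (rule Qadj_subring)
  have Fi: "inverse a \<in> F" if "a \<in> F" for a
    using Qadj_inverse[OF delta_nonzero(1)[OF n] z] that by (simp add: F_def)
  have FR: "F \<subseteq> \<real>"
  proof
    fix a assume "a \<in> F"
    then obtain p where "a = rpoly p z" by (auto simp: F_def Qadj_def)
    moreover have "rpoly p (of_real y) \<in> \<real>" for y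
    proof (induction p)
      case (pCons c p)
      have "(of_rat c :: complex) \<in> \<real>" by (cases c) (auto simp: of_rat_rat)
      then show ?case using pCons by simp
    qed simp
    ultimately show "a \<in> \<real>" by (simp add: z_def)
  qed
  have zF: "z \<in> F" unfolding F_def by (rule Qadj_gen)
  \<comment> \<open>The exponents \<open>m\<close> with \<open>w ^ m\<close> in Q(z) are the
    multiples of \<open>d\<close>, so \<open>d\<close> divides \<open>k\<close> and \<open>z\<close>
    is the \<open>(k div d)\<close>-th power of an element of Q(z).\<close>
  define d where "d = (LEAST m. 0 < m \<and> ?w ^ m \<in> F)"
  have d: "0 < d" "?w ^ d \<in> F" and dmin: "\<And>m. 0 < m ==> ?w ^ m \<in> F ==> d \<le> m"
    using LeastI[of "\<lambda>m. 0 < m \<and> ?w ^ m \<in> F" k] k wk zF Least_le[of "\<lambda>m. 0 < m \<and> ?w ^ m \<in> F"]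
    unfolding d_def by auto
  have "k mod d = 0"
  proof (rule ccontr)
    assume m: "k mod d \<noteq> 0"
    have "?w ^ k = ?w ^ (d * (k div d) + k mod d)" by simp
    also have "\<dots> = (?w ^ d) ^ (k div d) * ?w ^ (k mod d)" unfolding power_add power_mult ..
    finally have "z = (?w ^ d) ^ (k div d) * ?w ^ (k mod d)" unfolding wk .
    moreover have "(?w ^ d) ^ (k div d) \<noteq> 0" using x by (intro power_not_zero) simp
    moreover have "b = a * inverse c" if "a = c * b" "c \<noteq> 0" for a b c :: complex
      unfolding that(1) using that(2) by simp
    ultimately have e: "?w ^ (k mod d) = z * inverse ((?w ^ d) ^ (k div d))" by blast
    have "inverse ((?w ^ d) ^ (k div d)) \<in> F" by (rule Fi[OF subring_power[OF Fs d(2)]])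
    then have "?w ^ (k mod d) \<in> F" unfolding e by (rule subring_mult[OF Fs zF])
    moreover have "k mod d < d" by (rule mod_less_divisor[OF d(1)])
    ultimately show False using dmin[of "k mod d"] m by linarith
  qed
  then have kd: "k = d * (k div d)" using mult_div_mod_eq[of d k] by simp
  have "(?w ^ d) ^ (k div d) = ?w ^ (d * (k div d))" by (rule power_mult[symmetric])
  also have "\<dots> = z" using kd wk by simp
  finally have "(?w ^ d) ^ (k div d) = z" .
  then have "\<not> k div d > 1" using delta_perfect_power[OF n nsq z, of "?w ^ d" "k div d"] d npp by (auto simp: F_def)
  moreover have "k div d \<noteq> 0"
  proof
    assume "k div d = 0"
    then have "d * (k div d) = 0" by simp
    then show False using kd k by linarith
  qed
  ultimately have "k div d = 1" by linarith
  then have dk: "d = k" using kd by (metis mult.right_neutral)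
  \<comment> \<open>This is stronger than sharing one irreducible polynomial: every rational
    relation of \<open>w\<close> holds for its inverse.\<close>
  have key: "rpoly p (inverse ?w) = 0" if p: "rpoly p ?w = 0" for p
  proof -
    define pj where "pj j = (\<Sum>i | i \<le> degree p \<and> i mod k = j. monom (coeff p i) (i div k))" for j
    define f where "f = (\<Sum>j<k. monom (rpoly (pj j) z) j)"
    have cf: "coeff f i = (if i < k then rpoly (pj i) z else 0)" for i
      unfolding f_def by (simp add: coeff_sum coeff_monom)
    have "f = 0"
    proof (rule radical_independent[OF Fs Fi FR x])
      show "?w ^ k \<in> F" using wk zF by simp
      show "?w ^ m \<notin> F" if "0 < m" "m < k" for m using dmin[of m] that dk by auto
      show "coeff f i \<in> F" for i unfolding cf using Fs Qadj_I by (auto simp: F_def subring_set_def)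
      show "degree f < k" using k by (intro degree_lessI) (auto simp: cf)
      have "poly f ?w = (\<Sum>j<k. ?w ^ j * rpoly (pj j) z)"
        unfolding f_def by (simp add: poly_sum poly_monom mult.commute)
      also have "\<dots> = 0" unfolding pj_def root_decomposition[OF k wk, symmetric] by (rule p)
      finally show "poly f ?w = 0" .
    qed
    then have "rpoly (pj j) z = 0" if "j < k" for j using cf[of j] that by simp
    then have "rpoly (pj j) (inverse z) = 0" if "j < k" for j using delta_root_conj(2)[OF n nsq z] that by blast
    then have "(\<Sum>j<k. inverse ?w ^ j * rpoly (pj j) (inverse z)) = 0" by simp
    moreover have "inverse ?w ^ k = inverse z" using wk by (simp add: power_inverse)
    ultimately show ?thesis using root_decomposition[OF k, of "inverse ?w" "inverse z" p] by (simp add: pj_def)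
  qed
  \<comment> \<open>Substituting the \<open>k\<close>-th power of the variable exhibits
    \<open>w\<close> as algebraic, so that an irreducible polynomial exists.\<close>
  have "rpoly (pcompose (delta n) (monom 1 k)) ?w = 0"
  proof -
    have "rpoly (pcompose q (monom 1 k)) ?w = rpoly q z" for q
      by (induction q) (auto simp: pcompose_pCons wk algebra_simps)
    then show ?thesis using z by simp
  qed
  moreover have "pcompose (delta n) (monom 1 k) \<noteq> 0"
    using delta_nonzero(1)[OF n] k pcompose_eq_0[of "delta n" "monom 1 k"] by (auto simp: degree_monom_eq)
  ultimately obtain p where "irreducible p" "rpoly p ?w = 0" using irreducible_factor_root by blast
  then have "reciprocal ?w" unfolding reciprocal_def using key x by auto
  then show ?thesis by (simp add: x_def)
qed

lemma zroot_P_seq: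
  assumes n: "n > 0" and nsq: "\<nexists>k. 4 * n + 1 = k\<^sup>2" and npp: "\<not> perfect_power n"
  shows "(\<lambda>k. of_real (root k (zroot n))) \<in> P_seq"
  unfolding P_seq_def
proof (intro CollectI conjI allI impI)
  fix k :: nat assume k: "k \<ge> 1"
  then show "reciprocal (of_real (root k (zroot n)))" using root_reciprocal[OF n nsq npp] by simp
next
  fix m k :: nat assume mk: "m \<ge> 1" "k \<ge> 1"
  have "root (m * k) (zroot n) ^ m = root k (zroot n)"
    using mk zroot[OF n] by (simp add: real_root_mult_exp real_root_pow_pos)
  then show "complex_of_real (root (m * k) (zroot n)) ^ m = of_real (root k (zroot n))"
    by (simp flip: of_real_power)
qed

text \<open>A member of P through \<open>z\<close> supplies a reciprocal square root
  \<open>w\<close>. With \<open>n = m\<^sup>2\<close> the equation of \<open>z\<close> is an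
  equality of squares, so \<open>m (w^2 - 1)\<close> equals \<open>w\<close> or \<open>- w\<close>.
  Inverting \<open>w\<close> changes the sign of the left side relative to the right, so
  \<open>w\<close> and its inverse cannot both satisfy the same such equation.\<close>

lemma square_root_not_in_P_seq:
  assumes b: "b \<in> P_seq" and k: "k \<ge> 1" and n: "n = m\<^sup>2" "m \<ge> 1"
  shows "rpoly (delta n) (b k) \<noteq> 0"
proof
  assume z: "rpoly (delta n) (b k) = 0"
  define w where "w = b (2 * k)"
  have wr: "reciprocal w" and w2: "w\<^sup>2 = b k" using b k by (auto simp: P_seq_def w_def)
  have w0: "w \<noteq> 0" by (rule reciprocalD(1)[OF wr])
  have "(of_nat m * (w\<^sup>2 - 1))\<^sup>2 = of_nat n * (w\<^sup>2 - 1)\<^sup>2" unfolding n(1) by (simp add: power_mult_distrib)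
  also have "\<dots> = w\<^sup>2" using z unfolding rpoly_delta w2[symmetric] by simp
  finally have "(of_nat m * (w\<^sup>2 - 1))\<^sup>2 = w\<^sup>2" .
  then have "of_nat m * (w\<^sup>2 - 1) = w \<or> of_nat m * (w\<^sup>2 - 1) = - w" by (simp add: power2_eq_iff)
  then obtain c :: rat where c: "c \<noteq> 0" "of_nat m * (w\<^sup>2 - 1) = of_rat c * w"
  proof
    assume "of_nat m * (w\<^sup>2 - 1) = w"
    then show ?thesis using that[of 1] by simp
  next
    assume "of_nat m * (w\<^sup>2 - 1) = - w"
    then show ?thesis using that[of "- 1"] by (simp add: of_rat_minus)
  qed
  let ?A = "[:- of_nat m, - c, of_nat m:]"
  have "rpoly ?A w = of_nat m * (w\<^sup>2 - 1) - of_rat c * w" by (simp add: of_rat_minus power2_eq_square algebra_simps)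
  then have "rpoly ?A w = 0" using c(2) by simp
  then have "rpoly ?A (inverse w) = 0" using reciprocalD(4,7)[OF wr] by blast
  then have "rpoly ?A (inverse w) * w\<^sup>2 = 0" by simp
  then have "of_nat m * (1 - w\<^sup>2) = of_rat c * w" using w0 
  proof -
    assume h: "rpoly ?A (inverse w) * w\<^sup>2 = 0"
    have "rpoly ?A (inverse w) * w\<^sup>2 = of_nat m * (inverse w * w)\<^sup>2 - of_rat c * (inverse w * w) * w - of_nat m * w\<^sup>2"
      by (simp add: of_rat_minus power2_eq_square algebra_simps)
    also have "\<dots> = of_nat m * (1 - w\<^sup>2) - of_rat c * w" using w0 by (simp add: algebra_simps)
    finally show ?thesis using h by simp
  qed
  moreover have "of_nat m * (1 - w\<^sup>2) = - (of_nat m * (w\<^sup>2 - 1))" by (simp add: algebra_simps)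
  ultimately have "of_rat c * w = - (of_rat c * w)" using c(2) by simp
  then show False using c(1) w0 by simp
qed

declare add_2_eq_Suc [simp del] add_2_eq_Suc' [simp del]

section \<open>S-equivalence of rational matrices\<close>

definition sp :: "'a::comm_ring_1 mat => 'a mat" where
  "sp A = A + trp A"

lemma sp_carrier [simp]: "A \<in> Mat n n ==> sp A \<in> Mat n n"
  by (auto simp: sp_def)

lemma bf_sp: "A \<in> Mat n n ==> x \<in> Vec n ==> y \<in> Vec n ==>
  bf (sp A) x y = bf A x y + bf A y x"
  by (simp add: sp_def bf_add_mat[of _ n n] bf_transpose[of _ n n])

lemma sp_congruence:
  fixes A :: "'a::comm_ring_1 mat"
  assumes A: "A \<in> Mat n n" and P: "P \<in> Mat n m"
  shows "sp (trp P * A * P) = trp P * sp A * P"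
proof (rule bf_eqI)
  show c: "sp (trp P * A * P) \<in> Mat m m" "trp P * sp A * P \<in> Mat m m"
    using A P by auto
  have c': "trp P * A * P \<in> Mat m m" using A P by auto
  fix x y :: "'a vec" assume x: "x \<in> Vec m" and y: "y \<in> Vec m"
  have Px: "P *v x \<in> Vec n" "P *v y \<in> Vec n" using P x y by auto
  have "bf (sp (trp P * A * P)) x y = bf A (P *v x) (P *v y) + bf A (P *v y) (P *v x)"
    unfolding bf_sp[OF c' x y] bf_congruence[OF A P P x y] bf_congruence[OF A P P y x] ..
  also have "\<dots> = bf (trp P * sp A * P) x y"
    unfolding bf_congruence[OF sp_carrier[OF A] P P x y, symmetric] bf_sp[OF A Px] ..
  finally show "bf (sp (trp P * A * P)) x y = bf (trp P * sp A * P) x y" .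
qed

lemma sp_block_sum: "A \<in> Mat n n ==> B \<in> Mat m m ==> sp (A \<boxplus> B) = sp A \<boxplus> sp (B :: 'a::comm_ring_1 mat)"
  by (intro eq_matI) (auto simp: sp_def block_sum_def)

lemma det_congruence:
  fixes A :: "'a::idom mat"
  assumes "A \<in> Mat n n" "P \<in> Mat n n"
  shows "det (trp P * A * P) = det P * det A * det P"
  using assms by (simp add: det_mult[of _ n] det_transpose del: assoc_mult_mat)

lemma det_nondegenerate_iff:
  fixes G :: "'a::field mat"
  assumes G: "G \<in> Mat n n"
  shows "det G \<noteq> 0 \<longleftrightarrow> (\<forall>x\<in>Vec n. (\<forall>y\<in>Vec n. bf G x y = 0) --> x = 0\<^sub>v n)"
proof
  assume "det G \<noteq> 0"
  then show "\<forall>x\<in>Vec n. (\<forall>y\<in>Vec n. bf G x y = 0) --> x = 0\<^sub>v n"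
    using form_nondegenerate[OF G] by blast
next
  assume nd: "\<forall>x\<in>Vec n. (\<forall>y\<in>Vec n. bf G x y = 0) --> x = 0\<^sub>v n"
  show "det G \<noteq> 0"
  proof
    assume "det G = 0"
    then have "det (trp G) = 0" using det_transpose[OF G] by simp
    moreover have Gt: "trp G \<in> Mat n n" using G by simp
    ultimately obtain v where v: "v \<in> Vec n" "v \<noteq> 0\<^sub>v n" "trp G *v v = 0\<^sub>v n"
      using det_0_iff_vec_prod_zero_field[OF Gt] by blast
    have "bf G v y = 0" if y: "y \<in> Vec n" for y
    proof -
      have "bf G v y = bf (trp G) y v" using bf_transpose[OF G y v(1)] by simp
      also have "\<dots> = 0" unfolding bf_def v(3) using y by simp
      finally show ?thesis .
    qed
    then show False using nd v by blast
  qed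
qed

text \<open>One computation for skew forms (\<open>\<epsilon> = - 1\<close>) and symmetric forms
  (\<open>\<epsilon> = 1\<close>). An enlargement attaches a hyperbolic plane, coupled to the old
  space through \<open>c\<close>; the coupling can be absorbed, so the radical does not
  change.\<close>

lemma enlarged_nondegenerate_iff:
  fixes H K :: "'a::field mat"
  assumes H: "H \<in> Mat n n" and K: "K \<in> Mat (n + 2) (n + 2)" and c: "c \<in> Vec n"
    and s: "s \<noteq> 0" "\<epsilon> \<noteq> 0"
    and f: "\<And>v w v' w'. v \<in> Vec n ==> w \<in> Vec 2 ==> v' \<in> Vec n ==> w' \<in> Vec 2 ==>
      bf K (v @\<^sub>v w) (v' @\<^sub>v w') = bf H v v' + w' $ 0 * (c \<bullet> v) + \<epsilon> * (w $ 0 * (c \<bullet> v')) + s * (w $ 0 * w' $ 1 + \<epsilon> * (w' $ 0 * w $ 1))"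
  shows "det H \<noteq> 0 \<longleftrightarrow> det K \<noteq> 0"
proof -
  let ?p = "\<lambda>a b. vec 2 (\<lambda>i. if i = 0 then a else b)"
  have p: "?p a b \<in> Vec 2" "?p a b $ 0 = a" "?p a b $ 1 = b" for a b :: 'a by auto
  show ?thesis unfolding det_nondegenerate_iff[OF H] det_nondegenerate_iff[OF K]
  proof (intro iffI ballI impI)
    fix u assume nd: "\<forall>x\<in>Vec n. (\<forall>y\<in>Vec n. bf H x y = 0) --> x = 0\<^sub>v n"
      and u: "u \<in> Vec (n + 2)" and z: "\<forall>y\<in>Vec (n + 2). bf K u y = 0"
    obtain v w where vw: "v \<in> Vec n" "w \<in> Vec 2" "u = v @\<^sub>v w" using append_vec_cases[OF u] by blast
    have z': "bf H v v' + w' $ 0 * (c \<bullet> v) + \<epsilon> * (w $ 0 * (c \<bullet> v')) + s * (w $ 0 * w' $ 1 + \<epsilon> * (w' $ 0 * w $ 1)) = 0"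
      if "v' \<in> Vec n" "w' \<in> Vec 2" for v' w'
    proof -
      have "bf K u (v' @\<^sub>v w') = 0" using z append_carrier_vec[OF that] by blast
      then show ?thesis unfolding vw(3) f[OF vw(1,2) that] .
    qed
    have "w $ 0 = 0" using z'[OF zero_carrier_vec p(1)[of 0 1]] H vw c s by simp
    moreover have "bf H v v' = 0" if v': "v' \<in> Vec n" for v'
      using z'[OF v' p(1)[of 0 0]] calculation by simp
    then have v0: "v = 0\<^sub>v n" using nd vw by blast
    moreover have "w $ 1 = 0" using z'[OF zero_carrier_vec p(1)[of 1 0]] calculation H c s by simp
    ultimately have w0: "w = 0\<^sub>v 2" using vw(2) by (intro eq_vecI) (auto simp: less_2_cases_iff)
    show "u = 0\<^sub>v (n + 2)" unfolding vw(3) v0 w0 by (rule append_vec_zero)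
  next
    fix v assume nd: "\<forall>x\<in>Vec (n + 2). (\<forall>y\<in>Vec (n + 2). bf K x y = 0) --> x = 0\<^sub>v (n + 2)"
      and v: "v \<in> Vec n" and z: "\<forall>y\<in>Vec n. bf H v y = 0"
    \<comment> \<open>The last coordinate is chosen to cancel the coupling term
      \<open>c \<bullet> v\<close>, so a radical vector of \<open>H\<close> lifts to one of
      \<open>K\<close>.\<close>
    let ?w = "?p 0 (- (c \<bullet> v) / (s * \<epsilon>))"
    have "bf K (v @\<^sub>v ?w) y = 0" if y: "y \<in> Vec (n + 2)" for y
    proof -
      obtain v' w' where vw: "v' \<in> Vec n" "w' \<in> Vec 2" "y = v' @\<^sub>v w'" using append_vec_cases[OF y] by blast
      have "s * (\<epsilon> * (w' $ 0 * (- (c \<bullet> v) / (s * \<epsilon>)))) = - (w' $ 0 * (c \<bullet> v))" using s by simp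
      then show ?thesis unfolding vw(3) f[OF v p(1) vw(1,2)] using z vw(1) by simp
    qed
    then have "v @\<^sub>v ?w = 0\<^sub>v (n + 2)" using nd v p(1) by auto
    then have "v @\<^sub>v ?w = 0\<^sub>v n @\<^sub>v 0\<^sub>v 2" using append_vec_zero by metis
    then show "v = 0\<^sub>v n" using append_vec_inj[OF v zero_carrier_vec] by blast
  qed
qed

definition col_enl :: "nat => rat mat => rat mat => rat mat" where
  "col_enl n A c = four_block_mat A (four_block_mat c (0\<^sub>m n 1) (0\<^sub>m 0 1) (0\<^sub>m 0 1))
             (0\<^sub>m 2 n) (mat_of_rows_list 2 [[0, 1], [0, 0]])"

definition row_enl :: "nat => rat mat => rat mat => rat mat" where
  "row_enl n A r = four_block_mat A (0\<^sub>m n 2)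
             (four_block_mat r (0\<^sub>m 1 0) (0\<^sub>m 1 n) (0\<^sub>m 1 0))
             (mat_of_rows_list 2 [[0, 0], [1, 0]])"

lemma mat2_mult_vec: "w \<in> Vec 2 ==> mat_of_rows_list 2 [[a, b], [c, d]] *v w =
  vec 2 (\<lambda>i. if i = 0 then a * w $ 0 + b * w $ 1 else c * w $ 0 + d * w $ 1 :: 'a::comm_ring_1)"
  by (intro eq_vecI) (auto simp: scalar_prod_def mat_of_rows_list_def numeral_2_eq_2 less_Suc_eq)

lemma scalar_prod_vec2: "x \<in> Vec 2 ==> y \<in> Vec 2 ==> x \<bullet> y = x $ 0 * y $ 0 + x $ 1 * (y $ 1 :: 'a::comm_ring_1)"
  by (auto simp: scalar_prod_def numeral_2_eq_2)

lemma col_enl_form: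
  assumes A: "A \<in> Mat n n" and c: "c \<in> Mat n 1"
    and v: "v \<in> Vec n" "v' \<in> Vec n" and w: "w \<in> Vec 2" "w' \<in> Vec 2"
  shows "col_enl n A c \<in> Mat (n + 2) (n + 2)"
    "bf (col_enl n A c) (v @\<^sub>v w) (v' @\<^sub>v w') = bf A v v' + w' $ 0 * (col c 0 \<bullet> v) + w $ 0 * w' $ 1"
proof -
  let ?C = "four_block_mat c (0\<^sub>m n 1) (0\<^sub>m 0 1) (0\<^sub>m 0 1) :: rat mat" and ?M = "mat_of_rows_list 2 [[0, 1], [0, 0]] :: rat mat"
  have C: "?C \<in> Mat n 2" using four_block_carrier_mat[OF c, of "0\<^sub>m 0 1" 0 1] by (simp add: numeral_2_eq_2)
  have M: "?M \<in> Mat 2 2" by (auto simp: mat_of_rows_list_def)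
  show "col_enl n A c \<in> Mat (n + 2) (n + 2)" unfolding col_enl_def by (rule four_block_carrier_mat[OF A M])
  have cc: "col c 0 \<in> Vec n" using c col_dim[of c 0] by simp
  have Cw: "?C *v w' = w' $ 0 *s col c 0"
    using c w C by (intro eq_vecI) (auto simp: scalar_prod_def numeral_2_eq_2)
  have "col_enl n A c *v (v' @\<^sub>v w') = (A *v v' + ?C *v w') @\<^sub>v (0\<^sub>m 2 n *v v' + ?M *v w')"
    unfolding col_enl_def using A C M v w by (intro four_block_mat_mult_vec) auto
  also have "0\<^sub>m 2 n *v v' + ?M *v w' = vec 2 (\<lambda>i. if i = 0 then w' $ 1 else 0)"
    using v w by (intro eq_vecI) (auto simp: mat2_mult_vec)
  finally have "bf (col_enl n A c) (v @\<^sub>v w) (v' @\<^sub>v w') = v \<bullet> (A *v v' + ?C *v w') + w \<bullet> vec 2 (\<lambda>i. if i = 0 then w' $ 1 else 0)"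
    unfolding bf_def using A C v w by (simp add: scalar_prod_append[of _ n _ 2])
  also have "v \<bullet> (A *v v' + ?C *v w') = bf A v v' + v \<bullet> (w' $ 0 *s col c 0)"
    unfolding Cw bf_def using A v c by (intro scalar_prod_add_distrib[of _ n]) auto
  also have "v \<bullet> (w' $ 0 *s col c 0) = w' $ 0 * (col c 0 \<bullet> v)"
    using v cc comm_scalar_prod[OF v(1) cc] by simp
  finally show "bf (col_enl n A c) (v @\<^sub>v w) (v' @\<^sub>v w') = bf A v v' + w' $ 0 * (col c 0 \<bullet> v) + w $ 0 * w' $ 1"
    using w by (simp add: scalar_prod_vec2)
qed

lemma row_enl_form:
  assumes A: "A \<in> Mat n n" and r: "r \<in> Mat 1 n"
    and v: "v \<in> Vec n" "v' \<in> Vec n" and w: "w \<in> Vec 2" "w' \<in> Vec 2"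
  shows "row_enl n A r \<in> Mat (n + 2) (n + 2)"
    "bf (row_enl n A r) (v @\<^sub>v w) (v' @\<^sub>v w') = bf A v v' + w $ 0 * (row r 0 \<bullet> v') + w $ 1 * w' $ 0"
proof -
  let ?C = "four_block_mat r (0\<^sub>m 1 0) (0\<^sub>m 1 n) (0\<^sub>m 1 0) :: rat mat" and ?M = "mat_of_rows_list 2 [[0, 0], [1, 0]] :: rat mat"
  have C: "?C \<in> Mat 2 n" using four_block_carrier_mat[OF r, of "0\<^sub>m 1 0" 1 0] by (simp add: numeral_2_eq_2)
  have M: "?M \<in> Mat 2 2" by (auto simp: mat_of_rows_list_def)
  show "row_enl n A r \<in> Mat (n + 2) (n + 2)" unfolding row_enl_def by (rule four_block_carrier_mat[OF A M])
  have rows: "row ?C 0 = row r 0" "row ?C 1 = 0\<^sub>v n"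
    using r by (auto intro!: eq_vecI)
  have Cv: "?C *v v' = vec 2 (\<lambda>i. if i = 0 then row r 0 \<bullet> v' else 0)"
  proof (rule eq_vecI)
    fix i assume "i < dim_vec (vec 2 (\<lambda>i. if i = 0 then row r 0 \<bullet> v' else 0))"
    then have "i = 0 \<or> i = 1" by auto
    then show "(?C *v v') $ i = vec 2 (\<lambda>i. if i = 0 then row r 0 \<bullet> v' else 0) $ i"
      using rows C v by auto
  qed (use C in auto)
  have "row_enl n A r *v (v' @\<^sub>v w') = (A *v v' + 0\<^sub>m n 2 *v w') @\<^sub>v (?C *v v' + ?M *v w')"
    unfolding row_enl_def using A C M v w by (intro four_block_mat_mult_vec) auto
  also have "A *v v' + 0\<^sub>m n 2 *v w' = A *v v'" using A v w by (intro eq_vecI) auto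
  also have "?C *v v' + ?M *v w' = vec 2 (\<lambda>i. if i = 0 then row r 0 \<bullet> v' else w' $ 0)"
    unfolding Cv using w by (intro eq_vecI) (auto simp: mat2_mult_vec)
  finally have "bf (row_enl n A r) (v @\<^sub>v w) (v' @\<^sub>v w') = v \<bullet> (A *v v') + w \<bullet> vec 2 (\<lambda>i. if i = 0 then row r 0 \<bullet> v' else w' $ 0)"
    unfolding bf_def using A v w by (simp add: scalar_prod_append[of _ n _ 2])
  then show "bf (row_enl n A r) (v @\<^sub>v w) (v' @\<^sub>v w') = bf A v v' + w $ 0 * (row r 0 \<bullet> v') + w $ 1 * w' $ 0"
    using w by (simp add: bf_def scalar_prod_vec2)
qed

text \<open>Reduction along the isotropic line of the last coordinate: its orthogonal complement is
  \<open>w $ 0 = 0\<close>, and dividing by the line gives back the old space. The relation is the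
  graph of this quotient map, reversed.\<close>

lemma sim_enlargement:
  assumes A: "A \<in> Mat n n" and B: "B \<in> Mat (n + 2) (n + 2)" and c: "c \<in> Vec n" and s: "s \<noteq> 0"
    and dA: "det (sk A) \<noteq> 0" and dB: "det (sk B) \<noteq> 0"
    and iso: "\<And>v w v' w'. v \<in> Vec n ==> w \<in> Vec 2 ==> v' \<in> Vec n ==> w' \<in> Vec 2 ==>
      w $ 0 = 0 ==> w' $ 0 = 0 ==> bf B (v @\<^sub>v w) (v' @\<^sub>v w') = bf A v v'"
    and f: "\<And>v w v' w'. v \<in> Vec n ==> w \<in> Vec 2 ==> v' \<in> Vec n ==> w' \<in> Vec 2 ==>
      bf (sk B) (v @\<^sub>v w) (v' @\<^sub>v w') = bf (sk A) v v' + w' $ 0 * (c \<bullet> v) + (- 1) * (w $ 0 * (c \<bullet> v')) + s * (w $ 0 * w' $ 1 + (- 1) * (w' $ 0 * w $ 1))"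
  shows "sim A B"
proof (rule simI[OF A B dA dB])
  let ?R = "{(v, v @\<^sub>v w) |v (w :: rat vec). v \<in> Vec n \<and> w \<in> Vec 2 \<and> w $ 0 = 0}"
  have R: "(x, y) \<in> ?R \<longleftrightarrow> (\<exists>w. x \<in> Vec n \<and> w \<in> Vec 2 \<and> w $ 0 = 0 \<and> y = x @\<^sub>v w)" for x y by auto
  show iA: "isotropic_rel A B ?R" unfolding isotropic_rel_def R using iso by fastforce
  have iS: "isotropic_rel (sk A) (sk B) ?R" unfolding isotropic_rel_def R using f by fastforce
  show "Lrel n (n + 2) (sk A) (sk B) ?R"
  proof (rule LrelI[OF _ iS])
    show "linrel n (n + 2) ?R"
      unfolding linrel_def
    proof (intro conjI allI impI)
      show "?R \<subseteq> Vec n \<times> Vec (n + 2)" using append_carrier_vec by blast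
      show "(0\<^sub>v n, 0\<^sub>v (n + 2)) \<in> ?R" unfolding R by (intro exI[of _ "0\<^sub>v 2"]) (auto simp: append_vec_zero)
      fix x y x' y' a assume "(x, y) \<in> ?R"
      then obtain w where w: "x \<in> Vec n" "w \<in> Vec 2" "w $ 0 = 0" "y = x @\<^sub>v w" unfolding R by blast
      show "(a *s x, a *s y) \<in> ?R" unfolding R using w by (intro exI[of _ "a *s w"]) (auto simp: append_vec_smult)
      assume "(x', y') \<in> ?R"
      then obtain w' where w': "x' \<in> Vec n" "w' \<in> Vec 2" "w' $ 0 = 0" "y' = x' @\<^sub>v w'" unfolding R by blast
      show "(x + x', y + y') \<in> ?R" unfolding R using w w' by (intro exI[of _ "w + w'"]) (auto simp: append_vec_add'[of _ n _ _ 2])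
    qed
    fix u y assume u: "u \<in> Vec n" and y: "y \<in> Vec (n + 2)"
      and perp: "\<And>x' y'. (x', y') \<in> ?R ==> bf (sk A) u x' = bf (sk B) y y'"
    obtain v w where vw: "v \<in> Vec n" "w \<in> Vec 2" "y = v @\<^sub>v w" using append_vec_cases[OF y] by blast
    have key: "bf (sk A) u v' = bf (sk A) v v' - w $ 0 * (c \<bullet> v') + s * (w $ 0 * t)" if v': "v' \<in> Vec n" for v' t
    proof -
      let ?w' = "vec 2 (\<lambda>i. if i = 0 then 0 else t)"
      have "(v', v' @\<^sub>v ?w') \<in> ?R" unfolding R using v' by (intro exI[of _ ?w']) auto
      from perp[OF this] show ?thesis unfolding vw(3) using f[OF vw(1,2) v', of ?w'] by simp
    qed
    have w0: "w $ 0 = 0" using key[OF zero_carrier_vec, of 1] bf_zero_right[OF sk_carrier[OF A] u] bf_zero_right[OF sk_carrier[OF A] vw(1)] c s by simp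
    have "u - v = 0\<^sub>v n"
    proof (rule form_nondegenerate[OF sk_carrier[OF A] dA])
      show "u - v \<in> Vec n" using u vw by simp
      fix v' :: "rat vec" assume v': "v' \<in> Vec n"
      show "bf (sk A) (u - v) v' = 0" using key[OF v', of 0] w0 bf_minus_left[OF sk_carrier[OF A] u vw(1) v'] by simp
    qed
    then have "u = v" using u vw
      by (intro eq_vecI) (metis carrier_vecD eq_iff_diff_eq_0 index_minus_vec(1) index_zero_vec(1), auto)
    then show "(u, y) \<in> ?R" unfolding R using vw w0 by blast
  qed
qed

lemma S_step_invariants:
  assumes "S_step A B"
  shows "(\<exists>n. A \<in> Mat n n) \<and> (\<exists>n. B \<in> Mat n n) \<and> (det (sk A) \<noteq> 0 \<longleftrightarrow> det (sk B) \<noteq> 0) \<and>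
    (det (sp A) \<noteq> 0 \<longleftrightarrow> det (sp B) \<noteq> 0) \<and> (det (sk A) \<noteq> 0 --> sim A B)"
  using assms
proof cases
  case (congruence n P)
  then have "sk B = trp P * sk A * P" "sp B = trp P * sp A * P"
    using sk_congruence sp_congruence by blast+
  moreover have "det (trp P * sk A * P) = det P * det (sk A) * det P" "det (trp P * sp A * P) = det P * det (sp A) * det P"
    using congruence by (auto intro!: det_congruence[of _ n])
  moreover have "B \<in> Mat n n" using congruence by auto
  moreover have "sim A B" if "det (sk A) \<noteq> 0" unfolding congruence(1) using sim_congruence congruence that by blast
  ultimately show ?thesis using congruence(2-4) by auto
next
  case (column_enlargement n c)
  have A: "A \<in> Mat n n" and c: "c \<in> Mat n 1" and Be: "B = col_enl n A c"
    using column_enlargement by (auto simp: col_enl_def)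
  have B: "B \<in> Mat (n + 2) (n + 2)" unfolding Be using col_enl_form(1)[OF A c] zero_carrier_vec by blast
  have bB: "bf B (v @\<^sub>v w) (v' @\<^sub>v w') = bf A v v' + w' $ 0 * (col c 0 \<bullet> v) + w $ 0 * w' $ 1"
    if "v \<in> Vec n" "w \<in> Vec 2" "v' \<in> Vec n" "w' \<in> Vec 2" for v w v' w'
    unfolding Be using col_enl_form(2)[OF A c] that by blast
  have k: "col c 0 \<in> Vec n" using c by auto
  have fsk: "bf (sk B) (v @\<^sub>v w) (v' @\<^sub>v w') = bf (sk A) v v' + w' $ 0 * (col c 0 \<bullet> v) + (- 1) * (w $ 0 * (col c 0 \<bullet> v')) + 1 * (w $ 0 * w' $ 1 + (- 1) * (w' $ 0 * w $ 1))"
    if "v \<in> Vec n" "w \<in> Vec 2" "v' \<in> Vec n" "w' \<in> Vec 2" for v w v' w'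
    using that bB[OF that] bB[OF that(3,4,1,2)] by (simp add: bf_sk[OF A] bf_sk[OF B])
  have fsp: "bf (sp B) (v @\<^sub>v w) (v' @\<^sub>v w') = bf (sp A) v v' + w' $ 0 * (col c 0 \<bullet> v) + 1 * (w $ 0 * (col c 0 \<bullet> v')) + 1 * (w $ 0 * w' $ 1 + 1 * (w' $ 0 * w $ 1))"
    if "v \<in> Vec n" "w \<in> Vec 2" "v' \<in> Vec n" "w' \<in> Vec 2" for v w v' w'
    using that bB[OF that] bB[OF that(3,4,1,2)] by (simp add: bf_sp[OF A] bf_sp[OF B])
  have 1: "det (sk A) \<noteq> 0 \<longleftrightarrow> det (sk B) \<noteq> 0"
    by (rule enlarged_nondegenerate_iff[OF sk_carrier[OF A] sk_carrier[OF B] k _ _ fsk]) auto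
  have 2: "det (sp A) \<noteq> 0 \<longleftrightarrow> det (sp B) \<noteq> 0"
    by (rule enlarged_nondegenerate_iff[OF sp_carrier[OF A] sp_carrier[OF B] k _ _ fsp]) auto
  have "sim A B" if d: "det (sk A) \<noteq> 0"
    by (rule sim_enlargement[OF A B k _ d _ _ fsk]) (use 1 d bB in auto)
  then show ?thesis using 1 2 A B by blast
next
  case (row_enlargement n r)
  have A: "A \<in> Mat n n" and r: "r \<in> Mat 1 n" and Be: "B = row_enl n A r"
    using row_enlargement by (auto simp: row_enl_def)
  have B: "B \<in> Mat (n + 2) (n + 2)" unfolding Be using row_enl_form(1)[OF A r] zero_carrier_vec by blast
  have bB: "bf B (v @\<^sub>v w) (v' @\<^sub>v w') = bf A v v' + w $ 0 * (row r 0 \<bullet> v') + w $ 1 * w' $ 0"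
    if "v \<in> Vec n" "w \<in> Vec 2" "v' \<in> Vec n" "w' \<in> Vec 2" for v w v' w'
    unfolding Be using row_enl_form(2)[OF A r] that by blast
  \<comment> \<open>For the skew form a row enlargement looks like a column enlargement with
    \<open>c\<close> replaced by the negated row and \<open>s = - 1\<close>; for the symmetric form
    no sign appears.\<close>
  have k: "row r 0 \<in> Vec n" "- row r 0 \<in> Vec n" using r by auto
  have m: "(- row r 0) \<bullet> v = - (row r 0 \<bullet> v)" if "v \<in> Vec n" for v
    using uminus_scalar_prod[OF k(1) that] by simp
  have fsk: "bf (sk B) (v @\<^sub>v w) (v' @\<^sub>v w') = bf (sk A) v v' + w' $ 0 * (- row r 0 \<bullet> v) + (- 1) * (w $ 0 * (- row r 0 \<bullet> v')) + (- 1) * (w $ 0 * w' $ 1 + (- 1) * (w' $ 0 * w $ 1))"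
    if "v \<in> Vec n" "w \<in> Vec 2" "v' \<in> Vec n" "w' \<in> Vec 2" for v w v' w'
    using that bB[OF that] bB[OF that(3,4,1,2)] by (simp add: bf_sk[OF A] bf_sk[OF B] m algebra_simps)
  have fsp: "bf (sp B) (v @\<^sub>v w) (v' @\<^sub>v w') = bf (sp A) v v' + w' $ 0 * (row r 0 \<bullet> v) + 1 * (w $ 0 * (row r 0 \<bullet> v')) + 1 * (w $ 0 * w' $ 1 + 1 * (w' $ 0 * w $ 1))"
    if "v \<in> Vec n" "w \<in> Vec 2" "v' \<in> Vec n" "w' \<in> Vec 2" for v w v' w'
    using that bB[OF that] bB[OF that(3,4,1,2)] by (simp add: bf_sp[OF A] bf_sp[OF B] algebra_simps)
  have 1: "det (sk A) \<noteq> 0 \<longleftrightarrow> det (sk B) \<noteq> 0"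
    by (rule enlarged_nondegenerate_iff[OF sk_carrier[OF A] sk_carrier[OF B] k(2) _ _ fsk]) auto
  have 2: "det (sp A) \<noteq> 0 \<longleftrightarrow> det (sp B) \<noteq> 0"
    by (rule enlarged_nondegenerate_iff[OF sp_carrier[OF A] sp_carrier[OF B] k(1) _ _ fsp]) auto
  have "sim A B" if d: "det (sk A) \<noteq> 0"
    by (rule sim_enlargement[OF A B k(2) _ d _ _ fsk]) (use 1 d bB in auto)
  then show ?thesis using 1 2 A B by blast
qed

text \<open>Along the chain only the skew and symmetric forms are followed, so matrices that are
  singular themselves may occur in between.\<close>

lemma S_equivalent_sim:
  assumes "S_equivalent A B" "A \<in> Mat n n" "det (sk A) \<noteq> 0"
  shows "sim A B \<and> (det (sp A) \<noteq> 0 \<longleftrightarrow> det (sp B) \<noteq> 0)"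
  using assms(1) unfolding S_equivalent_def
proof (induction rule: equivclp_induct)
  case base
  then show ?case using sim_refl[OF assms(2,3)] by simp
next
  case (step B C)
  have dB: "det (sk B) \<noteq> 0" using step sim_carrier(4) by blast
  from step.hyps(2) show ?case
  proof
    assume "S_step B C"
    from S_step_invariants[OF this] show ?thesis using step dB sim_trans by blast
  next
    assume "S_step C B"
    from S_step_invariants[OF this] show ?thesis using step dB sim_trans sim_sym by blast
  qed
qed

text \<open>A null vector \<open>x\<close> of the form and a vector \<open>y\<close> with \<open>A(x, y) = 1\<close> and \<open>A(y, y) = 0\<close> split off
  the last two coordinates of a row enlargement.\<close>

lemma Trotter_step:
  assumes A: "A \<in> Mat n n" and d: "det (sk A) \<noteq> 0" and dA: "det A = 0"
  shows "\<exists>k A1. k < n \<and> A1 \<in> Mat k k \<and> det (sk A1) \<noteq> 0 \<and> S_equivalent A A1"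
proof -
  obtain x where x: "x \<in> Vec n" "x \<noteq> 0\<^sub>v n" "A *v x = 0\<^sub>v n"
    using det_0_iff_vec_prod_zero_field[OF A] dA by blast
  have rx: "bf A v x = 0" if "v \<in> Vec n" for v unfolding bf_def x(3) using that by simp
  obtain y0 where y0: "y0 \<in> Vec n" "bf (sk A) x y0 \<noteq> 0"
    using det_nondegenerate_iff[OF sk_carrier[OF A]] d x by blast
  have a0: "bf A x y0 \<noteq> 0" using y0 rx by (simp add: bf_sk[OF A x(1) y0(1)])
  define y1 where "y1 = inverse (bf A x y0) *s y0"
  have y1: "y1 \<in> Vec n" "bf A x y1 = 1"
    using y0 a0 bf_smult_right[OF A x(1) y0(1)] by (auto simp: y1_def)
  \<comment> \<open>Subtracting a multiple of \<open>x\<close> makes \<open>A(y, y)\<close> vanish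
    and leaves \<open>A(x, y) = 1\<close>, because \<open>x\<close> is a right null vector.\<close>
  define y where "y = y1 - bf A y1 y1 *s x"
  have sx: "bf A y1 y1 *s x \<in> Vec n" using x by simp
  have y: "y \<in> Vec n" using y1 x by (simp add: y_def)
  have xy: "bf A x y = 1"
    unfolding y_def bf_minus_right[OF A x(1) y1(1) sx] bf_smult_right[OF A x(1) x(1)] using rx[OF x(1)] y1 by simp
  have yy: "bf A y y = 0"
  proof -
    have "bf A y y = bf A y y1 - bf A y (bf A y1 y1 *s x)"
      unfolding y_def by (rule bf_minus_right[OF A _ y1(1) sx]) (use y y_def in simp)
    also have "bf A y (bf A y1 y1 *s x) = 0" using bf_smult_right[OF A y x(1)] rx[OF y] by simp
    also have "bf A y y1 = bf A y1 y1 - bf A (bf A y1 y1 *s x) y1"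
      unfolding y_def by (rule bf_minus_left[OF A y1(1) sx y1(1)])
    also have "bf A (bf A y1 y1 *s x) y1 = bf A y1 y1" using bf_smult_left[OF A x(1) y1(1)] y1 by simp
    finally show ?thesis by simp
  qed
  \<comment> \<open>The common kernel of \<open>A(x, _)\<close> and \<open>A(_, y)\<close>. On the
    span of \<open>y\<close> and \<open>x\<close> these two functionals are the dual basis, so
    \<open>W\<close> is a complement of that span.\<close>
  define W where "W = {w \<in> Vec n. bf A x w = 0 \<and> bf A w y = 0}"
  have "subsp n W"
    unfolding submod_def W_def using A x y
    by (auto simp: bf_add_right[of _ n n] bf_add_left[of _ n n] bf_smult_right[of _ n n] bf_smult_left[of _ n n])
  then obtain k P where P: "k \<le> n" "P \<in> Mat n k" "mat_kernel P = {0\<^sub>v k}" "(\<lambda>v. P *v v) ` Vec k = W"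
    using subsp_basis by blast
  have PW: "P *v v \<in> Vec n" "bf A x (P *v v) = 0" "bf A (P *v v) y = 0" if "v \<in> Vec k" for v
    using P(4) that by (auto simp: W_def)
  define Q where "Q = four_block_mat P (mat_of_cols n [y, x]) (0\<^sub>m 0 k) (0\<^sub>m 0 2)"
  have C: "mat_of_cols n [y, x] \<in> Mat n 2" using mat_of_cols_carrier(1)[of n "[y, x]"] by (simp add: numeral_2_eq_2)
  have Q: "Q \<in> Mat n (k + 2)" unfolding Q_def using four_block_carrier_mat[OF P(2), of "0\<^sub>m 0 2" 0 2] by simp
  have Cw: "mat_of_cols n [y, x] *v w = w $ 0 *s y + w $ 1 *s x" if "w \<in> Vec 2" for w
  proof (rule eq_vecI)
    fix i assume "i < dim_vec (w $ 0 *s y + w $ 1 *s x)"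
    then have i: "i < n" using x y by simp
    have "(mat_of_cols n [y, x] *v w) $ i = row (mat_of_cols n [y, x]) i \<bullet> w" using i by simp
    also have "\<dots> = row (mat_of_cols n [y, x]) i $ 0 * w $ 0 + row (mat_of_cols n [y, x]) i $ 1 * w $ 1"
      using C i that by (intro scalar_prod_vec2) auto
    also have "\<dots> = (w $ 0 *s y + w $ 1 *s x) $ i" using i x y by (simp add: mat_of_cols_index mult.commute)
    finally show "(mat_of_cols n [y, x] *v w) $ i = (w $ 0 *s y + w $ 1 *s x) $ i" .
  qed (use x y in simp)
  have Qv: "Q *v (v @\<^sub>v w) = P *v v + (w $ 0 *s y + w $ 1 *s x)" if v: "v \<in> Vec k" and w: "w \<in> Vec 2" for v w
  proof -
    have "Q *v (v @\<^sub>v w) = (P *v v + mat_of_cols n [y, x] *v w) @\<^sub>v (0\<^sub>m 0 k *v v + 0\<^sub>m 0 2 *v w)"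
      unfolding Q_def by (rule four_block_mat_mult_vec[OF P(2) C _ _ v w]) auto
    also have "\<dots> = P *v v + mat_of_cols n [y, x] *v w" using P(2) v w by (intro eq_vecI) auto
    finally show ?thesis unfolding Cw[OF w] .
  qed
  have bQ: "bf A (Q *v (v @\<^sub>v w)) (Q *v (v' @\<^sub>v w')) = bf A (P *v v) (P *v v') + w $ 0 * bf A y (P *v v') + w $ 1 * w' $ 0"
    if v: "v \<in> Vec k" "v' \<in> Vec k" and w: "w \<in> Vec 2" "w' \<in> Vec 2" for v w v' w'
    unfolding Qv[OF v(1) w(1)] Qv[OF v(2) w(2)] using A x y PW[OF v(1)] PW[OF v(2)] xy yy rx[OF PW(1)[OF v(1)]] rx[OF y] rx[OF x(1)]
    by (simp add: bf_add_right[of _ n n] bf_add_left[of _ n n] bf_smult_right[of _ n n] bf_smult_left[of _ n n])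
  have sur: "\<exists>v\<in>Vec (k + 2). Q *v v = u" if u: "u \<in> Vec n" for u
  proof -
    define \<alpha> where "\<alpha> = bf A x u"
    define u1 where "u1 = u - \<alpha> *s y"
    define \<beta> where "\<beta> = bf A u1 y"
    define w where "w = u1 - \<beta> *s x"
    have c: "u1 \<in> Vec n" "w \<in> Vec n" using u x y by (auto simp: u1_def w_def)
    have "bf A x w = 0" unfolding w_def u1_def using A u x y xy rx[OF x(1)]
      by (simp add: bf_minus_right[of _ n n] bf_smult_right[of _ n n] \<alpha>_def)
    moreover have "bf A w y = 0" unfolding w_def using A c x y xy
      by (simp add: bf_minus_left[of _ n n] bf_smult_left[of _ n n] \<beta>_def)
    ultimately have "w \<in> W" using c by (simp add: W_def)
    then obtain v where v: "v \<in> Vec k" "P *v v = w" using P(4) by blast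
    let ?w = "vec 2 (\<lambda>i. if i = 0 then \<alpha> else \<beta>)"
    have "Q *v (v @\<^sub>v ?w) = w + (\<alpha> *s y + \<beta> *s x)" using Qv[OF v(1), of ?w] v by simp
    also have "\<dots> = u" unfolding w_def u1_def using u x y by (intro eq_vecI) auto
    finally show ?thesis using append_carrier_vec[OF v(1), of ?w 2] by auto
  qed
  have inj: "v = 0\<^sub>v (k + 2)" if h: "v \<in> Vec (k + 2)" "Q *v v = 0\<^sub>v n" for v
  proof -
    obtain u w where uw: "u \<in> Vec k" "w \<in> Vec 2" "v = u @\<^sub>v w" using append_vec_cases[OF h(1)] by blast
    have z: "P *v u + (w $ 0 *s y + w $ 1 *s x) = 0\<^sub>v n" using h(2) Qv[OF uw(1,2)] uw(3) by simp
    have "bf A x (P *v u + (w $ 0 *s y + w $ 1 *s x)) = w $ 0"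
      using A x y PW[OF uw(1)] xy rx[OF x(1)] by (simp add: bf_add_right[of _ n n] bf_smult_right[of _ n n])
    then have w0: "w $ 0 = 0" unfolding z using A x by simp
    have "bf A (P *v u + (w $ 0 *s y + w $ 1 *s x)) y = w $ 1"
      using A x y PW[OF uw(1)] xy yy by (simp add: bf_add_left[of _ n n] bf_smult_left[of _ n n])
    then have w1: "w $ 1 = 0" unfolding z using A y by simp
    have "P *v u = P *v u + (w $ 0 *s y + w $ 1 *s x)" unfolding w0 w1 using PW(1)[OF uw(1)] P(2) x y by (intro eq_vecI) auto
    then have "P *v u = 0\<^sub>v n" using z by simp
    then have "u \<in> mat_kernel P" using P(2) uw(1) by (intro mat_kernelI[OF P(2)]) auto
    then have u0: "u = 0\<^sub>v k" using P(3) by simp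
    have w00: "w = 0\<^sub>v 2" using uw(2) w0 w1 by (intro eq_vecI) (auto simp: less_2_cases_iff)
    show ?thesis unfolding uw(3) u0 w00 by (rule append_vec_zero)
  qed
  have nk: "n = k + 2"
  proof (rule ccontr)
    assume "n \<noteq> k + 2"
    then consider "n < k + 2" | "k + 2 < n" by linarith
    then show False
    proof cases
      case 1
      from underdetermined[OF Q 1] inj show False by blast
    next
      case 2
      have Qt: "trp Q \<in> Mat (k + 2) n" using Q by simp
      obtain v where v: "v \<in> Vec n" "v \<noteq> 0\<^sub>v n" "trp Q *v v = 0\<^sub>v (k + 2)"
        using underdetermined[OF Qt 2] by blast
      have "v \<bullet> u = 0" if u: "u \<in> Vec n" for u
      proof -
        obtain w where w: "w \<in> Vec (k + 2)" "Q *v w = u" using sur[OF u] by blast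
        have "v \<bullet> (Q *v w) = bf Q v w" by (simp add: bf_def)
        also have "\<dots> = bf (trp Q) w v" using bf_transpose[OF Q w(1) v(1)] by simp
        also have "\<dots> = 0" unfolding bf_def v(3) using w by simp
        finally show ?thesis using w by simp
      qed
      then have "v $ i = 0" if "i < n" for i using that v(1) scalar_prod_right_unit[of i n v] by (metis unit_vec_carrier)
      then show False using v(1,2) by (auto intro!: eq_vecI)
    qed
  qed
  have Qn: "Q \<in> Mat n n" using Q nk by simp
  have dQ: "det Q \<noteq> 0" using det_0_iff_vec_prod_zero_field[OF Qn] inj nk by auto
  define A1 where "A1 = trp P * A * P"
  have A1: "A1 \<in> Mat k k" using A P(2) by (auto simp: A1_def)
  define r where "r = mat 1 k (\<lambda>(i, j). bf A y (P *v unit_vec k j))"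
  have r: "r \<in> Mat 1 k" by (simp add: r_def)
  have rv: "row r 0 \<bullet> v = bf A y (P *v v)" if v: "v \<in> Vec k" for v
  proof -
    define q where "q = trp P *v (trp A *v y)"
    have q: "q \<in> Vec k" using A P(2) y by (auto simp: q_def)
    have qv: "bf A y (P *v v) = q \<bullet> v" if v: "v \<in> Vec k" for v
    proof -
      have "q \<bullet> v = (trp A *v y) \<bullet> (P *v v)"
        unfolding q_def using A P(2) y v by (intro transpose_vec_mult_scalar) auto
      also have "\<dots> = y \<bullet> (A *v (P *v v))" using A P(2) y v by (intro transpose_vec_mult_scalar) auto
      finally show ?thesis by (simp add: bf_def)
    qed
    have "row r 0 = q" using q qv[OF unit_vec_carrier] by (intro eq_vecI) (auto simp: r_def)
    then show ?thesis using qv[OF v] by simp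
  qed
  have "trp Q * A * Q = row_enl k A1 r"
  proof (rule bf_eqI)
    show c: "trp Q * A * Q \<in> Mat (k + 2) (k + 2)" using Q A by auto
    show "row_enl k A1 r \<in> Mat (k + 2) (k + 2)" using row_enl_form(1)[OF A1 r] zero_carrier_vec by blast
    fix u u' :: "rat vec" assume u: "u \<in> Vec (k + 2)" "u' \<in> Vec (k + 2)"
    obtain v w where vw: "v \<in> Vec k" "w \<in> Vec 2" "u = v @\<^sub>v w" using append_vec_cases[OF u(1)] by blast
    obtain v' w' where vw': "v' \<in> Vec k" "w' \<in> Vec 2" "u' = v' @\<^sub>v w'" using append_vec_cases[OF u(2)] by blast
    have "bf (trp Q * A * Q) u u' = bf A (Q *v u) (Q *v u')" by (rule bf_congruence[OF A Q Q u, symmetric])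
    also have "\<dots> = bf A (P *v v) (P *v v') + w $ 0 * bf A y (P *v v') + w $ 1 * w' $ 0"
      unfolding vw(3) vw'(3) by (rule bQ[OF vw(1) vw'(1) vw(2) vw'(2)])
    also have "bf A (P *v v) (P *v v') = bf A1 v v'" unfolding A1_def by (rule bf_congruence[OF A P(2) P(2) vw(1) vw'(1)])
    finally show "bf (trp Q * A * Q) u u' = bf (row_enl k A1 r) u u'"
      unfolding vw(3) vw'(3) row_enl_form(2)[OF A1 r vw(1) vw'(1) vw(2) vw'(2)] rv[OF vw'(1)] .
  qed
  moreover have "S_step A (trp Q * A * Q)" by (rule S_step.congruence[OF A Qn dQ])
  moreover have s2: "S_step A1 (row_enl k A1 r)" unfolding row_enl_def by (rule S_step.row_enlargement[OF A1 r])
  ultimately have s1: "S_step A (row_enl k A1 r)" by simp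
  have "S_equivalent A A1" unfolding S_equivalent_def
    using s1 s2 by (meson r_into_equivclp equivclp_sym equivclp_trans)
  moreover have "det (sk A1) \<noteq> 0" using S_step_invariants[OF s1] S_step_invariants[OF s2] d by blast
  moreover have "k < n" using nk by simp
  ultimately show ?thesis using A1 by blast
qed

lemma S_equivalent_trans: "S_equivalent A B ==> S_equivalent B C ==> S_equivalent A C"
  unfolding S_equivalent_def by (rule equivclp_trans)

lemma S_equivalent_nonsingular:
  assumes "A \<in> Mat n n" "det (sk A) \<noteq> 0"
  shows "\<exists>m A'. A' \<in> Mat m m \<and> det A' \<noteq> 0 \<and> S_equivalent A A'"
  using assms
proof (induction n arbitrary: A rule: less_induct)
  case (less n)
  show ?case
  proof (cases "det A = 0")
    case True
    obtain k A1 where "k < n" "A1 \<in> Mat k k" "det (sk A1) \<noteq> 0" "S_equivalent A A1"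
      using Trotter_step[OF less.prems True] by blast
    then show ?thesis using less.IH S_equivalent_trans by blast
  next
    case False
    moreover have "S_equivalent A A" unfolding S_equivalent_def by simp
    ultimately show ?thesis using less.prems by blast
  qed
qed

text \<open>The symmetrization of an integral Seifert matrix agrees with the skew-symmetrization modulo 2.\<close>

lemma seifert_det_sp:
  assumes "seifert_matrix V"
  shows "det (sp (rm V)) \<noteq> 0"
proof -
  obtain n where V: "V \<in> Mat n n" and d: "det (sk V) = 1" using assms by (auto simp: seifert_matrix_sk)
  have m: "det A mod 2 = det (B :: int mat) mod 2"
    if A: "A \<in> Mat n n" and B: "B \<in> Mat n n" and AB: "\<And>i j. i < n ==> j < n ==> A $$ (i, j) mod 2 = B $$ (i, j) mod 2" for A B
  proof -
    have "signof p * (\<Prod>i = 0..<n. A $$ (i, p i)) mod 2 = signof p * (\<Prod>i = 0..<n. B $$ (i, p i)) mod (2::int)"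
      if p: "p permutes {0..<n}" for p
    proof -
      have "(\<Prod>i = 0..<n. A $$ (i, p i)) mod 2 = (\<Prod>i = 0..<n. A $$ (i, p i) mod 2) mod 2" by (simp add: mod_prod_eq)
      also have "(\<Prod>i = 0..<n. A $$ (i, p i) mod 2) = (\<Prod>i = 0..<n. B $$ (i, p i) mod 2)"
      proof (rule prod.cong[OF refl])
        fix i assume "i \<in> {0..<n}"
        then show "A $$ (i, p i) mod 2 = B $$ (i, p i) mod 2" using permutes_in_image[OF p, of i] by (intro AB) auto
      qed
      also have "(\<Prod>i = 0..<n. B $$ (i, p i) mod 2) mod 2 = (\<Prod>i = 0..<n. B $$ (i, p i)) mod 2" by (simp add: mod_prod_eq)
      finally show ?thesis using mod_mult_cong[OF refl] by blast
    qed
    then have "(\<Sum>p | p permutes {0..<n}. signof p * (\<Prod>i = 0..<n. A $$ (i, p i)) mod 2) =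
       (\<Sum>p | p permutes {0..<n}. signof p * (\<Prod>i = 0..<n. B $$ (i, p i)) mod (2::int))"
      by (intro sum.cong[OF refl]) blast
    then have "(\<Sum>p | p permutes {0..<n}. signof p * (\<Prod>i = 0..<n. A $$ (i, p i)) mod 2) mod 2 =
       (\<Sum>p | p permutes {0..<n}. signof p * (\<Prod>i = 0..<n. B $$ (i, p i)) mod 2) mod (2::int)"
      by (rule arg_cong)
    then show ?thesis unfolding det_def'[OF A] det_def'[OF B] mod_sum_eq .
  qed
  have "det (sp V) mod 2 = det (sk V) mod 2"
  proof (rule m)
    fix i j assume ij: "i < n" "j < n"
    have "(a + b) mod 2 = (a - b) mod 2" for a b :: int by presburger
    then show "sp V $$ (i, j) mod 2 = sk V $$ (i, j) mod 2" using V ij by (simp add: sp_def sk_def)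
  qed (use V in auto)
  then have "det (sp V) \<noteq> 0" using d by auto
  moreover have "sp (rm V) = rm (sp V)" using V by (intro eq_matI) (auto simp: sp_def)
  ultimately show ?thesis by simp
qed

section \<open>Isometric structures and Witt equivalence as a relation\<close>

lemma mat_eq_actI:
  assumes "A \<in> Mat n m" "B \<in> Mat n m" "\<And>v. v \<in> Vec m ==> A *v v = B *v (v :: 'a::comm_ring_1 vec)"
  shows "A = B"
proof (rule eq_matI)
  fix i j assume ij: "i < dim_row B" "j < dim_col B"
  have "A *v unit_vec m j = B *v unit_vec m j" by (intro assms) auto
  then have "(A *v unit_vec m j) $ i = (B *v unit_vec m j) $ i" by simp
  then show "A $$ (i, j) = B $$ (i, j)" using ij assms(1,2) by simp
qed (use assms in auto)

lemma bf_zero_mat: "x \<in> Vec n ==> y \<in> Vec m ==> bf (0\<^sub>m n m) x y = 0"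
  by (auto simp: bf_def scalar_prod_def)

lemma isometric_structureI:
  assumes "B \<in> Mat n n" "T \<in> Mat n n" "trp B = B" "det B \<noteq> 0"
    "\<And>x y. x \<in> Vec n ==> y \<in> Vec n ==> bf B (T *v x) (T *v y) = bf B x y"
  shows "isometric_structure n (B, T)"
proof -
  have "trp T * B * T = B"
    using assms by (intro bf_eqI[of _ n n]) (auto simp del: assoc_mult_mat simp flip: bf_congruence[of _ n n _ n _ n])
  then show ?thesis using assms by (simp add: isometric_structure_def)
qed

lemma isometric_structureD:
  assumes "isometric_structure n (B, T)"
  shows "B \<in> Mat n n" "T \<in> Mat n n" "trp B = B" "det B \<noteq> 0"
    "x \<in> Vec n ==> y \<in> Vec n ==> bf B (T *v x) (T *v y) = bf B x y"
    "x \<in> Vec n ==> y \<in> Vec n ==> bf B x y = bf B y x"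
proof -
  show c: "B \<in> Mat n n" "T \<in> Mat n n" "trp B = B" "det B \<noteq> 0"
    using assms by (auto simp: isometric_structure_def)
  have e: "trp T * B * T = B" using assms by (auto simp: isometric_structure_def)
  show "x \<in> Vec n ==> y \<in> Vec n ==> bf B (T *v x) (T *v y) = bf B x y"
    using bf_congruence[OF c(1,2,2)] e by simp
  show "x \<in> Vec n ==> y \<in> Vec n ==> bf B x y = bf B y x"
    using bf_transpose[OF c(1)] c(3) by metis
qed

lemma isometric_structure_dim: "isometric_structure n X ==> isometric_structure m X ==> n = m"
  by (cases X) (auto simp: isometric_structure_def)

definition wrel :: "nat => nat => iso_struct => iso_struct => (rat vec \<times> rat vec) set => bool" where
  "wrel n m X Y R \<longleftrightarrow> Lrel n m (fst X) (fst Y) R \<and> (\<forall>x y. (x, y) \<in> R --> (snd X *v x, snd Y *v y) \<in> R)"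

lemma isometric_structure_sum:
  assumes X: "isometric_structure n (B, T)" and Y: "isometric_structure m (B', T')"
  shows "isometric_structure (n + m) (B \<boxplus> - B', T \<boxplus> T')"
proof (rule isometric_structureI)
  note DX = isometric_structureD[OF X] and DY = isometric_structureD[OF Y]
  have mB: "- B' \<in> Mat m m" using DY(1) by simp
  show "B \<boxplus> - B' \<in> Mat (n + m) (n + m)" "T \<boxplus> T' \<in> Mat (n + m) (n + m)"
    using DX DY by (auto intro!: block_sum_carrier)
  show "det (B \<boxplus> - B') \<noteq> 0" using DX(1,4) DY(1,4) mB det_uminus_ne_0[OF DY(1)] by (simp add: det_block_sum[of _ n _ m])
  have i1: "B $$ (i, j) = B $$ (j, i)" if "i < n" "j < n" for i j
    using DX(3) that DX(1) by (metis carrier_matD index_transpose_mat(1))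
  have i2: "B' $$ (i, j) = B' $$ (j, i)" if "i < m" "j < m" for i j
    using DY(3) that DY(1) by (metis carrier_matD index_transpose_mat(1))
  show "trp (B \<boxplus> - B') = B \<boxplus> - B'"
    using DX(1) DY(1) i1 i2 by (intro eq_matI) (auto simp: block_sum_def)
  fix u v :: "rat vec" assume "u \<in> Vec (n + m)" "v \<in> Vec (n + m)"
  then obtain x y x' y' where "x \<in> Vec n" "y \<in> Vec m" "x' \<in> Vec n" "y' \<in> Vec m"
    "u = x @\<^sub>v y" "v = x' @\<^sub>v y'" by (metis append_vec_cases)
  then show "bf (B \<boxplus> - B') ((T \<boxplus> T') *v u) ((T \<boxplus> T') *v v) = bf (B \<boxplus> - B') u v"
    using DX DY mB by (simp add: block_sum_mult_vec[of _ n _ m] bf_block_sum[of _ n _ m] bf_uminus_mat[of _ m m])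
qed

lemma invariant_range_mat:
  fixes T :: "'a::comm_ring_1 mat"
  assumes T: "T \<in> Mat n n" and P: "P \<in> Mat n k"
    and inv: "\<And>v. v \<in> Vec k ==> \<exists>u\<in>Vec k. T *v (P *v v) = P *v u"
  shows "\<exists>S\<in>Mat k k. T * P = P * S"
proof -
  obtain u where u: "\<And>j. u j \<in> Vec k" "\<And>j. T *v (P *v unit_vec k j) = P *v u j"
    using inv[OF unit_vec_carrier] by metis
  define S where "S = mat k k (\<lambda>(i, j). u j $ i)"
  have S: "S \<in> Mat k k" by (simp add: S_def)
  have cS: "col S j = u j" if "j < k" for j using that u(1)[of j] by (intro eq_vecI) (auto simp: S_def)
  have ce: "A *v unit_vec k j = col A j" if "A \<in> Mat l k" "j < k" for A :: "'a mat" and j l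
    using that by (intro eq_vecI) auto
  have "T * P = P * S"
  proof (rule mat_col_eqI)
    fix j assume "j < dim_col (P * S)"
    then have j: "j < k" using S by simp
    have "col (T * P) j = T *v col P j" using T P j by (intro col_mult2) auto
    also have "\<dots> = P *v col S j" using u(2)[of j] ce[OF P j] cS[OF j] by simp
    also have "\<dots> = col (P * S) j" using S P j by (intro col_mult2[symmetric]) auto
    finally show "col (T * P) j = col (P * S) j" .
  qed (use T P S in auto)
  then show ?thesis using S by blast
qed

text \<open>A metabolizer given by a basis matrix becomes a Lagrangian relation closed under the
  pair of isometries. Transitivity of Witt equivalence is then composition of relations, with no
  cancellation argument.\<close>

lemma witt_equivalent_iff:
  assumes X: "isometric_structure n X" and Y: "isometric_structure m Y"
  shows "witt_equivalent X Y \<longleftrightarrow> (\<exists>R. wrel n m X Y R)"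
proof -
  obtain B T where Xe: "X = (B, T)" by (cases X)
  obtain B' T' where Ye: "Y = (B', T')" by (cases Y)
  note X' = X[unfolded Xe] and Y' = Y[unfolded Ye]
  note DX = isometric_structureD[OF X'] and DY = isometric_structureD[OF Y']
  let ?G = "B \<boxplus> - B'" and ?U = "T \<boxplus> T'"
  note S = isometric_structure_sum[OF X' Y']
  note DS = isometric_structureD[OF S]
  have Uxy: "?U *v (x @\<^sub>v y) = (T *v x) @\<^sub>v (T' *v y)" if "x \<in> Vec n" "y \<in> Vec m" for x y
    using that DX DY by (intro block_sum_mult_vec)
  show ?thesis
  proof
    assume "witt_equivalent X Y"
    then have "metabolic (?G, ?U)" by (simp add: witt_equivalent_def Xe Ye)
    then obtain k P Q where M: "isometric_structure (2 * k) (?G, ?U)" "P \<in> Mat (2 * k) k" "mat_kernel P = {0\<^sub>v k}"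
      "Q \<in> Mat k k" "?U * P = P * Q" "trp P * ?G * P = 0\<^sub>m k k"
      unfolding metabolic_def by blast
    have nk: "n + m = 2 * k" using isometric_structure_dim[OF S M(1)] .
    note P = M(2)[folded nk]
    define L where "L = (\<lambda>v. P *v v) ` Vec k"
    have iso: "bf ?G x y = 0" if h: "x \<in> L" "y \<in> L" for x y
    proof -
      obtain v w where vw: "v \<in> Vec k" "w \<in> Vec k" "x = P *v v" "y = P *v w" using h by (auto simp: L_def)
      have "bf ?G x y = bf (0\<^sub>m k k) v w" unfolding vw(3,4) bf_congruence[OF DS(1) P P vw(1,2)] M(6) ..
      also have "\<dots> = 0" by (rule bf_zero_mat[OF vw(1,2)])
      finally show ?thesis .
    qed
    have "Lagr (n + m) ?G L" by (rule basis_Lagr[OF P nk M(3) DS(1,4) L_def iso])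
    then have R: "Lrel n m B B' {(x, y). x \<in> Vec n \<and> y \<in> Vec m \<and> x @\<^sub>v y \<in> L}" (is "Lrel n m B B' ?R")
      by (rule Lagr_Lrel[OF DX(1) DY(1)])
    moreover have "(T *v x, T' *v y) \<in> ?R" if xy: "(x, y) \<in> ?R" for x y
    proof -
      have c: "x \<in> Vec n" "y \<in> Vec m" "x @\<^sub>v y \<in> L" using xy by auto
      then obtain v where v: "v \<in> Vec k" "x @\<^sub>v y = P *v v" by (auto simp: L_def)
      have "?U *v (P *v v) = (?U * P) *v v" using assoc_mult_mat_vec[OF DS(2) P v(1)] by simp
      also have "\<dots> = P *v (Q *v v)" unfolding M(5) by (rule assoc_mult_mat_vec[OF P M(4) v(1)])
      finally have "?U *v (x @\<^sub>v y) \<in> L" using v M(4) by (auto simp: L_def)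
      then show ?thesis using c DX DY Uxy[OF c(1,2)] by auto
    qed
    ultimately show "\<exists>R. wrel n m X Y R" unfolding wrel_def Xe Ye by auto
  next
    assume "\<exists>R. wrel n m X Y R"
    then obtain R where R: "Lrel n m B B' R" and inv: "\<And>x y. (x, y) \<in> R ==> (T *v x, T' *v y) \<in> R"
      unfolding wrel_def Xe Ye by auto
    have l: "linrel n m R" using R by (simp add: Lrel_def)
    obtain k P where P: "n + m = 2 * k" "P \<in> Mat (n + m) k" "mat_kernel P = {0\<^sub>v k}"
      "(\<lambda>v. P *v v) ` Vec k = rel_vecs R"
      using Lagr_basis[OF DS(1,4)] R Lrel_Lagr[OF DX(1) DY(1) l] by blast
    have L: "Lagr (n + m) ?G (rel_vecs R)" using R Lrel_Lagr[OF DX(1) DY(1) l] by blast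
    have "\<exists>u\<in>Vec k. ?U *v (P *v v) = P *v u" if v: "v \<in> Vec k" for v
    proof -
      have "P *v v \<in> rel_vecs R" using v P(4) by blast
      then obtain x y where xy: "(x, y) \<in> R" "P *v v = x @\<^sub>v y" by (auto simp: rel_vecs_def)
      have "?U *v (P *v v) = (T *v x) @\<^sub>v (T' *v y)" unfolding xy(2) using Uxy linrelD(1,2)[OF l xy(1)] by simp
      also have "\<dots> \<in> rel_vecs R" using inv[OF xy(1)] by (auto simp: rel_vecs_def)
      finally show ?thesis using P(4) by (auto simp: image_iff)
    qed
    then obtain Q where Q: "Q \<in> Mat k k" "?U * P = P * Q" using invariant_range_mat[OF DS(2) P(2)] by blast
    have "trp P * ?G * P = 0\<^sub>m k k"
    proof (rule bf_eqI)
      show "trp P * ?G * P \<in> Mat k k" using P(2) DS(1) by auto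
      fix v w :: "rat vec" assume vw: "v \<in> Vec k" "w \<in> Vec k"
      have "P *v v \<in> rel_vecs R" "P *v w \<in> rel_vecs R" using vw P(4) by blast+
      then have "bf ?G (P *v v) (P *v w) = 0" using L P(2) vw(1) unfolding Lagr_def by auto
      then show "bf (trp P * ?G * P) v w = bf (0\<^sub>m k k) v w"
        unfolding bf_congruence[OF DS(1) P(2,2) vw] bf_zero_mat[OF vw] .
    qed simp
    then have "metabolic (?G, ?U)" unfolding metabolic_def prod.case
      using S[unfolded P(1)] P(2)[unfolded P(1)] P(3) Q by blast
    then show "witt_equivalent X Y" unfolding witt_equivalent_def using X Y by (auto simp: Xe Ye)
  qed
qed

lemma wrel_comp:
  assumes "isometric_structure n X" "isometric_structure m Y" "isometric_structure p Z" "wrel n m X Y R" "wrel m p Y Z S"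
  shows "wrel n p X Z (R O S)"
proof -
  have "fst X \<in> Mat n n" "fst Y \<in> Mat m m" "fst Z \<in> Mat p p" "det (fst Y) \<noteq> 0"
    using assms(1-3) by (auto simp: isometric_structure_def split: prod.splits)
  then have "Lrel n p (fst X) (fst Z) (R O S)" using assms(4,5) unfolding wrel_def by (intro Lrel_comp) auto
  then show ?thesis using assms(4,5) unfolding wrel_def by blast
qed

lemma witt_trans:
  assumes "witt_equivalent X Y" "witt_equivalent Y Z"
  shows "witt_equivalent X Z"
proof -
  obtain n m p where i: "isometric_structure n X" "isometric_structure m Y" "isometric_structure p Z"
    using assms by (auto simp: witt_equivalent_def)
  then show ?thesis using assms wrel_comp[OF i] witt_equivalent_iff by blast
qed

lemma witt_sym:
  assumes "witt_equivalent X Y"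
  shows "witt_equivalent Y X"
proof -
  obtain n m where i: "isometric_structure n X" "isometric_structure m Y" using assms by (auto simp: witt_equivalent_def)
  then obtain R where "wrel n m X Y R" using assms witt_equivalent_iff by blast
  then have "wrel m n Y X (R\<inverse>)" unfolding wrel_def by (auto intro: Lrel_converse)
  then show ?thesis using witt_equivalent_iff[OF i(2,1)] by blast
qed

lemma seifert_structure:
  assumes A: "A \<in> Mat n n" "det A \<noteq> 0"
  shows "fst (seifert_structure A) = sp A" "snd (seifert_structure A) \<in> Mat n n" "A * snd (seifert_structure A) = trp A"
    "T \<in> Mat n n ==> A * T = trp A ==> snd (seifert_structure A) = T"
proof -
  show "fst (seifert_structure A) = sp A" by (simp add: seifert_structure_def sp_def)
  have "A \<in> Units (ring_mat TYPE(rat) n ())" by (rule det_non_zero_imp_unit[OF A])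
  then obtain A' where A': "mat_inverse A = Some A'" using mat_inverse(1)[OF A(1), where b = "()"] by (cases "mat_inverse A") auto
  have i: "A * A' = 1\<^sub>m n" "A' * A = 1\<^sub>m n" "A' \<in> Mat n n" using mat_inverse(2)[OF A(1) A'] by auto
  have T: "snd (seifert_structure A) = A' * trp A" by (simp add: seifert_structure_def A')
  show "snd (seifert_structure A) \<in> Mat n n" unfolding T using A i by simp
  have At: "trp A \<in> Mat n n" using A by simp
  have "A * (A' * trp A) = (A * A') * trp A" by (rule assoc_mult_mat[OF A(1) i(3) At, symmetric])
  also have "\<dots> = trp A" unfolding i(1) by (rule left_mult_one_mat[OF At])
  finally show "A * snd (seifert_structure A) = trp A" unfolding T .
  assume T': "T \<in> Mat n n" "A * T = trp A"
  have "A' * (A * T) = (A' * A) * T" by (rule assoc_mult_mat[OF i(3) A(1) T'(1), symmetric])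
  also have "\<dots> = T" unfolding i(2) by (rule left_mult_one_mat[OF T'(1)])
  finally show "snd (seifert_structure A) = T" unfolding T T'(2) .
qed

text \<open>The isometry is determined by \<open>A(x, T y) = A(y, x)\<close>; applying this twice
  shows that it preserves \<open>A\<close> itself, hence also the symmetrization.\<close>

lemma seifert_isometry:
  assumes A: "A \<in> Mat n n" and T: "T \<in> Mat n n" "A * T = trp A"
    and xy: "x \<in> Vec n" "y \<in> Vec n"
  shows "bf A x (T *v y) = bf A y (x :: 'a::comm_ring_1 vec)" "bf A (T *v x) (T *v y) = bf A x y"
proof -
  have *: "bf A x (T *v y) = bf A y x" if "x \<in> Vec n" "y \<in> Vec n" for x y
  proof -
    have "bf A x (T *v y) = bf (A * T) x y" by (rule bf_mult_right[OF A T(1) that(2)])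
    then show ?thesis unfolding T(2) using bf_transpose[OF A that] by simp
  qed
  show "bf A x (T *v y) = bf A y x" by (rule *[OF xy])
  have "bf A (T *v x) (T *v y) = bf A y (T *v x)" using T xy by (intro *) auto
  also have "\<dots> = bf A x y" by (rule *[OF xy(2,1)])
  finally show "bf A (T *v x) (T *v y) = bf A x y" .
qed

lemma seifert_isometric_structure:
  assumes A: "A \<in> Mat n n" "det A \<noteq> 0" and d: "det (sp A) \<noteq> 0"
  shows "isometric_structure n (seifert_structure A)"
proof -
  obtain B T where e: "seifert_structure A = (B, T)" by (cases "seifert_structure A")
  note S = seifert_structure[OF A]
  have B: "B = sp A" and T: "T \<in> Mat n n" "A * T = trp A" using S(1-3) e by auto
  show ?thesis unfolding e
  proof (rule isometric_structureI)
    show "trp B = B" unfolding B using A by (intro eq_matI) (auto simp: sp_def)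
    fix x y :: "rat vec" assume xy: "x \<in> Vec n" "y \<in> Vec n"
    then have c: "T *v x \<in> Vec n" "T *v y \<in> Vec n" using T by auto
    show "bf B (T *v x) (T *v y) = bf B x y"
      unfolding B bf_sp[OF A(1) c] bf_sp[OF A(1) xy] using seifert_isometry(2)[OF A(1) T xy] seifert_isometry(2)[OF A(1) T xy(2,1)] by simp
  qed (use A T d B in auto)
qed

text \<open>The relation is Lagrangian for the symmetrizations and also for the transposed Seifert
  forms, both by change of form. The second fact yields invariance: the pair of images under the
  isometries is orthogonal to the relation for the transposed forms, hence belongs to it.\<close>

lemma sim_witt_equivalent:
  assumes A: "A \<in> Mat n n" "det A \<noteq> 0" "det (sp A) \<noteq> 0" and B: "B \<in> Mat m m" "det B \<noteq> 0" "det (sp B) \<noteq> 0"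
    and sim: "sim A B"
  shows "witt_equivalent (seifert_structure A) (seifert_structure B)"
proof -
  obtain R where R: "Lrel n m (sk A) (sk B) R" "isotropic_rel A B R" "det (sk A) \<noteq> 0" "det (sk B) \<noteq> 0"
    using simE[OF sim A(1) B(1)] by blast
  have l: "linrel n m R" using R by (simp add: Lrel_def)
  note DR = linrelD[OF l]
  have iso': "isotropic_rel (trp A) (trp B) R"
    unfolding isotropic_rel_def
  proof (intro allI impI)
    fix x y x' y' assume r: "(x, y) \<in> R" "(x', y') \<in> R"
    have "bf A x' x = bf B y' y" using R(2) r unfolding isotropic_rel_def by blast
    then show "bf (trp A) x x' = bf (trp B) y y'"
      using bf_transpose[OF A(1)] bf_transpose[OF B(1)] DR(1,2) r by metis
  qed
  have isp: "isotropic_rel (sp A) (sp B) R"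
    unfolding isotropic_rel_def
  proof (intro allI impI)
    fix x y x' y' assume r: "(x, y) \<in> R" "(x', y') \<in> R"
    have "bf A x' x = bf B y' y" "bf A x x' = bf B y y'" using R(2) r unfolding isotropic_rel_def by blast+
    then show "bf (sp A) x x' = bf (sp B) y y'"
      using bf_sp[OF A(1)] bf_sp[OF B(1)] DR(1,2) r by metis
  qed
  have c: "sk A \<in> Mat n n" "sk B \<in> Mat m m" "sp A \<in> Mat n n" "sp B \<in> Mat m m"
    "trp A \<in> Mat n n" "trp B \<in> Mat m m" using A B by auto
  have d: "det (trp A) \<noteq> 0" "det (trp B) \<noteq> 0" using A B det_transpose by metis+
  have Rsp: "Lrel n m (sp A) (sp B) R" by (rule Lrel_change_form[OF c(1) R(3) c(2) R(4) c(3) A(3) c(4) B(3) R(1) isp])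
  have Rt: "Lrel n m (trp A) (trp B) R" by (rule Lrel_change_form[OF c(1) R(3) c(2) R(4) c(5) d(1) c(6) d(2) R(1) iso'])
  let ?T = "snd (seifert_structure A)" and ?U = "snd (seifert_structure B)"
  note SA = seifert_structure[OF A(1,2)] and SB = seifert_structure[OF B(1,2)]
  \<comment> \<open>Pairing with the images in the transposed forms reduces to the original pairings
    of \<open>A\<close> and \<open>B\<close>, on which the relation agrees.\<close>
  have "(?T *v x, ?U *v y) \<in> R" if r: "(x, y) \<in> R" for x y
  proof (rule Lrel_memI[OF Rt])
    have cc: "x \<in> Vec n" "y \<in> Vec m" using DR r by auto
    show "?T *v x \<in> Vec n" "?U *v y \<in> Vec m" using SA(2) SB(2) cc by auto
    fix x' y' assume r': "(x', y') \<in> R"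
    have cc': "x' \<in> Vec n" "y' \<in> Vec m" using DR r' by auto
    have "bf (trp A) (?T *v x) x' = bf A x' (?T *v x)" using SA(2) cc cc' by (intro bf_transpose[OF A(1)]) auto
    also have "\<dots> = bf A x x'" by (rule seifert_isometry(1)[OF A(1) SA(2,3) cc'(1) cc(1)])
    also have "\<dots> = bf B y y'" using R(2) r r' unfolding isotropic_rel_def by blast
    also have "\<dots> = bf B y' (?U *v y)" by (rule seifert_isometry(1)[OF B(1) SB(2,3) cc'(2) cc(2), symmetric])
    also have "\<dots> = bf (trp B) (?U *v y) y'" using SB(2) cc cc' by (intro bf_transpose[OF B(1), symmetric]) auto
    finally show "bf (trp A) (?T *v x) x' = bf (trp B) (?U *v y) y'" .
  qed
  then have "wrel n m (seifert_structure A) (seifert_structure B) R" unfolding wrel_def SA(1) SB(1) using Rsp by blast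
  then show ?thesis
    using witt_equivalent_iff[OF seifert_isometric_structure[OF A] seifert_isometric_structure[OF B]] by blast
qed

section \<open>Polynomials in an isometry and primary parts\<close>

lemma poly_mat_carrier [simp]: "T \<in> Mat n n ==> poly_mat p T \<in> Mat n n"
  by (auto simp: poly_mat_def)

lemma poly_mat_index:
  assumes "T \<in> Mat n n" "i < n" "j < n" "degree p \<le> N"
  shows "poly_mat p T $$ (i, j) = (\<Sum>k\<le>N. coeff p k * (T ^\<^sub>m k) $$ (i, j))"
proof -
  have "poly_mat p T $$ (i, j) = (\<Sum>k\<le>degree p. coeff p k * (T ^\<^sub>m k) $$ (i, j))" using assms by (simp add: poly_mat_def)
  also have "\<dots> = (\<Sum>k\<le>N. coeff p k * (T ^\<^sub>m k) $$ (i, j))"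
    using assms(4) by (intro sum.mono_neutral_left) (auto simp: coeff_eq_0)
  finally show ?thesis .
qed

lemma poly_mat_pCons:
  fixes T :: "'a::comm_ring_1 mat"
  assumes T: "T \<in> Mat n n"
  shows "poly_mat (pCons a p) T = a \<cdot>\<^sub>m 1\<^sub>m n + poly_mat p T * T"
proof (rule eq_matI)
  fix i j assume "i < dim_row (a \<cdot>\<^sub>m 1\<^sub>m n + poly_mat p T * T)" "j < dim_col (a \<cdot>\<^sub>m 1\<^sub>m n + poly_mat p T * T)"
  then have ij: "i < n" "j < n" using T carrier_matD[OF poly_mat_carrier[OF T, of p]] by auto
  have pc: "T ^\<^sub>m k \<in> Mat n n" for k using T by simp
  have pm: "poly_mat p T \<in> Mat n n" by (rule poly_mat_carrier[OF T])
  have pmT: "poly_mat p T * T \<in> Mat n n" by (rule mult_carrier_mat[OF pm T])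
  have "poly_mat (pCons a p) T $$ (i, j) = (\<Sum>k\<le>Suc (degree p). coeff (pCons a p) k * (T ^\<^sub>m k) $$ (i, j))"
    by (rule poly_mat_index[OF T ij]) (rule degree_pCons_le)
  also have "\<dots> = a * 1\<^sub>m n $$ (i, j) + (\<Sum>k\<le>degree p. coeff p k * (T ^\<^sub>m k * T) $$ (i, j))"
    using T by (subst sum.atMost_Suc_shift) simp
  also have "(\<Sum>k\<le>degree p. coeff p k * (T ^\<^sub>m k * T) $$ (i, j)) = (\<Sum>k\<le>degree p. \<Sum>l<n. coeff p k * ((T ^\<^sub>m k) $$ (i, l) * T $$ (l, j)))"
    using T ij pc by (auto simp: scalar_prod_def atLeast0LessThan sum_distrib_left intro!: sum.cong)
  also have "\<dots> = (\<Sum>l<n. \<Sum>k\<le>degree p. coeff p k * (T ^\<^sub>m k) $$ (i, l) * T $$ (l, j))"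
    by (subst sum.swap) (simp add: mult.assoc)
  also have "\<dots> = (\<Sum>l<n. poly_mat p T $$ (i, l) * T $$ (l, j))"
    using ij by (intro sum.cong refl) (simp add: poly_mat_index[OF T _ _ order_refl] sum_distrib_right)
  also have "\<dots> = (poly_mat p T * T) $$ (i, j)"
    using T ij carrier_matD[OF pm] by (simp add: scalar_prod_def atLeast0LessThan)
  finally show "poly_mat (pCons a p) T $$ (i, j) = (a \<cdot>\<^sub>m 1\<^sub>m n + poly_mat p T * T) $$ (i, j)"
    using ij carrier_matD[OF pmT] by (simp del: index_mult_mat(1))
qed (use T carrier_matD[OF poly_mat_carrier[OF T]] in auto)

text \<open>Polynomials are made to act on vectors, so that the algebra is done by induction on
  coefficients rather than with matrix powers.\<close>

definition pact :: "'a::comm_ring_1 mat => 'a poly => 'a vec => 'a vec" where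
  "pact T p v = poly_mat p T *v v"

lemma pact_carrier [simp]: "T \<in> Mat n n ==> v \<in> Vec n ==> pact T p v \<in> Vec n"
  by (auto simp: pact_def intro: mult_mat_vec_carrier[OF poly_mat_carrier])

lemma pact_pCons:
  assumes T: "T \<in> Mat n n" and v: "v \<in> Vec n"
  shows "pact T (pCons a p) v = a *s v + pact T p (T *v v)"
proof -
  have c: "a \<cdot>\<^sub>m 1\<^sub>m n \<in> Mat n n" "poly_mat p T * T \<in> Mat n n"
    using mult_carrier_mat[OF poly_mat_carrier[OF T, of p] T] by auto
  have "pact T (pCons a p) v = (a \<cdot>\<^sub>m 1\<^sub>m n) *v v + (poly_mat p T * T) *v v"
    unfolding pact_def poly_mat_pCons[OF T] by (rule add_mult_distrib_mat_vec[OF c v])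
  also have "(a \<cdot>\<^sub>m 1\<^sub>m n) *v v = a *s v" using v by (intro eq_vecI) auto
  also have "(poly_mat p T * T) *v v = pact T p (T *v v)" unfolding pact_def by (rule assoc_mult_mat_vec[OF poly_mat_carrier[OF T] T v])
  finally show ?thesis .
qed

lemma pact_0: "T \<in> Mat n n ==> v \<in> Vec n ==> pact T 0 v = 0\<^sub>v n"
  unfolding pact_def by (intro eq_vecI) (auto simp: poly_mat_def scalar_prod_def)

lemma pact_zero_vec: "T \<in> Mat n n ==> pact T p (0\<^sub>v n) = 0\<^sub>v n"
  unfolding pact_def by (rule mult_mat_zero_vec[OF poly_mat_carrier])

lemma pact_vec_add: "T \<in> Mat n n ==> v \<in> Vec n ==> w \<in> Vec n ==> pact T p (v + w) = pact T p v + pact T p w"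
  unfolding pact_def by (rule mult_add_distrib_mat_vec[OF poly_mat_carrier])

lemma pact_vec_smult: "T \<in> Mat n n ==> v \<in> Vec n ==> pact T p (c *s v) = c *s pact T p v"
  unfolding pact_def by (rule mult_mat_vec_smult[OF poly_mat_carrier])

lemma vec_add_combine: "v \<in> Vec n ==> x \<in> Vec n ==> y \<in> Vec n ==>
  (a + b) *s v + (x + y) = (a *s v + x) + (b *s v + (y :: 'a::comm_ring_1 vec))"
  by (intro eq_vecI) (auto simp: algebra_simps)

lemma vec_smult_combine: "v \<in> Vec n ==> x \<in> Vec n ==>
  (c * a) *s v + c *s x = c *s (a *s v + (x :: 'a::comm_ring_1 vec))"
  by (intro eq_vecI) (auto simp: algebra_simps)

lemma vec_zero_smult_add: "v \<in> Vec n ==> x \<in> Vec n ==> 0 *s v + x = (x :: 'a::comm_ring_1 vec)"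
  by (intro eq_vecI) auto

lemma smult_zero_vec': "c *s 0\<^sub>v n = (0\<^sub>v n :: 'a::comm_ring_1 vec)"
  by (intro eq_vecI) auto

lemma pact_add:
  assumes T: "T \<in> Mat n n"
  shows "v \<in> Vec n ==> pact T (p + q) v = pact T p v + pact T q v"
proof (induction p q arbitrary: v rule: poly_induct2)
  case 0
  then show ?case by (simp add: pact_0[OF T])
next
  case (pCons a p b q)
  have Tv: "T *v v \<in> Vec n" using T pCons.prems by simp
  show ?case unfolding add_pCons pact_pCons[OF T pCons.prems] pCons.IH[OF Tv]
    by (rule vec_add_combine[OF pCons.prems pact_carrier[OF T Tv] pact_carrier[OF T Tv]])
qed

lemma pact_smult:
  assumes T: "T \<in> Mat n n"
  shows "v \<in> Vec n ==> pact T (Polynomial.smult c p) v = c *s pact T p v"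
proof (induction p arbitrary: v)
  case 0
  then show ?case by (simp add: pact_0[OF T] smult_zero_vec')
next
  case (pCons a p)
  have Tv: "T *v v \<in> Vec n" using T pCons.prems by simp
  show ?case unfolding smult_pCons pact_pCons[OF T pCons.prems] pCons.IH[OF Tv]
    by (rule vec_smult_combine[OF pCons.prems pact_carrier[OF T Tv]])
qed

lemma pact_commute:
  assumes T: "T \<in> Mat n n"
  shows "v \<in> Vec n ==> T *v pact T p v = pact T p (T *v v)"
proof (induction p arbitrary: v)
  case 0
  then show ?case using T by (simp add: pact_0[OF T] mult_mat_zero_vec[OF T])
next
  case (pCons a p)
  have Tv: "T *v v \<in> Vec n" using T pCons.prems by simp
  show ?case unfolding pact_pCons[OF T pCons.prems] pact_pCons[OF T Tv] pCons.IH[OF Tv, symmetric]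
    using pCons.prems pact_carrier[OF T Tv]
    by (simp add: mult_add_distrib_mat_vec[OF T] mult_mat_vec_smult[OF T])
qed

lemma pact_mult:
  assumes T: "T \<in> Mat n n"
  shows "v \<in> Vec n ==> pact T (p * q) v = pact T p (pact T q v)"
proof (induction p arbitrary: v)
  case 0
  then show ?case by (simp add: pact_0[OF T] pact_0[OF T pact_carrier[OF T]])
next
  case (pCons a p)
  have Tv: "T *v v \<in> Vec n" using T pCons.prems by simp
  have qv: "pact T q v \<in> Vec n" using T pCons.prems by simp
  have "pact T (pCons a p * q) v = a *s pact T q v + pact T (pCons 0 (p * q)) v"
    unfolding mult_pCons_left pact_add[OF T pCons.prems] pact_smult[OF T pCons.prems] ..
  also have "pact T (pCons 0 (p * q)) v = pact T p (pact T q (T *v v))"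
    unfolding pact_pCons[OF T pCons.prems] pCons.IH[OF Tv]
    by (rule vec_zero_smult_add[OF pCons.prems pact_carrier[OF T pact_carrier[OF T Tv]]])
  also have "a *s pact T q v + \<dots> = pact T (pCons a p) (pact T q v)"
    unfolding pact_pCons[OF T qv] pact_commute[OF T pCons.prems] ..
  finally show ?case .
qed

lemma pact_1: "T \<in> Mat n n ==> v \<in> Vec n ==> pact T 1 v = v"
  unfolding one_pCons by (simp add: pact_pCons pact_0) 

lemma pact_append:
  assumes T: "T \<in> Mat n n" and S: "S \<in> Mat m m"
  shows "x \<in> Vec n ==> y \<in> Vec m ==> pact (T \<boxplus> S) p (x @\<^sub>v y) = pact T p x @\<^sub>v pact S p y"
proof (induction p arbitrary: x y)
  case 0
  have "x @\<^sub>v y \<in> Vec (n + m)" using 0 by simp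
  then show ?case using 0 by (simp add: pact_0[OF T] pact_0[OF S] pact_0[OF block_sum_carrier[OF T S]] append_vec_zero)
next
  case (pCons a p)
  note xy = pCons.prems
  have c: "T *v x \<in> Vec n" "S *v y \<in> Vec m" using T S xy by auto
  have "x @\<^sub>v y \<in> Vec (n + m)" using xy by simp
  then show ?case
    unfolding pact_pCons[OF block_sum_carrier[OF T S] \<open>x @\<^sub>v y \<in> Vec (n + m)\<close>] pact_pCons[OF T xy(1)] pact_pCons[OF S xy(2)]
      block_sum_mult_vec[OF T S xy] pCons.IH[OF c] append_vec_smult
    using xy c T S by (intro append_vec_add') auto
qed

lemma wrel_pact:
  assumes R: "linrel n m R" and T: "T \<in> Mat n n" and S: "S \<in> Mat m m"
    and inv: "\<And>x y. (x, y) \<in> R ==> (T *v x, S *v y) \<in> R"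
  shows "(x, y) \<in> R ==> (pact T p x, pact S p y) \<in> R"
proof (induction p arbitrary: x y)
  case 0
  then show ?case using linrelD[OF R] by (simp add: pact_0[OF T] pact_0[OF S])
next
  case (pCons a p)
  have c: "x \<in> Vec n" "y \<in> Vec m" using linrelD[OF R] pCons.prems by auto
  show ?case unfolding pact_pCons[OF T c(1)] pact_pCons[OF S c(2)]
    using linrelD(4,5)[OF R] pCons.IH[OF inv[OF pCons.prems]] pCons.prems by blast
qed

text \<open>The adjoint of an isometry is its inverse, so the adjoint of \<open>p(T)\<close> is the
  reflected polynomial in \<open>T\<close> divided by \<open>T ^ degree p\<close>. Moving that power
  to the other argument keeps the statement free of inverses.\<close>

lemma bf_pact_adjoint:
  assumes I: "isometric_structure n (B, T)"
  shows "x \<in> Vec n ==> w \<in> Vec n ==> bf B x (pact T p w) = bf B (pact T (reflect_poly p) x) (pact T (monom 1 (degree p)) w)"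
proof (induction p arbitrary: w)
  case 0
  note D = isometric_structureD[OF I]
  then show ?case using 0 by (simp add: pact_0[OF D(2)] pact_1[OF D(2)])
next
  case (pCons a p)
  note D = isometric_structureD[OF I]
  note x = pCons.prems(1) and w = pCons.prems(2)
  have Tw: "T *v w \<in> Vec n" using D w by simp
  have monom_Suc: "pact T (monom 1 (Suc d)) v = pact T (monom 1 d) (T *v v)" if "v \<in> Vec n" for v d
    unfolding monom_Suc pact_pCons[OF D(2) that]
    by (rule vec_zero_smult_add[OF that pact_carrier[OF D(2)]]) (use that D(2) in simp)
  have iso: "bf B (pact T (monom 1 d) u) (pact T (monom 1 d) v) = bf B u v" if "u \<in> Vec n" "v \<in> Vec n" for u v d
    using that
  proof (induction d arbitrary: u v)
    case 0
    then show ?case by (simp add: pact_1[OF D(2)])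
  next
    case (Suc d)
    have c: "T *v u \<in> Vec n" "T *v v \<in> Vec n" using D Suc.prems by auto
    show ?case unfolding monom_Suc[OF Suc.prems(1)] monom_Suc[OF Suc.prems(2)] Suc.IH[OF c] by (rule D(5)[OF Suc.prems])
  qed
  show ?case
  proof (cases "p = 0")
    case True
    have Tx: "T *v x \<in> Vec n" using D x by simp
    have "pact T [:a:] v = a *s v" if "v \<in> Vec n" "T *v v \<in> Vec n" for v
      unfolding pact_pCons[OF D(2) that(1)] pact_0[OF D(2) that(2)] using that(1) by (intro eq_vecI) auto
    then show ?thesis using True x w Tx Tw
      by (simp add: pact_1[OF D(2)] bf_smult_left[OF D(1)] bf_smult_right[OF D(1)])
  next
    case False
    have dg: "degree (pCons a p) = Suc (degree p)" using False by simp
    have m: "pact T (monom a (Suc (degree p))) x = a *s pact T (monom 1 (Suc (degree p))) x"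
      using pact_smult[OF D(2) x, of a "monom 1 (Suc (degree p))"] by (simp add: smult_monom)
    have cs: "pact T (reflect_poly p) x \<in> Vec n" "pact T (monom 1 (Suc (degree p))) x \<in> Vec n"
      "pact T (monom 1 (Suc (degree p))) w \<in> Vec n" "pact T p (T *v w) \<in> Vec n"
      using D(2) x w Tw by auto
    have "bf B (pact T (reflect_poly (pCons a p)) x) (pact T (monom 1 (degree (pCons a p))) w)
      = bf B (pact T (reflect_poly p) x) (pact T (monom 1 (Suc (degree p))) w) + a * bf B (pact T (monom 1 (Suc (degree p))) x) (pact T (monom 1 (Suc (degree p))) w)"
      unfolding dg reflect_poly_pCons'[OF False] pact_add[OF D(2) x] m using cs
      by (simp add: bf_add_left[OF D(1)] bf_smult_left[OF D(1)])
    also have "\<dots> = bf B x (pact T p (T *v w)) + a * bf B x w"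
      unfolding iso[OF x w] unfolding monom_Suc[OF w] pCons.IH[OF x Tw] ..
    also have "\<dots> = bf B x (pact T (pCons a p) w)"
      unfolding pact_pCons[OF D(2) w] using x w cs by (simp add: bf_add_right[OF D(1)] bf_smult_right[OF D(1)])
    finally show ?thesis by simp
  qed
qed

text \<open>The \<open>n * n + 1\<close> powers of \<open>T\<close> up to exponent
  \<open>n * n\<close> are dependent in a space of dimension \<open>n * n\<close>; the index
  \<open>r\<close> encodes the matrix position \<open>(r div n, r mod n)\<close>.\<close>

lemma annihilating_poly:
  fixes T :: "'a::field mat"
  assumes T: "T \<in> Mat n n"
  shows "\<exists>g. g \<noteq> 0 \<and> (\<forall>v\<in>Vec n. pact T g v = 0\<^sub>v n)"
proof -
  define M where "M = mat (n * n) (n * n + 1) (\<lambda>(r, k). (T ^\<^sub>m k) $$ (r div n, r mod n))"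
  obtain c where c: "c \<in> Vec (n * n + 1)" "c \<noteq> 0\<^sub>v (n * n + 1)" "M *v c = 0\<^sub>v (n * n)"
    using underdetermined[of M "n * n" "n * n + 1"] by (auto simp: M_def)
  define g where "g = (\<Sum>k\<le>n * n. monom (c $ k) k)"
  have cg: "coeff g k = (if k \<le> n * n then c $ k else 0)" for k
    unfolding g_def by (simp add: coeff_sum coeff_monom)
  have "g \<noteq> 0"
  proof
    assume "g = 0"
    then have "c $ k = 0" if "k \<le> n * n" for k using cg[of k] that by simp
    then have "c = 0\<^sub>v (n * n + 1)" using c(1) by (intro eq_vecI) auto
    then show False using c(2) by simp
  qed
  moreover have "poly_mat g T = 0\<^sub>m n n"
  proof (rule eq_matI)
    fix i j assume "i < dim_row (0\<^sub>m n n :: 'a mat)" "j < dim_col (0\<^sub>m n n :: 'a mat)"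
    then have ij: "i < n" "j < n" by auto
    have "degree g \<le> n * n" by (intro degree_le) (simp add: cg)
    from poly_mat_index[OF T ij this]
    have 1: "poly_mat g T $$ (i, j) = (\<Sum>k\<le>n * n. c $ k * (T ^\<^sub>m k) $$ (i, j))" by (simp add: cg)
    have r: "n * i + j < n * n"
    proof -
      have "n * i + j < n * i + n" using ij by simp
      also have "\<dots> = n * Suc i" by simp
      also have "\<dots> \<le> n * n" using ij by (intro mult_le_mono2) simp
      finally show ?thesis .
    qed
    have dm: "(n * i + j) div n = i" "(n * i + j) mod n = j" using ij by simp_all
    have "0 = (M *v c) $ (n * i + j)" using c(3) r by simp
    also have "\<dots> = (\<Sum>k<n * n + 1. M $$ (n * i + j, k) * c $ k)"
      using r c(1) by (auto simp: M_def scalar_prod_def atLeast0LessThan)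
    also have "\<dots> = (\<Sum>k<n * n + 1. (T ^\<^sub>m k) $$ (i, j) * c $ k)"
      using r dm by (intro sum.cong refl) (auto simp: M_def)
    also have "\<dots> = poly_mat g T $$ (i, j)" unfolding 1 by (simp add: mult.commute lessThan_Suc_atMost)
    finally show "poly_mat g T $$ (i, j) = 0\<^sub>m n n $$ (i, j)" using ij by simp
  qed (use poly_mat_carrier[OF T, of g] in auto)
  ultimately show ?thesis unfolding pact_def by (intro exI[of _ g]) auto
qed

lemma rpoly_reflect: "z \<noteq> 0 ==> rpoly (reflect_poly p) z = z ^ degree p * rpoly p (inverse z)"
proof (induction p)
  case (pCons a p)
  show ?case
  proof (cases "p = 0")
    case True
    then show ?thesis by simp
  next
    case False
    have "rpoly (reflect_poly (pCons a p)) z = z ^ degree p * rpoly p (inverse z) + of_rat a * z ^ Suc (degree p)"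
      unfolding reflect_poly_pCons'[OF False] using pCons by simp
    also have "\<dots> = z ^ Suc (degree p) * (of_rat a + inverse z * rpoly p (inverse z))"
    proof -
      have "z ^ Suc (degree p) * (inverse z * rpoly p (inverse z)) = z ^ degree p * rpoly p (inverse z)"
        using pCons.prems by simp
      then show ?thesis by (simp only: distrib_left) (simp add: mult.commute)
    qed
    finally show ?thesis using False by simp
  qed
qed simp

text \<open>The reflected polynomial vanishes at \<open>z\<close> because the original vanishes at
  \<open>inverse z\<close>; comparing degrees, it is a constant multiple.\<close>

lemma reflect_min_poly:
  assumes z: "reciprocal z"
  shows "\<exists>c. reflect_poly (min_poly z) = Polynomial.smult c (min_poly z)"
proof -
  let ?q = "min_poly z"
  note M = reciprocalD[OF z]
  have q0: "?q \<noteq> 0" using M(2) by auto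
  have "rpoly (reflect_poly ?q) z = 0" using rpoly_reflect[OF M(1)] M(6) by simp
  then have "?q dvd reflect_poly ?q" using M(4) by blast
  then obtain s where s: "reflect_poly ?q = ?q * s" by (auto simp: dvd_def)
  have "s \<noteq> 0" using s q0 by auto
  then have "degree ?q + degree s \<le> degree ?q"
    using degree_reflect_poly_le[of ?q] q0 unfolding s by (simp add: degree_mult_eq)
  then have "degree s = 0" by simp
  then obtain c where "s = [:c:]" by (rule degree_eq_zeroE)
  then show ?thesis using s by auto
qed

lemma primary_kernel:
  fixes T :: "rat mat"
  assumes T: "T \<in> Mat n n"
  shows "(\<Union>k. mat_kernel (poly_mat (q ^ k) T)) = {v \<in> Vec n. \<exists>k. pact T (q ^ k) v = 0\<^sub>v n}"
  using carrier_matD[OF poly_mat_carrier[OF T]] unfolding mat_kernel_def pact_def by auto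

text \<open>The product of annihilating polynomials is split into \<open>q ^ K\<close> and a factor
  \<open>h\<close> coprime to \<open>q\<close>. Then \<open>b * h\<close> projects onto the
  \<open>q\<close>-primary part in both spaces at once, which is needed to project a relation
  between them; \<open>K\<close> bounds the exponents in both.\<close>

lemma primary_bezout:
  fixes T :: "rat mat"
  assumes q: "irreducible q" and T: "T \<in> Mat n n" and S: "S \<in> Mat m m"
  shows "\<exists>K a b h. a * q ^ K + b * h = 1 \<and> (\<forall>v\<in>Vec n. pact T (q ^ K * h) v = 0\<^sub>v n) \<and>
    (\<forall>v\<in>Vec m. pact S (q ^ K * h) v = 0\<^sub>v m) \<and>
    (\<forall>v\<in>Vec n. (\<exists>k. pact T (q ^ k) v = 0\<^sub>v n) --> pact T (q ^ K) v = 0\<^sub>v n) \<and>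
    (\<forall>v\<in>Vec m. (\<exists>k. pact S (q ^ k) v = 0\<^sub>v m) --> pact S (q ^ K) v = 0\<^sub>v m)"
proof -
  obtain g1 where g1: "g1 \<noteq> 0" "\<And>v. v \<in> Vec n ==> pact T g1 v = 0\<^sub>v n" using annihilating_poly[OF T] by blast
  obtain g2 where g2: "g2 \<noteq> 0" "\<And>v. v \<in> Vec m ==> pact S g2 v = 0\<^sub>v m" using annihilating_poly[OF S] by blast
  have "g1 * g2 \<noteq> 0" using g1 g2 by simp
  moreover have "\<not> is_unit q" using q by (rule irreducible_not_unit)
  ultimately obtain h where h: "g1 * g2 = q ^ multiplicity q (g1 * g2) * h" "\<not> q dvd h"
    using multiplicity_decompose' by metis
  define K where "K = multiplicity q (g1 * g2)"
  have "coprime q h" using h(2) q by (intro prime_elem_imp_coprime) (simp_all add: irreducible_imp_prime_elem)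
  then have co: "coprime (q ^ k) h" for k by simp
  have bez: "\<exists>a b. a * q ^ k + b * h = 1" for k
    using bezout_coefficients_fst_snd[of "q ^ k" h] co[of k] by (metis coprime_imp_gcd_eq_1)
  obtain a b where ab: "a * q ^ K + b * h = 1" using bez by blast
  have kill: "pact T (q ^ K * h) v = 0\<^sub>v n" if "v \<in> Vec n" for v
    using g1(2)[OF pact_carrier[OF T that]] pact_mult[OF T that, of g1 g2] h(1) by (simp add: K_def)
  have kill2: "pact S (q ^ K * h) v = 0\<^sub>v m" if "v \<in> Vec m" for v
    using g2(2)[OF that] pact_mult[OF S that, of g1 g2] pact_zero_vec[OF S] h(1) by (simp add: K_def)
  have gen: "pact U (q ^ K) v = 0\<^sub>v l"
    if U: "U \<in> Mat l l" and v: "v \<in> Vec l" and k: "pact U (q ^ k) v = 0\<^sub>v l" and kl: "pact U (q ^ K * h) v = 0\<^sub>v l"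
    for U :: "rat mat" and l v k
  proof -
    obtain a' b' where ab': "a' * q ^ k + b' * h = 1" using bez by blast
    have "q ^ K = (q ^ K * a') * q ^ k + b' * (q ^ K * h)"
      using arg_cong[OF ab', of "\<lambda>x. q ^ K * x"] by (simp add: algebra_simps)
    then have "pact U (q ^ K) v = pact U ((q ^ K * a') * q ^ k) v + pact U (b' * (q ^ K * h)) v"
      using pact_add[OF U v] by metis
    also have "\<dots> = 0\<^sub>v l + 0\<^sub>v l" unfolding pact_mult[OF U v, of "q ^ K * a'"] pact_mult[OF U v, of b'] k kl pact_zero_vec[OF U] ..
    finally show ?thesis by simp
  qed
  show ?thesis
    by (intro exI[of _ K] exI[of _ a] exI[of _ b] exI[of _ h]) (use ab kill kill2 gen[OF T] gen[OF S] in blast)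
qed

text \<open>For a self-reciprocal \<open>q\<close> the adjoint of \<open>q ^ k\<close> is
  \<open>q ^ k\<close> up to an isometry and a constant, so its kernel is orthogonal to its
  image.\<close>

lemma adjoint_vanishing:
  assumes I: "isometric_structure n (B, T)" and c: "reflect_poly q = Polynomial.smult c q"
    and x: "x \<in> Vec n" "pact T (q ^ k) x = 0\<^sub>v n" and w: "w \<in> Vec n"
  shows "bf B x (pact T (q ^ k) w) = 0"
proof -
  note D = isometric_structureD[OF I]
  have "reflect_poly (q ^ k) = Polynomial.smult (c ^ k) (q ^ k)" unfolding reflect_poly_power c by (rule smult_power)
  then have "pact T (reflect_poly (q ^ k)) x = 0\<^sub>v n" using pact_smult[OF D(2) x(1)] x(2) smult_zero_vec' by simp
  then show ?thesis using bf_pact_adjoint[OF I x(1) w, of "q ^ k"] bf_zero_left[OF D(1) pact_carrier[OF D(2) w]] by simp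
qed

text \<open>Nonsingularity of the restricted form is the point: the space is the sum of the primary
  part and the image of \<open>q ^ K\<close>, and these are orthogonal, so a radical vector of the
  restriction is radical in the whole space.\<close>

lemma primary_partD:
  assumes I: "isometric_structure n (B, T)" and q: "irreducible q" and c: "reflect_poly q = Polynomial.smult c q"
    and pp: "primary_part q (B, T) X"
  shows "\<exists>m P. isometric_structure m X \<and> P \<in> Mat n m \<and> mat_kernel P = {0\<^sub>v m} \<and>
    (\<lambda>v. P *v v) ` Vec m = {v \<in> Vec n. \<exists>k. pact T (q ^ k) v = 0\<^sub>v n} \<and>
    fst X = trp P * B * P \<and> T * P = P * snd X"
proof -
  note D = isometric_structureD[OF I]
  obtain B' T' where X: "X = (B', T')" by (cases X)
  obtain m P where P: "P \<in> Mat n m" "mat_kernel P = {0\<^sub>v m}"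
    "(\<lambda>v. P *v v) ` Vec m = {v \<in> Vec n. \<exists>k. pact T (q ^ k) v = 0\<^sub>v n}"
    "B' = trp P * B * P" "T' \<in> Mat m m" "T * P = P * T'"
    using pp D(2) unfolding primary_part_def X prod.case primary_kernel[OF D(2)] by auto
  have B': "B' \<in> Mat m m" unfolding P(4) using P(1) D(1) by auto
  have b: "bf B' u v = bf B (P *v u) (P *v v)" if "u \<in> Vec m" "v \<in> Vec m" for u v
    unfolding P(4) using bf_congruence[OF D(1) P(1) P(1) that] by simp
  have TP: "T *v (P *v v) = P *v (T' *v v)" if "v \<in> Vec m" for v
    using assoc_mult_mat_vec[OF D(2) P(1) that] assoc_mult_mat_vec[OF P(1) P(5) that] P(6) by simp
  have "isometric_structure m X" unfolding X
  proof (rule isometric_structureI[OF B' P(5)])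
    show "trp B' = B'"
    proof (rule bf_eqI[OF _ B'])
      show "trp B' \<in> Mat m m" using B' by simp
      fix x y :: "rat vec" assume xy: "x \<in> Vec m" "y \<in> Vec m"
      have "P *v x \<in> Vec n" "P *v y \<in> Vec n" using P(1) xy by auto
      then show "bf (trp B') x y = bf B' x y"
        unfolding bf_transpose[OF B' xy] b[OF xy] b[OF xy(2,1)] by (intro D(6))
    qed
    fix x y :: "rat vec" assume xy: "x \<in> Vec m" "y \<in> Vec m"
    have cc: "T' *v x \<in> Vec m" "T' *v y \<in> Vec m" "P *v x \<in> Vec n" "P *v y \<in> Vec n" using P(1,5) xy by auto
    show "bf B' (T' *v x) (T' *v y) = bf B' x y"
      unfolding b[OF cc(1,2)] b[OF xy] TP[OF xy(1), symmetric] TP[OF xy(2), symmetric] by (rule D(5)[OF cc(3,4)])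
  next
    obtain K a bb h where K: "a * q ^ K + bb * h = 1" "\<And>v. v \<in> Vec n ==> pact T (q ^ K * h) v = 0\<^sub>v n"
      "\<And>v. v \<in> Vec n ==> \<exists>k. pact T (q ^ k) v = 0\<^sub>v n ==> pact T (q ^ K) v = 0\<^sub>v n"
      using primary_bezout[OF q D(2) D(2)] by blast
    have "x = 0\<^sub>v m" if x: "x \<in> Vec m" and perp: "\<And>y. y \<in> Vec m ==> bf B' x y = 0" for x
    proof -
      have Px: "P *v x \<in> Vec n" using P(1) x by simp
      have "P *v x \<in> {v \<in> Vec n. \<exists>k. pact T (q ^ k) v = 0\<^sub>v n}" using P(3) x by blast
      then have Kx: "pact T (q ^ K) (P *v x) = 0\<^sub>v n" using K(3) by blast
      have "bf B (P *v x) y = 0" if y: "y \<in> Vec n" for y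
      proof -
        \<comment> \<open>The Bezout identity splits \<open>y\<close> into an image of
          \<open>q ^ K\<close> and a primary vector.\<close>
        have "y = pact T (q ^ K * a + bb * h) y" using K(1) pact_1[OF D(2) y] by (simp add: mult.commute)
        also have "\<dots> = pact T (q ^ K) (pact T a y) + pact T (bb * h) y"
          unfolding pact_add[OF D(2) y] pact_mult[OF D(2) y, of "q ^ K"] ..
        finally have e: "y = pact T (q ^ K) (pact T a y) + pact T (bb * h) y" .
        have c1: "pact T (q ^ K) (pact T a y) \<in> Vec n" "pact T (bb * h) y \<in> Vec n" "pact T a y \<in> Vec n"
          using D(2) y by auto
        have "pact T (q ^ K) (pact T (bb * h) y) = pact T (bb * (q ^ K * h)) y"
          unfolding pact_mult[OF D(2) y, symmetric] by (simp add: mult.left_commute)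
        also have "\<dots> = 0\<^sub>v n" unfolding pact_mult[OF D(2) y, of bb] K(2)[OF y] by (rule pact_zero_vec[OF D(2)])
        finally have "pact T (bb * h) y \<in> (\<lambda>v. P *v v) ` Vec m" unfolding P(3) using c1(2) by blast
        then obtain v where v: "v \<in> Vec m" "pact T (bb * h) y = P *v v" by blast
        have "bf B (P *v x) (P *v v) = 0" using perp[OF v(1)] b[OF x v(1)] by simp
        moreover have "bf B (P *v x) (pact T (q ^ K) (pact T a y)) = 0" by (rule adjoint_vanishing[OF I c Px Kx c1(3)])
        ultimately show ?thesis using bf_add_right[OF D(1) Px c1(1,2)] e v(2) by simp
      qed
      then have "P *v x = 0\<^sub>v n" by (rule form_nondegenerate[OF D(1,4) Px])
      then have "x \<in> mat_kernel P" using x by (intro mat_kernelI[OF P(1)]) auto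
      then show ?thesis using P(2) by simp
    qed
    then show "det B' \<noteq> 0" unfolding det_nondegenerate_iff[OF B'] by blast
  qed
  then show ?thesis using P X by auto
qed

lemma primary_part_exists:
  assumes I: "isometric_structure n (B, T)" and q: "irreducible q"
  shows "\<exists>X. primary_part q (B, T) X"
proof -
  note D = isometric_structureD[OF I]
  obtain K a b h where K: "\<And>v. v \<in> Vec n ==> \<exists>k. pact T (q ^ k) v = 0\<^sub>v n ==> pact T (q ^ K) v = 0\<^sub>v n"
    using primary_bezout[OF q D(2) D(2)] by blast
  let ?M = "{v \<in> Vec n. \<exists>k. pact T (q ^ k) v = 0\<^sub>v n}"
  have M: "?M = {v \<in> Vec n. pact T (q ^ K) v = 0\<^sub>v n}" using K by blast
  have "subsp n ?M" unfolding M submod_def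
    using pact_zero_vec[OF D(2)] by (auto simp: pact_vec_add[OF D(2)] pact_vec_smult[OF D(2)] smult_zero_vec')
  then obtain m P where P: "P \<in> Mat n m" "mat_kernel P = {0\<^sub>v m}" "(\<lambda>v. P *v v) ` Vec m = ?M"
    using subsp_basis by blast
  have "\<exists>u\<in>Vec m. T *v (P *v v) = P *v u" if v: "v \<in> Vec m" for v
  proof -
    have "P *v v \<in> ?M" using P(3) v by blast
    then have Pv: "P *v v \<in> Vec n" "pact T (q ^ K) (P *v v) = 0\<^sub>v n" using K by auto
    have "pact T (q ^ K) (T *v (P *v v)) = 0\<^sub>v n"
      unfolding pact_commute[OF D(2) Pv(1), symmetric] Pv(2) by (rule mult_mat_zero_vec[OF D(2)])
    moreover have "T *v (P *v v) \<in> Vec n" using D(2) Pv(1) by simp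
    ultimately have "T *v (P *v v) \<in> (\<lambda>v. P *v v) ` Vec m" unfolding P(3) by blast
    then show ?thesis by blast
  qed
  then obtain S where S: "S \<in> Mat m m" "T * P = P * S" using invariant_range_mat[OF D(2) P(1)] by blast
  have "primary_part q (B, T) (trp P * B * P, S)"
    unfolding primary_part_def prod.case primary_kernel[OF D(2)] using P S D(2) by auto
  then show ?thesis by blast
qed

text \<open>A relation invariant under the isometries is stable under the simultaneous primary
  projection. So orthogonality tested on primary pairs of the relation implies orthogonality to all
  pairs, and the relation restricted to the primary parts is Lagrangian again.\<close>

lemma witt_primary_parts:
  assumes I: "isometric_structure n (B, T)" and I': "isometric_structure n' (B', T')"
    and q: "irreducible q" and c: "reflect_poly q = Polynomial.smult c q"
    and w: "witt_equivalent (B, T) (B', T')"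
    and pp: "primary_part q (B, T) X" and pp': "primary_part q (B', T') X'"
  shows "witt_equivalent X X'"
proof -
  note D = isometric_structureD[OF I] and D' = isometric_structureD[OF I']
  obtain m P where P: "isometric_structure m X" "P \<in> Mat n m" "mat_kernel P = {0\<^sub>v m}"
    "(\<lambda>v. P *v v) ` Vec m = {v \<in> Vec n. \<exists>k. pact T (q ^ k) v = 0\<^sub>v n}"
    "fst X = trp P * B * P" "T * P = P * snd X" using primary_partD[OF I q c pp] by blast
  obtain m' P' where P': "isometric_structure m' X'" "P' \<in> Mat n' m'" "mat_kernel P' = {0\<^sub>v m'}"
    "(\<lambda>v. P' *v v) ` Vec m' = {v \<in> Vec n'. \<exists>k. pact T' (q ^ k) v = 0\<^sub>v n'}"
    "fst X' = trp P' * B' * P'" "T' * P' = P' * snd X'" using primary_partD[OF I' q c pp'] by blast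
  obtain R where R: "Lrel n n' B B' R" "\<And>x y. (x, y) \<in> R ==> (T *v x, T' *v y) \<in> R"
    using w witt_equivalent_iff[OF I I'] by (auto simp: wrel_def)
  have l: "linrel n n' R" using R by (simp add: Lrel_def)
  note DR = linrelD[OF l]
  have SX: "snd X \<in> Mat m m" "snd X' \<in> Mat m' m'" using P(1) P'(1) by (auto simp: isometric_structure_def split: prod.splits)
  have b: "bf (fst X) u v = bf B (P *v u) (P *v v)" if "u \<in> Vec m" "v \<in> Vec m" for u v
    unfolding P(5) using bf_congruence[OF D(1) P(2) P(2) that] by simp
  have b': "bf (fst X') u v = bf B' (P' *v u) (P' *v v)" if "u \<in> Vec m'" "v \<in> Vec m'" for u v
    unfolding P'(5) using bf_congruence[OF D'(1) P'(2) P'(2) that] by simp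
  obtain K a bb h where K: "a * q ^ K + bb * h = 1" "\<And>v. v \<in> Vec n ==> pact T (q ^ K * h) v = 0\<^sub>v n"
    "\<And>v. v \<in> Vec n' ==> pact T' (q ^ K * h) v = 0\<^sub>v n'"
    "\<And>v. v \<in> Vec n ==> \<exists>k. pact T (q ^ k) v = 0\<^sub>v n ==> pact T (q ^ K) v = 0\<^sub>v n"
    "\<And>v. v \<in> Vec n' ==> \<exists>k. pact T' (q ^ k) v = 0\<^sub>v n' ==> pact T' (q ^ K) v = 0\<^sub>v n'"
    using primary_bezout[OF q D(2) D'(2)] by metis
  have split: "y = pact U (q ^ K) (pact U a y) + pact U (bb * h) y" "pact U (q ^ K) (pact U (bb * h) y) = 0\<^sub>v l"
    if U: "U \<in> Mat l l" and y: "y \<in> Vec l" and k: "pact U (q ^ K * h) y = 0\<^sub>v l" for U :: "rat mat" and l y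
  proof -
    have "y = pact U (q ^ K * a + bb * h) y" using K(1) pact_1[OF U y] by (simp add: mult.commute)
    then show "y = pact U (q ^ K) (pact U a y) + pact U (bb * h) y"
      unfolding pact_add[OF U y] pact_mult[OF U y, of "q ^ K"] .
    have "pact U (q ^ K) (pact U (bb * h) y) = pact U (bb * (q ^ K * h)) y"
      unfolding pact_mult[OF U y, symmetric] by (simp add: mult.left_commute)
    also have "\<dots> = 0\<^sub>v l" unfolding pact_mult[OF U y, of bb] k by (rule pact_zero_vec[OF U])
    finally show "pact U (q ^ K) (pact U (bb * h) y) = 0\<^sub>v l" .
  qed
  define R' where "R' = {(u, v). u \<in> Vec m \<and> v \<in> Vec m' \<and> (P *v u, P' *v v) \<in> R}"
  have lR': "linrel m m' R'"
    unfolding linrel_def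
  proof (intro conjI allI impI)
    show "R' \<subseteq> Vec m \<times> Vec m'" by (auto simp: R'_def)
    show "(0\<^sub>v m, 0\<^sub>v m') \<in> R'" using DR(3) mult_mat_zero_vec[OF P(2)] mult_mat_zero_vec[OF P'(2)] by (simp add: R'_def)
    fix u v u' v' d assume uv: "(u, v) \<in> R'"
    show "(d *s u, d *s v) \<in> R'" using uv DR(5) by (auto simp: R'_def mult_mat_vec_smult[OF P(2)] mult_mat_vec_smult[OF P'(2)])
    assume "(u', v') \<in> R'"
    then show "(u + u', v + v') \<in> R'" using uv DR(4)
      by (auto simp: R'_def mult_add_distrib_mat_vec[OF P(2)] mult_add_distrib_mat_vec[OF P'(2)])
  qed
  have "Lrel m m' (fst X) (fst X') R'"
  proof (rule LrelI[OF lR'])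
    show "isotropic_rel (fst X) (fst X') R'"
      unfolding isotropic_rel_def
    proof (intro allI impI)
      fix u v u' v' assume "(u, v) \<in> R'" "(u', v') \<in> R'"
      then show "bf (fst X) u u' = bf (fst X') v v'"
        using Lrel_isotropic[OF R(1)] by (auto simp: R'_def b b' isotropic_rel_def)
    qed
    fix u v assume u: "u \<in> Vec m" and v: "v \<in> Vec m'"
      and perp: "\<And>u' v'. (u', v') \<in> R' ==> bf (fst X) u u' = bf (fst X') v v'"
    have Pu: "P *v u \<in> Vec n" "pact T (q ^ K) (P *v u) = 0\<^sub>v n"
      and Pv: "P' *v v \<in> Vec n'" "pact T' (q ^ K) (P' *v v) = 0\<^sub>v n'"
      using P(4) P'(4) u v K(4,5) by blast+
    have "(P *v u, P' *v v) \<in> R"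
    proof (rule Lrel_memI[OF R(1) Pu(1) Pv(1)])
      fix x y assume xy: "(x, y) \<in> R"
      have xc: "x \<in> Vec n" "y \<in> Vec n'" using DR xy by auto
      \<comment> \<open>The primary projection of the pair. The remaining components are images of
        \<open>q ^ K\<close> and pair to zero with primary vectors.\<close>
      define x1 where "x1 = pact T (bb * h) x"
      define y1 where "y1 = pact T' (bb * h) y"
      have x1: "x1 \<in> Vec n" "pact T (q ^ K) x1 = 0\<^sub>v n" and y1: "y1 \<in> Vec n'" "pact T' (q ^ K) y1 = 0\<^sub>v n'"
        unfolding x1_def y1_def using split(2)[OF D(2) xc(1) K(2)[OF xc(1)]] split(2)[OF D'(2) xc(2) K(3)[OF xc(2)]] D(2) D'(2) xc by auto
      have r1: "(x1, y1) \<in> R" unfolding x1_def y1_def by (rule wrel_pact[OF l D(2) D'(2) R(2) xy])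
      have "x1 \<in> (\<lambda>v. P *v v) ` Vec m" "y1 \<in> (\<lambda>v. P' *v v) ` Vec m'" unfolding P(4) P'(4) using x1 y1 by blast+
      then obtain u1 v1 where uv1: "u1 \<in> Vec m" "v1 \<in> Vec m'" "x1 = P *v u1" "y1 = P' *v v1" by blast
      have "(u1, v1) \<in> R'" using r1 uv1 by (simp add: R'_def)
      then have "bf B (P *v u) x1 = bf B' (P' *v v) y1" using perp b[OF u uv1(1)] b'[OF v uv1(2)] uv1(3,4) by metis
      moreover have "bf B (P *v u) x = bf B (P *v u) x1"
      proof -
        have ax: "pact T a x \<in> Vec n" using D(2) xc by simp
        have "bf B (P *v u) x = bf B (P *v u) (pact T (q ^ K) (pact T a x)) + bf B (P *v u) x1"
          using split(1)[OF D(2) xc(1) K(2)[OF xc(1)], folded x1_def] bf_add_right[OF D(1) Pu(1) pact_carrier[OF D(2) ax] x1(1)] by metis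
        then show ?thesis using adjoint_vanishing[OF I c Pu ax] by simp
      qed
      moreover have "bf B' (P' *v v) y = bf B' (P' *v v) y1"
      proof -
        have ay: "pact T' a y \<in> Vec n'" using D'(2) xc by simp
        have "bf B' (P' *v v) y = bf B' (P' *v v) (pact T' (q ^ K) (pact T' a y)) + bf B' (P' *v v) y1"
          using split(1)[OF D'(2) xc(2) K(3)[OF xc(2)], folded y1_def] bf_add_right[OF D'(1) Pv(1) pact_carrier[OF D'(2) ay] y1(1)] by metis
        then show ?thesis using adjoint_vanishing[OF I' c Pv ay] by simp
      qed
      ultimately show "bf B (P *v u) x = bf B' (P' *v v) y" by simp
    qed
    then show "(u, v) \<in> R'" using u v by (simp add: R'_def)
  qed
  moreover have "(snd X *v u, snd X' *v v) \<in> R'" if "(u, v) \<in> R'" for u v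
  proof -
    have uv: "u \<in> Vec m" "v \<in> Vec m'" "(P *v u, P' *v v) \<in> R" using that by (auto simp: R'_def)
    have "P *v (snd X *v u) = T *v (P *v u)"
      using assoc_mult_mat_vec[OF D(2) P(2) uv(1)] assoc_mult_mat_vec[OF P(2) SX(1) uv(1)] P(6) by simp
    moreover have "P' *v (snd X' *v v) = T' *v (P' *v v)"
      using assoc_mult_mat_vec[OF D'(2) P'(2) uv(2)] assoc_mult_mat_vec[OF P'(2) SX(2) uv(2)] P'(6) by simp
    ultimately show ?thesis using R(2)[OF uv(3)] SX uv by (simp add: R'_def)
  qed
  ultimately have "wrel m m' X X' R'" by (simp add: wrel_def)
  then show ?thesis using witt_equivalent_iff[OF P(1) P'(1)] by blast
qed

text \<open>The added block is killed by \<open>g\<close>, which is coprime to \<open>q\<close>, so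
  it contains no primary vectors. The same structure \<open>X\<close> serves, embedded by the basis
  \<open>P\<close> padded with zero rows.\<close>

lemma primary_part_block_sum:
  assumes B: "B \<in> Mat n n" and T: "T \<in> Mat n n" and B2: "B2 \<in> Mat l l" and T2: "T2 \<in> Mat l l"
    and q: "irreducible q" and g: "\<not> q dvd g" "\<And>v. v \<in> Vec l ==> pact T2 g v = 0\<^sub>v l"
    and pp: "primary_part q (B, T) X"
  shows "primary_part q (B \<boxplus> B2, T \<boxplus> T2) X"
proof -
  obtain B' T' where X: "X = (B', T')" by (cases X)
  obtain m P where P: "P \<in> Mat n m" "mat_kernel P = {0\<^sub>v m}"
    "(\<lambda>v. P *v v) ` Vec m = {v \<in> Vec n. \<exists>k. pact T (q ^ k) v = 0\<^sub>v n}"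
    "B' = trp P * B * P" "T' \<in> Mat m m" "T * P = P * T'"
    using pp T unfolding primary_part_def X prod.case primary_kernel[OF T] by auto
  define Q where "Q = mat (n + l) m (\<lambda>(i, j). if i < n then P $$ (i, j) else 0)"
  have Q: "Q \<in> Mat (n + l) m" by (simp add: Q_def)
  have Qv: "Q *v v = (P *v v) @\<^sub>v 0\<^sub>v l" if "v \<in> Vec m" for v
  proof (rule eq_vecI)
    fix i assume "i < dim_vec ((P *v v) @\<^sub>v 0\<^sub>v l)"
    then have i: "i < n + l" using P(1) by simp
    show "(Q *v v) $ i = ((P *v v) @\<^sub>v 0\<^sub>v l) $ i"
    proof (cases "i < n")
      case True
      then have "row Q i = row P i" using i P(1) by (intro eq_vecI) (auto simp: Q_def)
      then show ?thesis using True i Q P(1) that by simp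
    next
      case False
      then have "row Q i = 0\<^sub>v m" using i by (intro eq_vecI) (auto simp: Q_def)
      then show ?thesis using False i Q P(1) that by simp
    qed
  qed (use Q P(1) in simp)
  have TT: "T \<boxplus> T2 \<in> Mat (n + l) (n + l)" "B \<boxplus> B2 \<in> Mat (n + l) (n + l)"
    using B B2 T T2 by (auto intro: block_sum_carrier)
  have zero2: "y = 0\<^sub>v l" if y: "y \<in> Vec l" and k: "pact T2 (q ^ k) y = 0\<^sub>v l" for y k
  proof -
    have "coprime q g" using g(1) q by (intro prime_elem_imp_coprime) (simp_all add: irreducible_imp_prime_elem)
    then have "coprime (q ^ k) g" by simp
    then obtain a b where ab: "a * q ^ k + b * g = 1"
      using bezout_coefficients_fst_snd[of "q ^ k" g] by (metis coprime_imp_gcd_eq_1)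
    have "y = pact T2 (a * q ^ k + b * g) y" unfolding ab pact_1[OF T2 y] ..
    also have "\<dots> = 0\<^sub>v l + 0\<^sub>v l" unfolding pact_add[OF T2 y] pact_mult[OF T2 y] k g(2)[OF y] pact_zero_vec[OF T2] ..
    finally show ?thesis by simp
  qed
  have "mat_kernel Q = {0\<^sub>v m}"
  proof (intro equalityI subsetI)
    fix v assume "v \<in> mat_kernel Q"
    then have v: "v \<in> Vec m" "Q *v v = 0\<^sub>v (n + l)" using mat_kernelD[OF Q] by auto
    then have "(P *v v) @\<^sub>v 0\<^sub>v l = 0\<^sub>v n @\<^sub>v 0\<^sub>v l" using Qv append_vec_zero by metis
    then have "P *v v = 0\<^sub>v n" using append_vec_inj[of "P *v v" n "0\<^sub>v n"] P(1) v(1) by auto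
    then show "v \<in> {0\<^sub>v m}" using P(2) v(1) mat_kernelI[OF P(1)] by auto
  next
    fix v assume "v \<in> {0\<^sub>v m :: rat vec}"
    then show "v \<in> mat_kernel Q" using mult_mat_zero_vec[OF Q] by (intro mat_kernelI[OF Q]) auto
  qed
  moreover have "(\<lambda>v. Q *v v) ` Vec m = {v \<in> Vec (n + l). \<exists>k. pact (T \<boxplus> T2) (q ^ k) v = 0\<^sub>v (n + l)}" (is "?I = ?J")
  proof (intro equalityI subsetI)
    fix u assume "u \<in> ?I"
    then obtain v where v: "v \<in> Vec m" "u = (P *v v) @\<^sub>v 0\<^sub>v l" using Qv by auto
    have "P *v v \<in> {v \<in> Vec n. \<exists>k. pact T (q ^ k) v = 0\<^sub>v n}" using P(3) v(1) by blast
    then obtain k where k: "P *v v \<in> Vec n" "pact T (q ^ k) (P *v v) = 0\<^sub>v n" by blast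
    have "pact (T \<boxplus> T2) (q ^ k) u = 0\<^sub>v n @\<^sub>v 0\<^sub>v l"
      unfolding v(2) pact_append[OF T T2 k(1) zero_carrier_vec] k(2) pact_zero_vec[OF T2] ..
    also have "\<dots> = 0\<^sub>v (n + l)" by (rule append_vec_zero)
    finally have "pact (T \<boxplus> T2) (q ^ k) u = 0\<^sub>v (n + l)" .
    moreover have "u \<in> Vec (n + l)" unfolding v(2) using k(1) by simp
    ultimately show "u \<in> ?J" by blast
  next
    fix u assume "u \<in> ?J"
    then obtain k where u: "u \<in> Vec (n + l)" "pact (T \<boxplus> T2) (q ^ k) u = 0\<^sub>v (n + l)" by blast
    obtain x y where xy: "x \<in> Vec n" "y \<in> Vec l" "u = x @\<^sub>v y" using append_vec_cases[OF u(1)] by blast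
    have "pact T (q ^ k) x @\<^sub>v pact T2 (q ^ k) y = 0\<^sub>v n @\<^sub>v 0\<^sub>v l"
      using u(2) unfolding xy(3) pact_append[OF T T2 xy(1,2)] append_vec_zero .
    then have e: "pact T (q ^ k) x = 0\<^sub>v n" "pact T2 (q ^ k) y = 0\<^sub>v l"
      using append_vec_inj[OF pact_carrier[OF T xy(1)] zero_carrier_vec] by auto
    have "x \<in> (\<lambda>v. P *v v) ` Vec m" unfolding P(3) using xy(1) e(1) by blast
    then obtain v where v: "v \<in> Vec m" "x = P *v v" by blast
    have "u = Q *v v" unfolding xy(3) v(2) Qv[OF v(1)] zero2[OF xy(2) e(2)] ..
    then show "u \<in> ?I" using v(1) by blast
  qed
  moreover have "B' = trp Q * (B \<boxplus> B2) * Q"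
  proof (rule bf_eqI)
    show "B' \<in> Mat m m" unfolding P(4) using P(1) B by auto
    show "trp Q * (B \<boxplus> B2) * Q \<in> Mat m m" using Q TT by auto
    fix u v :: "rat vec" assume uv: "u \<in> Vec m" "v \<in> Vec m"
    have c: "P *v u \<in> Vec n" "P *v v \<in> Vec n" using P(1) uv by auto
    show "bf B' u v = bf (trp Q * (B \<boxplus> B2) * Q) u v"
      unfolding bf_congruence[OF TT(2) Q Q uv, symmetric] Qv[OF uv(1)] Qv[OF uv(2)] P(4) bf_congruence[OF B P(1) P(1) uv, symmetric]
      using bf_block_sum[OF B B2 c(1) zero_carrier_vec c(2) zero_carrier_vec] bf_zero_left[OF B2 zero_carrier_vec] by simp
  qed
  moreover have "(T \<boxplus> T2) * Q = Q * T'"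
  proof (rule mat_eq_actI)
    show "(T \<boxplus> T2) * Q \<in> Mat (n + l) m" "Q * T' \<in> Mat (n + l) m" using TT Q P(5) by auto
    fix v :: "rat vec" assume v: "v \<in> Vec m"
    have c: "P *v v \<in> Vec n" "T' *v v \<in> Vec m" using P v by auto
    have "((T \<boxplus> T2) * Q) *v v = (T \<boxplus> T2) *v ((P *v v) @\<^sub>v 0\<^sub>v l)"
      unfolding assoc_mult_mat_vec[OF TT(1) Q v] Qv[OF v] ..
    also have "\<dots> = (T *v (P *v v)) @\<^sub>v 0\<^sub>v l"
      unfolding block_sum_mult_vec[OF T T2 c(1) zero_carrier_vec] mult_mat_zero_vec[OF T2] ..
    also have "T *v (P *v v) = P *v (T' *v v)"
      using assoc_mult_mat_vec[OF T P(1) v] assoc_mult_mat_vec[OF P(1) P(5) v] P(6) by simp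
    also have "(P *v (T' *v v)) @\<^sub>v 0\<^sub>v l = (Q * T') *v v"
      unfolding assoc_mult_mat_vec[OF Q P(5) v] Qv[OF c(2)] ..
    finally show "((T \<boxplus> T2) * Q) *v v = (Q * T') *v v" .
  qed
  ultimately show ?thesis
    unfolding primary_part_def X prod.case primary_kernel[OF TT(1)] using Q P(5) carrier_matD(1)[OF TT(1)] by auto
qed

section \<open>Hermitian forms over Q(z) and uniqueness of the discriminant\<close>

lemma min_poly_nonzero: "reciprocal z ==> min_poly z \<noteq> 0"
  using reciprocalD(2) by fastforce

lemma Qadj_inverse_closed: "reciprocal z ==> x \<in> Qadj z ==> inverse x \<in> Qadj z"
  using Qadj_inverse[OF min_poly_nonzero reciprocalD(5)] by blast

lemma rpoly_in_subring:
  assumes F: "subring_set F" "\<And>c. of_rat c \<in> F" and w: "w \<in> F"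
  shows "rpoly p w \<in> F"
proof (induction p)
  case (pCons a p)
  then show ?case using F w unfolding subring_set_def by simp
qed (use F in \<open>simp add: subring_set_def\<close>)

text \<open>Independent of the representing polynomial, because a rational relation of a reciprocal
  number also holds for its inverse.\<close>

lemma Qbar_rpoly:
  assumes z: "reciprocal z"
  shows "Qbar z (rpoly p z) = rpoly p (inverse z)"
  unfolding Qbar_def
proof (rule the_equality)
  fix y assume "\<exists>q. rpoly p z = rpoly q z \<and> y = rpoly q (inverse z)"
  then obtain q where q: "rpoly p z = rpoly q z" "y = rpoly q (inverse z)" by blast
  then have "rpoly (p - q) z = 0" by simp
  then have "rpoly (p - q) (inverse z) = 0" using reciprocalD(4,7)[OF z] by blast
  then show "y = rpoly p (inverse z)" using q by simp
qed blast

lemma Qbar_hom: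
  assumes z: "reciprocal z"
  shows "hom_on (Qadj z) (Qbar z)"
proof -
  have i: "inverse z \<in> Qadj z" using Qadj_inverse_closed[OF z Qadj_gen] .
  have m: "rpoly p (inverse z) \<in> Qadj z" for p
    using rpoly_in_subring[OF Qadj_subring _ i] Qadj_of_rat by blast
  have a: "Qbar z (rpoly p z + rpoly q z) = Qbar z (rpoly p z) + Qbar z (rpoly q z)" for p q
    using Qbar_rpoly[OF z, of "p + q"] Qbar_rpoly[OF z] by simp
  have t: "Qbar z (rpoly p z * rpoly q z) = Qbar z (rpoly p z) * Qbar z (rpoly q z)" for p q
    using Qbar_rpoly[OF z, of "p * q"] Qbar_rpoly[OF z] by simp
  show ?thesis unfolding hom_on_def
    using m a t Qbar_rpoly[OF z] Qbar_rpoly[OF z, of 1] Qbar_rpoly[OF z, of 0] unfolding Qadj_def by auto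
qed

lemma Qbar_involutive:
  assumes z: "reciprocal z" and x: "x \<in> Qadj z"
  shows "Qbar z (Qbar z x) = x"
proof -
  note h = Qbar_hom[OF z, unfolded hom_on_def] and s = Qadj_subring[of z, unfolded subring_set_def]
  have i: "inverse z \<in> Qadj z" using Qadj_inverse_closed[OF z Qadj_gen] .
  have q: "Qbar z (inverse z) = z"
  proof -
    have "Qbar z z = inverse z" using Qbar_rpoly[OF z, of "[:0, 1:]"] by simp
    moreover have "Qbar z (z * inverse z) = Qbar z z * Qbar z (inverse z)" using h i Qadj_gen[of z] by blast
    moreover have "Qbar z 1 = 1" using h by blast
    ultimately have "inverse z * Qbar z (inverse z) = 1" using reciprocalD(1)[OF z] by simp
    then have "z * (inverse z * Qbar z (inverse z)) = z" by simp
    then show ?thesis using reciprocalD(1)[OF z] by (simp add: mult.assoc[symmetric])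
  qed
  have c: "Qbar z (of_rat c) = of_rat c" for c
    using Qbar_rpoly[OF z, of "[:c:]"] by simp
  have "Qbar z (rpoly p (inverse z)) = rpoly p z" for p
  proof (induction p)
    case (pCons a p)
    have m: "rpoly p (inverse z) \<in> Qadj z" using rpoly_in_subring[OF Qadj_subring _ i] Qadj_of_rat by blast
    have "Qbar z (of_rat a + inverse z * rpoly p (inverse z)) = Qbar z (of_rat a) + Qbar z (inverse z) * Qbar z (rpoly p (inverse z))"
      using h s i m Qadj_of_rat[of a z] by metis
    then show ?case using pCons q c by simp
  qed (use h in simp)
  then show ?thesis using x Qbar_rpoly[OF z] unfolding Qadj_def by auto
qed

text \<open>Two polynomials with the same value at \<open>z\<close> differ by a multiple of the
  minimal polynomial, so they agree at every conjugate.\<close>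

lemma Qtrace_eqI:
  assumes z: "reciprocal z" and s: "of_rat s = (\<Sum>w | rpoly (min_poly z) w = 0. rpoly p w)"
  shows "Qtrace z (rpoly p z) = s"
  unfolding Qtrace_def
proof (rule the_equality)
  show "\<exists>p'. rpoly p z = rpoly p' z \<and> of_rat s = (\<Sum>w | rpoly (min_poly z) w = 0. rpoly p' w)" using s by blast
  fix t assume "\<exists>p'. rpoly p z = rpoly p' z \<and> of_rat t = (\<Sum>w | rpoly (min_poly z) w = 0. rpoly p' w)"
  then obtain p' where p': "rpoly (p' - p) z = 0" "of_rat t = (\<Sum>w | rpoly (min_poly z) w = 0. rpoly p' w)" by auto
  then have "min_poly z dvd p' - p" using reciprocalD(4)[OF z] by blast
  then have "rpoly p' w = rpoly p w" if "rpoly (min_poly z) w = 0" for w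
    using that rpoly_dvd[of "min_poly z" "p' - p" w] by simp
  then have "(\<Sum>w | rpoly (min_poly z) w = 0. rpoly p' w) = (\<Sum>w | rpoly (min_poly z) w = 0. rpoly p w)"
    by (intro sum.cong) auto
  then have "(of_rat t :: complex) = of_rat s" unfolding p'(2) s .
  then show "t = s" unfolding of_rat_eq_iff .
qed

lemma Qtrace_one:
  assumes z: "reciprocal z"
  shows "Qtrace z 1 \<noteq> 0"
proof -
  let ?W = "{w. rpoly (min_poly z) w = 0}"
  have "finite ?W" using rpoly_roots_finite[OF min_poly_nonzero[OF z]] .
  moreover have "Qtrace z (rpoly 1 z) = of_nat (card ?W)" by (rule Qtrace_eqI[OF z]) simp
  moreover have "z \<in> ?W" using reciprocalD(5)[OF z] by simp
  ultimately show ?thesis by auto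
qed

lemma hf_bf: "G \<in> Mat n n ==> x \<in> Vec n ==> y \<in> Vec n ==> hf \<sigma> n G x y = bf G x (map_vec \<sigma> y)"
  unfolding hf_def bf_def scalar_prod_def mult_mat_vec_def
  by (simp add: sum_distrib_left mult.assoc row_def lessThan_atLeast0 scalar_prod_def)

lemma hf_smult_left: "G \<in> Mat n n ==> x \<in> Vec n ==> y \<in> Vec n ==>
  hf \<sigma> n G (c *s x) y = c * hf \<sigma> n G x y"
  by (simp add: hf_bf bf_smult_left)

lemma hf_block_sum:
  assumes "G \<in> Mat n n" "H \<in> Mat m m" "x \<in> Vec n" "y \<in> Vec m" "x' \<in> Vec n" "y' \<in> Vec m"
  shows "hf \<sigma> (n + m) (G \<boxplus> - H) (x @\<^sub>v y) (x' @\<^sub>v y') = hf \<sigma> n G x x' - hf \<sigma> m H y y'"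
proof -
  have e: "map_vec \<sigma> (x' @\<^sub>v y') = map_vec \<sigma> x' @\<^sub>v map_vec \<sigma> y'"
    using assms by (intro eq_vecI) auto
  have c: "G \<boxplus> - H \<in> Mat (n + m) (n + m)" using assms by (intro block_sum_carrier) auto
  have "hf \<sigma> (n + m) (G \<boxplus> - H) (x @\<^sub>v y) (x' @\<^sub>v y') = bf (G \<boxplus> - H) (x @\<^sub>v y) (map_vec \<sigma> x' @\<^sub>v map_vec \<sigma> y')"
    unfolding e[symmetric] using assms c by (intro hf_bf) auto
  also have "\<dots> = bf G x (map_vec \<sigma> x') + bf (- H) y (map_vec \<sigma> y')"
    using assms by (intro bf_block_sum[where n = n and m = m]) auto
  also have "bf (- H) y (map_vec \<sigma> y') = - bf H y (map_vec \<sigma> y')"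
    using assms by (intro bf_uminus_mat[where n = m and m = m]) auto
  finally show ?thesis using assms by (simp add: hf_bf)
qed

lemma hf_closed:
  assumes "subring_set F" "hom_on F \<sigma>" "G \<in> Fmat F n" "x \<in> Fvec F n" "y \<in> Fvec F n"
  shows "hf \<sigma> n G x y \<in> F"
proof -
  have "x $ i * G $$ (i, j) * \<sigma> (y $ j) \<in> F" if "i < n" "j < n" for i j
    using that assms unfolding subring_set_def hom_on_def Fmat_def Fvec_def by simp
  then show ?thesis unfolding hf_def by (intro subring_sum[OF assms(1)]) auto
qed

definition hermitian_on :: "('a::comm_ring_1 => 'a) => nat => 'a mat => bool" where
  "hermitian_on \<sigma> n G \<longleftrightarrow> (\<forall>i<n. \<forall>j<n. G $$ (j, i) = \<sigma> (G $$ (i, j)))"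

lemma hermitian_onD: "hermitian_on \<sigma> n G ==> i < n ==> j < n ==> G $$ (j, i) = \<sigma> (G $$ (i, j))"
  unfolding hermitian_on_def by blast

lemma hf_hermitian:
  assumes F: "subring_set F" "hom_on F \<sigma>" "\<And>a. a \<in> F ==> \<sigma> (\<sigma> a) = a" and G: "G \<in> Fmat F n" "hermitian_on \<sigma> n G"
    and x: "x \<in> Fvec F n" and y: "y \<in> Fvec F n"
  shows "hf \<sigma> n G y x = \<sigma> (hf \<sigma> n G x y)"
proof -
  note h = F(2)[unfolded hom_on_def] and s = F(1)[unfolded subring_set_def]
  have m: "x $ i \<in> F" "y $ i \<in> F" "G $$ (i, j) \<in> F" "\<sigma> (y $ i) \<in> F" if "i < n" "j < n" for i j
    using that G(1) x y h unfolding Fmat_def Fvec_def by auto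
  have m': "x $ i * G $$ (i, j) \<in> F" if "i < n" "j < n" for i j using m[OF that] s by blast
  have m2: "x $ i * G $$ (i, j) * \<sigma> (y $ j) \<in> F" if "i < n" "j < n" for i j
    using m'[OF that] m[OF that(2,1)] s by blast
  have e: "\<sigma> (x $ i * G $$ (i, j) * \<sigma> (y $ j)) = y $ j * G $$ (j, i) * \<sigma> (x $ i)" if ij: "i < n" "j < n" for i j
  proof -
    have "\<sigma> (x $ i * G $$ (i, j) * \<sigma> (y $ j)) = \<sigma> (x $ i * G $$ (i, j)) * \<sigma> (\<sigma> (y $ j))"
      using h m'[OF ij] m(4)[OF ij(2,1)] by blast
    also have "\<sigma> (x $ i * G $$ (i, j)) = \<sigma> (x $ i) * \<sigma> (G $$ (i, j))" using h m(1,3)[OF ij] by blast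
    also have "\<sigma> (\<sigma> (y $ j)) = y $ j" using F(3) m(2)[OF ij(2,1)] by blast
    also have "\<sigma> (G $$ (i, j)) = G $$ (j, i)" using hermitian_onD[OF G(2) ij] by (rule sym)
    finally show ?thesis by (simp add: mult_ac)
  qed
  have "\<sigma> (hf \<sigma> n G x y) = (\<Sum>i<n. \<sigma> (\<Sum>j<n. x $ i * G $$ (i, j) * \<sigma> (y $ j)))"
    unfolding hf_def using m2 by (intro hom_on_sum[OF F(1,2)] subring_sum[OF F(1)]) auto
  also have "\<dots> = (\<Sum>i<n. \<Sum>j<n. \<sigma> (x $ i * G $$ (i, j) * \<sigma> (y $ j)))"
    using m2 by (intro sum.cong refl hom_on_sum[OF F(1,2)]) auto
  also have "\<dots> = (\<Sum>i<n. \<Sum>j<n. y $ j * G $$ (j, i) * \<sigma> (x $ i))"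
    using e by (intro sum.cong refl) auto
  also have "\<dots> = hf \<sigma> n G y x" unfolding hf_def by (rule sum.swap)
  finally show ?thesis by simp
qed

lemma unit_vec_Fvec: "subring_set F ==> unit_vec n i \<in> Fvec F n"
  unfolding Fvec_def subring_set_def by (auto simp: unit_vec_def)

lemma hf_unit:
  assumes "hom_on F \<sigma>" "G \<in> Mat n n" "i < n" "j < n"
  shows "hf \<sigma> n G (unit_vec n i) (unit_vec n j) = G $$ (i, j)"
proof -
  have "map_vec \<sigma> (unit_vec n j) = unit_vec n j"
    using assms(1,4) unfolding hom_on_def by (intro eq_vecI) (auto simp: unit_vec_def)
  then show ?thesis using assms by (simp add: hf_bf bf_unit)
qed

text \<open>In a basis adapted to the Lagrangian the matrix has a zero block of half size, and
  Hermitian symmetry makes the two off-diagonal blocks conjugate transposes of each other. The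
  determinant is therefore a norm up to \<open>(- 1) ^ k\<close>.\<close>

lemma metabolic_hermitian_det:
  fixes G :: "'a::field mat"
  assumes F: "subring_set F" "hom_on F \<sigma>" "\<And>a. a \<in> F ==> \<sigma> (\<sigma> a) = a" "\<And>a. a \<in> F ==> inverse a \<in> F"
    and G: "G \<in> Fmat F n" "hermitian_on \<sigma> n G" "det G \<noteq> 0" and L: "lagrangian F \<sigma> n G L"
  shows "\<exists>k c. n = 2 * k \<and> c \<in> F \<and> det G = (- 1) ^ k * (c * \<sigma> c)"
proof -
  have "submod F n L" using L unfolding lagrangian_def by blast
  then obtain U U' k where ad: "adapted F n L U U' k" using adapted_field[OF F(1,4)] by blast
  let ?M = "trp U * G * map_mat \<sigma> U"
  note hd = lagrangian_half_dim[OF F(1,2) G(1,3) ad L]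
  have U: "U \<in> Fmat F n" using ad unfolding adapted_def GL_pair_def by blast
  have M: "?M \<in> Mat n n" using Fmat_carrier[OF hd(4)] .
  have herm: "?M $$ (j, i) = \<sigma> (?M $$ (i, j))" if ij: "i < n" "j < n" for i j
  proof -
    let ?x = "U *v unit_vec n i" and ?y = "U *v unit_vec n j"
    have xy: "?x \<in> Fvec F n" "?y \<in> Fvec F n" using Fmat_mult_vec[OF F(1) U unit_vec_Fvec[OF F(1)]] by auto
    have e: "?M $$ (a, b) = hf \<sigma> n G (U *v unit_vec n a) (U *v unit_vec n b)" if ab: "a < n" "b < n" for a b
      unfolding hf_transform[OF F(1,2) U G(1) unit_vec_Fvec[OF F(1)] unit_vec_Fvec[OF F(1)]] hf_unit[OF F(2) M ab] ..
    show ?thesis unfolding e[OF ij] e[OF ij(2,1)] by (rule hf_hermitian[OF F(1-3) G(1,2) xy])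
  qed
  let ?C = "mat k k (\<lambda>(i, j). ?M $$ (i, k + j))" and ?D = "mat k k (\<lambda>(i, j). ?M $$ (k + i, j))"
  have C: "?C \<in> Fmat F k" using hd(4) unfolding Fmat_def hd(1) by auto
  have D: "?D = trp (map_mat \<sigma> ?C)"
  proof (intro eq_matI)
    fix i j assume "i < dim_row (trp (map_mat \<sigma> ?C))" "j < dim_col (trp (map_mat \<sigma> ?C))"
    then have ij: "i < k" "j < k" by auto
    then have "?M $$ (k + i, j) = \<sigma> (?M $$ (j, k + i))" using herm[of j "k + i"] unfolding hd(1) by simp
    then show "?D $$ (i, j) = trp (map_mat \<sigma> ?C) $$ (i, j)" using ij by simp
  qed auto
  have "det ?M = (- 1) ^ k * det ?C * det ?D"
    using det_antidiagonal[OF M[unfolded hd(1)] hd(2)] .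
  also have "det ?D = \<sigma> (det ?C)"
    unfolding D using det_transpose[of "map_mat \<sigma> ?C" k] hom_on_det[OF F(1,2) C] by simp
  finally have "det G = (- 1) ^ k * (det ?C * \<sigma> (det ?C))" using hd(3) by (simp add: mult.assoc)
  then show ?thesis using hd(1) det_in_subring[OF F(1) C] by blast
qed

lemma hermitian_liftD:
  assumes z: "reciprocal z" and I: "isometric_structure m (B, T)" and l: "hermitian_lift z (B, T) r f H"
  shows "bij_betw f (Vec m) (Fvec (Qadj z) r)"
    "v \<in> Vec m ==> w \<in> Vec m ==> f (v + w) = f v + f w"
    "f (0\<^sub>v m) = 0\<^sub>v r"
    "v \<in> Vec m ==> f (pact T p v) = rpoly p z *s f v"
    "H \<in> Fmat (Qadj z) r" "hermitian_on (Qbar z) r H" "det H \<noteq> 0"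
    "v \<in> Vec m ==> w \<in> Vec m ==> bf B v w = Qtrace z (hf (Qbar z) r H (f v) (f w))"
    "v \<in> Vec m ==> f v \<in> Fvec (Qadj z) r"
proof -
  note D = isometric_structureD[OF I]
  note l' = l[unfolded hermitian_lift_def Let_def prod.case carrier_matD(1)[OF D(1)]]
  show bij: "bij_betw f (Vec m) (Fvec (Qadj z) r)" using l' unfolding Fvec_def by blast
  then show mem: "f v \<in> Fvec (Qadj z) r" if "v \<in> Vec m" for v using that bij_betwE by metis
  then have car: "f v \<in> Vec r" if "v \<in> Vec m" for v using that Fvec_carrier by blast
  show add: "f (v + w) = f v + f w" if "v \<in> Vec m" "w \<in> Vec m" for v w using l' that by blast
  have sm: "f (c *s v) = of_rat c *s f v" if "v \<in> Vec m" for c v using l' that by blast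
  have Tv: "f (T *v v) = z *s f v" if "v \<in> Vec m" for v using l' that by blast
  have "0 *s 0\<^sub>v m = (0\<^sub>v m :: rat vec)" by (rule smult_zero_vec')
  then have "f (0\<^sub>v m) = of_rat 0 *s f (0\<^sub>v m)" using sm[of "0\<^sub>v m" 0] by simp
  also have "\<dots> = 0\<^sub>v r" using car[OF zero_carrier_vec] by (intro eq_vecI) auto
  finally show z0: "f (0\<^sub>v m) = 0\<^sub>v r" .
  show "f (pact T p v) = rpoly p z *s f v" if "v \<in> Vec m" for v
    using that
  proof (induction p arbitrary: v)
    case 0
    then show ?case using pact_0[OF D(2) 0] z0 car[OF 0] by (intro eq_vecI) auto
  next
    case (pCons a p)
    have Tc: "T *v v \<in> Vec m" by (rule mult_mat_vec_carrier[OF D(2) pCons.prems])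
    have "f (pact T (pCons a p) v) = of_rat a *s f v + rpoly p z *s (z *s f v)"
      using pact_pCons[OF D(2) pCons.prems] add[of "a *s v" "pact T p (T *v v)"] sm[OF pCons.prems]
        pCons.IH[OF Tc] Tv[OF pCons.prems] pCons.prems pact_carrier[OF D(2) Tc] by simp
    also have "\<dots> = rpoly (pCons a p) z *s f v"
      using car[OF pCons.prems] by (intro eq_vecI) (auto simp: algebra_simps)
    finally show ?case .
  qed
  show "H \<in> Fmat (Qadj z) r" using l' unfolding Fmat_def by blast
  show "hermitian_on (Qbar z) r H" using l' unfolding hermitian_on_def by blast
  show "det H \<noteq> 0" using l' by blast
  show "bf B v w = Qtrace z (hf (Qbar z) r H (f v) (f w))" if "v \<in> Vec m" "w \<in> Vec m" for v w
    using l' that unfolding bf_def hf_def by blast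
qed

text \<open>Nondegeneracy of the trace form. For \<open>a \<noteq> b\<close> the multiplier
  \<open>inverse (a - b)\<close> makes the two products differ by 1, whose trace, the number of
  conjugates, is nonzero. Additivity of \<open>Qtrace\<close> is read off the lift: every value is
  realized by the bilinear form.\<close>

lemma lift_trace_separates:
  assumes z: "reciprocal z" and I: "isometric_structure m (B, T)" and l: "hermitian_lift z (B, T) r f H" and r: "r > 0"
    and a: "a \<in> Qadj z" and b: "b \<in> Qadj z" and e: "\<And>c. c \<in> Qadj z ==> Qtrace z (c * a) = Qtrace z (c * b)"
  shows "a = b"
proof (rule ccontr)
  assume ne: "a \<noteq> b"
  note D = hermitian_liftD[OF z I l] and I' = isometric_structureD[OF I]
  note H = Fmat_carrier[OF D(5)] and F = Qadj_subring[of z] and F' = Qadj_subring[of z, unfolded subring_set_def]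
  have "\<exists>j<r. H $$ (0, j) \<noteq> 0"
  proof (rule ccontr)
    assume "\<not> ?thesis"
    then have "det H = 0" using r by (intro det_zero_block[OF H, of "{0}" "{..<r}"]) auto
    then show False using D(7) by simp
  qed
  then obtain j where j: "j < r" "H $$ (0, j) \<noteq> 0" by blast
  let ?h = "H $$ (0, j)"
  have h: "?h \<in> Qadj z" using D(5) j(1) r unfolding Fmat_def by blast
  have surj: "\<exists>v\<in>Vec m. f v = x" if "x \<in> Fvec (Qadj z) r" for x
    using D(1) that unfolding bij_betw_def by (metis imageE)
  obtain w where w: "w \<in> Vec m" "f w = unit_vec r j" using surj[OF unit_vec_Fvec[OF F]] by blast
  \<comment> \<open>With \<open>w\<close> fixed, a suitable multiple of the first unit vector
    realizes any given \<open>x\<close> as a Hermitian product, and so its trace as a value of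
    \<open>B\<close>.\<close>
  have tr: "\<exists>v\<in>Vec m. f v = (x * inverse ?h) *s unit_vec r 0 \<and> Qtrace z x = bf B v w" if x: "x \<in> Qadj z" for x
  proof -
    have xh: "x * inverse ?h \<in> Qadj z" using F' x Qadj_inverse_closed[OF z h] by blast
    have "(x * inverse ?h) *s unit_vec r 0 \<in> Fvec (Qadj z) r"
      using unit_vec_Fvec[OF F, of r 0] xh F' unfolding Fvec_def by simp
    then obtain v where v: "v \<in> Vec m" "f v = (x * inverse ?h) *s unit_vec r 0" using surj by blast
    have "hf (Qbar z) r H (f v) (f w) = (x * inverse ?h) * hf (Qbar z) r H (unit_vec r 0) (unit_vec r j)"
      unfolding v(2) w(2) using H by (intro hf_smult_left) auto
    also have "hf (Qbar z) r H (unit_vec r 0) (unit_vec r j) = ?h" by (rule hf_unit[OF Qbar_hom[OF z] H r j(1)])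
    finally have "hf (Qbar z) r H (f v) (f w) = x" using j(2) by simp
    then show ?thesis using D(8)[OF v(1) w(1)] v by auto
  qed
  have add: "Qtrace z (x + y) = Qtrace z x + Qtrace z y" if x: "x \<in> Qadj z" and y: "y \<in> Qadj z" for x y
  proof -
    have xy: "x + y \<in> Qadj z" using F' x y by blast
    obtain v1 where v1: "v1 \<in> Vec m" "f v1 = (x * inverse ?h) *s unit_vec r 0" "Qtrace z x = bf B v1 w" using tr[OF x] by blast
    obtain v2 where v2: "v2 \<in> Vec m" "f v2 = (y * inverse ?h) *s unit_vec r 0" "Qtrace z y = bf B v2 w" using tr[OF y] by blast
    obtain v where v: "v \<in> Vec m" "f v = ((x + y) * inverse ?h) *s unit_vec r 0" "Qtrace z (x + y) = bf B v w" using tr[OF xy] by blast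
    have "f v = f (v1 + v2)" unfolding v(2) D(2)[OF v1(1) v2(1)] v1(2) v2(2) by (intro eq_vecI) (auto simp: algebra_simps)
    then have "v = v1 + v2" using D(1) v(1) v1(1) v2(1) unfolding bij_betw_def inj_on_def by (meson add_carrier_vec)
    then show ?thesis unfolding v(3) v1(3) v2(3) using bf_add_left[OF I'(1) v1(1) v2(1) w(1)] by simp
  qed
  let ?c = "inverse (a - b)"
  have "a - b \<in> Qadj z" using F' a b by (metis diff_conv_add_uminus)
  then have c: "?c \<in> Qadj z" by (rule Qadj_inverse_closed[OF z])
  have "?c * a = ?c * b + 1" using ne by (simp add: field_simps)
  then have "Qtrace z (?c * a) = Qtrace z (?c * b) + Qtrace z 1" using add[of "?c * b" 1] F' b c by metis
  then show False using e[OF c] Qtrace_one[OF z] by simp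
qed

text \<open>Collects all signs in the comparison of two discriminants: the two discriminant signs,
  \<open>(- 1) ^ s\<close> from negating a form of rank \<open>s\<close>, and
  \<open>(- 1) ^ k\<close> from the metabolic form. Substituting \<open>r = 2 k - s\<close>, the
  total exponent is \<open>2 (k^2 - k s) + s (s + 1)\<close>, which is even.\<close>

lemma triangular_sign:
  assumes "r + s = 2 * (k::nat)"
  shows "(- 1) ^ (r * (r - 1) div 2) * ((- 1) ^ (s * (s - 1) div 2)) * ((- 1) ^ s * (- 1) ^ k) = (1 :: 'a::comm_ring_1)"
proof -
  have t: "2 * int (n * (n - 1) div 2) = int n * int n - int n" for n :: nat
  proof -
    have "even (n * (n - 1))" by (cases n) auto
    then have "2 * (n * (n - 1) div 2) = n * (n - 1)" by simp
    then have "2 * int (n * (n - 1) div 2) = int (n * (n - 1))" by linarith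
    then show ?thesis by (cases n) (auto simp: algebra_simps)
  qed
  let ?N = "r * (r - 1) div 2 + s * (s - 1) div 2 + (s + k)"
  have r: "int r = 2 * int k - int s" using assms by linarith
  have e: "2 * int ?N = 2 * (2 * (int k * int k - int k * int s) + int s * (int s + 1))"
    using t[of r] t[of s] unfolding r by (simp add: algebra_simps)
  have "(2::int) \<noteq> 0" by simp
  from mult_left_cancel[OF this, THEN iffD1, OF e]
  have "int ?N = 2 * (int k * int k - int k * int s) + int s * (int s + 1)" .
  then have "even (int ?N)" by simp
  then have "even ?N" by presburger
  then have "(- 1) ^ ?N = (1 :: 'a)" by simp
  then show ?thesis by (simp only: power_add)
qed

text \<open>The rational relation between the two structures, transported by the lifts, is a
  Q(z)-subspace, since it is closed under the isometries. It is Lagrangian for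
  \<open>H1 \<boxplus> - H2\<close>. So the product of the two discriminants is a norm, and as each
  of them is fixed by the involution, they differ by a norm.\<close>

lemma witt_lift_unique:
  assumes z: "reciprocal z" and I1: "isometric_structure m1 (B1, T1)" and I2: "isometric_structure m2 (B2, T2)"
    and l1: "hermitian_lift z (B1, T1) r1 f1 H1" and l2: "hermitian_lift z (B2, T2) r2 f2 H2"
    and w: "witt_equivalent (B1, T1) (B2, T2)"
  shows "norms z #>\<^bsub>fixed_units z\<^esub> ((- 1) ^ (r1 * (r1 - 1) div 2) * det H1) =
    norms z #>\<^bsub>fixed_units z\<^esub> ((- 1) ^ (r2 * (r2 - 1) div 2) * det H2)"
proof -
  let ?F = "Qadj z" and ?s = "Qbar z"
  note D1 = hermitian_liftD[OF z I1 l1] and D2 = hermitian_liftD[OF z I2 l2]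
  note i1 = isometric_structureD[OF I1] and i2 = isometric_structureD[OF I2]
  note H1 = Fmat_carrier[OF D1(5)] and H2 = Fmat_carrier[OF D2(5)]
  note F = Qadj_subring[of z] and h = Qbar_hom[OF z]
  note F' = F[unfolded subring_set_def] and h' = h[unfolded hom_on_def]
  obtain R where "wrel m1 m2 (B1, T1) (B2, T2) R" using witt_equivalent_iff[OF I1 I2] w by blast
  then have R: "Lrel m1 m2 B1 B2 R" and inv: "\<And>x y. (x, y) \<in> R ==> (T1 *v x, T2 *v y) \<in> R"
    unfolding wrel_def by auto
  have lr: "linrel m1 m2 R" using R unfolding Lrel_def by blast
  note lD = linrelD[OF lr]
  have pR: "(pact T1 p x, pact T2 p y) \<in> R" if "(x, y) \<in> R" for p x y
    by (rule wrel_pact[OF lr i1(2) i2(2) _ that]) (rule inv)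
  have key: "hf ?s r1 H1 (f1 x) (f1 x') = hf ?s r2 H2 (f2 y) (f2 y')" if xy: "(x, y) \<in> R" and xy': "(x', y') \<in> R" for x y x' y'
  proof -
    note c = lD(1,2)[OF xy] lD(1,2)[OF xy']
    let ?a = "hf ?s r1 H1 (f1 x) (f1 x')" and ?b = "hf ?s r2 H2 (f2 y) (f2 y')"
    have m: "?a \<in> ?F" "?b \<in> ?F" using hf_closed[OF F h D1(5) D1(9) D1(9)] hf_closed[OF F h D2(5) D2(9) D2(9)] c by auto
    \<comment> \<open>Multiplication by \<open>u\<close> is a polynomial in the isometry and keeps
      the pair inside the relation, so all traces agree and the Hermitian values do too.\<close>
    have e: "Qtrace z (u * ?a) = Qtrace z (u * ?b)" if u: "u \<in> ?F" for u
    proof -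
      obtain p where p: "u = rpoly p z" using u unfolding Qadj_def by blast
      have "Qtrace z (u * ?a) = bf B1 (pact T1 p x) x'"
        unfolding D1(8)[OF pact_carrier[OF i1(2) c(1)] c(3)] D1(4)[OF c(1)] p[symmetric]
        by (subst hf_smult_left[OF H1]) (use D1(9) c Fvec_carrier in auto)
      also have "\<dots> = bf B2 (pact T2 p y) y'"
        using Lrel_isotropic[OF R] pR[OF xy, of p] xy' unfolding isotropic_rel_def by blast
      also have "\<dots> = Qtrace z (u * ?b)"
        unfolding D2(8)[OF pact_carrier[OF i2(2) c(2)] c(4)] D2(4)[OF c(2)] p[symmetric]
        by (subst hf_smult_left[OF H2]) (use D2(9) c Fvec_carrier in auto)
      finally show ?thesis .
    qed
    consider "r1 > 0" | "r2 > 0" | "r1 = 0" "r2 = 0" by blast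
    then show ?thesis
    proof cases
      case 1 show ?thesis by (rule lift_trace_separates[OF z I1 l1 1 m e])
    next
      case 2 show ?thesis by (rule lift_trace_separates[OF z I2 l2 2 m e])
    next
      case 3 then show ?thesis unfolding hf_def by simp
    qed
  qed
  let ?L = "{f1 x @\<^sub>v f2 y |x y. (x, y) \<in> R}"
  let ?G = "H1 \<boxplus> - H2"
  have G: "?G \<in> Fmat ?F (r1 + r2)"
  proof -
    have "?G \<in> Mat (r1 + r2) (r1 + r2)" using H1 H2 by (intro block_sum_carrier) auto
    moreover have "?G $$ (i, j) \<in> ?F" if "i < r1 + r2" "j < r1 + r2" for i j
      using that D1(5) D2(5) H1 H2 F' unfolding block_sum_def Fmat_def by auto
    ultimately show ?thesis unfolding Fmat_def by blast
  qed
  have Gh: "hermitian_on ?s (r1 + r2) ?G"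
  proof -
    have "?s (- (H2 $$ (i, j))) = - ?s (H2 $$ (i, j))" if "i < r2" "j < r2" for i j
      using hom_on_uminus[OF F h, of "H2 $$ (i, j)"] D2(5) that unfolding Fmat_def by blast
    moreover have "?s 0 = 0" using h' by blast
    moreover have e: "?G $$ (i, j) = (if i < r1 then if j < r1 then H1 $$ (i, j) else 0 else if j < r1 then 0 else - (H2 $$ (i - r1, j - r1)))"
      if "i < r1 + r2" "j < r1 + r2" for i j
      using that H1 H2 unfolding block_sum_def by auto
    ultimately show ?thesis unfolding hermitian_on_def
    proof (intro allI impI, goal_cases)
      case (1 i j)
      have "i - r1 < r2" "j - r1 < r2" if "\<not> i < r1" "\<not> j < r1" using that 1 by auto
      then have "- (H2 $$ (j - r1, i - r1)) = ?s (- (H2 $$ (i - r1, j - r1)))" if "\<not> i < r1" "\<not> j < r1"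
        using that 1(1) hermitian_onD[OF D2(6), of "i - r1" "j - r1"] by simp
      then show ?case unfolding e[OF 1(4,5)] e[OF 1(5,4)]
        using hermitian_onD[OF D1(6), of i j] 1(2) by (cases "i < r1"; cases "j < r1") simp_all
    qed
  qed
  have dG: "det ?G = det H1 * ((- 1) ^ r2 * det H2)"
  proof -
    have "- H2 = (- 1) \<cdot>\<^sub>m H2" by (intro eq_matI) auto
    then have "det (- H2) = (- 1) ^ r2 * det H2" using H2 by (metis carrier_matD(2) det_smult)
    then show ?thesis using det_block_sum[OF H1, of "- H2" r2] H2 by simp
  qed
  have mem: "f1 x @\<^sub>v f2 y \<in> Fvec ?F (r1 + r2)" if "x \<in> Vec m1" "y \<in> Vec m2" for x y
    using D1(9)[OF that(1)] D2(9)[OF that(2)] unfolding Fvec_def by (auto simp: index_append_vec)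
  have L: "lagrangian ?F ?s (r1 + r2) ?G ?L"
    unfolding lagrangian_def
  proof (intro conjI ballI)
    show "submod ?F (r1 + r2) ?L"
      unfolding submod_def
    proof (intro conjI ballI)
      show "?L \<subseteq> Fvec ?F (r1 + r2)" using mem lD(1,2) by blast
      have "0\<^sub>v (r1 + r2) = f1 (0\<^sub>v m1) @\<^sub>v f2 (0\<^sub>v m2)" unfolding D1(3) D2(3) by (rule append_vec_zero[symmetric])
      then show "0\<^sub>v (r1 + r2) \<in> ?L" using lD(3) by blast
    next
      fix u v assume "u \<in> ?L" "v \<in> ?L"
      then obtain x y x' y' where xy: "(x, y) \<in> R" "(x', y') \<in> R" "u = f1 x @\<^sub>v f2 y" "v = f1 x' @\<^sub>v f2 y'" by blast
      have "u + v = f1 (x + x') @\<^sub>v f2 (y + y')"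
        unfolding xy(3,4) D1(2)[OF lD(1)[OF xy(1)] lD(1)[OF xy(2)]] D2(2)[OF lD(2)[OF xy(1)] lD(2)[OF xy(2)]]
        by (rule append_vec_add'[where n = r1 and m = r2]) (use D1(9) D2(9) lD(1,2) xy Fvec_carrier in blast)+
      then show "u + v \<in> ?L" using lD(4)[OF xy(1,2)] by blast
    next
      fix c u assume "c \<in> ?F" "u \<in> ?L"
      then obtain x y p where xy: "(x, y) \<in> R" "u = f1 x @\<^sub>v f2 y" "c = rpoly p z" unfolding Qadj_def by blast
      have "c *s u = f1 (pact T1 p x) @\<^sub>v f2 (pact T2 p y)"
        unfolding xy(2,3) D1(4)[OF lD(1)[OF xy(1)]] D2(4)[OF lD(2)[OF xy(1)]] by (rule append_vec_smult)
      then show "c *s u \<in> ?L" using pR[OF xy(1), of p] by blast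
    qed
  next
    fix u assume u: "u \<in> Fvec ?F (r1 + r2)"
    show "u \<in> ?L \<longleftrightarrow> (\<forall>v\<in>?L. hf ?s (r1 + r2) ?G u v = 0)"
    proof
      assume "u \<in> ?L"
      then obtain x y where xy: "(x, y) \<in> R" "u = f1 x @\<^sub>v f2 y" by blast
      show "\<forall>v\<in>?L. hf ?s (r1 + r2) ?G u v = 0"
      proof
        fix v assume "v \<in> ?L"
        then obtain x' y' where xy': "(x', y') \<in> R" "v = f1 x' @\<^sub>v f2 y'" by blast
        have "hf ?s (r1 + r2) ?G u v = hf ?s r1 H1 (f1 x) (f1 x') - hf ?s r2 H2 (f2 y) (f2 y')"
          unfolding xy(2) xy'(2) by (rule hf_block_sum[OF H1 H2]) (use D1(9) D2(9) lD(1,2) xy xy' Fvec_carrier in blast)+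
        then show "hf ?s (r1 + r2) ?G u v = 0" using key[OF xy(1) xy'(1)] by simp
      qed
    next
      assume a: "\<forall>v\<in>?L. hf ?s (r1 + r2) ?G u v = 0"
      obtain a b where ab: "a \<in> Vec r1" "b \<in> Vec r2" "u = a @\<^sub>v b" using append_vec_cases[OF Fvec_carrier[OF u]] by blast
      have "a $ i \<in> ?F" if "i < r1" for i
      proof -
        have "u $ i \<in> ?F" using u that unfolding Fvec_def by simp
        then show ?thesis unfolding ab(3) using that ab(1,2) by simp
      qed
      then have a': "a \<in> Fvec ?F r1" using ab(1) unfolding Fvec_def by blast
      have "b $ i \<in> ?F" if "i < r2" for i
      proof -
        have "u $ (r1 + i) \<in> ?F" using u that unfolding Fvec_def by simp
        then show ?thesis unfolding ab(3) using that ab(1,2) by simp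
      qed
      then have b': "b \<in> Fvec ?F r2" using ab(2) unfolding Fvec_def by blast
      obtain x where x: "x \<in> Vec m1" "f1 x = a" using D1(1) a' unfolding bij_betw_def by (metis imageE)
      obtain y where y: "y \<in> Vec m2" "f2 y = b" using D2(1) b' unfolding bij_betw_def by (metis imageE)
      have "(x, y) \<in> R"
      proof (rule Lrel_memI[OF R x(1) y(1)])
        fix x' y' assume xy': "(x', y') \<in> R"
        have "hf ?s (r1 + r2) ?G u (f1 x' @\<^sub>v f2 y') = 0" using a xy' by blast
        moreover have "hf ?s (r1 + r2) ?G u (f1 x' @\<^sub>v f2 y') = hf ?s r1 H1 a (f1 x') - hf ?s r2 H2 b (f2 y')"
          unfolding ab(3) by (rule hf_block_sum[OF H1 H2]) (use D1(9) D2(9) lD(1,2) xy' ab Fvec_carrier in blast)+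
        ultimately have "hf ?s r1 H1 (f1 x) (f1 x') = hf ?s r2 H2 (f2 y) (f2 y')" using x(2) y(2) by simp
        then show "bf B1 x x' = bf B2 y y'" using D1(8)[OF x(1) lD(1)[OF xy']] D2(8)[OF y(1) lD(2)[OF xy']] by simp
      qed
      then show "u \<in> ?L" using ab(3) x(2) y(2) by blast
    qed
  qed
  have dG0: "det ?G \<noteq> 0" unfolding dG using D1(7) D2(7) by simp
  obtain k c where kc: "r1 + r2 = 2 * k" "c \<in> ?F" "det ?G = (- 1) ^ k * (c * ?s c)"
    using metabolic_hermitian_det[OF F h Qbar_involutive[OF z] Qadj_inverse_closed[OF z] G Gh dG0 L] by blast
  have c0: "c \<noteq> 0" using kc(3) dG0 by auto
  define t1 t2 :: complex where "t1 = (- 1) ^ (r1 * (r1 - 1) div 2)" and "t2 = (- 1) ^ (r2 * (r2 - 1) div 2)"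
  define d1 d2 where "d1 = t1 * det H1" and "d2 = t2 * det H2"
  have sg: "t1 * t2 * ((- 1) ^ r2 * (- 1) ^ k) = 1" unfolding t1_def t2_def by (rule triangular_sign[OF kc(1)])
  have "d1 * d2 = d1 * d2 * ((- 1) ^ k * (- 1) ^ k) * ((- 1) ^ r2 * (- 1) ^ r2)" by (simp flip: power_mult_distrib)
  also have "\<dots> = (t1 * t2 * ((- 1) ^ r2 * (- 1) ^ k)) * ((- 1) ^ k * (det H1 * ((- 1) ^ r2 * det H2)))"
    unfolding d1_def d2_def by (simp add: mult_ac)
  also have "\<dots> = (- 1) ^ k * ((- 1) ^ k * (c * ?s c))" unfolding sg dG[symmetric] kc(3) by simp
  also have "\<dots> = c * ?s c" by (simp flip: mult.assoc power_mult_distrib)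
  finally have dd: "d1 * d2 = c * ?s c" .
  have d2F: "det H2 \<in> ?F" "t2 \<in> ?F" "d2 \<in> ?F"
  proof -
    show "det H2 \<in> ?F" by (rule det_in_subring[OF F D2(5)])
    show "t2 \<in> ?F" unfolding t2_def by (intro subring_power[OF F]) (use F' in blast)
    then show "d2 \<in> ?F" unfolding d2_def using F' \<open>det H2 \<in> ?F\<close> by blast
  qed
  \<comment> \<open>The determinant of a Hermitian matrix is fixed by the involution; hence the
    square of \<open>d2\<close> is a norm.\<close>
  have s2: "?s d2 = d2"
  proof -
    have "?s t2 = t2"
    proof (cases "even (r2 * (r2 - 1) div 2)")
      case True then show ?thesis unfolding t2_def using h' by simp
    next
      case False
      then have "t2 = - 1" unfolding t2_def by simp
      moreover have "?s (- 1) = - ?s 1" by (rule hom_on_uminus[OF F h]) (use F' in blast)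
      ultimately show ?thesis using h' by simp
    qed
    moreover have "?s (det H2) = det H2"
    proof -
      have "map_mat ?s H2 = trp H2"
      proof (intro eq_matI)
        fix i j assume "i < dim_row (trp H2)" "j < dim_col (trp H2)"
        then have ij: "i < r2" "j < r2" using H2 by auto
        show "map_mat ?s H2 $$ (i, j) = trp H2 $$ (i, j)"
          using ij H2 hermitian_onD[OF D2(6) ij, symmetric] by simp
      qed (use H2 in auto)
      then show ?thesis using hom_on_det[OF F h D2(5)] det_transpose[OF H2] by simp
    qed
    moreover have "?s (t2 * det H2) = ?s t2 * ?s (det H2)" using h' d2F by blast
    ultimately show ?thesis unfolding d2_def by simp
  qed
  have d20: "d2 \<noteq> 0" unfolding d2_def t2_def using D2(7) by simp
  \<comment> \<open>From \<open>d1 * d2 = c * ?s c\<close>, dividing by the norm of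
    \<open>d2\<close> gives \<open>d1\<close> as the norm of \<open>u\<close> times
    \<open>d2\<close>.\<close>
  define u where "u = c * inverse d2"
  have uF: "u \<in> ?F" "u \<noteq> 0" unfolding u_def using F' kc(2) Qadj_inverse_closed[OF z d2F(3)] c0 d20 by auto
  have su: "?s u * d2 = ?s c"
  proof -
    have "?s (u * d2) = ?s u * ?s d2" using h' uF(1) d2F(3) by blast
    then show ?thesis unfolding s2 u_def using d20 by (simp add: mult.assoc)
  qed
  have d1: "d1 = (u * ?s u) * d2"
  proof -
    have "d1 * d2 = (u * d2) * (?s u * d2)" unfolding su dd unfolding u_def using d20 by simp
    then have "d1 * d2 = ((u * ?s u) * d2) * d2" by (simp add: mult_ac)
    then show ?thesis using d20 by simp
  qed
  have N: "a * b \<in> norms z" if ab: "a \<in> norms z" "b \<in> norms z" for a b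
  proof -
    obtain x y where xy: "x \<in> ?F" "x \<noteq> 0" "a = x * ?s x" "y \<in> ?F" "y \<noteq> 0" "b = y * ?s y" using ab unfolding norms_def by blast
    have "?s (x * y) = ?s x * ?s y" using h' xy by blast
    then have "a * b = (x * y) * ?s (x * y)" unfolding xy by (simp add: mult_ac)
    moreover have "x * y \<in> ?F" using F' xy by blast
    moreover have "x * y \<noteq> 0" using xy by simp
    ultimately show ?thesis unfolding norms_def by blast
  qed
  have su0: "?s u \<noteq> 0" using su c0 d20 Qbar_involutive[OF z kc(2)] h' by (metis mult_zero_left)
  have iu: "inverse u \<in> ?F" by (rule Qadj_inverse_closed[OF z uF(1)])
  have Nu: "u * ?s u \<in> norms z" "inverse (u * ?s u) \<in> norms z"
  proof -
    show "u * ?s u \<in> norms z" unfolding norms_def using uF by blast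
    have "?s (inverse u * u) = ?s (inverse u) * ?s u" using h' uF(1) iu by blast
    then have "?s (inverse u) * ?s u = 1" using h' uF(2) by simp
    then have "?s u * ?s (inverse u) = 1" by (simp only: mult.commute)
    then have "?s (inverse u) = inverse (?s u)" by (rule inverse_unique[symmetric])
    then have "inverse (u * ?s u) = inverse u * ?s (inverse u)" by simp
    then show "inverse (u * ?s u) \<in> norms z" unfolding norms_def using iu uF(2) by fastforce
  qed
  have "(\<Union>x\<in>norms z. {x * d1}) = (\<Union>x\<in>norms z. {x * d2})"
  proof (intro equalityI subsetI)
    fix y assume "y \<in> (\<Union>x\<in>norms z. {x * d1})"
    then obtain x where x: "x \<in> norms z" "y = x * d1" by blast
    have "y = (x * (u * ?s u)) * d2" unfolding x(2) d1 by (simp add: mult_ac)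
    then show "y \<in> (\<Union>x\<in>norms z. {x * d2})" using N[OF x(1) Nu(1)] by blast
  next
    fix y assume "y \<in> (\<Union>x\<in>norms z. {x * d2})"
    then obtain x where x: "x \<in> norms z" "y = x * d2" by blast
    have "inverse (u * ?s u) * (u * ?s u) = 1" by (rule left_inverse) (use uF(2) su0 in simp)
    then have "(x * inverse (u * ?s u)) * ((u * ?s u) * d2) = x * d2"
      by (metis mult.assoc mult.right_neutral)
    then have "y = (x * inverse (u * ?s u)) * d1" unfolding x(2) d1 by (rule sym)
    then show "y \<in> (\<Union>x\<in>norms z. {x * d1})" using N[OF x(1) Nu(2)] by blast
  qed
  then show ?thesis unfolding r_coset_def fixed_units_def d1_def d2_def t1_def t2_def by simp
qed

section \<open>Values of the discriminant invariant\<close>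

definition d_values :: "complex => int mat => complex set set" where
  "d_values z V = {c. \<exists>A n X Y r f H.
     A \<in> Mat n n \<and> det A \<noteq> 0 \<and> S_equivalent (rm V) A \<and>
     primary_part (min_poly z) (seifert_structure A) X \<and>
     witt_equivalent X Y \<and>
     poly_mat (min_poly z) (snd Y) = 0\<^sub>m (dim_row (snd Y)) (dim_row (snd Y)) \<and>
     hermitian_lift z Y r f H \<and>
     c = norms z #>\<^bsub>fixed_units z\<^esub> ((-1) ^ (r * (r - 1) div 2) * det H)}"

lemma d_inv_values: "d_inv z V = (THE c. c \<in> d_values z V)"
  unfolding d_inv_def d_values_def by simp

lemma d_valuesE:
  assumes "c \<in> d_values z V"
  obtains A n X Y r f H where "A \<in> Mat n n" "det A \<noteq> 0" "S_equivalent (rm V) A"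
     "primary_part (min_poly z) (seifert_structure A) X" "witt_equivalent X Y"
     "poly_mat (min_poly z) (snd Y) = 0\<^sub>m (dim_row (snd Y)) (dim_row (snd Y))" "hermitian_lift z Y r f H"
     "c = norms z #>\<^bsub>fixed_units z\<^esub> ((-1) ^ (r * (r - 1) div 2) * det H)"
  using assms unfolding d_values_def by blast

lemma sim_primary_parts:
  assumes z: "reciprocal z" and A: "A \<in> Mat n n" "det A \<noteq> 0" "det (sp A) \<noteq> 0"
    and B: "B \<in> Mat m m" "det B \<noteq> 0" "det (sp B) \<noteq> 0" and s: "sim A B"
    and pp: "primary_part (min_poly z) (seifert_structure A) X" "primary_part (min_poly z) (seifert_structure B) X'"
  shows "witt_equivalent X X'"
proof -
  obtain c where c: "reflect_poly (min_poly z) = Polynomial.smult c (min_poly z)" using reflect_min_poly[OF z] by blast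
  obtain G T where GT: "seifert_structure A = (G, T)" by fastforce
  obtain G' T' where GT': "seifert_structure B = (G', T')" by fastforce
  note i = seifert_isometric_structure[OF A, unfolded GT] seifert_isometric_structure[OF B, unfolded GT']
  show ?thesis
    by (rule witt_primary_parts[OF i reciprocalD(2)[OF z] c sim_witt_equivalent[OF A B s, unfolded GT GT'] pp[unfolded GT GT']])
qed

lemma seifert_nonsingular:
  assumes "seifert_matrix V" "S_equivalent (rm V) A"
  shows "sim (rm V) A" "det (sp A) \<noteq> 0"
proof -
  obtain n where n: "V \<in> Mat n n" using seifert_carrier[OF assms(1)] by blast
  then have "rm V \<in> Mat n n" by simp
  from S_equivalent_sim[OF assms(2) this seifert_det_rat[OF assms(1)]] seifert_det_sp[OF assms(1)]
  show "sim (rm V) A" "det (sp A) \<noteq> 0" by auto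
qed

text \<open>Frees the choice of the matrix: instead of being S-equivalent to the Seifert matrix, a
  nonsingular \<open>B\<close> need only be related to it by \<open>sim\<close>. The value passes to
  an S-equivalent nonsingular matrix through Witt equivalence of primary parts.\<close>

lemma d_valuesI:
  assumes z: "reciprocal z" and V: "seifert_matrix V"
    and B: "B \<in> Mat m m" "det B \<noteq> 0" "det (sp B) \<noteq> 0" and s: "sim B (rm V)"
    and X: "primary_part (min_poly z) (seifert_structure B) X" and Y: "witt_equivalent X Y"
    "poly_mat (min_poly z) (snd Y) = 0\<^sub>m (dim_row (snd Y)) (dim_row (snd Y))" "hermitian_lift z Y r f H"
  shows "norms z #>\<^bsub>fixed_units z\<^esub> ((-1) ^ (r * (r - 1) div 2) * det H) \<in> d_values z V"
proof -
  obtain n where n: "V \<in> Mat n n" using seifert_carrier[OF V] by blast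
  then have "rm V \<in> Mat n n" by simp
  then obtain k A where A: "A \<in> Mat k k" "det A \<noteq> 0" "S_equivalent (rm V) A"
    using S_equivalent_nonsingular seifert_det_rat[OF V] by blast
  note sA = seifert_nonsingular[OF V A(3)]
  obtain G T where GT: "seifert_structure A = (G, T)" by fastforce
  obtain X' where X': "primary_part (min_poly z) (seifert_structure A) X'"
    using primary_part_exists[OF seifert_isometric_structure[OF A(1,2) sA(2), unfolded GT] reciprocalD(2)[OF z]] unfolding GT by blast
  have "witt_equivalent X X'" by (rule sim_primary_parts[OF z B A(1,2) sA(2) sim_trans[OF s sA(1)] X X'])
  then have "witt_equivalent X' Y" using witt_sym witt_trans Y(1) by blast
  then show ?thesis unfolding d_values_def using A X' Y(2,3) by blast
qed

lemma d_values_unique: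
  assumes z: "reciprocal z" and V: "seifert_matrix V" and c: "c \<in> d_values z V" and c': "c' \<in> d_values z V"
  shows "c = c'"
proof -
  obtain A n X Y r f H where 1: "A \<in> Mat n n" "det A \<noteq> 0" "S_equivalent (rm V) A"
     "primary_part (min_poly z) (seifert_structure A) X" "witt_equivalent X Y" "hermitian_lift z Y r f H"
     "c = norms z #>\<^bsub>fixed_units z\<^esub> ((-1) ^ (r * (r - 1) div 2) * det H)" using c unfolding d_values_def by blast
  obtain A' n' X' Y' r' f' H' where 2: "A' \<in> Mat n' n'" "det A' \<noteq> 0" "S_equivalent (rm V) A'"
     "primary_part (min_poly z) (seifert_structure A') X'" "witt_equivalent X' Y'" "hermitian_lift z Y' r' f' H'"
     "c' = norms z #>\<^bsub>fixed_units z\<^esub> ((-1) ^ (r' * (r' - 1) div 2) * det H')" using c' unfolding d_values_def by blast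
  note s = seifert_nonsingular[OF V 1(3)] seifert_nonsingular[OF V 2(3)]
  have "witt_equivalent X X'"
    by (rule sim_primary_parts[OF z 1(1,2) s(2) 2(1,2) s(4) sim_trans[OF sim_sym[OF s(1)] s(3)] 1(4) 2(4)])
  then have w: "witt_equivalent Y Y'" using witt_sym witt_trans 1(5) 2(5) by blast
  then obtain m m' where i: "isometric_structure m Y" "isometric_structure m' Y'" unfolding witt_equivalent_def by blast
  obtain B T B' T' where Y: "Y = (B, T)" "Y' = (B', T')" by fastforce
  show ?thesis unfolding 1(7) 2(7)
    by (rule witt_lift_unique[OF z i[unfolded Y] 1(6)[unfolded Y] 2(6)[unfolded Y] w[unfolded Y]])
qed

lemma d_inv_eqI: "reciprocal z ==> seifert_matrix V ==> c \<in> d_values z V ==> d_inv z V = c"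
  unfolding d_inv_values by (rule the_equality) (simp_all add: d_values_unique)

lemma d_values_concordant:
  assumes z: "reciprocal z" and VW: "(V, W) \<in> alg_concordant"
  shows "d_values z V \<subseteq> d_values z W"
proof
  fix c assume "c \<in> d_values z V"
  then show "c \<in> d_values z W"
  proof (cases rule: d_valuesE)
    case (1 A n X Y r f H)
    have V: "seifert_matrix V" "seifert_matrix W" "sim (rm V) (rm W)" using VW unfolding alg_concordant_iff by auto
    note s = seifert_nonsingular[OF V(1) 1(3)]
    show ?thesis unfolding 1(8)
      by (rule d_valuesI[OF z V(2) 1(1,2) s(2) sim_trans[OF sim_sym[OF s(1)] V(3)] 1(4-7)])
  qed
qed

lemma twist_nonsingular:
  assumes n: "n > 0"
  shows "rm (twist_knot n) \<in> Mat 2 2" "det (rm (twist_knot n)) \<noteq> 0" "det (sp (rm (twist_knot n))) \<noteq> 0"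
  using n seifert_det_sp[OF seifert_matrix_twist_knot] unfolding rm_twist by (auto simp: mat2_det)

lemma twist_structure:
  assumes n: "n > 0"
  shows "seifert_structure (rm (twist_knot n)) = (mat2 (- 2) 1 1 (2 * of_nat n), mat2 (1 + 1 / of_nat n) 1 (1 / of_nat n) 1)"
proof -
  note A = twist_nonsingular[OF n]
  have "rm (twist_knot n) * mat2 (1 + 1 / of_nat n) 1 (1 / of_nat n) 1 = trp (rm (twist_knot n))"
    using n unfolding rm_twist mat2_mult mat2_transpose by (simp add: field_simps)
  then have "snd (seifert_structure (rm (twist_knot n))) = mat2 (1 + 1 / of_nat n) 1 (1 / of_nat n) 1"
    by (rule seifert_structure(4)[OF A(1,2) mat2_carrier])
  moreover have "fst (seifert_structure (rm (twist_knot n))) = mat2 (- 2) 1 1 (2 * of_nat n)"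
    unfolding seifert_structure(1)[OF A(1,2)] unfolding sp_def rm_twist mat2_transpose mat2_add by simp
  ultimately show ?thesis by (simp add: prod_eq_iff)
qed

lemma seifert_structure_sum:
  assumes A: "A \<in> Mat n n" "det A \<noteq> 0" and B: "B \<in> Mat m m" "det B \<noteq> 0"
  shows "seifert_structure (A \<boxplus> B) = (fst (seifert_structure A) \<boxplus> fst (seifert_structure B), snd (seifert_structure A) \<boxplus> snd (seifert_structure B))"
proof -
  let ?S = "snd (seifert_structure A)" and ?S' = "snd (seifert_structure B)"
  note a = seifert_structure[OF A] and b = seifert_structure[OF B]
  have c: "A \<boxplus> B \<in> Mat (n + m) (n + m)" "det (A \<boxplus> B) \<noteq> 0"
    using block_sum_carrier[OF A(1) B(1)] det_block_sum[OF A(1) B(1)] A(2) B(2) by auto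
  have T: "?S \<boxplus> ?S' \<in> Mat (n + m) (n + m)"
    by (rule block_sum_carrier[OF a(2) b(2)])
  have "(A \<boxplus> B) * (?S \<boxplus> ?S') = trp (A \<boxplus> B)"
  proof -
    have "(A \<boxplus> B) * (?S \<boxplus> ?S') = trp A \<boxplus> trp B"
      unfolding a(3)[symmetric] b(3)[symmetric]
    proof (rule mat_eq_actI[where n = "n + m" and m = "n + m"])
      show "(A \<boxplus> B) * (?S \<boxplus> ?S') \<in> Mat (n + m) (n + m)"
        using c(1) T by (rule mult_carrier_mat)
      show "A * ?S \<boxplus> B * ?S' \<in> Mat (n + m) (n + m)"
        using A(1) B(1) a(2) b(2) by (intro block_sum_carrier mult_carrier_mat)
      fix v :: "rat vec" assume "v \<in> Vec (n + m)"
      then obtain x y where xy: "x \<in> Vec n" "y \<in> Vec m" "v = x @\<^sub>v y" using append_vec_cases by blast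
      have sx: "?S *v x \<in> Vec n" "?S' *v y \<in> Vec m"
        using mult_mat_vec_carrier[OF a(2) xy(1)] mult_mat_vec_carrier[OF b(2) xy(2)] by auto
      have v: "v \<in> Vec (n + m)" using xy by simp
      have "((A \<boxplus> B) * (?S \<boxplus> ?S')) *v v =
        (A \<boxplus> B) *v ((?S *v x) @\<^sub>v (?S' *v y))"
        unfolding assoc_mult_mat_vec[OF c(1) T v] unfolding xy(3) block_sum_mult_vec[OF a(2) b(2) xy(1,2)] ..
      also have "\<dots> = (A *v (?S *v x)) @\<^sub>v (B *v (?S' *v y))"
        by (rule block_sum_mult_vec[OF A(1) B(1) sx])
      also have "\<dots> = ((A * ?S) *v x) @\<^sub>v ((B * ?S') *v y)"
        unfolding assoc_mult_mat_vec[OF A(1) a(2) xy(1)] assoc_mult_mat_vec[OF B(1) b(2) xy(2)] ..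
      also have "\<dots> = (A * ?S \<boxplus> B * ?S') *v v"
        unfolding xy(3) using A(1) B(1) a(2) b(2) xy(1,2) by (intro block_sum_mult_vec[symmetric] mult_carrier_mat)
      finally show "((A \<boxplus> B) * (?S \<boxplus> ?S')) *v v =
        (A * ?S \<boxplus> B * ?S') *v v" .
    qed
    also have "\<dots> = trp (A \<boxplus> B)"
      using A(1) B(1) unfolding block_sum_def by (intro eq_matI) auto
    finally show ?thesis .
  qed
  then have "snd (seifert_structure (A \<boxplus> B)) = ?S \<boxplus> ?S'"
    by (rule seifert_structure(4)[OF c T])
  moreover have "fst (seifert_structure (A \<boxplus> B)) = fst (seifert_structure A) \<boxplus> fst (seifert_structure B)"
    unfolding seifert_structure(1)[OF c] a(1) b(1) by (rule sp_block_sum[OF A(1) B(1)])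
  ultimately show ?thesis by (simp add: prod_eq_iff)
qed

abbreviation twist_isometry :: "nat => rat mat" where
  "twist_isometry n \<equiv> mat2 (1 + 1 / of_nat n) 1 (1 / of_nat n) 1"

lemma mat2_mult_vec': "w \<in> Vec 2 ==> mat2 a b c d *v w =
  vec 2 (\<lambda>i. if i = 0 then a * w $ 0 + b * w $ 1 else c * w $ 0 + d * w $ 1 :: 'a::comm_ring_1)"
  unfolding mat2_def by (rule mat2_mult_vec)

text \<open>Cayley-Hamilton: the isometry has determinant 1 and trace \<open>2 + 1 / n\<close>, so
  \<open>delta n\<close> is \<open>n\<close> times its characteristic polynomial.\<close>

lemma twist_annihilated:
  assumes n: "n > 0" and v: "v \<in> Vec 2"
  shows "pact (twist_isometry n) (delta n) v = 0\<^sub>v 2"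
proof -
  let ?T = "twist_isometry n"
  define N d a b :: rat where "N = of_nat n" and "d = 1 / N" and "a = v $ 0" and "b = v $ 1"
  have Nd: "N * d = 1" unfolding N_def d_def using n by simp
  have T: "?T \<in> Mat 2 2" by simp
  have c: "?T *v v \<in> Vec 2" "?T *v (?T *v v) \<in> Vec 2" "?T *v (?T *v (?T *v v)) \<in> Vec 2"
    using mult_mat_vec_carrier[OF T] v by auto
  have 1: "?T *v v = vec 2 (\<lambda>i. if i = 0 then (1 + d) * a + b else d * a + b)"
    unfolding mat2_mult_vec'[OF v] a_def b_def d_def N_def by (intro eq_vecI) simp_all
  have 2: "?T *v (?T *v v) = vec 2 (\<lambda>i. if i = 0 then (1 + d) * ((1 + d) * a + b) + (d * a + b) else d * ((1 + d) * a + b) + (d * a + b))"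
    unfolding 1 by (subst mat2_mult_vec') (auto simp: d_def N_def)
  have e: "N * a + (- (2 * N + 1) * ((1 + d) * a + b) + N * ((1 + d) * ((1 + d) * a + b) + (d * a + b))) = 0"
    "N * b + (- (2 * N + 1) * (d * a + b) + N * (d * ((1 + d) * a + b) + (d * a + b))) = 0"
  proof -
    have "N * a + (- (2 * N + 1) * ((1 + d) * a + b) + N * ((1 + d) * ((1 + d) * a + b) + (d * a + b))) = (N * d - 1) * ((1 + d) * a + b)"
      "N * b + (- (2 * N + 1) * (d * a + b) + N * (d * ((1 + d) * a + b) + (d * a + b))) = (N * d - 1) * (d * a + b)"
      by (simp_all add: algebra_simps)
    then show "N * a + (- (2 * N + 1) * ((1 + d) * a + b) + N * ((1 + d) * ((1 + d) * a + b) + (d * a + b))) = 0"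
      "N * b + (- (2 * N + 1) * (d * a + b) + N * (d * ((1 + d) * a + b) + (d * a + b))) = 0" unfolding Nd by simp_all
  qed
  have "pact ?T (delta n) v = N *s v + ((- (2 * N + 1)) *s (?T *v v) + (N *s (?T *v (?T *v v)) + 0\<^sub>v 2))"
    unfolding delta_def pact_pCons[OF T v] pact_pCons[OF T c(1)] pact_pCons[OF T c(2)] pact_0[OF T c(3)] N_def ..
  also have "\<dots> = 0\<^sub>v 2"
  proof (intro eq_vecI)
    fix i :: nat assume "i < dim_vec (0\<^sub>v 2 :: rat vec)"
    then have "i = 0 \<or> i = 1" by auto
    then show "(N *s v + ((- (2 * N + 1)) *s (?T *v v) + (N *s (?T *v (?T *v v)) + 0\<^sub>v 2))) $ i = 0\<^sub>v 2 $ i"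
      unfolding 2 unfolding 1 using e v by (elim disjE) (simp_all add: a_def b_def)
  qed (use v in simp)
  finally show ?thesis .
qed

text \<open>The minimal polynomial of \<open>z\<close> does not divide \<open>delta m\<close>, which
  kills the added block; the primary part, and everything computed from it, is literally
  unchanged.\<close>

lemma d_values_twist_subset:
  assumes z: "reciprocal z" and V: "seifert_matrix V" and m: "m > 0" and d: "rpoly (delta m) z \<noteq> 0"
  shows "d_values z V \<subseteq> d_values z (V \<boxplus> twist_knot m)"
proof
  fix c assume "c \<in> d_values z V"
  then show "c \<in> d_values z (V \<boxplus> twist_knot m)"
  proof (cases rule: d_valuesE)
    case (1 A n X Y r f H)
    let ?W = "twist_knot m"
    note s = seifert_nonsingular[OF V 1(3)] and W = twist_nonsingular[OF m]
    have B: "A \<boxplus> rm ?W \<in> Mat (n + 2) (n + 2)" "det (A \<boxplus> rm ?W) \<noteq> 0" "det (sp (A \<boxplus> rm ?W)) \<noteq> 0"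
      using block_sum_carrier[OF 1(1) W(1)] det_block_sum[OF 1(1) W(1)] 1(2) W(2)
        det_block_sum[OF sp_carrier[OF 1(1)] sp_carrier[OF W(1)]] s(2) W(3)
      unfolding sp_block_sum[OF 1(1) W(1)] by auto
    obtain k where k: "V \<in> Mat k k" using seifert_carrier[OF V] by blast
    have "sim (A \<boxplus> rm ?W) (rm V \<boxplus> rm ?W)"
      by (rule sim_block_sum[OF sim_sym[OF s(1)] sim_refl[OF W(1) seifert_det_rat[OF seifert_matrix_twist_knot]]])
    also have "rm V \<boxplus> rm ?W = rm (V \<boxplus> ?W)" using map_block_sum[OF k twist_knot_carrier, of rat_of_int] by simp
    finally have sB: "sim (A \<boxplus> rm ?W) (rm (V \<boxplus> ?W))" .
    note a = seifert_structure[OF 1(1,2)]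
    have q: "\<not> min_poly z dvd delta m" using d reciprocalD(4)[OF z] by blast
    have X: "primary_part (min_poly z) (seifert_structure (A \<boxplus> rm ?W)) X"
      unfolding seifert_structure_sum[OF 1(1,2) W(1,2)] twist_structure[OF m] fst_conv snd_conv
    proof (rule primary_part_block_sum[where g = "delta m" and n = n and l = 2])
      show "fst (seifert_structure A) \<in> Mat n n" unfolding a(1) using 1(1) by simp
      show "primary_part (min_poly z) (fst (seifert_structure A), snd (seifert_structure A)) X" using 1(4) by simp
    qed (use a(2) q twist_annihilated[OF m] reciprocalD(2)[OF z] in auto)
    show ?thesis unfolding 1(8)
      by (rule d_valuesI[OF z seifert_block_sum[OF V seifert_matrix_twist_knot] B sB X 1(5-7)])
  qed
qed

lemma twist_concordant_4:
  assumes V: "seifert_matrix V" and m: "m > 0"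
  defines "W \<equiv> twist_knot m"
  shows "(V \<boxplus> W \<boxplus> W \<boxplus> W \<boxplus> W, V) \<in> alg_concordant"
proof -
  have W: "seifert_matrix W" unfolding W_def by (rule seifert_matrix_twist_knot)
  interpret comm_group AG by (rule AG_comm_group)
  let ?X = "alg_class W" and ?Y = "alg_class V"
  have c: "?X \<in> carrier AG" "?Y \<in> carrier AG" using V W AG_carrier by blast+
  note sb = seifert_block_sum
  have "alg_class (V \<boxplus> W \<boxplus> W \<boxplus> W \<boxplus> W) = ?Y \<otimes>\<^bsub>AG\<^esub> ?X \<otimes>\<^bsub>AG\<^esub> ?X \<otimes>\<^bsub>AG\<^esub> ?X \<otimes>\<^bsub>AG\<^esub> ?X"
    using V W by (simp add: AG_mult sb)
  also have "\<dots> = ?Y \<otimes>\<^bsub>AG\<^esub> (?X \<otimes>\<^bsub>AG\<^esub> ?X \<otimes>\<^bsub>AG\<^esub> (?X \<otimes>\<^bsub>AG\<^esub> ?X))" using c by (simp add: m_assoc)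
  also have "\<dots> = ?Y" using twist_order_4[OF m] c unfolding W_def by simp
  finally have "alg_class (V \<boxplus> W \<boxplus> W \<boxplus> W \<boxplus> W) = ?Y" .
  moreover have "seifert_matrix (V \<boxplus> W \<boxplus> W \<boxplus> W \<boxplus> W)" by (intro sb V W)
  ultimately show ?thesis using alg_class_eq_iff[OF _ V] by simp
qed

text \<open>The reverse inclusion comes from adding \<open>T_m\<close> three more times: the sets
  only grow, and after four copies the class, hence the set, is the original one.\<close>

lemma d_values_twist:
  assumes z: "reciprocal z" and V: "seifert_matrix V" and m: "m > 0" and d: "rpoly (delta m) z \<noteq> 0"
  shows "d_values z (V \<boxplus> twist_knot m) = d_values z V"
proof
  let ?W = "twist_knot m"
  note W = seifert_matrix_twist_knot[of m] and sb = seifert_block_sum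
  show "d_values z V \<subseteq> d_values z (V \<boxplus> ?W)" by (rule d_values_twist_subset[OF assms])
  note 1 = d_values_twist_subset[OF z sb[OF V W] m d] d_values_twist_subset[OF z sb[OF sb[OF V W] W] m d]
    d_values_twist_subset[OF z sb[OF sb[OF sb[OF V W] W] W] m d] d_values_concordant[OF z twist_concordant_4[OF V m]]
  then show "d_values z (V \<boxplus> ?W) \<subseteq> d_values z V" by blast
qed

lemma witt_refl:
  assumes "isometric_structure n X"
  shows "witt_equivalent X X"
proof -
  obtain B T where X: "X = (B, T)" by fastforce
  note i = isometric_structureD[OF assms[unfolded X]]
  have e: "trp (1\<^sub>m n) * B * 1\<^sub>m n = B" using i(1) by simp
  have "Lrel n n B B {(1\<^sub>m n *v v, v) |v. v \<in> Vec n}"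
    using Lrel_graph[OF i(1,4) one_carrier_mat] unfolding e by simp
  moreover have "{(1\<^sub>m n *v v, v) |v. v \<in> Vec n} = {(v, v) |v :: rat vec. v \<in> Vec n}" by force
  ultimately have "wrel n n (B, T) (B, T) {(v, v) |v. v \<in> Vec n}"
    unfolding wrel_def using mult_mat_vec_carrier[OF i(2)] by auto
  then show ?thesis using witt_equivalent_iff[OF assms assms] unfolding X by blast
qed

lemma primary_part_self:
  assumes B: "B \<in> Mat n n" and T: "T \<in> Mat n n" and q: "poly_mat q T = 0\<^sub>m n n"
  shows "primary_part q (B, T) (B, T)"
proof -
  have "v \<in> (\<Union>k. mat_kernel (poly_mat (q ^ k) T))" if v: "v \<in> Vec n" for v
  proof -
    have "pact T (q ^ 1) v = 0\<^sub>v n" unfolding pact_def using q v by (intro eq_vecI) auto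
    then show ?thesis unfolding primary_kernel[OF T] using v by blast
  qed
  moreover have "(\<Union>k. mat_kernel (poly_mat (q ^ k) T)) \<subseteq> Vec n" unfolding primary_kernel[OF T] by blast
  moreover have "(\<lambda>v. 1\<^sub>m n *v v) ` Vec n = (Vec n :: rat vec set)" by force
  moreover have "mat_kernel (1\<^sub>m n) = {0\<^sub>v n :: rat vec}" unfolding mat_kernel_def by auto
  ultimately show ?thesis unfolding primary_part_def prod.case
    by (intro exI[of _ n] exI[of _ "1\<^sub>m n"]) (use B T in auto)
qed

lemma one_in_norms: "reciprocal z ==> 1 \<in> norms z"
  unfolding norms_def using Qbar_rpoly[of z 1] Qadj_I[of 1 z] by (intro CollectI exI[of _ 1]) auto

text \<open>The empty Hermitian form of rank 0 has determinant 1, so the value is the coset of the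
  norms.\<close>

lemma d_inv_unknot:
  assumes z: "reciprocal z"
  shows "d_inv z (0\<^sub>m 0 0) = \<one>\<^bsub>d_group z\<^esub>"
proof -
  let ?Z = "0\<^sub>m 0 0 :: rat mat"
  have d0: "det ?Z = 1" by simp
  have s: "seifert_structure ?Z = (?Z, ?Z)"
  proof -
    have "?Z * ?Z = trp ?Z" by (intro eq_matI) auto
    then have "snd (seifert_structure ?Z) = ?Z" using seifert_structure(4)[of ?Z 0 ?Z] d0 by simp
    moreover have "fst (seifert_structure ?Z) = ?Z" using seifert_structure(1)[of ?Z 0] unfolding sp_def
      by (intro eq_matI) (auto simp: seifert_structure_def)
    ultimately show ?thesis by (simp add: prod_eq_iff)
  qed
  have spZ: "sp ?Z = ?Z" unfolding sp_def by (intro eq_matI) auto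
  have I: "isometric_structure 0 (?Z, ?Z)"
    using seifert_isometric_structure[of ?Z 0] d0 unfolding s spZ by simp
  have pz: "poly_mat q ?Z = ?Z" for q unfolding poly_mat_def by (intro eq_matI) auto
  have skZ: "sk ?Z = ?Z" unfolding sk_def by (intro eq_matI) auto
  have rmZ: "rm (0\<^sub>m 0 0) = ?Z" by (intro eq_matI) auto
  have cv: "Vec 0 = {0\<^sub>v 0 :: 'a::zero vec}" by auto
  have l: "hermitian_lift z (?Z, ?Z) 0 (\<lambda>_. 0\<^sub>v 0) (0\<^sub>m 0 0)"
    unfolding hermitian_lift_def Let_def prod.case
    using Qtrace_eqI[OF z, of 0 0] by (auto simp: cv bij_betw_def scalar_prod_def)
  have "norms z #>\<^bsub>fixed_units z\<^esub> ((-1) ^ (0 * (0 - 1) div 2) * det (0\<^sub>m 0 0)) \<in> d_values z (0\<^sub>m 0 0)"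
    by (rule d_valuesI[OF z seifert_zero, of ?Z 0 "(?Z, ?Z)" "(?Z, ?Z)" 0])
      (use d0 s spZ skZ rmZ sim_refl[of ?Z 0] primary_part_self[of ?Z 0 ?Z] pz witt_refl[OF I] l in auto)
  then have "norms z #>\<^bsub>fixed_units z\<^esub> 1 \<in> d_values z (0\<^sub>m 0 0)" by simp
  then have "d_inv z (0\<^sub>m 0 0) = norms z #>\<^bsub>fixed_units z\<^esub> 1" by (rule d_inv_eqI[OF z seifert_zero])
  then show ?thesis unfolding d_group_def FactGroup_def r_coset_def fixed_units_def by simp
qed

section \<open>The discriminant of two copies of a twist knot\<close>

text \<open>The symmetrized Seifert form of \<open>T_n\<close> is the trace form of the rank one
  Hermitian form -1, in the coordinate \<open>x0 - (N + 1) x1 + z N x1\<close>. The left side is the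
  sum over the conjugates \<open>z\<close> and \<open>w = inverse z\<close>.\<close>

lemma twist_trace_identity:
  fixes N z w x0 x1 y0 y1 :: complex
  assumes "N * (z + w) = 2 * N + 1" "z * w = 1"
  shows "- ((x0 - (N + 1) * x1 + z * (N * x1)) * (y0 - (N + 1) * y1 + w * (N * y1))) +
     - ((x0 - (N + 1) * x1 + w * (N * x1)) * (y0 - (N + 1) * y1 + z * (N * y1))) =
     x0 * (- 2 * y0 + y1) + x1 * (y0 + 2 * N * y1)"
proof -
  define X Y where "X = x0 - (N + 1) * x1" and "Y = y0 - (N + 1) * y1"
  have "- ((X + z * (N * x1)) * (Y + w * (N * y1))) + - ((X + w * (N * x1)) * (Y + z * (N * y1))) =
    - (2 * X * Y + (X * y1 + x1 * Y) * (N * (z + w)) + 2 * N * N * x1 * y1 * (z * w))"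
    by (simp add: algebra_simps)
  also have "\<dots> = x0 * (- 2 * y0 + y1) + x1 * (y0 + 2 * N * y1)"
    unfolding assms unfolding X_def Y_def by (simp add: algebra_simps)
  finally show ?thesis unfolding X_def Y_def .
qed

text \<open>The same coordinate is a left eigenvector of the isometry with eigenvalue
  \<open>z\<close>, so the isometry becomes multiplication by \<open>z\<close>.\<close>

lemma twist_eigen_identity:
  fixes N z d x0 x1 :: complex
  assumes "N * d = 1" "N * (z - 1)\<^sup>2 - z = 0"
  shows "(1 + d) * x0 + x1 - (N + 1) * (d * x0 + x1) + z * (N * (d * x0 + x1)) = z * (x0 - (N + 1) * x1 + z * (N * x1))"
proof -
  have "(1 + d) * x0 + x1 - (N + 1) * (d * x0 + x1) + z * (N * (d * x0 + x1)) = z * x0 + N * x1 * (z - 1) + (N * d - 1) * (z - 1) * x0"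
    by (simp add: algebra_simps)
  moreover have "z * (x0 - (N + 1) * x1 + z * (N * x1)) = z * x0 + N * x1 * (z - 1) + (N * (z - 1)\<^sup>2 - z) * x1"
    by (simp add: algebra_simps power2_eq_square)
  ultimately show ?thesis using assms by simp
qed

text \<open>Each copy lifts to the Hermitian form -1. In rank two the determinant is 1 and the sign
  \<open>(- 1) ^ (2 * (2 - 1) div 2)\<close> is -1, so the discriminant is the class of -1.\<close>

lemma twist_double_d:
  assumes z: "reciprocal z" and n: "n > 0" and nsq: "\<nexists>k. 4 * n + 1 = k\<^sup>2" and r: "rpoly (delta n) z = 0"
  shows "norms z #>\<^bsub>fixed_units z\<^esub> (- 1) \<in> d_values z (twist_knot n \<boxplus> twist_knot n)"
proof -
  define N :: rat where "N = of_nat n"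
  define w where "w = inverse z"
  define G T where "G = mat2 (- 2) 1 1 (2 * N)" and "T = twist_isometry n"
  \<comment> \<open>\<open>p x\<close> represents the coordinate of \<open>x\<close> as a polynomial
    in \<open>z\<close>. \<open>q y\<close> represents the conjugate coordinate, rewritten as a
    polynomial in \<open>z\<close> by means of \<open>N (z + w) = 2 N + 1\<close>; this is needed
    because \<open>Qtrace\<close> is evaluated on a single representing polynomial.\<close>
  define p q :: "rat vec => rat poly" where "p x = [:x $ 0 - (N + 1) * x $ 1, N * x $ 1:]" and "q y = [:y $ 0 + N * y $ 1, - (N * y $ 1):]" for x y
  define g where "g x = rpoly (p x) z" for x
  define f where "f u = vec 2 (\<lambda>i. if i = 0 then g (vec 2 (\<lambda>j. u $ j)) else g (vec 2 (\<lambda>j. u $ (2 + j))))" for u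
  note z0 = delta_root_nonzero(1)[OF r n] and zw = delta_root_nonzero(3)[OF r n]
  have N: "N \<noteq> 0" "(of_rat N :: complex) \<noteq> 0" "of_rat N = (of_nat n :: complex)" unfolding N_def using n by auto
  have sw: "of_rat N * (z + w) = 2 * of_rat N + 1" "z * w = 1"
    using zw z0 n unfolding w_def N(3) by (simp_all add: distrib_left)
  have qz: "rpoly (q y) z = rpoly (p y) w" "rpoly (q y) w = g y" for y
    using arg_cong[OF sw(1), of "\<lambda>u. u * of_rat (y $ 1)"] unfolding g_def p_def q_def
    by (simp_all add: of_rat_add of_rat_mult of_rat_diff of_rat_minus algebra_simps)
  have roots: "{u. rpoly (min_poly z) u = 0} = {z, w}"
  proof (intro equalityI subsetI)
    fix u assume "u \<in> {u. rpoly (min_poly z) u = 0}"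
    moreover have "min_poly z dvd delta n" using reciprocalD(4)[OF z] r by blast
    ultimately have "of_nat n * (u - 1)\<^sup>2 - u = 0" using rpoly_dvd unfolding rpoly_delta[symmetric] by blast
    moreover have "of_nat n * ((u - z) * (u - w)) =
      (of_nat n * (u - 1)\<^sup>2 - u) - (of_nat n * (z + w) - (2 * of_nat n + 1)) * u + of_nat n * (z * w - 1)"
      by (simp add: power2_eq_square algebra_simps)
    ultimately have "of_nat n * ((u - z) * (u - w)) = 0" using sw unfolding N(3) by simp
    then show "u \<in> {z, w}" using n by auto
  qed (use reciprocalD(5,6)[OF z] w_def in auto)
  have zw': "z \<noteq> w"
  proof
    assume "z = w"
    then have "(z - 1) * (z + 1) = 0" using sw(2) by (simp add: algebra_simps)
    then have "z = of_rat 1 \<or> z = of_rat (- 1)" by (auto simp: add_eq_0_iff2 of_rat_minus)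
    then show False using delta_root_irrational[OF n nsq r] by blast
  qed
  have bG: "bf G x y = x $ 0 * (- 2 * y $ 0 + y $ 1) + x $ 1 * (y $ 0 + 2 * N * y $ 1)"
    if "x \<in> Vec 2" "y \<in> Vec 2" for x y
    using that unfolding bf_def G_def mat2_mult_vec'[OF that(2)] by (subst scalar_prod_vec2) auto
  have tr: "rpoly (- (p x * q y)) z + rpoly (- (p x * q y)) w = of_rat (bf G x y)" if xy: "x \<in> Vec 2" "y \<in> Vec 2" for x y
    unfolding bG[OF xy] rpoly_uminus rpoly_mult qz unfolding g_def p_def
    using twist_trace_identity[OF sw] by (simp add: of_rat_add of_rat_mult of_rat_diff of_rat_minus)
  have Qg: "Qbar z (g y) = rpoly (p y) w" for y unfolding g_def w_def by (rule Qbar_rpoly[OF z])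
  have gi: "x = y" if xy: "x \<in> Vec 2" "y \<in> Vec 2" and e: "g x = g y" for x y
  proof -
    have "of_rat (x $ 0 - (N + 1) * x $ 1 - (y $ 0 - (N + 1) * y $ 1)) + of_rat (N * (x $ 1 - y $ 1)) * z = 0"
      using e unfolding g_def p_def by (simp add: of_rat_add of_rat_mult of_rat_diff algebra_simps)
    from delta_root_indep[OF n nsq r this] have "x $ 1 = y $ 1" "x $ 0 = y $ 0" using N(1) by auto
    then show ?thesis using xy by (intro eq_vecI) (auto simp: less_2_cases_iff)
  qed
  have gs: "\<exists>x\<in>Vec 2. g x = t" if t: "t \<in> Qadj z" for t
  proof -
    obtain s where s: "t = rpoly s z" using t unfolding Qadj_def by blast
    obtain a b k where "s = delta n * k + [:a, b:]" using delta_rep[OF n nsq r] by blast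
    then have tab: "t = of_rat a + z * of_rat b" unfolding s using r by simp
    let ?x = "vec 2 (\<lambda>i. if i = 0 then a + (N + 1) * (b / N) else b / N)"
    have "p ?x = [:a, b:]" unfolding p_def using N(1) by simp
    then have "g ?x = t" unfolding g_def tab by simp
    moreover have "?x \<in> Vec 2" by simp
    ultimately show ?thesis by blast
  qed
  have ga: "g (x + y) = g x + g y" "g (c *s x) = of_rat c * g x" if "x \<in> Vec 2" "y \<in> Vec 2" for x y c
    using that unfolding g_def p_def by (simp_all add: of_rat_add of_rat_mult of_rat_diff algebra_simps)
  have T: "T \<in> Mat 2 2" and G: "G \<in> Mat 2 2" unfolding T_def G_def by simp_all
  have gT: "g (T *v x) = z * g x" if x: "x \<in> Vec 2" for x
  proof -
    define d where "d = 1 / N"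
    have "N * d = 1" unfolding d_def using N(1) by simp
    then have Nd: "of_rat N * of_rat d = (1 :: complex)" by (metis of_rat_1 of_rat_mult)
    have Tx: "T *v x = vec 2 (\<lambda>i. if i = 0 then (1 + d) * x $ 0 + 1 * x $ 1 else d * x $ 0 + 1 * x $ 1)"
      unfolding T_def mat2_mult_vec'[OF x] d_def N_def ..
    have rz: "of_rat N * (z - 1)\<^sup>2 - z = 0" using r unfolding rpoly_delta N(3) .
    show ?thesis unfolding Tx g_def p_def
      using twist_eigen_identity[OF Nd rz] by (simp add: of_rat_add of_rat_mult of_rat_diff)
  qed
  have fa: "f (x @\<^sub>v y) = vec 2 (\<lambda>i. if i = 0 then g x else g y)" if "x \<in> Vec 2" "y \<in> Vec 2" for x y
  proof -
    have e: "vec 2 (\<lambda>j. (x @\<^sub>v y) $ j) = x" "vec 2 (\<lambda>j. (x @\<^sub>v y) $ (2 + j)) = y"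
      using that by (intro eq_vecI; simp)+
    show ?thesis unfolding f_def e ..
  qed
  let ?B = "rm (twist_knot n) \<boxplus> rm (twist_knot n)"
  let ?Y = "(G \<boxplus> G, T \<boxplus> T)" and ?H = "mat2 (- 1) 0 0 (- 1) :: complex mat"
  note W = twist_nonsingular[OF n]
  have B: "?B \<in> Mat (2 + 2) (2 + 2)" "det ?B \<noteq> 0" "det (sp ?B) \<noteq> 0"
    using block_sum_carrier[OF W(1,1)] det_block_sum[OF W(1,1)] W(2,3)
      det_block_sum[OF sp_carrier[OF W(1)] sp_carrier[OF W(1)]] unfolding sp_block_sum[OF W(1,1)] by auto
  have sY: "seifert_structure ?B = ?Y"
    unfolding seifert_structure_sum[OF W(1,2,1,2)] twist_structure[OF n] G_def T_def N_def by simp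
  have I: "isometric_structure (2 + 2) ?Y" using seifert_isometric_structure[OF B] unfolding sY .
  note i = isometric_structureD[OF I]
  have pz: "poly_mat (min_poly z) (T \<boxplus> T) = 0\<^sub>m (2 + 2) (2 + 2)"
  proof (rule mat_eq_actI)
    show "poly_mat (min_poly z) (T \<boxplus> T) \<in> Mat (2 + 2) (2 + 2)" using i(2) by (rule poly_mat_carrier)
    fix v :: "rat vec" assume "v \<in> Vec (2 + 2)"
    then obtain x y where xy: "x \<in> Vec 2" "y \<in> Vec 2" "v = x @\<^sub>v y" using append_vec_cases by blast
    obtain k where k: "min_poly z = delta n * k" using delta_root_conj(1)[OF n nsq r reciprocalD(5)[OF z]] by blast
    have "pact T (min_poly z) x = 0\<^sub>v 2" if "x \<in> Vec 2" for x
      unfolding k pact_mult[OF T that] using twist_annihilated[OF n, of "pact T k x"] pact_carrier[OF T that] unfolding T_def by blast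
    then have "pact (T \<boxplus> T) (min_poly z) v = 0\<^sub>v 2 @\<^sub>v 0\<^sub>v 2" unfolding xy(3) pact_append[OF T T xy(1,2)] using xy(1,2) by simp
    also have "\<dots> = 0\<^sub>v (2 + 2)" by (rule append_vec_zero)
    also have "\<dots> = 0\<^sub>m (2 + 2) (2 + 2) *v v" using xy by (intro eq_vecI) (auto simp: scalar_prod_def)
    finally show "poly_mat (min_poly z) (T \<boxplus> T) *v v = 0\<^sub>m (2 + 2) (2 + 2) *v v" unfolding pact_def .
  qed simp
  have cases: "\<exists>x y. x \<in> Vec 2 \<and> y \<in> Vec 2 \<and> u = x @\<^sub>v y" if u: "u \<in> Vec (2 + 2)" for u :: "rat vec"
    using append_vec_cases[OF u] by blast
  have "hermitian_lift z ?Y 2 f ?H"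
    unfolding hermitian_lift_def Let_def prod.case carrier_matD(1)[OF i(1)]
  proof (intro conjI allI impI ballI)
    show "bij_betw f (Vec (2 + 2)) {x \<in> Vec 2. \<forall>i<2. x $ i \<in> Qadj z}"
      unfolding bij_betw_def
    proof (intro conjI inj_onI equalityI subsetI)
      fix u u' assume uu: "u \<in> Vec (2 + 2)" "u' \<in> Vec (2 + 2)" "f u = f u'"
      obtain x y where u: "x \<in> Vec 2" "y \<in> Vec 2" "u = x @\<^sub>v y" using cases[OF uu(1)] by blast
      obtain x' y' where u': "x' \<in> Vec 2" "y' \<in> Vec 2" "u' = x' @\<^sub>v y'" using cases[OF uu(2)] by blast
      have "f u $ 0 = f u' $ 0" "f u $ 1 = f u' $ 1" using uu(3) by simp_all
      then have "g x = g x'" "g y = g y'" unfolding u(3) u'(3) fa[OF u(1,2)] fa[OF u'(1,2)] by simp_all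
      then show "u = u'" unfolding u(3) u'(3) using gi u u' by blast
    next
      fix t assume "t \<in> f ` Vec (2 + 2)"
      then obtain u where "u \<in> Vec (2 + 2)" "t = f u" by blast
      then show "t \<in> {x \<in> Vec 2. \<forall>i<2. x $ i \<in> Qadj z}" unfolding f_def g_def using Qadj_I by auto
    next
      fix t assume "t \<in> {x \<in> Vec 2. \<forall>i<2. x $ i \<in> Qadj z}"
      then have t: "t \<in> Vec 2" "t $ 0 \<in> Qadj z" "t $ 1 \<in> Qadj z" by auto
      obtain x where x: "x \<in> Vec 2" "g x = t $ 0" using gs[OF t(2)] by blast
      obtain y where y: "y \<in> Vec 2" "g y = t $ 1" using gs[OF t(3)] by blast
      have "t = f (x @\<^sub>v y)" unfolding fa[OF x(1) y(1)] x(2) y(2) using t(1)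
        by (intro eq_vecI) (auto simp: less_2_cases_iff)
      moreover have "x @\<^sub>v y \<in> Vec (2 + 2)" using x(1) y(1) by (rule append_carrier_vec)
      ultimately show "t \<in> f ` Vec (2 + 2)" by blast
    qed
  next
    fix u u' :: "rat vec" assume uu: "u \<in> Vec (2 + 2)" "u' \<in> Vec (2 + 2)"
    obtain x y where u: "x \<in> Vec 2" "y \<in> Vec 2" "u = x @\<^sub>v y" using cases[OF uu(1)] by blast
    obtain x' y' where u': "x' \<in> Vec 2" "y' \<in> Vec 2" "u' = x' @\<^sub>v y'" using cases[OF uu(2)] by blast
    have s: "u + u' = (x + x') @\<^sub>v (y + y')" unfolding u(3) u'(3) by (rule append_vec_add'[OF u(1) u'(1) u(2) u'(2)])
    show "f (u + u') = f u + f u'"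
      unfolding s fa[OF add_carrier_vec[OF u(1) u'(1)] add_carrier_vec[OF u(2) u'(2)]] unfolding u(3) u'(3) fa[OF u(1,2)] fa[OF u'(1,2)]
      using ga u u' by (intro eq_vecI) auto
    have "u \<bullet> ((G \<boxplus> G) *v u') = bf G x x' + bf G y y'"
      unfolding bf_def[symmetric] u(3) u'(3) by (rule bf_block_sum[OF G G u(1,2) u'(1,2)])
    also have "\<dots> = Qtrace z (rpoly (- (p x * q x') - p y * q y') z)"
    proof (rule Qtrace_eqI[OF z, symmetric])
      have "of_rat (bf G x x' + bf G y y') = rpoly (- (p x * q x') - p y * q y') z + rpoly (- (p x * q x') - p y * q y') w"
        unfolding of_rat_add tr[OF u(1) u'(1), symmetric] tr[OF u(2) u'(2), symmetric] by simp
      then show "of_rat (bf G x x' + bf G y y') = (\<Sum>u | rpoly (min_poly z) u = 0. rpoly (- (p x * q x') - p y * q y') u)"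
        unfolding roots using zw' by simp
    qed
    also have "rpoly (- (p x * q x') - p y * q y') z = (\<Sum>i<2. \<Sum>j<2. f u $ i * ?H $$ (i, j) * Qbar z (f u' $ j))"
      unfolding u(3) u'(3) fa[OF u(1,2)] fa[OF u'(1,2)]
      by (simp add: numeral_2_eq_2 lessThan_Suc Qg qz g_def[symmetric])
    finally show "u \<bullet> ((G \<boxplus> G) *v u') = Qtrace z (\<Sum>i<2. \<Sum>j<2. f u $ i * ?H $$ (i, j) * Qbar z (f u' $ j))" .
  next
    fix u :: "rat vec" assume uu: "u \<in> Vec (2 + 2)"
    obtain x y where u: "x \<in> Vec 2" "y \<in> Vec 2" "u = x @\<^sub>v y" using cases[OF uu] by blast
    have Tc: "T *v x \<in> Vec 2" "T *v y \<in> Vec 2" using mult_mat_vec_carrier[OF T] u by auto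
    show "f ((T \<boxplus> T) *v u) = z *s f u"
      unfolding u(3) block_sum_mult_vec[OF T T u(1,2)] fa[OF Tc] fa[OF u(1,2)] gT[OF u(1)] gT[OF u(2)]
      by (intro eq_vecI) auto
    show "f (c *s u) = of_rat c *s f u" for c
      unfolding u(3) append_vec_smult fa[OF smult_carrier_vec[THEN iffD2, OF u(1)] smult_carrier_vec[THEN iffD2, OF u(2)]] fa[OF u(1,2)]
      using ga(2)[OF u(1,1)] ga(2)[OF u(2,2)] by (intro eq_vecI) auto
  next
    show "det ?H \<noteq> 0" unfolding mat2_det by simp
  next
    fix i j :: nat assume ij: "i < 2" "j < 2"
    have Q: "Qbar z (- 1) = - 1" "Qbar z 0 = 0" using Qbar_rpoly[OF z, of "- 1"] Qbar_rpoly[OF z, of 0] by simp_all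
    have m: "- 1 \<in> Qadj z" "0 \<in> Qadj z" using Qadj_I[of "- 1" z] Qadj_I[of 0 z] by simp_all
    show "?H $$ (i, j) \<in> Qadj z" using ij m by (auto simp: less_2_cases_iff)
    show "?H $$ (j, i) = Qbar z (?H $$ (i, j))" using ij Q by (auto simp: less_2_cases_iff)
  qed simp
  then have l: "hermitian_lift z ?Y 2 f ?H" .
  have TT: "seifert_matrix (twist_knot n \<boxplus> twist_knot n)" by (intro seifert_block_sum seifert_matrix_twist_knot)
  have rmB: "?B = rm (twist_knot n \<boxplus> twist_knot n)"
    using map_block_sum[OF twist_knot_carrier twist_knot_carrier, of rat_of_int] by simp
  have "norms z #>\<^bsub>fixed_units z\<^esub> ((-1) ^ (2 * (2 - 1) div 2) * det ?H) \<in> d_values z (twist_knot n \<boxplus> twist_knot n)"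
  proof (rule d_valuesI[OF z TT B _ _ witt_refl[OF I] _ l])
    show "sim ?B (rm (twist_knot n \<boxplus> twist_knot n))"
      unfolding rmB[symmetric] using sim_refl[OF B(1)] seifert_det_rat[OF TT] unfolding rmB[symmetric] by blast
    show "primary_part (min_poly z) (seifert_structure ?B) ?Y"
      unfolding sY by (rule primary_part_self[OF i(1,2) pz])
    show "poly_mat (min_poly z) (snd ?Y) = 0\<^sub>m (dim_row (snd ?Y)) (dim_row (snd ?Y))"
      using pz carrier_matD(1)[OF i(2)] by simp
  qed
  then show ?thesis by (simp add: mat2_det)
qed

section \<open>Signatures of twist knots\<close>

text \<open>The signature as a function of the characteristic polynomial. Additivity under block
  sums is then additivity of root orders, and no diagonalization enters.\<close>

definition poly_sig :: "complex poly => int" where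
  "poly_sig p = (\<Sum>x | poly p x = 0 \<and> Re x > 0. int (Polynomial.order x p)) -
     (\<Sum>x | poly p x = 0 \<and> Re x < 0. int (Polynomial.order x p))"

lemma poly_sig_mult:
  assumes "p \<noteq> 0" "q \<noteq> 0"
  shows "poly_sig (p * q) = poly_sig p + poly_sig q"
proof -
  have pq: "p * q \<noteq> 0" using assms by simp
  have fin: "finite {x. poly r x = 0 \<and> Q x}" if "r \<noteq> 0" for r :: "complex poly" and Q
    using poly_roots_finite[OF that] by (rule finite_subset[rotated]) auto
  have ext: "(\<Sum>x | poly r x = 0 \<and> Q x. int (Polynomial.order x r)) = (\<Sum>x | poly (p * q) x = 0 \<and> Q x. int (Polynomial.order x r))"
    if "r = p \<or> r = q" for r Q
  proof (rule sum.mono_neutral_left[OF fin[OF pq]])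
    show "{x. poly r x = 0 \<and> Q x} \<subseteq> {x. poly (p * q) x = 0 \<and> Q x}" using that by auto
    show "\<forall>x\<in>{x. poly (p * q) x = 0 \<and> Q x} - {x. poly r x = 0 \<and> Q x}. int (Polynomial.order x r) = 0"
    proof
      fix x assume "x \<in> {x. poly (p * q) x = 0 \<and> Q x} - {x. poly r x = 0 \<and> Q x}"
      then have "poly r x \<noteq> 0" by auto
      then show "int (Polynomial.order x r) = 0" by (simp add: order_0I)
    qed
  qed
  have "(\<Sum>x | poly (p * q) x = 0 \<and> Q x. int (Polynomial.order x (p * q))) =
    (\<Sum>x | poly p x = 0 \<and> Q x. int (Polynomial.order x p)) + (\<Sum>x | poly q x = 0 \<and> Q x. int (Polynomial.order x q))" for Q
    unfolding ext[of p Q, simplified] ext[of q Q, simplified] using order_mult[OF pq] by (simp add: sum.distrib)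
  then show ?thesis unfolding poly_sig_def by simp
qed

lemma poly_sig_linear:
  fixes a :: real
  shows "a > 0 ==> poly_sig [:- of_real a, 1:] = 1" "a < 0 ==> poly_sig [:- of_real a, 1:] = - 1" "poly_sig [:0, 1:] = 0"
proof -
  have o: "Polynomial.order (of_real a) [:- of_real a, 1:] = 1" using order_power_n_n[of "of_real a :: complex" 1] by simp
  have r: "{x. poly [:- of_real a, 1:] x = 0 \<and> Q x} = (if Q (of_real a) then {of_real a :: complex} else {})" for Q
    by (auto simp: add_eq_0_iff2)
  show "a > 0 ==> poly_sig [:- of_real a, 1:] = 1" "a < 0 ==> poly_sig [:- of_real a, 1:] = - 1"
    unfolding poly_sig_def r by (simp_all add: o)
  have "{x. poly [:0, 1:] x = 0 \<and> Re x > 0} = {}" "{x. poly [:0, 1:] x = 0 \<and> Re x < 0} = {}" by auto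
  then show "poly_sig [:0, 1:] = 0" unfolding poly_sig_def by (simp only: sum.empty)
qed

lemma signature_block_sum:
  assumes A: "A \<in> Mat n n" and B: "B \<in> Mat m m"
  shows "signature (A \<boxplus> B) = signature A + signature B"
proof -
  have "char_poly_matrix (A \<boxplus> B) = char_poly_matrix A \<boxplus> char_poly_matrix B"
    using A B unfolding char_poly_matrix_def block_sum_def by (intro eq_matI) auto
  then have "char_poly (A \<boxplus> B) = char_poly A * char_poly B"
    unfolding char_poly_def using A B by (simp add: det_block_sum[where n = n and m = m])
  moreover have "char_poly A \<noteq> 0" "char_poly B \<noteq> 0"
    using degree_monic_char_poly[OF A] degree_monic_char_poly[OF B] by auto
  ultimately show ?thesis using poly_sig_mult unfolding signature_def poly_sig_def[symmetric] by simp
qed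

lemma tristram_levine_block_sum:
  assumes V: "V \<in> Mat n n" and W: "W \<in> Mat m m"
  shows "tristram_levine (V \<boxplus> W) \<omega> = tristram_levine V \<omega> + tristram_levine W \<omega>"
proof -
  let ?M = "\<lambda>V. (1 - \<omega>) \<cdot>\<^sub>m map_mat of_int V + (1 - cnj \<omega>) \<cdot>\<^sub>m map_mat of_int (trp V)"
  have "?M (V \<boxplus> W) = ?M V \<boxplus> ?M W"
    using V W unfolding block_sum_def by (intro eq_matI) auto
  moreover have "?M V \<in> Mat n n" "?M W \<in> Mat m m" using V W by auto
  ultimately show ?thesis unfolding tristram_levine_def using signature_block_sum by simp
qed

text \<open>A negative determinant gives one positive and one negative real root of the
  characteristic polynomial. The remaining case, a double root 0, is needed for
  \<open>\<omega> = 1\<close>, where the Tristram-Levine matrix vanishes.\<close>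

lemma signature_mat2:
  fixes t r :: real
  assumes tr: "a + d = of_real t" and dt: "a * d - b * c = of_real r" and r: "r < 0 \<or> t = 0 \<and> r = 0"
  shows "signature (mat2 a b c d) = 0"
proof -
  have "char_poly_matrix (mat2 a b c d) = mat2 [:- a, 1:] [:- b:] [:- c:] [:- d, 1:]"
    by (rule eq_mat2I) (auto simp: char_poly_matrix_def)
  then have cp: "char_poly (mat2 a b c d) = [:a * d - b * c, - (a + d), 1:]"
    unfolding char_poly_def by (simp add: mat2_det algebra_simps)
  show ?thesis
  proof (cases "r < 0")
    case True
    define s where "s = sqrt (t\<^sup>2 - 4 * r)"
    have s2: "s\<^sup>2 = t\<^sup>2 - 4 * r" unfolding s_def using True zero_le_power2[of t] by (intro real_sqrt_pow2) linarith
    have s: "s > \<bar>t\<bar>" unfolding s_def using True by (intro real_less_rsqrt) simp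
    define x y where "x = (t + s) / 2" and "y = (t - s) / 2"
    have xy: "x > 0" "y < 0" "x + y = t" using s unfolding x_def y_def by (auto simp: field_simps)
    have "x * y = (t\<^sup>2 - s\<^sup>2) / 4" unfolding x_def y_def by (simp add: power2_eq_square algebra_simps)
    then have xr: "x * y = r" unfolding s2 by simp
    have cp': "char_poly (mat2 a b c d) = [:- of_real x, 1:] * [:- of_real y, 1:]"
      unfolding cp tr dt xr[symmetric] xy(3)[symmetric] by simp
    show ?thesis unfolding signature_def poly_sig_def[symmetric] cp'
      by (subst poly_sig_mult) (use poly_sig_linear(1)[OF xy(1)] poly_sig_linear(2)[OF xy(2)] in simp_all)
  next
    case False
    then have cp': "char_poly (mat2 a b c d) = [:0, 1:] * [:0, 1:]" using r unfolding cp tr dt by simp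
    show ?thesis unfolding signature_def poly_sig_def[symmetric] cp'
      by (subst poly_sig_mult) (simp_all add: poly_sig_linear(3))
  qed
qed

text \<open>On the unit circle the sum and the product of \<open>1 - \<omega>\<close> and its
  conjugate are both \<open>s = |1 - \<omega>|^2\<close>. The determinant is therefore
  \<open>- n s^2 - s\<close>, negative unless \<open>\<omega> = 1\<close>.\<close>

lemma tristram_levine_twist:
  assumes w: "cmod \<omega> = 1" and n: "n > 0"
  shows "tristram_levine (twist_knot n) \<omega> = 0"
proof -
  let ?a = "1 - \<omega>" and ?b = "1 - cnj \<omega>"
  define s where "s = 2 - 2 * Re \<omega>"
  have ww: "\<omega> * cnj \<omega> = 1" using w by (simp add: complex_norm_square[symmetric])
  have ab: "?a + ?b = of_real s" unfolding s_def by (simp add: complex_eq_iff)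
  have ab': "?a * ?b = of_real s" using ww ab by (simp add: algebra_simps)
  have s0: "s \<ge> 0" unfolding s_def using complex_Re_le_cmod[of \<omega>] w by simp
  have "(1 - \<omega>) \<cdot>\<^sub>m map_mat of_int (twist_knot n) + (1 - cnj \<omega>) \<cdot>\<^sub>m map_mat of_int (trp (twist_knot n)) =
    mat2 (- (?a + ?b)) ?a ?b (of_nat n * (?a + ?b))"
    unfolding twist_knot_mat2 mat2_transpose by (rule eq_mat2I) (auto simp: algebra_simps)
  moreover have "signature (mat2 (- (?a + ?b)) ?a ?b (of_nat n * (?a + ?b))) = 0"
  proof (rule signature_mat2[where t = "(real n - 1) * s" and r = "- (real n * s\<^sup>2) - s"])
    show "- (?a + ?b) + of_nat n * (?a + ?b) = of_real ((real n - 1) * s)" unfolding ab by (simp add: algebra_simps)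
    show "- (?a + ?b) * (of_nat n * (?a + ?b)) - ?a * ?b = of_real (- (real n * s\<^sup>2) - s)"
      unfolding ab ab' by (simp add: power2_eq_square algebra_simps)
    show "- (real n * s\<^sup>2) - s < 0 \<or> (real n - 1) * s = 0 \<and> - (real n * s\<^sup>2) - s = 0"
    proof (cases "s = 0")
      case False
      then have "s > 0" using s0 by simp
      then have "real n * s\<^sup>2 + s > 0" by (intro add_nonneg_pos) auto
      then show ?thesis by linarith
    qed simp
  qed
  ultimately show ?thesis unfolding tristram_levine_def by simp
qed

text \<open>The two signature functions agree at every point of the circle, so the one-sided limits
  are taken of the same function.\<close>

lemma s_inv_twist:
  assumes z: "cmod z = 1" and n: "n > 0" and V: "seifert_matrix V"
  shows "s_inv z (V \<boxplus> twist_knot n) = s_inv z V"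
proof -
  obtain k where k: "V \<in> Mat k k" using seifert_carrier[OF V] by blast
  have "cmod (z * cis \<theta>) = 1" for \<theta> using z by (simp add: norm_mult)
  then have "tristram_levine (V \<boxplus> twist_knot n) (z * cis \<theta>) = tristram_levine V (z * cis \<theta>)" for \<theta>
    unfolding tristram_levine_block_sum[OF k twist_knot_carrier] by (simp add: tristram_levine_twist[OF _ n])
  then show ?thesis unfolding s_inv_def by presburger
qed

section \<open>Parity of multiplicities in the Alexander polynomial\<close>

definition pencil :: "'a::comm_ring_1 mat => 'a mat => 'a poly" where
  "pencil A B = det (mat (dim_row A) (dim_row A) (\<lambda>ij. [:A $$ ij, - B $$ ij:]))"

lemma poly_pencil:
  assumes A: "A \<in> Mat n n" and B: "B \<in> Mat n n"
  shows "poly (pencil A B) x = det (A - x \<cdot>\<^sub>m B)"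
proof -
  have h: "comm_ring_hom (\<lambda>p. poly p x)" by unfold_locales
  have "map_mat (\<lambda>p. poly p x) (mat (dim_row A) (dim_row A) (\<lambda>ij. [:A $$ ij, - B $$ ij:])) = A - x \<cdot>\<^sub>m B"
    using A B by (intro eq_matI) auto
  then show ?thesis unfolding pencil_def using comm_ring_hom.hom_det[OF h] by metis
qed

lemma pencil_congruence:
  fixes A :: "rat mat"
  assumes A: "A \<in> Mat n n" and B: "B \<in> Mat n n" and P: "P \<in> Mat n n"
  shows "pencil (trp P * A * P) (trp P * B * P) = [:det P * det P:] * pencil A B"
proof (rule poly_eq_poly_eq_iff[THEN iffD1], rule ext)
  fix x
  have C: "trp P * A * P \<in> Mat n n" "trp P * B * P \<in> Mat n n" "A - x \<cdot>\<^sub>m B \<in> Mat n n"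
    using A B P by auto
  have "trp P * A * P - x \<cdot>\<^sub>m (trp P * B * P) = trp P * (A - x \<cdot>\<^sub>m B) * P"
  proof (rule bf_eqI[where n = n and m = n])
    show "trp P * A * P - x \<cdot>\<^sub>m (trp P * B * P) \<in> Mat n n"
      by (rule minus_carrier_mat[OF smult_carrier_mat[OF C(2)]])
    show "trp P * (A - x \<cdot>\<^sub>m B) * P \<in> Mat n n"
      by (rule mult_carrier_mat[OF mult_carrier_mat[OF transpose_carrier_mat[THEN iffD2, OF P] C(3)] P])
    fix u v :: "rat vec" assume uv: "u \<in> Vec n" "v \<in> Vec n"
    have Pv: "P *v u \<in> Vec n" "P *v v \<in> Vec n" using mult_mat_vec_carrier[OF P] uv by auto
    have s: "bf (x \<cdot>\<^sub>m M) a b = x * bf M a b" if "M \<in> Mat n n" "a \<in> Vec n" "b \<in> Vec n" for M a b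
    proof -
      have "(x \<cdot>\<^sub>m M) *v b = x *s (M *v b)" using that by (intro eq_vecI) auto
      also have "\<dots> = M *v (x *s b)" by (rule mult_mat_vec_smult[OF that(1,3), symmetric])
      finally have "bf (x \<cdot>\<^sub>m M) a b = bf M a (x *s b)" unfolding bf_def by simp
      then show ?thesis using bf_smult_right[OF that] by simp
    qed
    have "bf (trp P * A * P - x \<cdot>\<^sub>m (trp P * B * P)) u v =
      bf (trp P * A * P) u v - x * bf (trp P * B * P) u v"
      using bf_minus_mat[OF C(1) _ uv, of "x \<cdot>\<^sub>m (trp P * B * P)"] s[OF C(2) uv] C(2) by simp
    also have "\<dots> = bf A (P *v u) (P *v v) - x * bf B (P *v u) (P *v v)"
      unfolding bf_congruence[OF A P P uv] bf_congruence[OF B P P uv] ..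
    also have "\<dots> = bf (A - x \<cdot>\<^sub>m B) (P *v u) (P *v v)"
      using bf_minus_mat[OF A _ Pv, of "x \<cdot>\<^sub>m B"] s[OF B Pv] B by simp
    also have "\<dots> = bf (trp P * (A - x \<cdot>\<^sub>m B) * P) u v" by (rule bf_congruence[OF C(3) P P uv])
    finally show "bf (trp P * A * P - x \<cdot>\<^sub>m (trp P * B * P)) u v = bf (trp P * (A - x \<cdot>\<^sub>m B) * P) u v" .
  qed
  then show "poly (pencil (trp P * A * P) (trp P * B * P)) x = poly ([:det P * det P:] * pencil A B) x"
    unfolding poly_pencil[OF C(1,2)] using det_congruence[OF C(3) P] poly_pencil[OF A B, of x] by simp
qed

lemma pencil_block_sum:
  fixes A :: "rat mat"
  assumes A: "A \<in> Mat n n" "A' \<in> Mat n n" and B: "B \<in> Mat m m" "B' \<in> Mat m m"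
  shows "pencil (A \<boxplus> B) (A' \<boxplus> B') = pencil A A' * pencil B B'"
proof (rule poly_eq_poly_eq_iff[THEN iffD1], rule ext)
  fix x
  have c: "A - x \<cdot>\<^sub>m A' \<in> Mat n n" "B - x \<cdot>\<^sub>m B' \<in> Mat m m" using A B by auto
  have "A \<boxplus> B - x \<cdot>\<^sub>m (A' \<boxplus> B') = (A - x \<cdot>\<^sub>m A') \<boxplus> (B - x \<cdot>\<^sub>m B')"
    using A B unfolding block_sum_def by (intro eq_matI) auto
  then show "poly (pencil (A \<boxplus> B) (A' \<boxplus> B')) x = poly (pencil A A' * pencil B B') x"
    unfolding poly_mult poly_pencil[OF A] poly_pencil[OF B] poly_pencil[OF block_sum_carrier[OF A(1) B(1)] block_sum_carrier[OF A(2) B(2)]]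
    using det_block_sum[OF c] by (simp only:)
qed

lemma min_poly_prime:
  assumes z: "reciprocal z"
  shows "prime_elem (min_poly z)" "\<not> min_poly z dvd monom 1 k"
proof -
  show "prime_elem (min_poly z)" using reciprocalD(2)[OF z] by (rule irreducible_imp_prime_elem_gcd)
  show "\<not> min_poly z dvd monom 1 k" using reciprocalD(1)[OF z] reciprocalD(4)[OF z, of "monom 1 k"] by simp
qed

text \<open>Exchanging the two matrices reflects the determinant polynomial, up to sign and a power
  of the variable. The minimal polynomial of \<open>z\<close> is self-reciprocal up to a constant
  and coprime to the variable, so the same powers of it divide both.\<close>

lemma pencil_swap_dvd:
  assumes z: "reciprocal z" and R: "R \<in> Mat k k" and S: "S \<in> Mat k k" and d: "min_poly z ^ j dvd pencil R S"
  shows "min_poly z ^ j dvd pencil S R"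
proof -
  let ?q = "min_poly z" and ?f = "pencil R S"
  obtain c where c: "reflect_poly ?q = Polynomial.smult c ?q" using reflect_min_poly[OF z] by blast
  obtain r where r: "?f = ?q ^ j * r" using d by blast
  have "reflect_poly ?f = ?q ^ j * (Polynomial.smult (c ^ j) (reflect_poly r))"
    unfolding r reflect_poly_mult reflect_poly_power c by (simp add: smult_power)
  then have 1: "?q ^ j dvd reflect_poly ?f" by (metis dvd_triv_left)
  \<comment> \<open>The extra factor \<open>x\<close> makes the identity trivial at 0, where
    inversion is impossible; it is cancelled again once the identity holds between
    polynomials.\<close>
  have pt: "x * (x ^ degree ?f * poly (pencil S R) x) = x * ((- 1) ^ k * x ^ k * poly (reflect_poly ?f) x)" for x
  proof (cases "x = 0")
    case False
    have e: "S - x \<cdot>\<^sub>m R = (- x) \<cdot>\<^sub>m (R - inverse x \<cdot>\<^sub>m S)"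
      using R S False by (intro eq_matI) (auto simp: algebra_simps)
    have "poly (pencil S R) x = (- x) ^ k * poly ?f (inverse x)"
      unfolding poly_pencil[OF S R] poly_pencil[OF R S] e using S by (simp add: det_smult)
    moreover have "poly (reflect_poly ?f) x = x ^ degree ?f * poly ?f (inverse x)"
      using poly_reflect_poly_nz[OF False] by simp
    ultimately show ?thesis by (simp add: power_minus[of x])
  qed simp
  have "monom 1 1 * (monom 1 (degree ?f) * pencil S R) = monom 1 1 * (monom ((- 1) ^ k) k * reflect_poly ?f)"
    by (rule poly_eq_poly_eq_iff[THEN iffD1], rule ext) (use pt in \<open>simp add: poly_monom\<close>)
  then have "monom 1 (degree ?f) * pencil S R = monom ((- 1) ^ k) k * reflect_poly ?f" by simp
  then have "?q ^ j dvd monom 1 (degree ?f) * pencil S R" using 1 by simp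
  moreover have "coprime (?q ^ j) (monom 1 (degree ?f))"
    using prime_elem_imp_coprime[OF min_poly_prime(1)[OF z] min_poly_prime(2)[OF z]] by (simp add: coprime_power_left_iff)
  ultimately show ?thesis using coprime_dvd_mult_right_iff by blast
qed

abbreviation apoly :: "rat mat => rat poly" where
  "apoly A \<equiv> pencil A (trp A)"

text \<open>The value at 1 is the determinant of the skew-symmetrization.\<close>

lemma apoly_nonzero:
  assumes "A \<in> Mat n n" "det (sk A) \<noteq> 0"
  shows "apoly A \<noteq> 0"
proof
  assume "apoly A = 0"
  then have "det (A - 1 \<cdot>\<^sub>m trp A) = 0" using poly_pencil[OF assms(1), of "trp A" 1] assms(1) by simp
  moreover have "1 \<cdot>\<^sub>m trp A = trp A" by (intro eq_matI) auto
  ultimately show False using assms(2) unfolding sk_def by simp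
qed

text \<open>The Fox-Milnor factorization: a zero block of half size splits the polynomial, up to
  sign, into the pencils of \<open>R\<close>, \<open>S\<close> and of \<open>S\<close>,
  \<open>R\<close>, in which the minimal polynomial of \<open>z\<close> has the same
  multiplicity.\<close>

lemma zero_block_apoly_even:
  assumes z: "reciprocal z" and M: "M \<in> Mat (2 * g) (2 * g)" and b: "zero_block g M" and nz: "apoly M \<noteq> 0"
  shows "even (multiplicity (min_poly z) (apoly M))"
proof -
  let ?q = "min_poly z"
  define R S where "R = mat g g (\<lambda>(i, j). M $$ (i, g + j))" and "S = mat g g (\<lambda>(i, j). M $$ (g + j, i))"
  have RS: "R \<in> Mat g g" "S \<in> Mat g g" unfolding R_def S_def by auto
  have "apoly M = [:(- 1) ^ g:] * (pencil R S * pencil S R)"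
  proof (rule poly_eq_poly_eq_iff[THEN iffD1], rule ext)
    fix x
    let ?N = "M - x \<cdot>\<^sub>m trp M"
    have N: "?N \<in> Mat (2 * g) (2 * g)" using M by auto
    have "zero_block g ?N" using b M unfolding zero_block_def by auto
    note d = det_antidiagonal[OF N this]
    have 1: "mat g g (\<lambda>(i, j). ?N $$ (i, g + j)) = R - x \<cdot>\<^sub>m S" using M unfolding R_def S_def by (intro eq_matI) auto
    have 2: "mat g g (\<lambda>(i, j). ?N $$ (g + i, j)) = trp (S - x \<cdot>\<^sub>m R)" using M unfolding R_def S_def by (intro eq_matI) auto
    have "S - x \<cdot>\<^sub>m R \<in> Mat g g" using RS by auto
    then show "poly (apoly M) x = poly ([:(- 1) ^ g:] * (pencil R S * pencil S R)) x"
      unfolding poly_pencil[OF M transpose_carrier_mat[THEN iffD2, OF M]] d unfolding 1 2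
      using poly_pencil[OF RS, of x] poly_pencil[OF RS(2,1), of x] by (simp add: det_transpose)
  qed
  moreover from this nz have nz': "pencil R S \<noteq> 0" "pencil S R \<noteq> 0" by auto
  moreover have "multiplicity ?q [:(- 1) ^ g:] = 0" by (intro multiplicity_unit_right) (simp add: is_unit_const_poly_iff)
  ultimately have "multiplicity ?q (apoly M) = multiplicity ?q (pencil R S) + multiplicity ?q (pencil S R)"
    using min_poly_prime(1)[OF z] by (simp add: prime_elem_multiplicity_mult_distrib del: mult_pCons_left)
  moreover have "multiplicity ?q (pencil R S) = multiplicity ?q (pencil S R)"
  proof -
    have nu: "\<not> is_unit ?q" using min_poly_prime(1)[OF z] unfolding prime_elem_def by blast
    have "?q ^ j dvd pencil R S \<longleftrightarrow> ?q ^ j dvd pencil S R" for j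
      using pencil_swap_dvd[OF z RS] pencil_swap_dvd[OF z RS(2,1)] by blast
    then have "j \<le> multiplicity ?q (pencil R S) \<longleftrightarrow> j \<le> multiplicity ?q (pencil S R)" for j
      using power_dvd_iff_le_multiplicity[OF nz'(1) nu] power_dvd_iff_le_multiplicity[OF nz'(2) nu] by simp
    then show ?thesis by (meson order_antisym order_refl)
  qed
  ultimately show ?thesis by simp
qed

text \<open>Dividing by a power of the variable does not affect the multiplicity, because
  \<open>z \<noteq> 0\<close>. The unnormalized polynomial is easier to use, being multiplicative
  over block sums.\<close>

lemma e_inv_apoly:
  assumes z: "reciprocal z" and V: "seifert_matrix V"
  shows "e_inv z V = multiplicity (min_poly z) (apoly (rm V)) mod 2"
proof -
  obtain n where n: "V \<in> Mat n n" using seifert_carrier[OF V] by blast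
  define p where "p = pencil V (trp V)"
  have h: "comm_ring_hom (map_poly rat_of_int)" by unfold_locales
  have "map_mat (\<lambda>c. [:c:]) V - [:0, 1:] \<cdot>\<^sub>m map_mat (\<lambda>c. [:c:]) (trp V) =
    mat (dim_row V) (dim_row V) (\<lambda>ij. [:V $$ ij, - trp V $$ ij:])"
    using n by (intro eq_matI) auto
  then have ap: "alexander_poly V = poly_shift (Polynomial.order 0 p) p"
    unfolding alexander_poly_def Let_def p_def pencil_def by simp
  have mp: "map_poly rat_of_int p = apoly (rm V)"
  proof -
    have "map_mat (map_poly rat_of_int) (mat (dim_row V) (dim_row V) (\<lambda>ij. [:V $$ ij, - trp V $$ ij:])) =
      mat (dim_row (rm V)) (dim_row (rm V)) (\<lambda>ij. [:rm V $$ ij, - trp (rm V) $$ ij:])"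
      using n by (intro eq_matI) (auto intro!: poly_eqI simp: coeff_map_poly coeff_pCons split: nat.split)
    then show ?thesis unfolding p_def pencil_def using comm_ring_hom.hom_det[OF h] by metis
  qed
  have nz: "apoly (rm V) \<noteq> 0" using apoly_nonzero[of "rm V" n] n seifert_det_rat[OF V] by simp
  let ?k = "Polynomial.order 0 p"
  have "[:- 0, 1:] ^ ?k dvd p" by (rule order_1)
  then obtain r where r: "p = monom 1 ?k * r" by (auto simp: monom_altdef)
  have "poly_shift ?k p = r" by (subst (2) r) (simp add: poly_eq_iff coeff_poly_shift coeff_monom_mult)
  then have rp: "p = monom 1 ?k * alexander_poly V" using r ap by simp
  have "apoly (rm V) = monom 1 ?k * map_poly rat_of_int (alexander_poly V)"
    unfolding mp[symmetric] by (subst (1) rp) (simp add: of_int_poly_hom.hom_mult map_poly_monom)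
  moreover from this nz have "map_poly rat_of_int (alexander_poly V) \<noteq> 0" by auto
  moreover have "multiplicity (min_poly z) (monom 1 ?k) = 0"
    by (rule not_dvd_imp_multiplicity_0[OF min_poly_prime(2)[OF z]])
  ultimately have "multiplicity (min_poly z) (apoly (rm V)) = multiplicity (min_poly z) (map_poly rat_of_int (alexander_poly V))"
    using min_poly_prime(1)[OF z] by (simp add: prime_elem_multiplicity_mult_distrib)
  then show ?thesis unfolding e_inv_def by simp
qed

lemma apoly_block_sum:
  assumes A: "A \<in> Mat n n" and B: "B \<in> Mat m m"
  shows "apoly (A \<boxplus> B) = apoly A * apoly B"
proof -
  have "trp (A \<boxplus> B) = trp A \<boxplus> trp B"
    using A B unfolding block_sum_def by (intro eq_matI) auto
  then show ?thesis using pencil_block_sum[OF A _ B] A B by simp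
qed

text \<open>The polynomial of \<open>V \<boxplus> - W\<close> is the product of the two polynomials
  up to sign, and the metabolizer makes the total multiplicity even.\<close>

lemma e_inv_concordant:
  assumes z: "reciprocal z" and VW: "(V, W) \<in> alg_concordant"
  shows "e_inv z V = e_inv z W"
proof -
  have s: "seifert_matrix V" "seifert_matrix W" "algebraically_slice (V \<boxplus> - W)" using VW unfolding alg_concordant_def by auto
  obtain n m where c: "V \<in> Mat n n" "W \<in> Mat m m" using seifert_carrier s by blast
  let ?U = "rm (V \<boxplus> - W)" and ?q = "min_poly z"
  obtain g P where P: "V \<boxplus> - W \<in> Mat (2 * g) (2 * g)" "P \<in> Mat (2 * g) (2 * g)" "\<bar>det P\<bar> = 1"
    "\<forall>i<g. \<forall>j<g. (trp P * (V \<boxplus> - W) * P) $$ (i, j) = 0" using s(3) unfolding algebraically_slice_def by blast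
  have U: "?U \<in> Mat (2 * g) (2 * g)" and P': "rm P \<in> Mat (2 * g) (2 * g)" using P by auto
  let ?M = "trp (rm P) * ?U * rm P"
  have M: "?M = rm (trp P * (V \<boxplus> - W) * P)"
  proof -
    have "rm (trp P * (V \<boxplus> - W) * P) = rm (trp P * (V \<boxplus> - W)) * rm P"
      by (rule of_int_hom.mat_hom_mult[of _ "2 * g" "2 * g" _ "2 * g"]) (use P in auto)
    also have "rm (trp P * (V \<boxplus> - W)) = rm (trp P) * ?U"
      by (rule of_int_hom.mat_hom_mult[of _ "2 * g" "2 * g" _ "2 * g"]) (use P in auto)
    also have "rm (trp P) = trp (rm P)" by (intro eq_matI) auto
    finally show ?thesis by simp
  qed
  have Mc: "?M \<in> Mat (2 * g) (2 * g)" using U P' by auto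
  have zb: "zero_block g ?M" unfolding M zero_block_def using P(1,2,4) by auto
  have "det (rm P) = of_int (det P)" by (rule of_int_hom.hom_det)
  then have dP: "det (rm P) * det (rm P) = 1" using P(3) by (auto simp: abs_if split: if_splits)
  have "trp ?M = trp (rm P) * trp ?U * rm P"
  proof -
    have "trp ?M = trp (rm P) * trp (trp (rm P) * ?U)"
      by (rule transpose_mult[of _ "2 * g" "2 * g" _ "2 * g"]) (use U P' in auto)
    also have "trp (trp (rm P) * ?U) = trp ?U * trp (trp (rm P))"
      by (rule transpose_mult[of _ "2 * g" "2 * g" _ "2 * g"]) (use U P' in auto)
    also have "trp (rm P) * (trp ?U * trp (trp (rm P))) = trp (rm P) * trp ?U * rm P"
      using assoc_mult_mat[of "trp (rm P)" "2 * g" "2 * g" "trp ?U" "2 * g" "rm P" "2 * g"] U P' by simp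
    finally show ?thesis .
  qed
  then have aM: "apoly ?M = apoly ?U"
    using pencil_congruence[OF U transpose_carrier_mat[THEN iffD2, OF U] P'] dP by (simp add: one_pCons[symmetric])
  have mW: "- rm W \<in> Mat m m" using c by simp
  have "?U = rm V \<boxplus> - rm W" using map_block_sum[OF c(1), of "- W" m rat_of_int] c rm_uminus by simp
  then have aU: "apoly ?U = apoly (rm V) * apoly (- rm W)" using apoly_block_sum[of "rm V" n "- rm W" m] c by simp
  have aW: "apoly (- rm W) = [:(- 1) ^ m:] * apoly (rm W)"
  proof (rule poly_eq_poly_eq_iff[THEN iffD1], rule ext)
    fix x
    have "- rm W - x \<cdot>\<^sub>m trp (- rm W) = (- 1) \<cdot>\<^sub>m (rm W - x \<cdot>\<^sub>m trp (rm W))"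
      using c by (intro eq_matI) auto
    then show "poly (apoly (- rm W)) x = poly ([:(- 1) ^ m:] * apoly (rm W)) x"
      using poly_pencil[OF mW, of "trp (- rm W)" x] poly_pencil[of "rm W" m "trp (rm W)" x] c
      by (simp add: det_smult)
  qed
  have nz: "apoly (rm V) \<noteq> 0" "apoly (rm W) \<noteq> 0"
    using apoly_nonzero[of "rm V" n] apoly_nonzero[of "rm W" m] c seifert_det_rat s by auto
  have nzU: "apoly ?M \<noteq> 0" unfolding aM aU aW using nz by simp
  have "multiplicity ?q [:(- 1) ^ m:] = 0" by (intro multiplicity_unit_right) (simp add: is_unit_const_poly_iff)
  then have "multiplicity ?q (apoly ?M) = multiplicity ?q (apoly (rm V)) + multiplicity ?q (apoly (rm W))"
    unfolding aM aU aW using nz min_poly_prime(1)[OF z] by (simp add: prime_elem_multiplicity_mult_distrib del: mult_pCons_left)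
  then have "even (multiplicity ?q (apoly (rm V)) + multiplicity ?q (apoly (rm W)))"
    using zero_block_apoly_even[OF z Mc zb nzU] by simp
  moreover have "even (a + b) ==> a mod 2 = b mod 2" for a b :: nat by presburger
  ultimately show ?thesis unfolding e_inv_apoly[OF z s(1)] e_inv_apoly[OF z s(2)] by blast
qed

lemma apoly_twist: "apoly (rm (twist_knot n)) = - delta n"
proof (rule poly_eq_poly_eq_iff[THEN iffD1], rule ext)
  fix x
  have "rm (twist_knot n) - x \<cdot>\<^sub>m trp (rm (twist_knot n)) = mat2 (- 1 + x) 1 (- x) (of_nat n - x * of_nat n)"
    unfolding rm_twist mat2_transpose by (rule eq_mat2I) auto
  moreover have "poly (pencil (rm (twist_knot n)) (trp (rm (twist_knot n)))) x = det (rm (twist_knot n) - x \<cdot>\<^sub>m trp (rm (twist_knot n)))"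
    by (rule poly_pencil[where n = 2]) (auto simp: twist_knot_carrier)
  ultimately show "poly (apoly (rm (twist_knot n))) x = poly (- delta n) x"
    by (simp add: mat2_det delta_def algebra_simps)
qed

lemma multiplicity_apoly_twist:
  assumes z: "reciprocal z" and V: "seifert_matrix V" and n: "n > 0"
  shows "multiplicity (min_poly z) (apoly (rm (V \<boxplus> twist_knot n))) =
    multiplicity (min_poly z) (apoly (rm V)) + multiplicity (min_poly z) (delta n)"
proof -
  obtain k where k: "V \<in> Mat k k" using seifert_carrier[OF V] by blast
  have "rm (V \<boxplus> twist_knot n) = rm V \<boxplus> rm (twist_knot n)" using map_block_sum[OF k twist_knot_carrier, of rat_of_int] by simp
  then have e: "apoly (rm (V \<boxplus> twist_knot n)) = apoly (rm V) * - delta n"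
    using apoly_block_sum[of "rm V" k "rm (twist_knot n)" 2] k twist_knot_carrier apoly_twist by simp
  have "multiplicity (min_poly z) (- delta n) = multiplicity (min_poly z) (delta n)"
    unfolding multiplicity_def by simp
  then show ?thesis unfolding e using min_poly_prime(1)[OF z] apoly_nonzero[of "rm V" k] k seifert_det_rat[OF V] delta_nonzero(1)[OF n]
    by (simp add: prime_elem_multiplicity_mult_distrib del: mult_minus_right)
qed

lemma e_inv_twist:
  assumes z: "reciprocal z" and V: "seifert_matrix V" and n: "n > 0" and d: "rpoly (delta n) z \<noteq> 0"
  shows "e_inv z (V \<boxplus> twist_knot n) = e_inv z V"
proof -
  have "multiplicity (min_poly z) (delta n) = 0" using d reciprocalD(4)[OF z] by (intro not_dvd_imp_multiplicity_0) blast
  then show ?thesis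
    unfolding e_inv_apoly[OF z V] e_inv_apoly[OF z seifert_block_sum[OF V seifert_matrix_twist_knot]] multiplicity_apoly_twist[OF z V n] by simp
qed

lemma unknot_rationally_slice: "rationally_algebraically_slice (0\<^sub>m 0 0)"
proof -
  have "signature (0\<^sub>m 0 0) = 0"
  proof -
    have "char_poly (0\<^sub>m 0 0 :: complex mat) = 1" unfolding char_poly_def char_poly_matrix_def by simp
    then show ?thesis unfolding signature_def by simp
  qed
  moreover have "(1 - \<omega>) \<cdot>\<^sub>m map_mat of_int (0\<^sub>m 0 0) + (1 - cnj \<omega>) \<cdot>\<^sub>m map_mat of_int (trp (0\<^sub>m 0 0)) = 0\<^sub>m 0 0" for \<omega>
    by (intro eq_matI) auto
  ultimately have "tristram_levine (0\<^sub>m 0 0) \<omega> = 0" for \<omega> unfolding tristram_levine_def by simp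
  then have s: "s_inv z (0\<^sub>m 0 0) = 0" for z
    unfolding s_inv_def by (simp add: tendsto_Lim[OF _ tendsto_const])
  have e: "e_inv z (0\<^sub>m 0 0) = 0" if "reciprocal z" for z
    unfolding e_inv_apoly[OF that seifert_zero] pencil_def by simp
  show ?thesis unfolding rationally_algebraically_slice_def P_seq_def using s e d_inv_unknot by simp
qed


section \<open>Sums of twist knots and the kernel\<close>

text \<open>Elements of the subgroup are handled as lists of knots added to a start matrix
  \<open>U\<close>; a knot is attached at the right end, where the invariance lemmas apply.\<close>

definition twist_sum :: "int mat => nat list => int mat" where
  "twist_sum U ns = foldr (\<lambda>n V. V \<boxplus> twist_knot n) ns U"

abbreviation twist_class :: "nat => int mat set" where
  "twist_class n \<equiv> alg_class (twist_knot n)"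

lemma twist_sum_simps [simp]: "twist_sum U [] = U" "twist_sum U (n # ns) = twist_sum U ns \<boxplus> twist_knot n"
  unfolding twist_sum_def by simp_all

lemma seifert_twist_sum: "seifert_matrix U ==> seifert_matrix (twist_sum U ns)"
  by (induction ns) (simp_all add: seifert_block_sum seifert_matrix_twist_knot)

lemma twist_sum_append: "twist_sum U (ns @ ms) = twist_sum (twist_sum U ms) ns"
  by (induction ns) simp_all

lemma twist_sum_start: "twist_sum U ns = U \<boxplus> twist_sum (0\<^sub>m 0 0) ns"
  by (induction ns) (simp_all add: block_sum_zero_right block_sum_assoc)

lemma twist_class_carrier: "twist_class n \<in> carrier AG"
  using AG_carrier seifert_matrix_twist_knot by blast

lemma twist_sum_class:
  assumes "seifert_matrix U"
  shows "alg_class (twist_sum U ns) = alg_class U \<otimes>\<^bsub>AG\<^esub> alg_class (twist_sum (0\<^sub>m 0 0) ns)"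
  using AG_mult[OF assms seifert_twist_sum[OF seifert_zero]] twist_sum_start by metis

lemma twist_class_power_4:
  assumes n: "n > 0"
  shows "twist_class n [^]\<^bsub>AG\<^esub> (4 * k :: nat) = \<one>\<^bsub>AG\<^esub>"
proof -
  interpret comm_group AG by (rule AG_comm_group)
  note c = twist_class_carrier[of n]
  have "twist_class n [^]\<^bsub>AG\<^esub> (4::nat) = twist_class n \<otimes>\<^bsub>AG\<^esub> twist_class n \<otimes>\<^bsub>AG\<^esub> (twist_class n \<otimes>\<^bsub>AG\<^esub> twist_class n)"
    using c by (simp add: numeral_eq_Suc m_assoc)
  then have "twist_class n [^]\<^bsub>AG\<^esub> (4::nat) = \<one>\<^bsub>AG\<^esub>" unfolding twist_order_4[OF n] .
  then show ?thesis using nat_pow_pow[OF c, of 4 k, symmetric] by simp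
qed

lemma twist_class_inverse:
  assumes n: "n > 0"
  shows "inv\<^bsub>AG\<^esub> twist_class n = twist_class n \<otimes>\<^bsub>AG\<^esub> twist_class n \<otimes>\<^bsub>AG\<^esub> twist_class n"
proof -
  interpret comm_group AG by (rule AG_comm_group)
  note c = twist_class_carrier[of n]
  show ?thesis
    by (rule inv_equality) (use twist_order_4[OF n] c in \<open>simp_all add: m_assoc\<close>)
qed

text \<open>Commutativity collects all copies of \<open>T_n\<close>, so that they can be studied or
  removed together.\<close>

lemma twist_sum_filter:
  "alg_class (twist_sum (0\<^sub>m 0 0) ns) =
    twist_class n [^]\<^bsub>AG\<^esub> count_list ns n \<otimes>\<^bsub>AG\<^esub> alg_class (twist_sum (0\<^sub>m 0 0) (filter (\<lambda>m. m \<noteq> n) ns))"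
proof (induction ns)
  interpret comm_group AG by (rule AG_comm_group)
  case Nil
  have "alg_class (0\<^sub>m 0 0) \<in> carrier AG" using AG_carrier seifert_zero by blast
  then show ?case by simp
next
  interpret comm_group AG by (rule AG_comm_group)
  case (Cons m ns)
  note z = seifert_twist_sum[OF seifert_zero] and t = seifert_matrix_twist_knot
  have cl: "alg_class (twist_sum (0\<^sub>m 0 0) ms) \<in> carrier AG" for ms using AG_carrier z by blast
  have c: "twist_class k \<in> carrier AG" for k by (rule twist_class_carrier)
  have step: "alg_class (twist_sum (0\<^sub>m 0 0) (k # ms)) = alg_class (twist_sum (0\<^sub>m 0 0) ms) \<otimes>\<^bsub>AG\<^esub> twist_class k" for k ms
    using AG_mult[OF z t] by simp
  show ?case
  proof (cases "m = n")
    case True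
    then show ?thesis unfolding step Cons using c cl by (simp add: m_ac del: twist_sum_simps)
  next
    case False
    then have "filter (\<lambda>m. m \<noteq> n) (m # ns) = m # filter (\<lambda>m. m \<noteq> n) ns" "count_list (m # ns) n = count_list ns n" by auto
    then show ?thesis unfolding step Cons using c cl by (simp add: step m_assoc del: twist_sum_simps)
  qed
qed

text \<open>Lists with positive multiplicities suffice, because the inverse of a twist knot class is
  its third power.\<close>

lemma generate_twist_sum:
  assumes "X \<in> twist_subgroup Q"
  shows "\<exists>ns. (\<forall>n\<in>set ns. n > 0 \<and> Q n) \<and> X = alg_class (twist_sum (0\<^sub>m 0 0) ns)"
  using assms unfolding twist_subgroup_def
proof (induction rule: generate.induct)
  case one
  show ?case by (rule exI[of _ "[]"]) (simp add: AG_one)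
next
  case (incl h)
  then obtain n where "h = twist_class n" "n > 0" "Q n" by blast
  then show ?case by (intro exI[of _ "[n]"]) (simp add: block_sum_zero_left)
next
  case (inv h)
  then obtain n where n: "h = twist_class n" "n > 0" "Q n" by blast
  have "inv\<^bsub>AG\<^esub> h = alg_class (twist_knot n \<boxplus> twist_knot n \<boxplus> twist_knot n)"
    unfolding n(1) twist_class_inverse[OF n(2)] by (simp add: AG_mult seifert_block_sum seifert_matrix_twist_knot)
  then show ?case using n(2,3) by (intro exI[of _ "[n, n, n]"]) (simp add: block_sum_zero_left)
next
  case (eng h1 h2)
  then obtain ns ms where 1: "\<forall>n\<in>set ns. n > 0 \<and> Q n" "h1 = alg_class (twist_sum (0\<^sub>m 0 0) ns)"
    and 2: "\<forall>n\<in>set ms. n > 0 \<and> Q n" "h2 = alg_class (twist_sum (0\<^sub>m 0 0) ms)" by blast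
  have "h1 \<otimes>\<^bsub>AG\<^esub> h2 = alg_class (twist_sum (0\<^sub>m 0 0) (ms @ ns))"
    unfolding twist_sum_append twist_sum_class[OF seifert_twist_sum[OF seifert_zero], of ns ms] 1(2) 2(2) ..
  then show ?case using 1(1) 2(1) by (intro exI[of _ "ms @ ns"]) auto
qed

lemma twist_sum_generate:
  assumes "\<forall>n\<in>set ns. n > 0 \<and> Q n"
  shows "alg_class (twist_sum (0\<^sub>m 0 0) ns) \<in> twist_subgroup Q"
  using assms
proof (induction ns)
  case Nil
  show ?case using generate.one[of AG] unfolding twist_subgroup_def AG_one by simp
next
  case (Cons n ns)
  have e: "alg_class (twist_sum (0\<^sub>m 0 0) (n # ns)) = alg_class (twist_sum (0\<^sub>m 0 0) ns) \<otimes>\<^bsub>AG\<^esub> twist_class n"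
    using AG_mult[OF seifert_twist_sum[OF seifert_zero] seifert_matrix_twist_knot] by simp
  have 1: "alg_class (twist_sum (0\<^sub>m 0 0) ns) \<in> twist_subgroup Q" using Cons by simp
  have 2: "twist_class n \<in> twist_subgroup Q" unfolding twist_subgroup_def using Cons.prems by (intro generate.incl) auto
  show ?case unfolding e using generate.eng[OF 1[unfolded twist_subgroup_def] 2[unfolded twist_subgroup_def]]
    unfolding twist_subgroup_def .
qed

text \<open>\<open>delta n\<close> and the minimal polynomial of \<open>z\<close> divide each other,
  while no other \<open>delta m\<close> vanishes at \<open>z\<close>; so the multiplicity counts the
  occurrences of \<open>n\<close>.\<close>

lemma multiplicity_twist_sum:
  assumes n: "n > 0" and nsq: "\<nexists>k. 4 * n + 1 = k\<^sup>2" and r: "rpoly (delta n) z = 0" and z: "reciprocal z"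
    and ns: "\<forall>m\<in>set ns. m > 0"
  shows "multiplicity (min_poly z) (apoly (rm (twist_sum (0\<^sub>m 0 0) ns))) = count_list ns n"
  using ns
proof (induction ns)
  case Nil
  show ?case by (simp add: pencil_def)
next
  case (Cons m ns)
  let ?q = "min_poly z"
  have "multiplicity ?q (delta m) = (if m = n then 1 else 0)"
  proof (cases "m = n")
    case True
    have "delta n dvd ?q" by (rule delta_root_conj(1)[OF n nsq r reciprocalD(5)[OF z]])
    moreover have "?q dvd delta n" using reciprocalD(4)[OF z] r by blast
    ultimately obtain u where u: "delta n = ?q * u" "is_unit u"
      using delta_nonzero(1)[OF n] by (metis associatedD2 associated_unit dvd_def dvd_mult_cancel_left dvd_refl mult.right_neutral mult_eq_0_iff)
    have "u \<noteq> 0" using u(2) by auto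
    then have "multiplicity ?q (delta n) = multiplicity ?q ?q + multiplicity ?q u"
      unfolding u(1) using min_poly_prime(1)[OF z] min_poly_nonzero[OF z] by (intro prime_elem_multiplicity_mult_distrib)
    also have "\<dots> = 1" using min_poly_prime(1)[OF z] u(2) min_poly_nonzero[OF z]
      by (simp add: multiplicity_unit_right multiplicity_self prime_elem_def)
    finally show ?thesis using True by simp
  next
    case False
    then have "rpoly (delta m) z \<noteq> 0" using delta_root_unique[OF r] n Cons.prems by force
    then show ?thesis using False reciprocalD(4)[OF z] by (simp add: not_dvd_imp_multiplicity_0)
  qed
  then show ?case using multiplicity_apoly_twist[OF z seifert_twist_sum[OF seifert_zero, of ns], of m] Cons by simp
qed

lemma d_values_twist_sum:
  assumes "reciprocal z" "seifert_matrix U" "\<forall>m\<in>set ns. m > 0 \<and> rpoly (delta m) z \<noteq> 0"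
  shows "d_values z (twist_sum U ns) = d_values z U"
  using assms(3) by (induction ns) (simp_all add: d_values_twist[OF assms(1) seifert_twist_sum[OF assms(2)]])

text \<open>Translates a norm from Q(z) into a norm from the quadratic field of
  \<open>4 n + 1\<close>, the form in which -1 acts on the Seifert matrix.\<close>

lemma minus_one_norm:
  assumes z: "reciprocal z" and n: "n > 0" and nsq: "\<nexists>k. 4 * n + 1 = k\<^sup>2" and r: "rpoly (delta n) z = 0"
    and m: "- 1 \<in> norms z"
  shows "\<exists>a b. a\<^sup>2 - (4 * of_nat n + 1) * b\<^sup>2 = (- 1 :: rat)"
proof -
  obtain u where u: "u \<in> Qadj z" "u * Qbar z u = - 1" using m unfolding norms_def by auto
  then obtain p where p: "u = rpoly p z" unfolding Qadj_def by blast
  obtain a b q where q: "p = delta n * q + [:a, b:]" using delta_rep[OF n nsq r] by blast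
  define N :: rat where "N = of_nat n"
  have N: "N \<noteq> 0" unfolding N_def using n by simp
  note d = delta_root_nonzero[OF r n]
  have "u = of_rat a + z * of_rat b" "Qbar z u = of_rat a + inverse z * of_rat b"
    unfolding p Qbar_rpoly[OF z] unfolding q using r d(2) by simp_all
  then have "(of_rat a + z * of_rat b) * (of_rat a + inverse z * of_rat b) = - 1" using u(2) by simp
  moreover have "(of_rat a + z * of_rat b) * (of_rat a + inverse z * of_rat b) =
    of_rat a * of_rat a + of_rat a * of_rat b * (z + inverse z) + (z * inverse z) * (of_rat b * of_rat b)" by (simp add: algebra_simps)
  ultimately have "of_rat a * of_rat a + of_rat a * of_rat b * (2 + 1 / of_nat n) + of_rat b * of_rat b = (- 1 :: complex)"
    unfolding d(3) using d(1) by simp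
  then have "of_rat (a * a + a * b * (2 + 1 / N) + b * b) = (of_rat (- 1) :: complex)"
    unfolding N_def by (simp add: of_rat_add of_rat_mult of_rat_divide)
  then have e: "a * a + a * b * (2 + 1 / N) + b * b = - 1" unfolding of_rat_eq_iff .
  \<comment> \<open>Completing the square: \<open>z\<close> is \<open>1 + h\<close> plus or minus
    \<open>h\<close> times the square root of \<open>4 n + 1\<close>.\<close>
  define h where "h = 1 / (2 * N)"
  have h: "2 * N * h = 1" "1 / N = 2 * h" unfolding h_def using N by simp_all
  have "(a + b * (1 + h))\<^sup>2 - (4 * N + 1) * (b * h)\<^sup>2 = a * a + a * b * (2 + 2 * h) + b * b + (2 * h - 2 * (2 * N * h) * h) * (b * b)"
    by (simp add: power2_eq_square algebra_simps)
  also have "\<dots> = - 1" unfolding h(1) using e unfolding h(2) by simp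
  finally show ?thesis unfolding N_def by blast
qed

text \<open>The copies of \<open>T_n\<close> cancel among themselves for each \<open>n\<close> that
  is not a perfect power. Since four copies always cancel, only the count modulo 4 matters: parity
  is read from \<open>e_inv\<close>, and a remainder of 2 from \<open>d_inv\<close>.\<close>

lemma slice_twist_multiplicity:
  assumes V: "seifert_matrix V" "rationally_algebraically_slice V" and e: "alg_class V = alg_class (twist_sum (0\<^sub>m 0 0) ns)"
    and ns: "\<forall>m\<in>set ns. m > 0" and n: "n > 0" and npp: "\<not> perfect_power n"
  shows "twist_class n [^]\<^bsub>AG\<^esub> count_list ns n = \<one>\<^bsub>AG\<^esub>"
proof -
  interpret comm_group AG by (rule AG_comm_group)
  note tc = twist_class_carrier[of n] and s0 = seifert_twist_sum[OF seifert_zero] and t = seifert_matrix_twist_knot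
  show ?thesis
  proof (cases "\<exists>k. 4 * n + 1 = k\<^sup>2")
    case True
    then obtain k where k: "4 * n + 1 = k\<^sup>2" by blast
    have "odd (4 * n + 1)" by simp
    then have "odd (k\<^sup>2)" unfolding k .
    then have "odd k" by simp
    then obtain j where "k = 2 * j + 1" by (rule oddE)
    then have "n = j * (j + 1)" using k by (simp add: power2_eq_square)
    then have "twist_class n = \<one>\<^bsub>AG\<^esub>" using twist_slice by simp
    then show ?thesis by simp
  next
    case False
    define b :: "nat => complex" where "b = (\<lambda>k. of_real (root k (zroot n)))"
    have b: "b \<in> P_seq" unfolding b_def by (rule zroot_P_seq[OF n False npp])
    define z where "z = b 1"
    have z: "reciprocal z" using b unfolding P_seq_def z_def by blast
    have r: "rpoly (delta n) z = 0" unfolding z_def b_def using zroot(2)[OF n] by simp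
    have sl: "e_inv z V = 0" "d_inv z V = \<one>\<^bsub>d_group z\<^esub>"
      using V(2) b unfolding rationally_algebraically_slice_def z_def by blast+
    have VW: "(V, twist_sum (0\<^sub>m 0 0) ns) \<in> alg_concordant" using e alg_class_eq_iff[OF V(1) s0] by blast
    have "even (count_list ns n)"
      using e_inv_concordant[OF z VW] sl(1) unfolding e_inv_apoly[OF z s0] multiplicity_twist_sum[OF n False r z ns] by presburger
    then have "count_list ns n = 4 * (count_list ns n div 4) \<or> count_list ns n = 4 * (count_list ns n div 4) + 2"
      by presburger
    then consider k where "count_list ns n = 4 * k" | k where "count_list ns n = 4 * k + 2" by blast
    then show ?thesis
    proof cases
      case 1
      then show ?thesis using twist_class_power_4[OF n] by simp
    next
      case 2
      let ?t = "twist_class n" and ?ms = "filter (\<lambda>m. m \<noteq> n) ns" and ?D = "twist_knot n \<boxplus> twist_knot n"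
      have tp: "?t [^]\<^bsub>AG\<^esub> count_list ns n = ?t \<otimes>\<^bsub>AG\<^esub> ?t"
        unfolding 2 using nat_pow_mult[OF tc, of "4 * k" 2, symmetric] twist_class_power_4[OF n, of k] tc
        by (simp add: numeral_2_eq_2)
      have D: "seifert_matrix ?D" by (intro seifert_block_sum t)
      have "alg_class V = alg_class ?D \<otimes>\<^bsub>AG\<^esub> alg_class (twist_sum (0\<^sub>m 0 0) ?ms)"
        unfolding e twist_sum_filter[of ns n] tp AG_mult[OF t t] ..
      also have "\<dots> = alg_class (twist_sum ?D ?ms)" by (rule twist_sum_class[OF D, symmetric])
      finally have "alg_class (twist_sum ?D ?ms) = alg_class V" by (rule sym)
      then have "(twist_sum ?D ?ms, V) \<in> alg_concordant" by (rule alg_class_eq_iff[OF seifert_twist_sum[OF D] V(1), THEN iffD1])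
      then have "d_values z (twist_sum ?D ?ms) \<subseteq> d_values z V" by (rule d_values_concordant[OF z])
      moreover have "\<forall>m\<in>set ?ms. m > 0 \<and> rpoly (delta m) z \<noteq> 0"
        using ns delta_root_unique[OF r] n by force
      then have "d_values z (twist_sum ?D ?ms) = d_values z ?D" by (rule d_values_twist_sum[OF z D])
      ultimately have "norms z #>\<^bsub>fixed_units z\<^esub> (- 1) \<in> d_values z V" using twist_double_d[OF z n False r] by blast
      then have "d_inv z V = norms z #>\<^bsub>fixed_units z\<^esub> (- 1)" by (rule d_inv_eqI[OF z V(1)])
      then have "norms z #>\<^bsub>fixed_units z\<^esub> (- 1) = norms z" using sl(2) unfolding d_group_def FactGroup_def by simp
      \<comment> \<open>Triviality of the coset of -1 says exactly that -1 is a norm.\<close>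
      moreover have "1 * (- 1) \<in> norms z #>\<^bsub>fixed_units z\<^esub> (- 1)"
        using one_in_norms[OF z] unfolding r_coset_def fixed_units_def by force
      ultimately have "- 1 \<in> norms z" by simp
      then obtain a b where "a\<^sup>2 - (4 * of_nat n + 1) * b\<^sup>2 = (- 1 :: rat)" using minus_one_norm[OF z n False r] by blast
      then show ?thesis unfolding tp by (rule twist_order_2)
    qed
  qed
qed

text \<open>Removing all copies of one unwanted knot leaves the class and the other multiplicities
  unchanged, so the unwanted knots can be eliminated one after another.\<close>

lemma twist_sum_remove:
  assumes "\<forall>m\<in>set ns. m > 0"
    and "\<And>n. n > 0 ==> \<not> Q n ==> twist_class n [^]\<^bsub>AG\<^esub> count_list ns n = \<one>\<^bsub>AG\<^esub>"
  shows "alg_class (twist_sum (0\<^sub>m 0 0) ns) \<in> twist_subgroup Q"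
  using assms
proof (induction ns rule: length_induct)
  case (1 ns)
  interpret comm_group AG by (rule AG_comm_group)
  show ?case
  proof (cases "\<forall>m\<in>set ns. Q m")
    case True
    then show ?thesis using 1(2) by (intro twist_sum_generate) blast
  next
    case False
    then obtain n where n: "n \<in> set ns" "\<not> Q n" by blast
    let ?ms = "filter (\<lambda>m. m \<noteq> n) ns"
    have cl: "alg_class (twist_sum (0\<^sub>m 0 0) ?ms) \<in> carrier AG" using AG_carrier seifert_twist_sum[OF seifert_zero] by blast
    have "twist_class n [^]\<^bsub>AG\<^esub> count_list ns n = \<one>\<^bsub>AG\<^esub>" using 1(2,3) n by blast
    then have e: "alg_class (twist_sum (0\<^sub>m 0 0) ns) = alg_class (twist_sum (0\<^sub>m 0 0) ?ms)"
      unfolding twist_sum_filter[of ns n] using cl by simp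
    have "length ?ms < length ns" using n(1) by (rule length_filter_less) simp
    moreover have "\<forall>m\<in>set ?ms. m > 0" using 1(2) by simp
    moreover have "twist_class k [^]\<^bsub>AG\<^esub> count_list ?ms k = \<one>\<^bsub>AG\<^esub>" if k: "k > 0" "\<not> Q k" for k
    proof (cases "k = n")
      case True
      then have "count_list ?ms k = 0" by (simp add: count_list_0_iff)
      then show ?thesis by simp
    next
      case False
      have "count_list (filter (\<lambda>m. m \<noteq> n) xs) k = count_list xs k" for xs using False by (induction xs) auto
      then show ?thesis using 1(3)[OF k] by simp
    qed
    ultimately show ?thesis unfolding e using 1(1) by blast
  qed
qed

text \<open>The signature is unaffected by any \<open>T_n\<close>. The other two invariants are
  evaluated only at entries of members of P, and none of these is a root of \<open>delta n\<close>
  for a square \<open>n\<close>.\<close>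

lemma slice_classes_add_square:
  assumes X: "X \<in> rationally_slice_classes" and n: "n > 0" "perfect_square n"
  shows "X \<otimes>\<^bsub>AG\<^esub> twist_class n \<in> rationally_slice_classes"
proof -
  obtain V where V: "X = alg_class V" "seifert_matrix V" "rationally_algebraically_slice V"
    using X unfolding rationally_slice_classes_def by blast
  obtain \<alpha> where a: "\<alpha> \<ge> 1" "n = \<alpha>\<^sup>2" using n(2) unfolding perfect_square_def by blast
  let ?W = "V \<boxplus> twist_knot n"
  have W: "seifert_matrix ?W" by (rule seifert_block_sum[OF V(2) seifert_matrix_twist_knot])
  have "rationally_algebraically_slice ?W"
    unfolding rationally_algebraically_slice_def
  proof (intro conjI ballI allI impI)
    fix a :: "nat => complex" and k :: nat assume "a \<in> P0_seq" "k \<ge> 1"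
    then show "s_inv (a k) ?W = 0"
      using V(3) s_inv_twist[OF _ n(1) V(2), of "a k"] unfolding rationally_algebraically_slice_def P0_seq_def by simp
  next
    fix b :: "nat => complex" and k :: nat assume bk: "b \<in> P_seq" "k \<ge> 1"
    then have z: "reciprocal (b k)" unfolding P_seq_def by blast
    have d: "rpoly (delta n) (b k) \<noteq> 0" by (rule square_root_not_in_P_seq[OF bk a(2,1)])
    have "e_inv (b k) V = 0" "d_inv (b k) V = \<one>\<^bsub>d_group (b k)\<^esub>"
      using V(3) bk unfolding rationally_algebraically_slice_def by blast+
    then show "e_inv (b k) ?W = 0" "d_inv (b k) ?W = \<one>\<^bsub>d_group (b k)\<^esub>"
      unfolding e_inv_twist[OF z V(2) n(1) d] d_inv_values d_values_twist[OF z V(2) n(1) d] by auto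
  qed
  then show ?thesis unfolding V(1) AG_mult[OF V(2) seifert_matrix_twist_knot] rationally_slice_classes_def using W by blast
qed

text \<open>The set of slice classes is stable under right multiplication by the subgroup. Applying
  this to \<open>X\<close> gives one inclusion of the coset equality, and applying it to the inverse
  of \<open>X\<close> gives the other.\<close>

lemma square_subgroup_absorbed:
  assumes X: "X \<in> twist_subgroup perfect_square"
  shows "rationally_slice_classes #>\<^bsub>AG\<^esub> X = rationally_slice_classes"
proof -
  interpret comm_group AG by (rule AG_comm_group)
  let ?H = rationally_slice_classes
  have Hc: "?H \<subseteq> carrier AG" unfolding rationally_slice_classes_def using AG_carrier by blast
  have cl: "alg_class (twist_sum (0\<^sub>m 0 0) ns) \<in> carrier AG" for ns using AG_carrier seifert_twist_sum[OF seifert_zero] by blast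
  have add: "\<forall>n\<in>set ns. n > 0 \<and> perfect_square n ==> Y \<in> ?H ==> Y \<otimes>\<^bsub>AG\<^esub> alg_class (twist_sum (0\<^sub>m 0 0) ns) \<in> ?H" for ns Y
  proof (induction ns arbitrary: Y)
    case Nil
    then show ?case using Hc unfolding twist_sum_simps AG_one[symmetric] by auto
  next
    case (Cons n ns)
    have "alg_class (twist_sum (0\<^sub>m 0 0) (n # ns)) = alg_class (twist_sum (0\<^sub>m 0 0) ns) \<otimes>\<^bsub>AG\<^esub> twist_class n"
      using AG_mult[OF seifert_twist_sum[OF seifert_zero] seifert_matrix_twist_knot] by simp
    then have "Y \<otimes>\<^bsub>AG\<^esub> alg_class (twist_sum (0\<^sub>m 0 0) (n # ns)) = Y \<otimes>\<^bsub>AG\<^esub> alg_class (twist_sum (0\<^sub>m 0 0) ns) \<otimes>\<^bsub>AG\<^esub> twist_class n"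
      using Cons.prems(2) Hc cl twist_class_carrier by (simp add: m_assoc subset_iff del: twist_sum_simps)
    then show ?case using slice_classes_add_square Cons by simp
  qed
  have add': "Y \<otimes>\<^bsub>AG\<^esub> Z \<in> ?H" if Z: "Z \<in> twist_subgroup perfect_square" and Y: "Y \<in> ?H" for Y Z
    using generate_twist_sum[OF Z] add Y by blast
  have S: "{twist_class n |n. n > 0 \<and> perfect_square n} \<subseteq> carrier AG" using twist_class_carrier by blast
  have X': "X \<in> carrier AG" "inv\<^bsub>AG\<^esub> X \<in> twist_subgroup perfect_square"
    using X generate_in_carrier[OF S] generate_m_inv_closed[OF S] unfolding twist_subgroup_def by auto
  show ?thesis
  proof (intro equalityI subsetI)
    fix Y assume "Y \<in> ?H #>\<^bsub>AG\<^esub> X"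
    then show "Y \<in> ?H" using add'[OF X] unfolding r_coset_def by auto
  next
    fix Y assume Y: "Y \<in> ?H"
    have "Y = (Y \<otimes>\<^bsub>AG\<^esub> inv\<^bsub>AG\<^esub> X) \<otimes>\<^bsub>AG\<^esub> X" using Y Hc X'(1) by (simp add: m_assoc subset_iff)
    then show "Y \<in> ?H #>\<^bsub>AG\<^esub> X" using add'[OF X'(2) Y] unfolding r_coset_def by blast
  qed
qed

theorem corollary4p7:
  shows "twist_subgroup perfect_square \<subseteq> twist_kernel \<and>
         twist_kernel \<subseteq> twist_subgroup perfect_power"
proof
  interpret comm_group AG by (rule AG_comm_group)
  \<comment> \<open>The identity of the quotient is the set of slice classes itself, so lying in the
    kernel is an equality of cosets.\<close>
  have ker: "X \<in> twist_kernel \<longleftrightarrow> X \<in> twist_subgroup (\<lambda>_. True) \<and> rationally_slice_classes #>\<^bsub>AG\<^esub> X = rationally_slice_classes" for X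
    unfolding twist_kernel_def natural_map_def rat_alg_concordance_group_def FactGroup_def Coset.kernel_def by simp
  have "twist_subgroup perfect_square \<subseteq> twist_subgroup (\<lambda>_. True)"
    unfolding twist_subgroup_def by (intro mono_generate) blast
  then show "twist_subgroup perfect_square \<subseteq> twist_kernel" using ker square_subgroup_absorbed by blast
  show "twist_kernel \<subseteq> twist_subgroup perfect_power"
  proof
    fix X assume "X \<in> twist_kernel"
    then have X: "X \<in> twist_subgroup (\<lambda>_. True)" "rationally_slice_classes #>\<^bsub>AG\<^esub> X = rationally_slice_classes" using ker by auto
    obtain ns where ns: "\<forall>n\<in>set ns. n > 0" "X = alg_class (twist_sum (0\<^sub>m 0 0) ns)" using generate_twist_sum[OF X(1)] by blast
    have "X \<in> carrier AG" unfolding ns(2) using AG_carrier seifert_twist_sum[OF seifert_zero] by blast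
    moreover have "\<one>\<^bsub>AG\<^esub> \<in> rationally_slice_classes"
      unfolding AG_one rationally_slice_classes_def using seifert_zero unknot_rationally_slice by blast
    \<comment> \<open>The unknot puts \<open>X\<close> into its own coset, which equals the set of
      slice classes.\<close>
    ultimately have "X \<in> rationally_slice_classes #>\<^bsub>AG\<^esub> X" unfolding r_coset_def by force
    then obtain V where V: "X = alg_class V" "seifert_matrix V" "rationally_algebraically_slice V"
      unfolding X(2) unfolding rationally_slice_classes_def by blast
    show "X \<in> twist_subgroup perfect_power"
      unfolding ns(2)
      by (rule twist_sum_remove[OF ns(1)])
        (use slice_twist_multiplicity[OF V(2,3) V(1)[symmetric, unfolded ns(2)] ns(1)] in blast)
  qed
qed

end
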